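(* Let $(\phi_t)_{t\ge0}$ be a continuous one-parameter semigroup of holomorphic functions in the unit disk $\mathbb{D}$ and suppose that $\zeta\in\partial\mathbb{D}$ is not a fixed point of $(\phi_t)$ and satisfies $S_\zeta>0$. Let $\gamma_\zeta$ be the boundary orbit of $\zeta$. (a) If $\gamma_\zeta$ is an exceptional orbit, then it is Lipschitz. (b) If $\gamma_\zeta$ is an isolated orbit, then it is not Lipschitz.
   Context: A (continuous one-parameter) semigroup in $\mathbb{D}$ is a family $(\phi_t)_{t\ge0}$ of holomorphic functions $\phi_t:\mathbb{D}\to\mathbb{D}$ such that $\phi_0=\mathrm{id}_{\mathbb{D}}$, $\phi_{t+s}=\phi_t\circ\phi_s$ for all $t,s\ge0$, and $\phi_t\to\phi_0$ locally uniformly as $t\to0^+$. If $(\phi_t)$ is not a group of hyperbolic rotations (including the trivial semigroup), there is a unique $\tau\in\overline{\mathbb{D}}$ (Denjoy-Wolff point) with $\phi_t(z)\to\tau$ as $t\to+\infty$ for all $z\in\mathbb{D}$; $(\phi_t)$ is elliptic if $\tau\in\mathbb{D}$ and non-elliptic if $\tau\in\partial\mathbb{D}$. Koenigs function: if $(\phi_t)$ is elliptic, it is the conformal map $h:\mathbb{D}\to\mathbb{C}$ onto its image (unique up to a multiplicative constant) with $h(\tau)=0$ and $h(\phi_t(z))=e^{-\mu t}h(z)$ for all $t\ge0$, $z\in\mathbb{D}$, where the spectral value $\mu$, $\mathrm{Re}\,\mu>0$, is the unique complex number with $\phi_t'(\tau)=e^{-\mu t}$ for all $t\ge0$. If $(\phi_t)$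 is non-elliptic, it is the conformal map $h:\mathbb{D}\to\mathbb{C}$ onto its image (unique up to an additive constant) with $h(\phi_t(z))=h(z)+t$ for all $t\ge0$, $z\in\mathbb{D}$. The Koenigs domain is $\Omega=h(\mathbb{D})$. Boundary orbits: for $\zeta\in\partial\mathbb{D}$ and $t\ge0$ the non-tangential limit $\phi_t(\zeta):=\angle\lim_{z\to\zeta}\phi_t(z)$ exists, and $t\mapsto\phi_t(\zeta)$ is continuous on $[0,+\infty)$. The point $\zeta$ is a fixed point of $(\phi_t)$ if $\phi_t(\zeta)=\zeta$ for all $t\ge0$. The life-time of $\zeta$ is $S_\zeta:=\sup\{t\in[0,+\infty):\phi_t(\zeta)\in\partial\mathbb{D}\}\in[0,+\infty]$; one has $\phi_t(\zeta)\in\partial\mathbb{D}$ exactly for $t\in[0,S_\zeta]$ (for all $t\ge 0$ if $S_\zeta=+\infty$). The boundary orbit of $\zeta$ is the curve $\gamma_\zeta(t)=\phi_t(\zeta)$ restricted to $t\in[0,S_\zeta]$ (to $t\in[0,+\infty)$ if $S_\zeta=+\infty$). For $\zeta$ not a fixed point with $S_\zeta>0$: - $\gamma_\zeta$ is exceptional if $S_\zeta=+\infty$ (then $(\phi_t)$ is non-elliptic and $\gamma_\zeta$ ends at the Denjoy-Wolff point). - Suppose $S_\zeta<+\infty$, and let $h(\zeta)=\angle\lim_{z\to\zeta}h(z)\in\mathbb{C}$ be the non-tangential limit. Put $L_\zeta=\{h(\zeta)+s:s\in(-\infty,S_\zeta]\}$ in the non-elliptic case and $\Lambda_\zeta=\{e^{-\mu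 s}h(\zeta):s\in(-\infty,S_\zeta]\}$ in the elliptic case; these sets are contained in $\mathbb{C}\setminus\Omega$. With $D(w,r)$ the Euclidean disk of center $w$ and radius $r$, $\gamma_\zeta$ is isolated if there is $\epsilon>0$ such that $D(h(\zeta)+S_\zeta,\epsilon)\cap\partial\Omega\subset L_\zeta$ (non-elliptic case), respectively $D(e^{-\mu S_\zeta}h(\zeta),\epsilon)\cap\partial\Omega\subset\Lambda_\zeta$ (elliptic case). A function $\gamma:I\to\mathbb{C}$ on an interval $I\subset\mathbb{R}$ is Lipschitz if there is $C>0$ with $|\gamma(t)-\gamma(s)|\le C|t-s|$ for all $t,s\in I$. *)

theory Defs
  imports "HOL-Complex_Analysis.Complex_Analysis"
begin

text \<open>
  Only times t \<open>\<ge>\<close> 0 and points of the open unit disk \<^term>\<open>ball 0 1 :: complex set\<close> matter;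
  the values of \<open>phi\<close> elsewhere are never used.
\<close>

definition disc_semigroup :: "(real \<Rightarrow> complex \<Rightarrow> complex) \<Rightarrow> bool" where
  "disc_semigroup phi \<longleftrightarrow>
     (\<forall>t\<ge>0. phi t holomorphic_on ball 0 1 \<and> phi t ` ball 0 1 \<subseteq> ball 0 1) \<and>
     (\<forall>z\<in>ball 0 1. phi 0 z = z) \<and>
     (\<forall>t\<ge>0. \<forall>s\<ge>0. \<forall>z\<in>ball 0 1. phi (t + s) z = phi t (phi s z)) \<and>
     (\<forall>K. compact K \<longrightarrow> K \<subseteq> ball 0 1 \<longrightarrow> uniform_limit K phi (phi 0) (at_right 0))"

text \<open>
  For a group of hyperbolic rotations (or the trivial semigroup) no point satisfies the following
  predicate, so these semigroups are neither elliptic nor non-elliptic below.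
\<close>

definition denjoy_wolff_point :: "(real \<Rightarrow> complex \<Rightarrow> complex) \<Rightarrow> complex \<Rightarrow> bool" where
  "denjoy_wolff_point phi \<tau> \<longleftrightarrow>
     \<tau> \<in> cball 0 1 \<and> (\<forall>z\<in>ball 0 1. ((\<lambda>t. phi t z) \<longlongrightarrow> \<tau>) at_top)"

definition elliptic :: "(real \<Rightarrow> complex \<Rightarrow> complex) \<Rightarrow> bool" where
  "elliptic phi \<longleftrightarrow> (\<exists>\<tau>\<in>ball 0 1. denjoy_wolff_point phi \<tau>)"

definition non_elliptic :: "(real \<Rightarrow> complex \<Rightarrow> complex) \<Rightarrow> bool" where
  "non_elliptic phi \<longleftrightarrow> (\<exists>\<tau>\<in>sphere 0 1. denjoy_wolff_point phi \<tau>)"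

definition spectral_value :: "(real \<Rightarrow> complex \<Rightarrow> complex) \<Rightarrow> complex \<Rightarrow> bool" where
  "spectral_value phi \<mu> \<longleftrightarrow>
     Re \<mu> > 0 \<and>
     (\<exists>\<tau>\<in>ball 0 1. denjoy_wolff_point phi \<tau> \<and>
        (\<forall>t\<ge>0. deriv (phi t) \<tau> = exp (- \<mu> * of_real t)))"

definition koenigs_elliptic ::
  "(real \<Rightarrow> complex \<Rightarrow> complex) \<Rightarrow> complex \<Rightarrow> (complex \<Rightarrow> complex) \<Rightarrow> bool" where
  "koenigs_elliptic phi \<mu> h \<longleftrightarrow>
     elliptic phi \<and> spectral_value phi \<mu> \<and>
     h holomorphic_on ball 0 1 \<and> inj_on h (ball 0 1) \<and>
     (\<forall>\<tau>\<in>ball 0 1. denjoy_wolff_point phi \<tau> \<longrightarrow> h \<tau> = 0) \<and>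
     (\<forall>t\<ge>0. \<forall>z\<in>ball 0 1. h (phi t z) = exp (- \<mu> * of_real t) * h z)"

definition koenigs_non_elliptic ::
  "(real \<Rightarrow> complex \<Rightarrow> complex) \<Rightarrow> (complex \<Rightarrow> complex) \<Rightarrow> bool" where
  "koenigs_non_elliptic phi h \<longleftrightarrow>
     non_elliptic phi \<and>
     h holomorphic_on ball 0 1 \<and> inj_on h (ball 0 1) \<and>
     (\<forall>t\<ge>0. \<forall>z\<in>ball 0 1. h (phi t z) = h z + of_real t)"

definition stolz_region :: "complex \<Rightarrow> real \<Rightarrow> complex set" where
  "stolz_region \<zeta> M = {z \<in> ball 0 1. dist z \<zeta> < M * (1 - norm z)}"

text \<open>
  Convergence along this filter is convergence inside every Stolz region with vertex \<open>\<zeta>\<close>;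
  see \<open>tendsto_nontangential_iff\<close>.
\<close>

definition nontangential_at :: "complex \<Rightarrow> complex filter" where
  "nontangential_at \<zeta> = (SUP M\<in>{1<..}. at \<zeta> within stolz_region \<zeta> M)"

lemma tendsto_nontangential_iff:
  "(f \<longlongrightarrow> l) (nontangential_at \<zeta>) \<longleftrightarrow>
     (\<forall>M>1. (f \<longlongrightarrow> l) (at \<zeta> within stolz_region \<zeta> M))"
  unfolding nontangential_at_def filterlim_iff eventually_Sup by auto

lemma nontangential_at_neq_bot:
  assumes "\<zeta> \<in> sphere 0 1"
  shows "nontangential_at \<zeta> \<noteq> bot"
proof -
  have n: "norm \<zeta> = 1" using assms by simp
  have "\<zeta> islimpt stolz_region \<zeta> 2"
    unfolding islimpt_approachable
  proof (intro allI impI)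
    fix e :: real assume e: "e > 0"
    define d where "d = min (e / 2) (1 / 2)"
    have d: "0 < d" "d < e" "d < 1" using e by (auto simp: d_def)
    define x where "x = of_real (1 - d) * \<zeta>"
    have nx: "norm x = 1 - d" using d n by (simp add: x_def norm_mult del: of_real_diff)
    have "x - \<zeta> = - (of_real d * \<zeta>)" by (simp add: x_def algebra_simps)
    then have dx: "dist x \<zeta> = d" using d n by (simp add: dist_norm norm_mult)
    show "\<exists>x\<in>stolz_region \<zeta> 2. x \<noteq> \<zeta> \<and> dist x \<zeta> < e"
      using d nx dx n by (intro bexI[of _ x]) (auto simp: stolz_region_def)
  qed
  then have "at \<zeta> within stolz_region \<zeta> 2 \<noteq> bot"
    by (simp add: trivial_limit_within)
  moreover have "at \<zeta> within stolz_region \<zeta> 2 \<le> nontangential_at \<zeta>"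
    unfolding nontangential_at_def by (rule SUP_upper) auto
  ultimately show ?thesis by (metis bot.extremum_uniqueI)
qed

definition fixed_boundary_point :: "(real \<Rightarrow> complex \<Rightarrow> complex) \<Rightarrow> complex \<Rightarrow> bool" where
  "fixed_boundary_point phi \<zeta> \<longleftrightarrow> (\<forall>t\<ge>0. (phi t \<longlongrightarrow> \<zeta>) (nontangential_at \<zeta>))"

definition life_time :: "(real \<Rightarrow> complex \<Rightarrow> complex) \<Rightarrow> complex \<Rightarrow> ereal" where
  "life_time phi \<zeta> =
     Sup (ereal ` {t. 0 \<le> t \<and> (\<exists>w\<in>sphere 0 1. (phi t \<longlongrightarrow> w) (nontangential_at \<zeta>))})"

text \<open>
  For a semigroup and \<open>\<zeta>\<close> on the unit circle this limit always exists, by a theorem of boundary dynamics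
  that is not part of the libraries; \<^term>\<open>Lim\<close> is unspecified otherwise.
\<close>

definition boundary_orbit :: "(real \<Rightarrow> complex \<Rightarrow> complex) \<Rightarrow> complex \<Rightarrow> real \<Rightarrow> complex" where
  "boundary_orbit phi \<zeta> t = Lim (nontangential_at \<zeta>) (phi t)"

text \<open>The interval on which the boundary orbit is considered: [0, S] if the life-time S is finite,
  and [0, \<open>\<infinity>\<close>) otherwise.\<close>

definition orbit_interval :: "(real \<Rightarrow> complex \<Rightarrow> complex) \<Rightarrow> complex \<Rightarrow> real set" where
  "orbit_interval phi \<zeta> = {t. 0 \<le> t \<and> ereal t \<le> life_time phi \<zeta>}"

definition lipschitz_orbit :: "(real \<Rightarrow> complex \<Rightarrow> complex) \<Rightarrow> complex \<Rightarrow> bool" where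
  "lipschitz_orbit phi \<zeta> \<longleftrightarrow>
     (\<exists>C>0. C-lipschitz_on (orbit_interval phi \<zeta>) (boundary_orbit phi \<zeta>))"

text \<open>The next two notions are meant for a boundary point that is not fixed and has positive
  life-time.\<close>

definition exceptional_orbit :: "(real \<Rightarrow> complex \<Rightarrow> complex) \<Rightarrow> complex \<Rightarrow> bool" where
  "exceptional_orbit phi \<zeta> \<longleftrightarrow> life_time phi \<zeta> = \<infinity>"

text \<open>
  The Koenigs function is unique up to an additive (non-elliptic case) or nonzero multiplicative
  (elliptic case) constant, so the condition does not depend on the choice of \<open>h\<close>. The number \<open>w\<close>
  is the non-tangential limit of \<open>h\<close> at \<open>\<zeta>\<close>.
\<close>

definition isolated_orbit :: "(real \<Rightarrow> complex \<Rightarrow> complex) \<Rightarrow> complex \<Rightarrow> bool" where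
  "isolated_orbit phi \<zeta> \<longleftrightarrow>
     (\<exists>S::real. life_time phi \<zeta> = ereal S \<and>
       ((\<exists>h w. koenigs_non_elliptic phi h \<and> (h \<longlongrightarrow> w) (nontangential_at \<zeta>) \<and>
           (\<exists>\<epsilon>>0. ball (w + of_real S) \<epsilon> \<inter> frontier (h ` ball 0 1)
                    \<subseteq> {w + of_real s | s. s \<le> S})) \<or>
        (\<exists>\<mu> h w. koenigs_elliptic phi \<mu> h \<and> (h \<longlongrightarrow> w) (nontangential_at \<zeta>) \<and>
           (\<exists>\<epsilon>>0. ball (exp (- \<mu> * of_real S) * w) \<epsilon> \<inter> frontier (h ` ball 0 1)
                    \<subseteq> {exp (- \<mu> * of_real s) * w | s. s \<le> S}))))"

end

theory Submission
  imports Defs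
begin

text \<open>
  \<^bold>\<open>Exceptional orbits.\<close> The upper half-plane covers the disc, punctured at the interior fixed point if
  there is one, and the semigroup lifts to a flow with generator \<open>G\<close>, where \<open>Im G \<ge> 0\<close>. If \<open>G\<close> is not a real
  constant, a primitive \<open>h\<close> of \<open>1 / G\<close> is injective and conjugates the flow to translations. An infinite
  life-time means that the orbits started at \<open>x\<^sub>0 + i y\<close> leave all compact sets as \<open>y \<rightarrow> 0\<close>. Monotonicity of
  \<open>Re h\<close> and \<open>Im h\<close> along vertical and horizontal lines then forces \<open>h (x\<^sub>0 + i y) \<rightarrow> p\<close>, and \<open>h\<^sup>-\<^sup>1\<close> extends by
  reflection over the ray \<open>p + t\<close>, \<open>t > 0\<close>, on which it is the boundary orbit \<open>X\<close>. Since \<open>Im (h\<^sup>-\<^sup>1)' > 0\<close> above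
  the ray, \<open>X'\<close> is monotone; together with \<open>|X'| \<le> C (1 + X\<^sup>2)\<close> (boundary Denjoy-Wolff point, where this is
  exactly the factor of the Cayley transform) or with the periodicity of the lift (interior fixed point)
  this bounds the speed of the orbit in the disc.

  \<^bold>\<open>Isolated orbits.\<close> Near its tip, the Koenigs domain is the complement of an analytic slit. The square root
  opens the slit, so the inverse Koenigs function extends by reflection as an injective function of
  \<open>u = \<surd>(S - t)\<close>. Its derivative at \<open>0\<close> is nonzero, hence the orbit moves by at least a multiple of \<open>\<surd>(S - t)\<close>
  during the time \<open>S - t\<close>.
\<close>

section \<open>Reflection across the real axis\<close>

text \<open>The obstacle is the boundary: no extension of a conformal map to it is given, and only
  the life-time and nontangential limits carry boundary information. Limits are therefore approached
  from inside, and the boundary is crossed only by reflection, under the weak hypothesis that an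
  imaginary part or a modulus converges. In the exceptional case the inverse map might run through
  infinity while it follows the ray, since infinity is an ordinary boundary point of the half-plane.
  The first reflection is therefore made in the disc, and the pole is excluded afterwards. The
  growth bound with \<open>1 + X\<^sup>2\<close> is a Cauchy estimate for
  \<open>1 / (F - \<omega>)\<close>: by injectivity, the inverse map reflected over the ray omits a
  disc about a point \<open>\<omega>\<close> that is taken elsewhere. In the isolated case both
  models, translation and spiral, are brought to one coordinate in which time is a real translation
  and the tip is 0. The slit is known to lie outside the Koenigs domain only where boundary limits
  before the life-time put it, so its guaranteed length is \<open>S\<close> and the neighbourhood of
  the tip is shrunk accordingly.\<close>

lemma deriv_bound_upper_half_plane:
  assumes holf: "f holomorphic_on ball z \<rho>" and pos: "\<And>w. w \<in> ball z \<rho> \<Longrightarrow> Im (f w) > 0" and \<rho>: "\<rho> > 0"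
  shows "norm (deriv f z) \<le> 2 * Im (f z) / \<rho>"
proof -
  define b where "b = f z"
  have bp: "Im b > 0" using pos[of z] \<rho> by (simp add: b_def)
  \<comment> \<open>After rescaling the disc, \<open>f\<close> is followed by the map of the
    half-plane onto the disc that sends \<open>b\<close> to 0; Schwarz's lemma at 0 then gives the
    bound.\<close>
  define g where "g = (\<lambda>w. (f (z + of_real \<rho> * w) - b) / (f (z + of_real \<rho> * w) - cnj b))"
  have inb: "z + of_real \<rho> * w \<in> ball z \<rho>" if "norm w < 1" for w
    using that \<rho> by (simp add: dist_norm norm_mult)
  have nz: "u - cnj b \<noteq> 0" if "Im u > 0" for u using that bp by (auto simp: complex_eq_iff)
  have holg: "g holomorphic_on ball 0 1"
  proof -
    have "(\<lambda>w. f (z + of_real \<rho> * w)) holomorphic_on ball 0 1"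
      by (rule holomorphic_on_compose_gen[OF _ holf, unfolded o_def]) (auto intro!: holomorphic_intros inb simp: image_subset_iff simp del: mem_ball)
    moreover have "f (z + of_real \<rho> * w) - cnj b \<noteq> 0" if "w \<in> ball 0 1" for w
      using that inb[of w] pos nz by auto
    ultimately show ?thesis unfolding g_def by (intro holomorphic_intros) auto
  qed
  have lt1: "norm (g w) < 1" if "norm w < 1" for w
  proof -
    define u where "u = f (z + of_real \<rho> * w)"
    have up: "Im u > 0" using pos inb that u_def by auto
    have "norm (u - b) < norm (u - cnj b)"
      using up bp unfolding cmod_def by (auto intro!: real_sqrt_less_mono simp: power2_eq_square algebra_simps)
    then show ?thesis using nz[OF up] by (simp add: g_def u_def[symmetric] norm_divide)
  qed
  have g0: "g 0 = 0" by (simp add: g_def b_def)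
  have d1: "norm (deriv g 0) \<le> 1"
    using Schwarz_Lemma(2)[OF holg g0 lt1, of 0] by simp
  have fd: "(f has_field_derivative deriv f z) (at z)"
    using holf \<rho> by (simp add: holomorphic_derivI)
  have "((\<lambda>w. f (z + of_real \<rho> * w)) has_field_derivative deriv f z * of_real \<rho>) (at 0)"
    by (rule DERIV_chain2[where f=f]) (use fd in \<open>auto intro!: derivative_eq_intros\<close>)
  then have "(g has_field_derivative
      ((deriv f z * of_real \<rho>) * (b - cnj b) - (b - b) * (deriv f z * of_real \<rho>)) / ((b - cnj b) * (b - cnj b))) (at 0)"
    unfolding g_def using nz[OF bp]
    by (auto intro!: derivative_eq_intros simp: b_def)
  then have "deriv g 0 = (deriv f z * of_real \<rho>) / (b - cnj b)"
    using nz[OF bp] by (simp add: DERIV_imp_deriv)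
  moreover have "norm (b - cnj b) = 2 * Im b"
    using bp by (simp add: complex_diff_cnj norm_mult)
  ultimately have "norm (deriv f z) * \<rho> / (2 * Im b) \<le> 1"
    using d1 \<rho> by (simp add: norm_divide norm_mult)
  then show ?thesis using bp \<rho> by (simp add: b_def field_simps)
qed

text \<open>Comparison with an explicit harmonic function. \<open>v\<close> is the continuous
  extension of \<open>Im f\<close> by 0 to the diameter, so no boundary behaviour of
  \<open>Re f\<close> is involved. The linear decay towards the axis later cancels the
  \<open>1 / y\<close> of the derivative bound.\<close>

lemma Im_barrier_bound:
  fixes f :: "complex \<Rightarrow> complex" and x \<rho> M :: real
  defines "U \<equiv> {z. dist z (of_real x) < \<rho> \<and> Im z > 0}"
      and "K \<equiv> {z. dist z (of_real x) \<le> \<rho> \<and> Im z \<ge> 0}"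
  assumes holf: "f holomorphic_on U" and \<rho>: "\<rho> > 0"
    and contv: "continuous_on K v" and v: "\<And>z. z \<in> U \<Longrightarrow> v z = Im (f z)"
    and v0: "\<And>z. z \<in> K \<Longrightarrow> Im z = 0 \<Longrightarrow> v z = 0" and vM: "\<And>z. z \<in> K \<Longrightarrow> v z \<le> M" and M: "M \<ge> 0"
    and y: "0 < y" "y < \<rho>"
  shows "Im (f (Complex x y)) \<le> 2 * M / \<rho> * y"
proof -
  \<comment> \<open>The barrier \<open>Im B\<close> is nonnegative on the diameter, and on the half
    circle it is \<open>M\<close> plus a nonnegative term. On the vertical line through
    \<open>x\<close> its quadratic term is negative, so only the linear term remains as an upper
    bound.\<close>
  define B where "B = (\<lambda>z::complex. of_real (M/\<rho>\<^sup>2) * \<i> * (z - of_real x)\<^sup>2 + of_real (2*M/\<rho>) * (z - of_real x))"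
  have ImB: "Im (B z) = M/\<rho>\<^sup>2 * ((Re z - x)\<^sup>2 - (Im z)\<^sup>2) + 2*M/\<rho> * Im z" for z
  proof -
    have "Im (of_real c * \<i> * (z - of_real x)\<^sup>2 + of_real d * (z - of_real x)) = c * ((Re z - x)\<^sup>2 - (Im z)\<^sup>2) + d * Im z" for c d
      by (simp add: power2_eq_square algebra_simps)
    then show ?thesis unfolding B_def .
  qed
  define u where "u = (\<lambda>z. v z - Im (B z))"
  have Keq: "K = cball (of_real x) \<rho> \<inter> {z. Im z \<ge> 0}" by (auto simp: K_def dist_commute)
  have compK: "compact K" unfolding Keq
    by (intro compact_Int_closed compact_cball closed_halfspace_Im_ge)
  have xK: "of_real x \<in> K" using \<rho> by (simp add: K_def)
  have contu: "continuous_on K u"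
    unfolding u_def ImB by (intro continuous_intros contv)
  obtain m where m: "m \<in> K" "\<And>z. z \<in> K \<Longrightarrow> u z \<le> u m"
    using continuous_attains_sup[OF compK _ contu] xK by blast
  have bdry: "u z \<le> 0" if "z \<in> K" "z \<notin> U" for z
  proof (cases "Im z = 0")
    case True
    then show ?thesis using v0[OF that(1)] M by (simp add: u_def ImB)
  next
    case False
    then have im: "Im z > 0" and d: "dist z (of_real x) = \<rho>" using that by (auto simp: K_def U_def)
    have e: "(Re z - x)\<^sup>2 + (Im z)\<^sup>2 = \<rho>\<^sup>2"
      using d[symmetric] by (simp add: dist_norm cmod_power2)
    then have le: "Im z \<le> \<rho>" using \<rho> by (metis abs_le_square_iff abs_of_pos abs_of_nonneg im less_eq_real_def le_add_same_cancel2 zero_le_power2)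
    define c where "c = M/\<rho>\<^sup>2"
    have c: "M = c * \<rho>\<^sup>2" "2*M/\<rho> = 2*c*\<rho>" using \<rho> by (simp_all add: c_def power2_eq_square)
    have "Im (B z) = c * ((Re z - x)\<^sup>2 + (Im z)\<^sup>2) + 2*c * (Im z) * (\<rho> - Im z)"
      unfolding ImB c_def[symmetric] c(2) by (simp add: algebra_simps power2_eq_square)
    also have "\<dots> = M + 2*c * (Im z) * (\<rho> - Im z)" by (simp only: e c(1)[symmetric])
    also have "\<dots> \<ge> M" using M im le by (simp add: c_def)
    finally show ?thesis using vM[OF that(1)] by (simp add: u_def)
  qed
  have openU: "open U"
  proof -
    have "U = ball (of_real x) \<rho> \<inter> {z. Im z > 0}" by (auto simp: U_def dist_commute)
    then show ?thesis by (simp add: open_Int open_halfspace_Im_gt)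
  qed
  have convU: "convex U"
  proof -
    have "U = ball (of_real x) \<rho> \<inter> {z. Im z > 0}" by (auto simp: U_def dist_commute)
    then show ?thesis by (simp add: convex_Int convex_halfspace_Im_gt)
  qed
  have UK: "U \<subseteq> K" by (auto simp: U_def K_def)
  have um: "u m \<le> 0"
  proof (cases "m \<in> U")
    case False then show ?thesis using bdry m by blast
  next
    case True
    \<comment> \<open>The modulus of \<open>g\<close> is \<open>exp u\<close>, which brings in the
      maximum modulus principle. An interior maximum makes \<open>u\<close> constant, and the
      constant is read off at the boundary point \<open>x\<close>.\<close>
    define g where "g = (\<lambda>z. exp (- \<i> * (f z - B z)))"
    have holg: "g holomorphic_on U" unfolding g_def B_def by (intro holomorphic_intros holf)
    have ng: "norm (g z) = exp (u z)" if "z \<in> U" for z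
      using v[OF that] by (simp add: g_def u_def)
    have "g constant_on U"
      by (rule maximum_modulus_principle[OF holg openU convex_connected[OF convU] openU order_refl True])
        (use m UK ng True in auto)
    then have cu: "u z = u m" if "z \<in> U" for z
      using ng[OF that] ng[OF True] that True unfolding constant_on_def by (metis exp_inj_iff)
    have "((\<lambda>t. u (Complex x t)) \<longlongrightarrow> u (of_real x)) (at_right 0)"
    proof -
      have ev: "\<forall>\<^sub>F t in at_right 0. Complex x t \<in> K"
        using eventually_at_right_less[of 0] eventually_at_right_real[OF \<rho>]
        by eventually_elim (auto simp: K_def dist_norm cmod_def)
      have "((\<lambda>t. Complex x t) \<longlongrightarrow> Complex x 0) (at_right 0)" by (intro tendsto_intros)
      then have "((\<lambda>t. Complex x t) \<longlongrightarrow> of_real x) (at_right 0)" by (simp add: complex_of_real_def)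
      from continuous_on_tendsto_compose[OF contu this xK ev] show ?thesis .
    qed
    moreover have "\<forall>\<^sub>F t in at_right 0. u (Complex x t) = u m"
      using eventually_at_right_less[of 0] eventually_at_right_real[OF \<rho>]
      by eventually_elim (auto simp: U_def dist_norm cmod_def intro!: cu)
    ultimately have "u (of_real x) = u m"
      by (intro tendsto_unique[OF trivial_limit_at_right_real _ tendsto_eventually])
    moreover have "u (of_real x) \<le> 0" using bdry[OF xK] by (simp add: U_def)
    ultimately show ?thesis by simp
  qed
  have "Complex x y \<in> U" using y by (auto simp: U_def dist_norm cmod_def)
  then have "u (Complex x y) \<le> 0" "v (Complex x y) = Im (f (Complex x y))" using m(2) UK um v by force+
  then have "Im (f (Complex x y)) \<le> - (M/\<rho>\<^sup>2) * y\<^sup>2 + 2*M/\<rho> * y" by (simp add: u_def ImB)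
  also have "\<dots> \<le> 2*M/\<rho> * y" using M by simp
  finally show ?thesis .
qed

lemma field_derivative_quotient_right:
  assumes "(F has_field_derivative D) (at z)" "c \<noteq> 0"
  shows "((\<lambda>t. (F (z + c * of_real t) - F z) / (c * of_real t)) \<longlongrightarrow> D) (at_right (0::real))"
proof -
  have "((\<lambda>h. (F (z + h) - F z) / h) \<longlongrightarrow> D) (at 0)" using assms by (simp add: DERIV_def)
  moreover have "filterlim (\<lambda>t. c * of_real t) (at 0) (at_right (0::real))"
    unfolding filterlim_at using assms(2)
    by (auto intro!: tendsto_eq_intros eventually_at_right_less[THEN eventually_mono])
  ultimately show ?thesis by (rule filterlim_compose)
qed

lemma Im_field_derivative_eq_0:
  assumes "(F has_field_derivative D) (at z)"
    and "\<forall>\<^sub>F t in at_right 0. Im (F (z + of_real t)) = Im (F z)"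
  shows "Im D = 0"
proof -
  have "((\<lambda>t. Im ((F (z + 1 * of_real t) - F z) / (1 * of_real t))) \<longlongrightarrow> Im D) (at_right 0)"
    by (intro tendsto_Im field_derivative_quotient_right assms) simp
  moreover have "\<forall>\<^sub>F t in at_right 0. Im ((F (z + 1 * of_real t) - F z) / (1 * of_real t)) = 0"
    using assms(2) by eventually_elim auto
  ultimately show ?thesis
    by (intro tendsto_unique[OF trivial_limit_at_right_real _ tendsto_eventually])
qed

text \<open>By the Cauchy-Riemann equations the vertical derivative of \<open>Im F\<close> is the
  real part of the complex derivative.\<close>

lemma Re_field_derivative_nonneg:
  assumes "(F has_field_derivative D) (at z)"
    and "\<forall>\<^sub>F t in at_right 0. Im (F z) \<le> Im (F (z + \<i> * of_real t))"
  shows "Re D \<ge> 0"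
proof (rule tendsto_lowerbound)
  show "((\<lambda>t. Re ((F (z + \<i> * of_real t) - F z) / (\<i> * of_real t))) \<longlongrightarrow> Re D) (at_right 0)"
    by (intro tendsto_Re field_derivative_quotient_right assms) simp
  show "\<forall>\<^sub>F t in at_right 0. 0 \<le> Re ((F (z + \<i> * of_real t) - F z) / (\<i> * of_real t))"
    using assms(2) eventually_at_right_less[of 0]
  proof eventually_elim
    case (elim t)
    have "Re (A / (\<i> * of_real t)) = Im A / t" for A
      using elim by (simp add: Re_divide power2_eq_square)
    then show ?case using elim by simp
  qed
qed simp

text \<open>Reflection needs \<open>f\<close> to be continuous up to the axis, while only
  \<open>Im f\<close> has boundary values. A gradient estimate closes the gap: \<open>Im f\<close>
  is at most a multiple of the height, so Schwarz's lemma in the disc of radius \<open>Im z\<close>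
  about \<open>z\<close> bounds \<open>deriv f\<close>, and a Lipschitz function extends to the
  closure. Injectivity makes the derivative nonzero on the axis, hence positive there.\<close>

lemma Schwarz_reflection_Im:
  fixes a R :: real and f :: "complex \<Rightarrow> complex"
  defines "U \<equiv> {z. dist z (of_real a) < R \<and> Im z > 0}"
  assumes R: "R > 0" and holf: "f holomorphic_on U" and pos: "\<And>z. z \<in> U \<Longrightarrow> Im (f z) > 0"
    and inj: "inj_on f U"
    and lim: "\<And>x. \<bar>x - a\<bar> < R \<Longrightarrow> ((\<lambda>z. Im (f z)) \<longlongrightarrow> 0) (at (of_real x) within {z. Im z > 0})"
  obtains r F where "0 < r" "r \<le> R" "F holomorphic_on ball (of_real a) r"
    "\<And>z. z \<in> ball (of_real a) r \<Longrightarrow> Im z > 0 \<Longrightarrow> F z = f z"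
    "\<And>z. z \<in> ball (of_real a) r \<Longrightarrow> Im z = 0 \<Longrightarrow> Im (F z) = 0"
    "\<And>z. z \<in> ball (of_real a) r \<Longrightarrow> Im z < 0 \<Longrightarrow> Im (F z) < 0"
    "inj_on F (ball (of_real a) r)"
    "\<And>x. \<bar>x - a\<bar> < r \<Longrightarrow> Im (deriv F (of_real x)) = 0 \<and> Re (deriv F (of_real x)) > 0"
proof -
  have Ueq: "U = ball (of_real a) R \<inter> {z. Im z > 0}" by (auto simp: U_def dist_commute)
  have openU: "open U" unfolding Ueq by (simp add: open_Int open_halfspace_Im_gt)
  define v where "v = (\<lambda>z. if Im z > 0 then Im (f z) else 0)"
  define K0 where "K0 = cball (complex_of_real a) (R/2) \<inter> {z. Im z \<ge> 0}"
  have contv: "continuous_on K0 v"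
    unfolding continuous_on_eq_continuous_within
  proof
    fix z assume z: "z \<in> K0"
    show "continuous (at z within K0) v"
    proof (cases "Im z > 0")
      case True
      then have zU: "z \<in> U" using z R by (auto simp: U_def K0_def dist_commute)
      have "isCont f z" using holomorphic_on_imp_continuous_on[OF holf] openU zU
        by (simp add: continuous_on_eq_continuous_at)
      then have "isCont (\<lambda>z. Im (f z)) z" unfolding isCont_def by (rule tendsto_Im)
      moreover have "\<forall>\<^sub>F w in nhds z. Im (f w) = v w"
        using eventually_nhds_in_open[OF openU zU] by eventually_elim (auto simp: v_def U_def)
      ultimately have "isCont v z" by (simp add: isCont_cong)
      then show ?thesis by (rule continuous_at_imp_continuous_at_within)
    next
      case False
      then have im: "Im z = 0" using z by (auto simp: K0_def)
      have zr: "z = of_real (Re z)" using im by (simp add: complex_eq_iff)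
      have "\<bar>Re z - a\<bar> < R"
      proof -
        have "\<bar>Re z - a\<bar> \<le> norm (z - of_real a)" using abs_Re_le_cmod[of "z - of_real a"] by simp
        then show ?thesis using z R by (auto simp: K0_def dist_norm norm_minus_commute)
      qed
      from lim[OF this] have l: "((\<lambda>z. Im (f z)) \<longlongrightarrow> 0) (at z within {z. Im z > 0})" using zr by simp
      have "(v \<longlongrightarrow> 0) (at z within K0)"
        unfolding tendsto_iff
      proof (intro allI impI)
        fix e :: real assume e: "e > 0"
        have "\<forall>\<^sub>F w in at z within {z. Im z > 0}. dist (Im (f w)) 0 < e" using l e by (simp add: tendsto_iff)
        then obtain d where d: "d > 0" "\<And>w. Im w > 0 \<Longrightarrow> w \<noteq> z \<Longrightarrow> dist w z < d \<Longrightarrow> dist (Im (f w)) 0 < e"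
          unfolding eventually_at by auto
        show "\<forall>\<^sub>F w in at z within K0. dist (v w) 0 < e"
          unfolding eventually_at using d e by (intro exI[of _ d]) (auto simp: v_def)
      qed
      then show ?thesis using im by (simp add: continuous_within v_def)
    qed
  qed
  have compK0: "compact K0" unfolding K0_def by (intro compact_Int_closed compact_cball closed_halfspace_Im_ge)
  have "bounded (v ` K0)" using compact_continuous_image[OF contv compK0] compact_imp_bounded by blast
  then obtain M where M: "M > 0" "\<And>z. z \<in> K0 \<Longrightarrow> norm (v z) \<le> M" unfolding bounded_pos by auto
  \<comment> \<open>Points of \<open>V\<close> have real part within \<open>R/8\<close> of
    \<open>a\<close>. Half discs of radius \<open>R/4\<close> about their projections to the axis
    then stay inside \<open>K0\<close>, whose radius is \<open>R/2\<close>, and the disc about such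
    a point that touches the axis stays inside \<open>U\<close>.\<close>
  define r where "r = R/8"
  have r0: "r > 0" using R by (simp add: r_def)
  define V where "V = ball (complex_of_real a) r \<inter> {z. Im z > 0}"
  have VU: "V \<subseteq> U" using R by (auto simp: V_def U_def r_def dist_commute)
  have bd: "norm (deriv f z) \<le> 16*M/R" if z: "z \<in> V" for z
  proof -
    define x where "x = Re z"
    define y where "y = Im z"
    have zxy: "z = Complex x y" by (simp add: x_def y_def)
    have dz: "norm (z - of_real a) < R/8" using z by (simp add: V_def r_def dist_norm norm_minus_commute)
    have xa: "\<bar>x - a\<bar> < R/8" using abs_Re_le_cmod[of "z - of_real a"] dz by (simp add: x_def)
    have y: "0 < y" "y < R/8" using abs_Im_le_cmod[of "z - of_real a"] dz z by (auto simp: y_def V_def)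
    have in1: "norm (w - of_real a) < R/8 + e" if "norm (w - of_real x) \<le> e" for w :: complex and e
    proof -
      have "norm (w - of_real a) \<le> norm (w - of_real x) + norm (of_real x - of_real a :: complex)"
        using norm_triangle_ineq[of "w - of_real x" "of_real x - of_real a"] by simp
      also have "norm (of_real x - of_real a :: complex) = \<bar>x - a\<bar>" by (metis norm_of_real of_real_diff)
      finally show ?thesis using xa that by linarith
    qed
    have KK: "{z. dist z (of_real x) \<le> R/4 \<and> Im z \<ge> 0} \<subseteq> K0"
      using in1[of _ "R/4"] R by (force simp: K0_def dist_norm norm_minus_commute)
    have UU: "{z. dist z (of_real x) < R/4 \<and> Im z > 0} \<subseteq> U"
    proof clarify
      fix w assume w: "dist w (complex_of_real x) < R/4" "Im w > 0"
      then have "norm (w - of_real a) < R/8 + R/4" using in1[of w "R/4"] by (simp add: dist_norm)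
      then show "w \<in> U" using R w by (simp add: U_def dist_norm)
    qed
    have "Im (f (Complex x y)) \<le> 2 * M / (R/4) * y"
    proof (rule Im_barrier_bound[where v=v])
      show "f holomorphic_on {z. dist z (of_real x) < R/4 \<and> Im z > 0}"
        using holf UU by (rule holomorphic_on_subset)
      show "continuous_on {z. dist z (of_real x) \<le> R/4 \<and> Im z \<ge> 0} v"
        using contv KK by (rule continuous_on_subset)
      show "v z \<le> M" if "z \<in> {z. dist z (of_real x) \<le> R/4 \<and> Im z \<ge> 0}" for z
        using M(2)[of z] that KK by (force simp: subset_iff)
    qed (use R y M in \<open>auto simp: v_def\<close>)
    then have i: "Im (f z) \<le> 8 * M / R * y" by (simp add: zxy)
    have ballU: "ball z y \<subseteq> U"
    proof
      fix w assume w: "w \<in> ball z y"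
      have "norm (w - z) < y" using w by (simp add: dist_norm norm_minus_commute)
      moreover have "\<bar>Im w - Im z\<bar> \<le> norm (w - z)" using abs_Im_le_cmod[of "w - z"] by simp
      moreover have "norm (w - of_real a) \<le> norm (w - z) + norm (z - of_real a)"
        using norm_triangle_ineq[of "w - z" "z - of_real a"] by simp
      ultimately show "w \<in> U" using dz y by (auto simp: U_def dist_norm y_def)
    qed
    have "norm (deriv f z) \<le> 2 * Im (f z) / y"
      by (rule deriv_bound_upper_half_plane) (use ballU holf pos y in \<open>auto intro: holomorphic_on_subset\<close>)
    also have "\<dots> \<le> 2 * (8 * M / R * y) / y" using i y by (intro divide_right_mono mult_left_mono) auto
    also have "\<dots> = 16*M/R" using y by simp
    finally show ?thesis .
  qed
  have convV: "convex V" unfolding V_def by (simp add: convex_Int convex_halfspace_Im_gt)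
  have "(16*M/R)-lipschitz_on V f"
  proof (rule lipschitz_onI)
    fix x y assume xy: "x \<in> V" "y \<in> V"
    have "norm (f x - f y) \<le> (16*M/R) * norm (x - y)"
    proof (rule field_differentiable_bound[OF convV, where f' = "deriv f"])
      show "(f has_field_derivative deriv f z) (at z within V)" if "z \<in> V" for z
        using holomorphic_derivI[OF holf openU] that VU has_field_derivative_at_within by blast
    qed (use bd xy in auto)
    then show "dist (f x) (f y) \<le> (16*M/R) * dist x y" by (simp add: dist_norm)
  qed (use M R in simp)
  then have "uniformly_continuous_on V f" by (rule lipschitz_on_uniformly_continuous)
  then obtain g where g: "uniformly_continuous_on (closure V) g" "\<And>x. x \<in> V \<Longrightarrow> f x = g x"
    using uniformly_continuous_on_extension_on_closure by metis
  have contg: "continuous_on (closure V) g" using g(1) by (rule uniformly_continuous_imp_continuous)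
  have realpt: "of_real x islimpt V" if x: "\<bar>x - a\<bar> < r" for x
    unfolding islimpt_approachable
  proof (intro allI impI)
    fix e :: real assume e: "e > 0"
    define t where "t = min (e/2) ((r - \<bar>x - a\<bar>)/2)"
    have t: "t > 0" "t < e" "\<bar>x - a\<bar> + t < r"
      unfolding t_def using e x by (auto simp: min_def field_simps)
    have "norm (Complex x t - of_real a) \<le> \<bar>x - a\<bar> + \<bar>t\<bar>"
      using cmod_le[of "Complex x t - of_real a"] by simp
    then have "Complex x t \<in> V" using t by (auto simp: V_def dist_norm norm_minus_commute)
    moreover have "dist (Complex x t) (of_real x) < e"
      using t by (simp add: dist_norm cmod_def)
    moreover have "Complex x t \<noteq> of_real x" using t by (auto simp: complex_eq_iff)
    ultimately show "\<exists>x'\<in>V. x' \<noteq> of_real x \<and> dist x' (of_real x) < e" by blast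
  qed
  have cl: "ball (of_real a) r \<inter> {z. 0 \<le> Im z} \<subseteq> closure V"
  proof
    fix z assume z: "z \<in> ball (complex_of_real a) r \<inter> {z. 0 \<le> Im z}"
    show "z \<in> closure V"
    proof (cases "Im z > 0")
      case True then have "z \<in> V" using z by (simp add: V_def)
      then show ?thesis using closure_subset by blast
    next
      case False
      then have zr: "z = of_real (Re z)" using z by (auto simp: complex_eq_iff)
      have "\<bar>Re z - a\<bar> < r" using z abs_Re_le_cmod[of "z - of_real a"] by (auto simp: dist_norm norm_minus_commute)
      from realpt[OF this] show ?thesis using zr by (simp add: closure_def)
    qed
  qed
  have greal: "g z \<in> \<real>" if z: "z \<in> ball (of_real a) r" "z \<in> \<real>" for z
  proof -
    obtain x where x: "z = of_real x" using z(2) by (auto elim: Reals_cases)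
    have xa: "\<bar>x - a\<bar> < r" using z x by (metis dist_commute dist_of_real mem_ball real_norm_def dist_norm)
    have "(g \<longlongrightarrow> g z) (at z within closure V)"
    proof -
      have "z \<in> closure V" using cl z by (auto simp: complex_is_Real_iff)
      then show ?thesis using contg unfolding continuous_on_def by blast
    qed
    then have "(g \<longlongrightarrow> g z) (at z within V)" by (rule tendsto_within_subset) (rule closure_subset)
    then have l1: "((\<lambda>w. Im (g w)) \<longlongrightarrow> Im (g z)) (at z within V)" by (rule tendsto_Im)
    have "((\<lambda>w. Im (f w)) \<longlongrightarrow> 0) (at z within V)"
    proof (rule tendsto_within_subset)
      show "((\<lambda>w. Im (f w)) \<longlongrightarrow> 0) (at z within {z. Im z > 0})"
        unfolding x by (rule lim) (use xa R in \<open>auto simp: r_def\<close>)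
    qed (auto simp: V_def)
    moreover have "\<forall>\<^sub>F w in at z within V. Im (f w) = Im (g w)"
      using g(2) by (auto simp: eventually_at intro!: exI[of _ 1])
    ultimately have l2: "((\<lambda>w. Im (g w)) \<longlongrightarrow> 0) (at z within V)" by (rule Lim_transform_eventually)
    have "at z within V \<noteq> bot" using realpt[OF xa] x by (simp add: trivial_limit_within)
    then have "Im (g z) = 0" using l1 l2 tendsto_unique by blast
    then show ?thesis by (simp add: complex_is_Real_iff)
  qed
  define F where "F = (\<lambda>z. if 0 \<le> Im z then g z else cnj (g (cnj z)))"
  have holF: "F holomorphic_on ball (of_real a) r"
    unfolding F_def
  proof (rule Schwarz_reflection)
    show "cnj ` ball (of_real a) r \<subseteq> ball (of_real a) r"
    proof clarify
      fix z assume "z \<in> ball (complex_of_real a) r"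
      moreover have "norm (of_real a - cnj z) = norm (of_real a - z)"
        by (metis complex_cnj_complex_of_real complex_cnj_diff complex_mod_cnj)
      ultimately show "cnj z \<in> ball (complex_of_real a) r" by (simp add: dist_norm)
    qed
    have "f holomorphic_on V" using holf VU by (rule holomorphic_on_subset)
    then show "g holomorphic_on ball (of_real a) r \<inter> {z. 0 < Im z}"
      using g(2) by (subst holomorphic_cong[of _ _ _ f]) (auto simp: V_def)
  qed (use greal contg cl in \<open>auto intro: continuous_on_subset\<close>)
  have Fup: "F z = f z" if "z \<in> ball (of_real a) r" "Im z > 0" for z
    using that g(2)[of z] by (simp add: F_def V_def)
  have Freal: "Im (F z) = 0" if "z \<in> ball (of_real a) r" "Im z = 0" for z
    using greal[of z] that by (simp add: F_def complex_is_Real_iff)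
  have cnjball: "cnj z \<in> ball (of_real a) r" if "z \<in> ball (of_real a) r" for z
  proof -
    have "norm (of_real a - cnj z) = norm (of_real a - z)"
      by (metis complex_cnj_complex_of_real complex_cnj_diff complex_mod_cnj)
    then show ?thesis using that by (simp add: dist_norm)
  qed
  have Fcnj: "F z = cnj (f (cnj z))" if "z \<in> ball (of_real a) r" "Im z < 0" for z
    using that g(2)[of "cnj z"] cnjball[of z] by (simp add: F_def V_def)
  have Flow: "Im (F z) < 0" if "z \<in> ball (of_real a) r" "Im z < 0" for z
  proof -
    have "cnj z \<in> U" using cnjball[OF that(1)] that VU by (auto simp: V_def)
    then show ?thesis using pos Fcnj[OF that] by simp
  qed
  have Fpos: "Im (F z) > 0" if "z \<in> ball (of_real a) r" "Im z > 0" for z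
    using Fup[OF that] pos[of z] that VU by (auto simp: V_def)
  have inball: "of_real x \<in> ball (complex_of_real a) r \<longleftrightarrow> \<bar>x - a\<bar> < r" for x
    by (metis dist_commute dist_of_real mem_ball dist_real_def)
  have dF: "(F has_field_derivative deriv F z) (at z)" if "z \<in> ball (of_real a) r" for z
    using holF that by (simp add: holomorphic_derivI)
  have small: "\<forall>\<^sub>F t in at_right (0::real). of_real x + c * of_real t \<in> ball (of_real a) r"
    if "\<bar>x - a\<bar> < r" for x and c :: complex
  proof -
    have "((\<lambda>t. of_real x + c * of_real t) \<longlongrightarrow> of_real x + c * of_real 0) (at_right (0::real))"
      by (intro tendsto_intros)
    then show ?thesis using inball[of x] that by (intro topological_tendstoD) auto
  qed
  have dre: "Im (deriv F (of_real x)) = 0" if x: "\<bar>x - a\<bar> < r" for x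
  proof (rule Im_field_derivative_eq_0)
    show "(F has_field_derivative deriv F (of_real x)) (at (of_real x))" using dF inball x by blast
    show "\<forall>\<^sub>F t in at_right 0. Im (F (of_real x + of_real t)) = Im (F (of_real x))"
      using small[OF x, of 1] by eventually_elim (use Freal inball x in auto)
  qed
  have dnn: "Re (deriv F (of_real x)) \<ge> 0" if x: "\<bar>x - a\<bar> < r" for x
  proof (rule Re_field_derivative_nonneg)
    show "(F has_field_derivative deriv F (of_real x)) (at (of_real x))" using dF inball x by blast
    show "\<forall>\<^sub>F t in at_right 0. Im (F (of_real x)) \<le> Im (F (of_real x + \<i> * of_real t))"
      using small[OF x, of \<i>] eventually_at_right_less[of 0]
    proof eventually_elim
      case (elim t)
      have "Im (F (of_real x + \<i> * of_real t)) > 0" using elim Fpos by auto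
      then show ?case using Freal inball x by auto
    qed
  qed
  \<comment> \<open>Along the axis \<open>F\<close> is real and nondecreasing. Equal values at two
    points would make it constant on the segment between them, hence on the ball, against
    \<open>Im F > 0\<close> above the axis.\<close>
  have injreal: "F (of_real x1) \<noteq> F (of_real x2)" if x: "\<bar>x1 - a\<bar> < r" "\<bar>x2 - a\<bar> < r" "x1 < x2" for x1 x2
  proof
    assume eq: "F (of_real x1) = F (of_real x2)"
    have mono: "Re (F (of_real s)) \<le> Re (F (of_real t))" if "x1 \<le> s" "s \<le> t" "t \<le> x2" for s t
    proof (rule DERIV_nonneg_imp_nondecreasing[OF \<open>s \<le> t\<close>])
      fix u assume u: "s \<le> u" "u \<le> t"
      have ua: "\<bar>u - a\<bar> < r" using u that x by linarith
      then have "of_real u \<in> ball (complex_of_real a) r" using inball by blast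
      from has_vector_derivative_real_field[OF dF[OF this]]
      have "((\<lambda>v. F (of_real v)) has_vector_derivative deriv F (of_real u)) (at u)" by (simp add: o_def)
      then have "((\<lambda>v. Re (F (of_real v))) has_vector_derivative Re (deriv F (of_real u))) (at u)"
        by (rule bounded_linear.has_vector_derivative[OF bounded_linear_Re])
      then show "\<exists>y. ((\<lambda>v. Re (F (of_real v))) has_real_derivative y) (at u) \<and> 0 \<le> y"
        using dnn[OF ua] by (auto simp: has_real_derivative_iff_has_vector_derivative)
    qed
    have const: "F (of_real s) - F (of_real x1) = 0" if "x1 \<le> s" "s \<le> x2" for s
    proof -
      have "Re (F (of_real s)) = Re (F (of_real x1))"
        using mono[of x1 s] mono[of s x2] that x eq by auto
      moreover have "\<bar>s - a\<bar> < r" using that x by linarith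
      ultimately show ?thesis using Freal[of "of_real s"] Freal[of "of_real x1"] inball x
        by (auto simp: complex_eq_iff)
    qed
    have lp: "complex_of_real x1 islimpt of_real ` {x1..x2}"
      unfolding islimpt_approachable
    proof (intro allI impI)
      fix e :: real assume e: "e > 0"
      define t where "t = min (e/2) (x2 - x1)"
      have "t > 0" "t < e" "x1 + t \<le> x2" using e x by (auto simp: t_def)
      then show "\<exists>x'\<in>complex_of_real ` {x1..x2}. x' \<noteq> of_real x1 \<and> dist x' (of_real x1) < e"
        by (intro bexI[of _ "of_real (x1+t)"] imageI conjI) (auto simp: dist_norm)
    qed
    have zero: "F z - F (of_real x1) = 0" if "z \<in> ball (of_real a) r" for z
    proof (rule analytic_continuation[where f = "\<lambda>z. F z - F (of_real x1)" and S = "ball (of_real a) r"])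
      show "of_real ` {x1..x2} \<subseteq> ball (complex_of_real a) r"
      proof (rule image_subsetI)
        fix s assume "s \<in> {x1..x2}"
        then have "\<bar>s - a\<bar> < r" using x by auto
        then show "complex_of_real s \<in> ball (of_real a) r" by (simp only: inball)
      qed
      show "complex_of_real x1 \<in> ball (of_real a) r" using x(1) by (simp only: inball)
      show "(\<lambda>z. F z - F (of_real x1)) holomorphic_on ball (of_real a) r"
        by (intro holomorphic_intros holF)
      show "F u - F (of_real x1) = 0" if u: "u \<in> of_real ` {x1..x2}" for u
      proof -
        obtain s where "u = of_real s" "x1 \<le> s" "s \<le> x2" using u by auto
        with const[of s] show ?thesis by simp
      qed
    qed (use lp that in auto)
    define w where "w = Complex a (r/2)"
    have "w \<in> ball (of_real a) r" using r0 by (simp add: w_def dist_norm cmod_def)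
    moreover have "Im w > 0" using r0 by (simp add: w_def)
    ultimately show False
      using Fpos[of w] zero[of w] Freal[of "of_real x1"] inball[of x1] x by auto
  qed
  have injF: "inj_on F (ball (of_real a) r)"
  proof (rule inj_onI)
    fix z w assume z: "z \<in> ball (complex_of_real a) r" and w: "w \<in> ball (complex_of_real a) r" and eq: "F z = F w"
    \<comment> \<open>The sign of \<open>Im (F z)\<close> is that of \<open>Im z\<close>, so only
      points on the same side of the axis can have equal values.\<close>
    consider "Im z > 0" | "Im z = 0" | "Im z < 0" by linarith
    then show "z = w"
    proof cases
      case 1
      then have "Im w > 0" using Fpos[of z] Freal[of w] Flow[of w] z w eq by (metis less_numeral_extra(3) linorder_neqE_linordered_idom order_less_asym)
      then show ?thesis using 1 Fup z w eq VU inj unfolding inj_on_def V_def by (metis (mono_tags, lifting) IntI mem_Collect_eq subsetD)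
    next
      case 2
      then have iw: "Im w = 0" using Fpos[of w] Freal[of z] Flow[of w] z w eq by (metis less_numeral_extra(3) linorder_neqE_linordered_idom)
      have zw: "z = of_real (Re z)" "w = of_real (Re w)" using 2 iw by (auto simp: complex_eq_iff)
      have za: "\<bar>Re z - a\<bar> < r" using z inball[of "Re z"] unfolding zw(1)[symmetric] by blast
      have wa: "\<bar>Re w - a\<bar> < r" using w inball[of "Re w"] unfolding zw(2)[symmetric] by blast
      have "Re z = Re w"
        using injreal[OF za wa] injreal[OF wa za] eq unfolding zw[symmetric] by force
      then show ?thesis using 2 iw by (simp add: complex_eq_iff)
    next
      case 3
      then have iw: "Im w < 0" using Fpos[of w] Flow[of z] Freal[of w] z w eq by (metis less_numeral_extra(3) linorder_neqE_linordered_idom order_less_asym)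
      have "cnj (f (cnj z)) = cnj (f (cnj w))" using Fcnj[OF z 3] Fcnj[OF w iw] eq by metis
      then have "f (cnj z) = f (cnj w)" by (simp only: complex_cnj_cancel_iff)
      moreover have "cnj z \<in> U" "cnj w \<in> U" using cnjball z w 3 iw VU by (auto simp: V_def)
      ultimately have "cnj z = cnj w" using inj_onD[OF inj] by blast
      then show ?thesis by simp
    qed
  qed
  have dpos: "Im (deriv F (of_real x)) = 0 \<and> Re (deriv F (of_real x)) > 0" if x: "\<bar>x - a\<bar> < r" for x
  proof -
    have "of_real x \<in> ball (complex_of_real a) r" using inball x by blast
    then have "deriv F (of_real x) \<noteq> 0"
      using holomorphic_injective_imp_regular[OF holF _ injF] by auto
    then show ?thesis using dre[OF x] dnn[OF x] by (auto simp: complex_eq_iff)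
  qed
  show thesis
    by (rule that[OF r0 _ holF Fup Freal Flow injF dpos]) (use R in \<open>auto simp: r_def\<close>)
qed

text \<open>The logarithm turns the unit circle into the real axis: for
  \<open>k = exp (\<i> * f)\<close> the hypothesis on the modulus says that \<open>Im f\<close>
  tends to 0. The conclusion keeps \<open>F\<close> rather than its exponential because
  \<open>F\<close> is real on the axis and injective.\<close>

lemma Schwarz_reflection_disc:
  fixes a R :: real and k :: "complex \<Rightarrow> complex"
  defines "U \<equiv> {z. dist z (of_real a) < R \<and> Im z > 0}"
  assumes R: "R > 0" and holk: "k holomorphic_on U" and kD: "k ` U \<subseteq> ball 0 1"
    and inj: "inj_on k U"
    and lim: "\<And>x. \<bar>x - a\<bar> < R \<Longrightarrow> ((\<lambda>z. norm (k z)) \<longlongrightarrow> 1) (at (of_real x) within {z. Im z > 0})"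
  obtains r F where "0 < r" "r \<le> R" "F holomorphic_on ball (of_real a) r"
    "\<And>z. z \<in> ball (of_real a) r \<Longrightarrow> Im z > 0 \<Longrightarrow> k z = exp (\<i> * F z)"
    "\<And>z. z \<in> ball (of_real a) r \<Longrightarrow> Im z = 0 \<Longrightarrow> Im (F z) = 0"
    "inj_on F (ball (of_real a) r)"
proof -
  have "((\<lambda>z. norm (k z)) \<longlongrightarrow> 1) (at (of_real a) within {z. Im z > 0})" using lim[of a] R by simp
  then have "\<forall>\<^sub>F z in at (of_real a) within {z. Im z > 0}. norm (k z) > 1/2"
    by (rule order_tendstoD(1)) simp
  then obtain d where d: "d > 0"
    "\<And>z. Im z > 0 \<Longrightarrow> z \<noteq> of_real a \<Longrightarrow> dist z (of_real a) < d \<Longrightarrow> norm (k z) > 1/2"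
    unfolding eventually_at by auto
  \<comment> \<open>On this smaller half disc \<open>k\<close> has no zeros, and convexity provides
    a logarithm.\<close>
  define R' where "R' = min d R"
  have R': "R' > 0" "R' \<le> R" using d R by (auto simp: R'_def)
  define U' where "U' = {z. dist z (complex_of_real a) < R' \<and> Im z > 0}"
  have U'U: "U' \<subseteq> U" using R' by (auto simp: U'_def U_def)
  have knz: "k z \<noteq> 0" if "z \<in> U'" for z
    using d(2)[of z] that by (fastforce simp: U'_def R'_def)
  have U'eq: "U' = ball (of_real a) R' \<inter> {z. Im z > 0}" by (auto simp: U'_def dist_commute)
  have convU': "convex U'" unfolding U'eq by (simp add: convex_Int convex_halfspace_Im_gt)
  obtain L where L: "L holomorphic_on U'" "\<And>z. z \<in> U' \<Longrightarrow> k z = exp (L z)"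
    using contractible_imp_holomorphic_log[OF holomorphic_on_subset[OF holk U'U] convex_imp_contractible[OF convU'] knz] by metis
  define f where "f = (\<lambda>z. - \<i> * L z)"
  have kf: "k z = exp (\<i> * f z)" if "z \<in> U'" for z using L(2)[OF that] by (simp add: f_def)
  have Imf: "Im (f z) = - ln (norm (k z))" if "z \<in> U'" for z
    using L(2)[OF that] by (simp add: f_def)
  have lim': "((\<lambda>z. Im (f z)) \<longlongrightarrow> 0) (at (of_real x) within {z. Im z > 0})" if x: "\<bar>x - a\<bar> < R'" for x
  proof -
    have "\<forall>\<^sub>F z in nhds (complex_of_real x). z \<in> ball (of_real a) R'"
      by (rule eventually_nhds_in_open) (use x in \<open>auto simp: dist_real_def abs_minus_commute dist_of_real\<close>)
    then have ev: "\<forall>\<^sub>F z in at (of_real x) within {z. Im z > 0}. - ln (norm (k z)) = Im (f z)"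
      unfolding eventually_at_filter by eventually_elim (auto simp: Imf U'eq)
    have "((\<lambda>z. - ln (norm (k z))) \<longlongrightarrow> - ln 1) (at (of_real x) within {z. Im z > 0})"
      by (intro tendsto_intros lim) (use x R' in auto)
    then show ?thesis using tendsto_cong[OF ev] by simp
  qed
  have pos: "Im (f z) > 0" if "z \<in> U'" for z
  proof -
    have "norm (k z) < 1" using kD that U'U by (auto simp: image_subset_iff subset_iff)
    then show ?thesis unfolding Imf[OF that] using knz[OF that] by simp
  qed
  have inj': "inj_on f U'"
    using kf inj U'U unfolding inj_on_def by (metis subsetD)
  have holf: "f holomorphic_on U'" unfolding f_def by (intro holomorphic_intros L)
  obtain r F where "0 < r" "r \<le> R'" "F holomorphic_on ball (of_real a) r"
    and up: "\<And>z. z \<in> ball (of_real a) r \<Longrightarrow> Im z > 0 \<Longrightarrow> F z = f z"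
    and "\<And>z. z \<in> ball (of_real a) r \<Longrightarrow> Im z = 0 \<Longrightarrow> Im (F z) = 0"
    "inj_on F (ball (of_real a) r)"
    using Schwarz_reflection_Im[OF R'(1) holf[unfolded U'_def] _ inj'[unfolded U'_def] lim'] pos
    unfolding U'_def by (metis (no_types, lifting))
  then show thesis
    by (intro that[of r F]) (use R' kf in \<open>auto simp: U'eq\<close>)
qed

text \<open>Boundary uniqueness: extended by 0 and reflected, the function vanishes on a segment
  inside its domain, and the identity theorem applies.\<close>

lemma boundary_zero_imp_zero:
  fixes a r :: real
  defines "U \<equiv> {z. dist z (complex_of_real a) < r \<and> Im z > 0}"
  assumes holf: "f holomorphic_on U" and z: "z \<in> U"
    and lim: "\<And>x. \<bar>x - a\<bar> < r \<Longrightarrow> (f \<longlongrightarrow> 0) (at (of_real x) within {z. Im z > 0})"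
  shows "f z = 0"
proof -
  define B where "B = ball (complex_of_real a) r"
  have r: "r > 0" using z by (auto simp: U_def intro: le_less_trans[OF zero_le_dist])
  have Ueq: "U = B \<inter> {z. Im z > 0}" by (auto simp: U_def B_def dist_commute)
  have openU: "open U" unfolding Ueq B_def by (simp add: open_Int open_halfspace_Im_gt)
  define f0 where "f0 = (\<lambda>z. if Im z > 0 then f z else 0)"
  have inB: "\<bar>Re z - a\<bar> < r" if "z \<in> B" for z
    using that abs_Re_le_cmod[of "z - of_real a"] by (auto simp: B_def dist_norm norm_minus_commute)
  have contf0: "continuous_on (B \<inter> {z. 0 \<le> Im z}) f0"
    unfolding continuous_on_def
  proof
    fix z assume z: "z \<in> B \<inter> {z. 0 \<le> Im z}"
    show "(f0 \<longlongrightarrow> f0 z) (at z within B \<inter> {z. 0 \<le> Im z})"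
    proof (cases "Im z > 0")
      case True
      then have zU: "z \<in> U" using z by (auto simp: Ueq)
      have "isCont f z" using holomorphic_on_imp_continuous_on[OF holf] openU zU
        by (simp add: continuous_on_eq_continuous_at)
      moreover have "\<forall>\<^sub>F w in nhds z. f w = f0 w"
        using eventually_nhds_in_open[OF openU zU] by eventually_elim (auto simp: f0_def Ueq)
      ultimately have "isCont f0 z" by (simp add: isCont_cong)
      then show ?thesis unfolding isCont_def by (rule tendsto_within_subset) simp
    next
      case False
      then have zr: "z = of_real (Re z)" using z by (auto simp: complex_eq_iff)
      have l: "(f \<longlongrightarrow> 0) (at z within {z. Im z > 0})" using lim[OF inB[of z]] z zr by auto
      show ?thesis unfolding tendsto_iff
      proof (intro allI impI)
        fix e :: real assume e: "e > 0"
        have "\<forall>\<^sub>F w in at z within {z. Im z > 0}. dist (f w) 0 < e" using l e by (simp add: tendsto_iff)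
        then show "\<forall>\<^sub>F w in at z within B \<inter> {z. 0 \<le> Im z}. dist (f0 w) (f0 z) < e"
          unfolding eventually_at_filter by eventually_elim (use False e in \<open>auto simp: f0_def\<close>)
      qed
    qed
  qed
  define F where "F = (\<lambda>z. if 0 \<le> Im z then f0 z else cnj (f0 (cnj z)))"
  have holF: "F holomorphic_on B" unfolding F_def
  proof (rule Schwarz_reflection)
    show "cnj ` B \<subseteq> B"
    proof clarify
      fix z assume "z \<in> B"
      moreover have "norm (of_real a - cnj z) = norm (of_real a - z)"
        by (metis complex_cnj_complex_of_real complex_cnj_diff complex_mod_cnj)
      ultimately show "cnj z \<in> B" by (simp add: dist_norm B_def)
    qed
    show "f0 holomorphic_on B \<inter> {z. 0 < Im z}"
      using holf by (subst holomorphic_cong[of _ _ _ f]) (auto simp: f0_def Ueq)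
  qed (use contf0 in \<open>auto simp: B_def f0_def complex_is_Real_iff\<close>)
  have lp: "complex_of_real a islimpt of_real ` {a..<a+r}"
    unfolding islimpt_approachable
  proof (intro allI impI)
    fix e :: real assume e: "e > 0"
    define t where "t = min e r / 2"
    have "t > 0" "t < e" "t < r" using e r by (auto simp: t_def)
    then show "\<exists>x'\<in>complex_of_real ` {a..<a+r}. x' \<noteq> of_real a \<and> dist x' (of_real a) < e"
      by (intro bexI[of _ "of_real (a+t)"] imageI conjI) (auto simp: dist_norm)
  qed
  have "F z = 0"
  proof (rule analytic_continuation[OF holF _ _ _ _ lp])
    show "of_real ` {a..<a+r} \<subseteq> B"
      by (auto simp: B_def dist_norm abs_less_iff simp flip: of_real_diff)
  qed (use r z in \<open>auto simp: B_def Ueq F_def f0_def\<close>)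
  then show ?thesis using z by (auto simp: F_def f0_def Ueq)
qed

abbreviation uhp :: "complex set" where "uhp \<equiv> {z. Im z > 0}"

lemma open_uhp: "open uhp" by (rule open_halfspace_Im_gt)
lemma convex_uhp: "convex uhp" by (rule convex_halfspace_Im_gt)

section \<open>Flows on the upper half-plane\<close>

text \<open>
  The flow is \<open>z \<mapsto> g (h z + t)\<close> with generator \<open>1 / h'\<close>, and \<open>w t y\<close> is its trajectory started at \<open>x\<^sub>0 + i y\<close>.
\<close>

locale half_plane_koenigs =
  fixes h :: "complex \<Rightarrow> complex" and x0 :: real
  assumes holh: "h holomorphic_on uhp"
    and Im_deriv: "\<And>z. Im z > 0 \<Longrightarrow> Im (deriv h z) < 0"
    and shift: "\<And>q t. q \<in> h ` uhp \<Longrightarrow> t \<ge> 0 \<Longrightarrow> q + of_real t \<in> h ` uhp"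
begin

definition "\<Omega> = h ` uhp"
definition "g = inv_into uhp h"
definition "w t y = g (h (Complex x0 y) + of_real t)"

text \<open>The quotient is the mean of \<open>deriv h\<close> over the segment, so the sign of the
  derivative passes to it, as in the Noshiro-Warschawski theorem. Injectivity of \<open>h\<close>
  and its monotonicity along vertical and horizontal lines are special cases.\<close>

lemma Im_quotient:
  assumes "Im a > 0" "Im b > 0" "a \<noteq> b"
  shows "Im ((h b - h a) / (b - a)) < 0"
proof -
  define \<phi> where "\<phi> = (\<lambda>s. Im (h (a + of_real s * (b - a)) / (b - a)))"
  have up: "Im (a + of_real s * (b - a)) > 0" if "0 \<le> s" "s \<le> 1" for s
  proof -
    have "(1 - s) *\<^sub>R a + s *\<^sub>R b \<in> uhp" by (rule convexD[OF convex_uhp]) (use assms that in auto)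
    moreover have "(1 - s) *\<^sub>R a + s *\<^sub>R b = a + of_real s * (b - a)" by (simp add: scaleR_conv_of_real algebra_simps)
    ultimately show ?thesis by simp
  qed
  have der: "(\<phi> has_real_derivative Im (deriv h (a + of_real s * (b - a)))) (at s)" if "0 \<le> s" "s \<le> 1" for s
  proof -
    have d: "(h has_field_derivative deriv h (a + of_real s * (b - a))) (at (a + of_real s * (b - a)))"
      by (rule holomorphic_derivI[OF holh open_uhp]) (use up that in auto)
    have "((\<lambda>s. h (a + s * (b - a)) / (b - a)) has_field_derivative deriv h (a + of_real s * (b - a))) (at (of_real s))"
      by (rule DERIV_cong, rule DERIV_cdivide,
          rule DERIV_chain2[where f=h and g="\<lambda>s. a + s * (b - a)" and x="of_real s", OF d])
        (use assms(3) in \<open>auto intro!: derivative_eq_intros\<close>)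
    from has_vector_derivative_real_field[OF this]
    have "((\<lambda>s. h (a + of_real s * (b - a)) / (b - a)) has_vector_derivative deriv h (a + of_real s * (b - a))) (at s)"
      by (simp add: o_def)
    then have "(\<phi> has_vector_derivative Im (deriv h (a + of_real s * (b - a)))) (at s)"
      unfolding \<phi>_def by (rule bounded_linear.has_vector_derivative[OF bounded_linear_Im])
    then show ?thesis by (simp add: has_real_derivative_iff_has_vector_derivative)
  qed
  have "\<phi> 1 < \<phi> 0"
    by (rule DERIV_neg_imp_decreasing) (use der Im_deriv up in \<open>auto intro!: exI\<close>)
  then show ?thesis by (simp add: \<phi>_def diff_divide_distrib)
qed

lemma inj_h: "inj_on h uhp"
proof (rule inj_onI)
  fix a b assume "a \<in> uhp" "b \<in> uhp" "h a = h b"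
  then show "a = b" using Im_quotient[of a b] by fastforce
qed

lemma Re_h_less: "0 < y1 \<Longrightarrow> y1 < y2 \<Longrightarrow> Re (h (Complex x y1)) < Re (h (Complex x y2))"
proof -
  assume y: "0 < y1" "y1 < y2"
  define A where "A = h (Complex x y2) - h (Complex x y1)"
  have "Complex x y2 - Complex x y1 = \<i> * of_real (y2 - y1)" by (simp add: complex_eq_iff)
  then have "Im (A / (\<i> * of_real (y2 - y1))) < 0"
    using Im_quotient[of "Complex x y1" "Complex x y2"] y by (simp add: A_def)
  moreover have "Im (A / (\<i> * of_real (y2 - y1))) = - (Re A / (y2 - y1))"
    using y by (simp add: Im_divide power2_eq_square del: of_real_diff)
  ultimately show ?thesis using y by (simp add: A_def zero_less_divide_iff)
qed

lemma Im_h_less: "0 < y \<Longrightarrow> x1 < x2 \<Longrightarrow> Im (h (Complex x2 y)) < Im (h (Complex x1 y))"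
proof -
  assume y: "0 < y" "x1 < x2"
  define A where "A = h (Complex x2 y) - h (Complex x1 y)"
  have "Complex x2 y - Complex x1 y = of_real (x2 - x1)" by (simp add: complex_eq_iff)
  then have "Im (A / of_real (x2 - x1)) < 0"
    using Im_quotient[of "Complex x1 y" "Complex x2 y"] y by (simp add: A_def)
  then show ?thesis using y by (simp add: A_def divide_less_0_iff del: of_real_diff)
qed

lemma open_\<Omega>: "open \<Omega>" unfolding \<Omega>_def
  using open_mapping_thm3[OF holh open_uhp inj_h] .

lemma g_h: "Im z > 0 \<Longrightarrow> g (h z) = z" unfolding g_def by (simp add: inv_into_f_f[OF inj_h])
lemma h_g: "q \<in> \<Omega> \<Longrightarrow> h (g q) = q" unfolding g_def \<Omega>_def by (rule f_inv_into_f)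
lemma g_uhp: "q \<in> \<Omega> \<Longrightarrow> Im (g q) > 0" unfolding g_def \<Omega>_def using inv_into_into[of q h uhp] by simp
lemma h_in: "Im z > 0 \<Longrightarrow> h z \<in> \<Omega>" by (simp add: \<Omega>_def)
lemma shift_\<Omega>: "q \<in> \<Omega> \<Longrightarrow> t \<ge> 0 \<Longrightarrow> q + of_real t \<in> \<Omega>" using shift by (simp add: \<Omega>_def)
lemma inj_g: "inj_on g \<Omega>" by (metis h_g inj_onI)

lemma holg: "g holomorphic_on \<Omega>"
proof -
  obtain k where k: "k holomorphic_on (h ` uhp)" "\<And>z. z \<in> uhp \<Longrightarrow> k (h z) = z"
    using holomorphic_has_inverse[OF holh open_uhp inj_h] by metis
  have "g holomorphic_on \<Omega> \<longleftrightarrow> k holomorphic_on \<Omega>"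
    by (rule holomorphic_cong) (use k(2) g_h in \<open>auto simp: \<Omega>_def\<close>)
  then show ?thesis using k(1) by (simp add: \<Omega>_def)
qed

lemma contg: "continuous_on \<Omega> g" using holg by (rule holomorphic_on_imp_continuous_on)
lemma conth: "continuous_on uhp h" using holh by (rule holomorphic_on_imp_continuous_on)
lemma isCont_g: "q \<in> \<Omega> \<Longrightarrow> isCont g q" using contg open_\<Omega> continuous_on_eq_continuous_at by blast
lemma isCont_h: "Im z > 0 \<Longrightarrow> isCont h z" using conth open_uhp continuous_on_eq_continuous_at by blast

lemma deriv_h_nz: "Im z > 0 \<Longrightarrow> deriv h z \<noteq> 0" using Im_deriv by force

lemma deriv_g: "q \<in> \<Omega> \<Longrightarrow> (g has_field_derivative 1 / deriv h (g q)) (at q)"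
proof -
  assume q: "q \<in> \<Omega>"
  have "(g has_field_derivative inverse (deriv h (g q))) (at q)"
  proof (rule has_field_derivative_inverse_strong_x[where f=h and S=uhp and y="q"])
    show "(h has_field_derivative deriv h (g q)) (at (g q))"
      by (rule holomorphic_derivI[OF holh open_uhp]) (use g_uhp q in simp)
  qed (use q in \<open>auto simp: deriv_h_nz g_uhp h_g g_h conth open_uhp open_\<Omega>\<close>)
  then show ?thesis by (simp add: inverse_eq_divide)
qed

lemma Im_deriv_g: "q \<in> \<Omega> \<Longrightarrow> Im (1 / deriv h (g q)) > 0"
proof -
  assume "q \<in> \<Omega>"
  then have "Im (deriv h (g q)) < 0" by (intro Im_deriv g_uhp)
  then show ?thesis by (auto simp: Im_divide intro!: divide_neg_pos add_nonneg_pos)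
qed

lemma w_in: "y > 0 \<Longrightarrow> t \<ge> 0 \<Longrightarrow> h (Complex x0 y) + of_real t \<in> \<Omega>"
  by (intro shift_\<Omega> h_in) auto
lemma h_w: "y > 0 \<Longrightarrow> t \<ge> 0 \<Longrightarrow> h (w t y) = h (Complex x0 y) + of_real t"
  unfolding w_def by (rule h_g[OF w_in])
lemma w_uhp: "y > 0 \<Longrightarrow> t \<ge> 0 \<Longrightarrow> Im (w t y) > 0" unfolding w_def by (rule g_uhp[OF w_in])
lemma w_0: "y > 0 \<Longrightarrow> w 0 y = Complex x0 y" by (simp add: w_def g_h)

lemma cont_w: "y > 0 \<Longrightarrow> continuous_on {0..T} (\<lambda>t. w t y)"
  unfolding w_def
  by (rule continuous_on_compose2[OF contg]) (use w_in in \<open>auto intro!: continuous_intros\<close>)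

text \<open>The velocity of a trajectory is \<open>1 / deriv h\<close>, whose imaginary part is
  positive.\<close>

lemma Im_w_mono: "y > 0 \<Longrightarrow> 0 \<le> s \<Longrightarrow> s \<le> t \<Longrightarrow> Im (w s y) \<le> Im (w t y)"
proof (rule DERIV_nonneg_imp_nondecreasing[of s t "\<lambda>t. Im (w t y)"])
  fix u assume y: "y > 0" "0 \<le> s" and u: "s \<le> u" "u \<le> t"
  define q where "q = h (Complex x0 y) + of_real u"
  have q: "q \<in> \<Omega>" using w_in[of y u] y u by (simp add: q_def)
  have "((\<lambda>t. g (h (Complex x0 y) + t)) has_field_derivative 1 / deriv h (g q)) (at (of_real u))"
    by (rule DERIV_cong, rule DERIV_chain2[where f=g and g="\<lambda>t. h (Complex x0 y) + t" and x="of_real u", OF deriv_g[OF q, unfolded q_def]])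
      (auto intro!: derivative_eq_intros simp: q_def)
  from has_vector_derivative_real_field[OF this]
  have "((\<lambda>t. w t y) has_vector_derivative 1 / deriv h (g q)) (at u)" by (simp add: o_def w_def)
  then have "((\<lambda>t. Im (w t y)) has_vector_derivative Im (1 / deriv h (g q))) (at u)"
    by (rule bounded_linear.has_vector_derivative[OF bounded_linear_Im])
  then show "\<exists>D. ((\<lambda>t. Im (w t y)) has_real_derivative D) (at u) \<and> 0 \<le> D"
    using Im_deriv_g[OF q] by (auto simp: has_real_derivative_iff_has_vector_derivative intro: less_imp_le)
qed

text \<open>Passes from time \<open>T\<close> to all earlier times at once: an orbit that meets
  \<open>K\<close> at some time up to \<open>T\<close> lies at time \<open>T\<close> in the set
  \<open>K'\<close> of positions reachable from \<open>K\<close> within time \<open>T\<close>, which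
  is again compact.\<close>

lemma uniformly_hugging:
  assumes hug: "\<And>K. compact K \<Longrightarrow> K \<subseteq> uhp \<Longrightarrow> \<forall>\<^sub>F y in at_right 0. w T y \<notin> K"
    and K: "compact K" "K \<subseteq> uhp" and T: "T \<ge> 0"
  shows "\<forall>\<^sub>F y in at_right 0. \<forall>t\<in>{0..T}. w t y \<notin> K"
proof -
  define K' where "K' = (\<lambda>(q, s). g (h q + of_real s)) ` (K \<times> {0..T})"
  have "continuous_on (K \<times> {0..T}) (\<lambda>p. h (fst p) + of_real (snd p))"
    by (intro continuous_intros continuous_on_compose2[OF conth]) (use K in auto)
  then have "continuous_on (K \<times> {0..T}) (\<lambda>p. g (h (fst p) + of_real (snd p)))"
    by (rule continuous_on_compose2[OF contg]) (use K in \<open>auto intro!: shift_\<Omega> h_in\<close>)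
  then have "compact K'" unfolding K'_def case_prod_unfold
    by (intro compact_continuous_image compact_Times K) auto
  moreover have "K' \<subseteq> uhp" unfolding K'_def using K by (auto intro!: g_uhp shift_\<Omega> h_in)
  ultimately have "\<forall>\<^sub>F y in at_right 0. w T y \<notin> K'" by (rule hug)
  then show ?thesis using eventually_at_right_less[of 0]
  proof eventually_elim
    case (elim y)
    show ?case
    proof (intro ballI notI)
      fix t assume t: "t \<in> {0..T}" and wK: "w t y \<in> K"
      have "w T y = g (h (w t y) + of_real (T - t))"
        using h_w[of y t] elim t by (simp add: w_def)
      then have "w T y \<in> K'" unfolding K'_def using wK t by (intro image_eqI[of _ _ "(w t y, T - t)"]) auto
      then show False using elim by simp
    qed
  qed
qed

text \<open>Otherwise \<open>exp (h z)\<close> has boundary values 0 on an interval.\<close>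

lemma not_Re_h_unbounded_below:
  assumes r: "r > 0"
  shows "\<not> (\<forall>x. \<bar>x - a\<bar> < r \<longrightarrow> (\<forall>c. \<exists>v>0. Re (h (Complex x v)) < c))"
proof
  assume unb: "\<forall>x. \<bar>x - a\<bar> < r \<longrightarrow> (\<forall>c. \<exists>v>0. Re (h (Complex x v)) < c)"
  define z where "z = Complex a (r/2)"
  have "exp (h z) = 0"
  proof (rule boundary_zero_imp_zero[where f="\<lambda>z. exp (h z)" and a=a and r=r])
    show "(\<lambda>z. exp (h z)) holomorphic_on {z. dist z (of_real a) < r \<and> 0 < Im z}"
      by (intro holomorphic_intros holomorphic_on_subset[OF holh]) auto
    show "z \<in> {z. dist z (of_real a) < r \<and> 0 < Im z}" using r by (simp add: z_def dist_norm cmod_def)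
    fix x assume x: "\<bar>x - a\<bar> < r"
    show "((\<lambda>z. exp (h z)) \<longlongrightarrow> 0) (at (of_real x) within uhp)"
      unfolding tendsto_iff
    proof (intro allI impI)
      fix e :: real assume e: "e > 0"
      obtain v where v: "v > 0" "Re (h (Complex x v)) < ln e" using unb x by blast
      have "isCont (\<lambda>s. Re (h (Complex s v))) x"
        by (intro isCont_Re isCont_o2[OF _ isCont_h]) (use v in \<open>auto simp: Complex_eq\<close>)
      then have "((\<lambda>s. Re (h (Complex s v))) \<longlongrightarrow> Re (h (Complex x v))) (at x)" by (simp add: isCont_def)
      then have "\<forall>\<^sub>F s in at x. Re (h (Complex s v)) < ln e" using v(2) by (rule order_tendstoD)
      then obtain d where d: "d > 0" "\<And>s. s \<noteq> x \<Longrightarrow> dist s x < d \<Longrightarrow> Re (h (Complex s v)) < ln e"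
        unfolding eventually_at by auto
      then have d': "Re (h (Complex s v)) < ln e" if "dist s x < d" for s using that v by (cases "s = x") auto
      have "norm (exp (h z)) < e" if z: "Im z > 0" "dist z (of_real x) < min d v" for z
      proof -
        have "\<bar>Re z - x\<bar> < d" "\<bar>Im z\<bar> < v"
          using abs_Re_le_cmod[of "z - of_real x"] abs_Im_le_cmod[of "z - of_real x"] z by (auto simp: dist_norm)
        then have "Re (h (Complex (Re z) (Im z))) < ln e"
          using Re_h_less[of "Im z" v "Re z"] d'[of "Re z"] z by (auto simp: dist_real_def)
        then have "exp (Re (h z)) < exp (ln e)" by (simp del: exp_ln)
        then show ?thesis using e by simp
      qed
      then show "\<forall>\<^sub>F z in at (of_real x) within uhp. dist (exp (h z)) 0 < e"
        unfolding eventually_at using d v by (intro exI[of _ "min d v"]) auto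
    qed
  qed
  then show False by simp
qed

text \<open>An orbit that leaves the disc of radius \<open>\<epsilon>\<close> about
  \<open>x0\<close> without rising to height \<open>\<eta>\<close> has to travel sideways. When it
  first reaches the circle its height is below \<open>\<epsilon> / 2\<close>, so its horizontal
  displacement is at least \<open>\<epsilon> / 2\<close>. The sign \<open>\<sigma>\<close> is the
  side, and every abscissa in between is passed at low height.\<close>

lemma exit_crossing:
  assumes y: "y > 0" and T: "T \<ge> 0" and \<eta>: "0 < \<eta>" "\<eta> < \<epsilon> / 2" "y < \<eta>"
    and out: "dist (w T y) (of_real x0) \<ge> \<epsilon>"
    and low: "\<forall>t\<in>{0..T}. w t y \<notin> {z. dist z (of_real x0) \<le> \<epsilon> \<and> Im z \<ge> \<eta>}"
  shows "\<exists>\<sigma>\<in>{-1,1}. \<forall>b\<in>{0..\<epsilon>/2}. \<exists>t\<in>{0..T}. Re (w t y) = x0 + \<sigma> * b \<and> Im (w t y) < \<eta>"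
proof -
  define D where "D = (\<lambda>t. dist (w t y) (of_real x0))"
  have contD: "continuous_on {0..T} D" unfolding D_def by (intro continuous_intros cont_w y)
  have D0: "D 0 = y" using y by (simp add: D_def w_0 dist_norm cmod_def)
  define A where "A = {t\<in>{0..T}. D t \<ge> \<epsilon>}"
  have "closed A" unfolding A_def
    by (rule continuous_on_closed_Collect_le[OF continuous_on_const contD]) simp
  have Ane: "T \<in> A" using out T by (simp add: A_def D_def)
  have bdA: "bdd_below A" by (auto simp: A_def intro!: bdd_belowI[of _ 0])
  \<comment> \<open>The first exit time; up to it the orbit is in the disc, where \<open>low\<close>
    bounds its height.\<close>
  define s where "s = Inf A"
  have sA: "s \<in> A" unfolding s_def using closed_contains_Inf[OF _ bdA \<open>closed A\<close>] Ane by blast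
  have s: "0 \<le> s" "s \<le> T" "D s \<ge> \<epsilon>" using sA by (auto simp: A_def)
  have before: "D t < \<epsilon>" if "0 \<le> t" "t < s" for t
    using cInf_lower[OF _ bdA, of t] that s by (force simp: A_def s_def)
  have Ds: "D s = \<epsilon>"
  proof -
    obtain t where "0 \<le> t" "t \<le> s" "D t = \<epsilon>"
      using IVT'[of D 0 \<epsilon> s] D0 \<eta> s continuous_on_subset[OF contD, of "{0..s}"] by auto
    then show ?thesis using before[of t] by (cases "t < s") auto
  qed
  have Dle: "D t \<le> \<epsilon>" if "0 \<le> t" "t \<le> s" for t using before[of t] Ds that by (cases "t < s") auto
  have Imlow: "Im (w t y) < \<eta>" if "0 \<le> t" "t \<le> s" for t
    using low Dle[OF that] that s by (auto simp: D_def)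
  have ImP: "Im (w t y) > 0" if "0 \<le> t" for t using w_uhp[OF y that] .
  have "\<epsilon> \<le> \<bar>Re (w s y) - x0\<bar> + \<bar>Im (w s y)\<bar>"
    using Ds cmod_le[of "w s y - of_real x0"] by (simp add: D_def dist_norm)
  then have far: "\<bar>Re (w s y) - x0\<bar> \<ge> \<epsilon>/2" using Imlow[of s] ImP[of s] s \<eta> by simp
  have contR: "continuous_on {0..s} (\<lambda>t. \<sigma> * (Re (w t y) - x0))" for \<sigma>
    by (intro continuous_intros continuous_on_subset[OF cont_w[OF y, of T]]) (use s in auto)
  define \<sigma> :: real where "\<sigma> = (if Re (w s y) \<ge> x0 then 1 else -1)"
  have \<sigma>: "\<sigma> \<in> {-1,1}" "\<sigma> * \<sigma> = 1" by (auto simp: \<sigma>_def)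
  have "\<exists>t\<in>{0..T}. Re (w t y) = x0 + \<sigma> * b \<and> Im (w t y) < \<eta>" if b: "b \<in> {0..\<epsilon>/2}" for b
  proof -
    have "\<sigma> * (Re (w s y) - x0) \<ge> b" using far b by (auto simp: \<sigma>_def)
    then obtain t where t: "0 \<le> t" "t \<le> s" "\<sigma> * (Re (w t y) - x0) = b"
      using IVT'[OF _ _ s(1) contR, of \<sigma> b] b y by (auto simp: w_0)
    have "\<sigma> * b = Re (w t y) - x0" using t(3) \<sigma>(2) by (metis mult.assoc mult_1)
    then show ?thesis using t s Imlow[of t] by (intro bexI[of _ t]) auto
  qed
  then show ?thesis using \<sigma> by blast
qed

end

text \<open>The assumption \<open>leaves\<close> is the half-plane form of an infinite life-time: at
  no time does the boundary point \<open>x0\<close> enter the interior. The assumption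
  \<open>nonfixed\<close> says that it does not stay in place either.\<close>

locale half_plane_boundary_orbit = half_plane_koenigs +
  assumes leaves: "\<And>K t. compact K \<Longrightarrow> K \<subseteq> uhp \<Longrightarrow> t \<ge> 0 \<Longrightarrow> \<forall>\<^sub>F y in at_right 0. w t y \<notin> K"
    and nonfixed: "\<exists>t\<ge>0. \<not> ((\<lambda>y. w t y) \<longlongrightarrow> of_real x0) (at_right 0)"
begin

text \<open>Suppose \<open>Re h\<close> decreases to minus infinity along the vertical line. Orbits
  that start lower and lower still leave a fixed disc within time \<open>T\<close>, so they run
  along the axis on one side. At each abscissa that they pass, \<open>Re h\<close> exceeds its
  starting value by at most \<open>T\<close>; hence it is unbounded below over a whole
  interval.\<close>

lemma Re_h_bounded_below: "\<exists>c. \<forall>y>0. Re (h (Complex x0 y)) \<ge> c"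
proof (rule ccontr)
  assume "\<not> (\<exists>c. \<forall>y>0. Re (h (Complex x0 y)) \<ge> c)"
  then have unb: "\<exists>y>0. Re (h (Complex x0 y)) < c" for c by (meson not_le)
  obtain T where T: "T \<ge> 0" "\<not> ((\<lambda>y. w T y) \<longlongrightarrow> of_real x0) (at_right 0)" using nonfixed by blast
  then obtain \<epsilon> where \<epsilon>: "\<epsilon> > 0" "\<not> (\<forall>\<^sub>F y in at_right 0. dist (w T y) (of_real x0) < \<epsilon>)"
    unfolding tendsto_iff by blast
  define P where "P = (\<lambda>\<sigma> n y. y > 0 \<and> Re (h (Complex x0 y)) < - real n \<and>
     (\<forall>b\<in>{0..\<epsilon>/2}. \<exists>t\<in>{0..T}. Re (w t y) = x0 + \<sigma> * b))"
  have ex: "\<exists>y. P 1 n y \<or> P (-1) n y" for n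
  proof -
    define \<eta> where "\<eta> = \<epsilon>/4"
    have \<eta>: "0 < \<eta>" "\<eta> < \<epsilon>/2" using \<epsilon> by (auto simp: \<eta>_def)
    define K where "K = {z. dist z (of_real x0) \<le> \<epsilon> \<and> Im z \<ge> \<eta>}"
    have "K = cball (of_real x0) \<epsilon> \<inter> {z. Im z \<ge> \<eta>}" by (auto simp: K_def dist_commute)
    then have "compact K" by (simp add: compact_Int_closed closed_halfspace_Im_ge)
    moreover have "K \<subseteq> uhp" using \<eta> by (auto simp: K_def)
    ultimately have ev: "\<forall>\<^sub>F y in at_right 0. \<forall>t\<in>{0..T}. w t y \<notin> K"
      by (intro uniformly_hugging leaves T)
    obtain y1 where y1: "y1 > 0" "Re (h (Complex x0 y1)) < - real n" using unb by blast
    have ev2: "\<forall>\<^sub>F y in at_right 0. y < min \<eta> y1" 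
      using y1 \<eta> by (intro eventually_at_right_real[THEN eventually_mono, of 0 "min \<eta> y1"]) auto
    have "\<exists>\<^sub>F y in at_right 0. dist (w T y) (of_real x0) \<ge> \<epsilon>"
      using \<epsilon>(2) by (simp add: frequently_def not_le)
    from frequently_eventually_conj[OF this eventually_conj[OF ev eventually_conj[OF ev2 eventually_at_right_less[of 0]]]]
    obtain y where y: "dist (w T y) (of_real x0) \<ge> \<epsilon>" "\<forall>t\<in>{0..T}. w t y \<notin> K" "y < \<eta>" "y < y1" "y > 0"
      by (auto dest!: frequently_ex)
    obtain \<sigma> where \<sigma>: "\<sigma>\<in>{-1,1}" "\<forall>b\<in>{0..\<epsilon>/2}. \<exists>t\<in>{0..T}. Re (w t y) = x0 + \<sigma> * b"
      using exit_crossing[OF y(5) T(1) \<eta> y(3) y(1) y(2)[unfolded K_def]] by blast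
    have "Re (h (Complex x0 y)) < - real n" using Re_h_less[OF y(5,4), of x0] y1 by simp
    then have "P \<sigma> n y" using \<sigma> y by (simp add: P_def)
    then show ?thesis using \<sigma>(1) by auto
  qed
  \<comment> \<open>Each \<open>n\<close> yields one of the two sides. As \<open>P\<close> is
    inherited by smaller \<open>n\<close>, a single side works for all of them.\<close>
  have "\<exists>\<sigma>\<in>{-1,1}. \<forall>n. \<exists>y. P \<sigma> n y"
  proof (rule ccontr)
    assume "\<not> (\<exists>\<sigma>\<in>{-1,1}. \<forall>n. \<exists>y. P \<sigma> n y)"
    then obtain n1 n2 where n: "\<forall>y. \<not> P 1 n1 y" "\<forall>y. \<not> P (-1) n2 y" by auto
    obtain y where "P 1 (max n1 n2) y \<or> P (-1) (max n1 n2) y" using ex by blast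
    moreover have "P \<sigma> n y" if "P \<sigma> m y" "n \<le> m" for \<sigma> n m using that by (force simp: P_def)
    ultimately show False using n by (metis max.cobounded1 max.cobounded2)
  qed
  then obtain \<sigma> where \<sigma>: "\<sigma> \<in> {-1,1}" "\<And>n. \<exists>y. P \<sigma> n y" by blast
  have "\<exists>v>0. Re (h (Complex x v)) < c" if x: "\<bar>x - (x0 + \<sigma> * (\<epsilon>/4))\<bar> < \<epsilon>/4" for x c
  proof -
    define b where "b = \<sigma> * (x - x0)"
    have "x0 + \<sigma> * (\<epsilon>/4) - \<epsilon>/4 < x" "x < x0 + \<sigma> * (\<epsilon>/4) + \<epsilon>/4" using x by linarith+
    then have b: "b \<in> {0..\<epsilon>/2}" "x0 + \<sigma> * b = x" using x \<sigma>(1) by (auto simp: b_def abs_less_iff)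
    obtain n where n: "real n \<ge> T - c" using real_arch_simple by blast
    obtain y where y: "P \<sigma> n y" using \<sigma> by blast
    then have "\<exists>t\<in>{0..T}. Re (w t y) = x0 + \<sigma> * b" using b(1) unfolding P_def by blast
    then obtain t where t: "t \<in> {0..T}" "Re (w t y) = x" using b(2) by auto
    have y0: "y > 0" "Re (h (Complex x0 y)) < - real n" using y by (auto simp: P_def)
    have "Complex x (Im (w t y)) = w t y" using t by (simp add: complex_eq_iff)
    then have "Re (h (Complex x (Im (w t y)))) = Re (h (Complex x0 y)) + t" using h_w[OF y0(1), of t] t by simp
    then show ?thesis using w_uhp[OF y0(1), of t] t y0 n by (intro exI[of _ "Im (w t y)"]) auto
  qed
  then show False using not_Re_h_unbounded_below[of "\<epsilon>/4" "x0 + \<sigma> * (\<epsilon>/4)"] \<epsilon> by auto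
qed

lemma Re_h_limit:
  obtains c where "((\<lambda>y. Re (h (Complex x0 y))) \<longlongrightarrow> c) (at_right 0)" "\<And>y. y > 0 \<Longrightarrow> c < Re (h (Complex x0 y))"
proof -
  define A where "A = (\<lambda>y. Re (h (Complex x0 y))) ` {0<..}"
  have bd: "bdd_below A" using Re_h_bounded_below by (auto simp: A_def bdd_below_def)
  have ne: "A \<noteq> {}" by (auto simp: A_def)
  define c where "c = Inf A"
  have le: "c \<le> Re (h (Complex x0 y))" if "y > 0" for y
    unfolding c_def by (rule cInf_lower[OF _ bd]) (use that in \<open>auto simp: A_def\<close>)
  have less: "c < Re (h (Complex x0 y))" if "y > 0" for y
    using le[of "y/2"] Re_h_less[of "y/2" y x0] that by simp
  have "((\<lambda>y. Re (h (Complex x0 y))) \<longlongrightarrow> c) (at_right 0)"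
  proof (rule order_tendstoI)
    fix a assume "a < c"
    show "\<forall>\<^sub>F y in at_right 0. a < Re (h (Complex x0 y))"
      using eventually_at_right_less[of 0] by eventually_elim (use less \<open>a < c\<close> in force)
  next
    fix a assume "c < a"
    then obtain y1 where y1: "y1 > 0" "Re (h (Complex x0 y1)) < a"
      using cInf_less_iff[OF ne bd, of a] unfolding c_def[symmetric] by (auto simp: A_def)
    show "\<forall>\<^sub>F y in at_right 0. Re (h (Complex x0 y)) < a"
      using eventually_at_right_real[OF y1(1)]
      by eventually_elim (use Re_h_less[of _ y1 x0] y1 in force)
  qed
  then show thesis using that less by blast
qed

text \<open>If the level \<open>\<eta>\<close> were met at arbitrarily small \<open>y\<close>, the
  orbits would after time 1 be close, in the Koenigs coordinate, to the point \<open>q\<close> on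
  this level with real part \<open>c + 1\<close>. If \<open>q\<close> is in \<open>\<Omega>\<close>,
  they are then in a compact set about \<open>g q\<close>, which \<open>leaves\<close> forbids. If
  it is not, then \<open>q\<close> nevertheless lies ahead on one of these orbits, against
  invariance under translation.\<close>

lemma Im_h_avoids: "\<forall>\<^sub>F y in at_right 0. Im (h (Complex x0 y)) \<noteq> \<eta>"
proof -
  obtain c where c: "((\<lambda>y. Re (h (Complex x0 y))) \<longlongrightarrow> c) (at_right 0)" "\<And>y. y > 0 \<Longrightarrow> c < Re (h (Complex x0 y))"
    using Re_h_limit by blast
  define q where "q = Complex (c + 1) \<eta>"
  have evc: "\<forall>\<^sub>F y in at_right 0. Re (h (Complex x0 y)) < c + 1"
    using c(1) by (rule order_tendstoD) simp
  show ?thesis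
  proof (cases "q \<in> \<Omega>")
    case False
    show ?thesis using evc eventually_at_right_less[of 0]
    proof eventually_elim
      case (elim y)
      show ?case
      proof
        assume "Im (h (Complex x0 y)) = \<eta>"
        then have "q = h (Complex x0 y) + of_real (c + 1 - Re (h (Complex x0 y)))"
          by (simp add: q_def complex_eq_iff)
        then have "q \<in> \<Omega>" using shift_\<Omega>[OF h_in[of "Complex x0 y"], of "c + 1 - Re (h (Complex x0 y))"] elim by simp
        then show False using False by simp
      qed
    qed
  next
    case True
    define K where "K = cball (g q) (Im (g q) / 2)"
    have gq: "Im (g q) > 0" by (rule g_uhp[OF True])
    have "K \<subseteq> uhp"
    proof
      fix z assume "z \<in> K"
      then have "\<bar>Im z - Im (g q)\<bar> \<le> Im (g q) / 2"
        using abs_Im_le_cmod[of "z - g q"] by (auto simp: K_def dist_norm norm_minus_commute)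
      then have "Im z > 0" using gq by linarith
      then show "z \<in> uhp" by simp
    qed
    then have ev1: "\<forall>\<^sub>F y in at_right 0. w 1 y \<notin> K" by (intro leaves) (auto simp: K_def)
    have "(g \<longlongrightarrow> g q) (nhds q)" using isCont_g[OF True] by (simp add: isCont_def tendsto_nhds_iff)
    from tendstoD[OF this, of "Im (g q) / 2"]
    have "\<forall>\<^sub>F u in nhds q. dist (g u) (g q) < Im (g q) / 2" using gq by simp
    then obtain d where d: "d > 0" "\<And>u. dist u q < d \<Longrightarrow> dist (g u) (g q) < Im (g q) / 2"
      unfolding eventually_nhds_metric by auto
    have "\<forall>\<^sub>F y in at_right 0. Re (h (Complex x0 y)) < c + d" using c(1) by (rule order_tendstoD) (use d in simp)
    then show ?thesis using ev1 eventually_at_right_less[of 0]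
    proof eventually_elim
      case (elim y)
      show ?case
      proof
        assume "Im (h (Complex x0 y)) = \<eta>"
        then have "h (Complex x0 y) + of_real 1 - q = of_real (Re (h (Complex x0 y)) - c)"
          by (simp add: q_def complex_eq_iff)
        then have "dist (h (Complex x0 y) + of_real 1) q < d"
          using elim c(2)[of y] by (simp add: dist_norm del: of_real_diff)
        then have "dist (w 1 y) (g q) < Im (g q) / 2" unfolding w_def by (rule d)
        then show False using elim by (auto simp: K_def dist_commute)
      qed
    qed
  qed
qed

lemma cont_h_vertical: "continuous_on {0<..} (\<lambda>y. h (Complex x y))"
  by (rule continuous_on_compose2[OF conth]) (auto simp: Complex_eq intro!: continuous_intros)

text \<open>By connectedness \<open>Im h\<close> finally stays on one side of each level, which
  amounts to convergence in the extended reals. The infinite limits are excluded by the next two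
  lemmas.\<close>

lemma Im_h_side:
  "(\<forall>\<^sub>F y in at_right 0. Im (h (Complex x0 y)) < \<eta>) \<or> (\<forall>\<^sub>F y in at_right 0. Im (h (Complex x0 y)) > \<eta>)"
proof -
  define e where "e = (\<lambda>y. Im (h (Complex x0 y)))"
  obtain b where b: "b > 0" "\<And>y. 0 < y \<Longrightarrow> y < b \<Longrightarrow> e y \<noteq> \<eta>"
    using Im_h_avoids[of \<eta>] unfolding eventually_at_right_field e_def by auto
  have conn: "connected (e ` {0<..<b})"
    by (intro connected_continuous_image) (auto simp: e_def intro!: continuous_intros continuous_on_subset[OF cont_h_vertical])
  have no: "\<eta> \<notin> e ` {0<..<b}" using b(2) by (metis greaterThanLessThan_iff imageE)
  have "(\<forall>y\<in>{0<..<b}. e y < \<eta>) \<or> (\<forall>y\<in>{0<..<b}. e y > \<eta>)"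
  proof (rule ccontr)
    assume "\<not> ?thesis"
    then obtain y1 y2 where "y1 \<in> {0<..<b}" "e y1 \<ge> \<eta>" "y2 \<in> {0<..<b}" "e y2 \<le> \<eta>" by force
    then show False using connectedD_interval[OF conn, of "e y2" "e y1" \<eta>] no by blast
  qed
  then show ?thesis
  proof
    assume "\<forall>y\<in>{0<..<b}. e y < \<eta>"
    then show ?thesis by (intro disjI1 eventually_at_rightI[OF _ b(1)]) (simp add: e_def)
  next
    assume "\<forall>y\<in>{0<..<b}. e y > \<eta>"
    then show ?thesis by (intro disjI2 eventually_at_rightI[OF _ b(1)]) (simp add: e_def)
  qed
qed

text \<open>A limit minus infinity over \<open>x0\<close> spreads to the right, since
  \<open>Im h\<close> decreases in the horizontal direction. Then \<open>exp (- \<i> * h z)\<close>,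
  of modulus \<open>exp (Im (h z))\<close>, has boundary values 0 between \<open>x0\<close> and
  \<open>x0 + 2\<close>.\<close>

lemma not_Im_h_at_bot: "\<exists>c. \<not> (\<forall>\<^sub>F y in at_right 0. Im (h (Complex x0 y)) < c)"
proof (rule ccontr)
  assume "\<not> ?thesis"
  then have all: "\<forall>\<^sub>F y in at_right 0. Im (h (Complex x0 y)) < c" for c by blast
  define z where "z = Complex (x0+1) (1/2)"
  have "exp (- \<i> * h z) = 0"
  proof (rule boundary_zero_imp_zero[where f="\<lambda>z. exp (- \<i> * h z)" and a="x0+1" and r=1])
    show "(\<lambda>z. exp (- \<i> * h z)) holomorphic_on {z. dist z (of_real (x0+1)) < 1 \<and> 0 < Im z}"
      by (intro holomorphic_intros holomorphic_on_subset[OF holh]) auto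
    show "z \<in> {z. dist z (of_real (x0+1)) < 1 \<and> 0 < Im z}" by (simp add: z_def dist_norm cmod_def power2_eq_square)
    fix x assume x: "\<bar>x - (x0+1)\<bar> < 1"
    show "((\<lambda>z. exp (- \<i> * h z)) \<longlongrightarrow> 0) (at (of_real x) within uhp)"
      unfolding tendsto_iff
    proof (intro allI impI)
      fix e :: real assume e: "e > 0"
      obtain b where b: "b > 0" "\<And>y. 0 < y \<Longrightarrow> y < b \<Longrightarrow> Im (h (Complex x0 y)) < ln e"
        using all[of "ln e"] unfolding eventually_at_right_field by auto
      have "norm (exp (- \<i> * h z)) < e" if z: "Im z > 0" "dist z (of_real x) < min (x - x0) b" for z
      proof -
        have "\<bar>Re z - x\<bar> < x - x0" "\<bar>Im z\<bar> < b"
          using abs_Re_le_cmod[of "z - of_real x"] abs_Im_le_cmod[of "z - of_real x"] z by (auto simp: dist_norm)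
        then have "Im (h (Complex (Re z) (Im z))) < ln e"
          using Im_h_less[of "Im z" x0 "Re z"] b(2)[of "Im z"] z by (auto simp: abs_less_iff)
        then have "exp (Im (h z)) < exp (ln e)" by (simp del: exp_ln)
        then show ?thesis using e by simp
      qed
      then show "\<forall>\<^sub>F z in at (of_real x) within uhp. dist (exp (- \<i> * h z)) 0 < e"
        unfolding eventually_at using b x by (intro exI[of _ "min (x - x0) b"]) auto
    qed
  qed
  then show False by simp
qed

lemma not_Im_h_at_top: "\<exists>c. \<not> (\<forall>\<^sub>F y in at_right 0. Im (h (Complex x0 y)) > c)"
proof (rule ccontr)
  assume "\<not> ?thesis"
  then have all: "\<forall>\<^sub>F y in at_right 0. Im (h (Complex x0 y)) > c" for c by blast
  define z where "z = Complex (x0-1) (1/2)"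
  have "exp (\<i> * h z) = 0"
  proof (rule boundary_zero_imp_zero[where f="\<lambda>z. exp (\<i> * h z)" and a="x0-1" and r=1])
    show "(\<lambda>z. exp (\<i> * h z)) holomorphic_on {z. dist z (of_real (x0-1)) < 1 \<and> 0 < Im z}"
      by (intro holomorphic_intros holomorphic_on_subset[OF holh]) auto
    show "z \<in> {z. dist z (of_real (x0-1)) < 1 \<and> 0 < Im z}" by (simp add: z_def dist_norm cmod_def power2_eq_square)
    fix x assume x: "\<bar>x - (x0-1)\<bar> < 1"
    show "((\<lambda>z. exp (\<i> * h z)) \<longlongrightarrow> 0) (at (of_real x) within uhp)"
      unfolding tendsto_iff
    proof (intro allI impI)
      fix e :: real assume e: "e > 0"
      obtain b where b: "b > 0" "\<And>y. 0 < y \<Longrightarrow> y < b \<Longrightarrow> Im (h (Complex x0 y)) > - ln e"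
        using all[of "- ln e"] unfolding eventually_at_right_field by auto
      have "norm (exp (\<i> * h z)) < e" if z: "Im z > 0" "dist z (of_real x) < min (x0 - x) b" for z
      proof -
        have "\<bar>Re z - x\<bar> < x0 - x" "\<bar>Im z\<bar> < b"
          using abs_Re_le_cmod[of "z - of_real x"] abs_Im_le_cmod[of "z - of_real x"] z by (auto simp: dist_norm)
        then have "- Im (h (Complex (Re z) (Im z))) < ln e"
          using Im_h_less[of "Im z" "Re z" x0] b(2)[of "Im z"] z by (auto simp: abs_less_iff)
        then have "exp (- Im (h z)) < exp (ln e)" by (simp del: exp_ln)
        then show ?thesis using e by simp
      qed
      then show "\<forall>\<^sub>F z in at (of_real x) within uhp. dist (exp (\<i> * h z)) 0 < e"
        unfolding eventually_at using b x by (intro exI[of _ "min (x0 - x) b"]) auto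
    qed
  qed
  then show False by simp
qed

lemma Im_h_limit: obtains d where "((\<lambda>y. Im (h (Complex x0 y))) \<longlongrightarrow> d) (at_right 0)"
proof -
  define e where "e = (\<lambda>y. Im (h (Complex x0 y)))"
  define L where "L = {\<eta>. \<forall>\<^sub>F y in at_right 0. e y > \<eta>}"
  obtain c1 c2 where c1: "\<not> (\<forall>\<^sub>F y in at_right 0. e y < c1)" and c2: "\<not> (\<forall>\<^sub>F y in at_right 0. e y > c2)"
    using not_Im_h_at_bot not_Im_h_at_top unfolding e_def by blast
  have "c1 \<in> L" using Im_h_side[of c1] c1 by (auto simp: L_def e_def)
  have lt: "\<forall>\<^sub>F y in at_right 0. e y < c2" using Im_h_side[of c2] c2 by (auto simp: e_def)
  have bd: "bdd_above L"
  proof (rule bdd_aboveI)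
    fix \<eta> assume "\<eta> \<in> L"
    then have "\<forall>\<^sub>F y in at_right 0. e y > \<eta>" by (simp add: L_def)
    from eventually_happens'[OF trivial_limit_at_right_real eventually_conj[OF this lt]]
    show "\<eta> \<le> c2" by auto
  qed
  have "(e \<longlongrightarrow> Sup L) (at_right 0)"
  proof (rule order_tendstoI)
    fix a assume "a < Sup L"
    then obtain \<eta> where \<eta>: "\<eta> \<in> L" "a < \<eta>" using less_cSup_iff[OF _ bd] \<open>c1 \<in> L\<close> by blast
    then have "\<forall>\<^sub>F y in at_right 0. e y > \<eta>" by (simp add: L_def)
    then show "\<forall>\<^sub>F y in at_right 0. a < e y" by eventually_elim (use \<eta> in auto)
  next
    fix a assume "Sup L < a"
    then have "a \<notin> L" using cSup_upper[OF _ bd, of a] by auto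
    then show "\<forall>\<^sub>F y in at_right 0. e y < a" using Im_h_side[of a] by (auto simp: L_def e_def)
  qed
  then show thesis using that by (simp add: e_def)
qed

lemma h_limit:
  obtains p where "((\<lambda>y. h (Complex x0 y)) \<longlongrightarrow> p) (at_right 0)"
    "\<And>y. y > 0 \<Longrightarrow> Re p < Re (h (Complex x0 y))"
    "(\<forall>\<^sub>F y in at_right 0. Im (h (Complex x0 y)) < Im p) \<or> (\<forall>\<^sub>F y in at_right 0. Im (h (Complex x0 y)) > Im p)"
proof -
  obtain c where c: "((\<lambda>y. Re (h (Complex x0 y))) \<longlongrightarrow> c) (at_right 0)" "\<And>y. y > 0 \<Longrightarrow> c < Re (h (Complex x0 y))"
    using Re_h_limit by blast
  obtain d where d: "((\<lambda>y. Im (h (Complex x0 y))) \<longlongrightarrow> d) (at_right 0)" by (rule Im_h_limit)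
  have "((\<lambda>y. Complex (Re (h (Complex x0 y))) (Im (h (Complex x0 y)))) \<longlongrightarrow> Complex c d) (at_right 0)"
    by (intro tendsto_Complex c d)
  then show thesis using that[of "Complex c d"] c Im_h_side[of d] by simp
qed

end

section \<open>The Cayley transform and the extension of the inverse map over the ray\<close>

lemma cayley_norm_less_1: "Im z > 0 \<Longrightarrow> norm ((z - \<i>) / (z + \<i>)) < 1"
proof -
  assume z: "Im z > 0"
  have "norm (z - \<i>) < norm (z + \<i>)"
    using z unfolding cmod_def by (auto intro!: real_sqrt_less_mono simp: power2_eq_square algebra_simps)
  moreover have "z + \<i> \<noteq> 0" using z by (auto simp: complex_eq_iff)
  ultimately show ?thesis by (simp add: norm_divide)
qed

lemma cayley_inverse: "Im z > 0 \<Longrightarrow> k = (z - \<i>) / (z + \<i>) \<Longrightarrow> z = \<i> * (1 + k) / (1 - k)"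
proof -
  assume z: "Im z > 0" and k: "k = (z - \<i>) / (z + \<i>)"
  have nz: "z + \<i> \<noteq> 0" using z by (auto simp: complex_eq_iff)
  have "1 - k = 2 * \<i> / (z + \<i>)" "1 + k = 2 * z / (z + \<i>)" using nz by (simp_all add: k divide_simps)
  then show ?thesis using nz by simp
qed

lemma Im_cayley_inverse_eq:
  "Im (\<i> * (1 + k) / (1 - k)) = (1 - (norm k)\<^sup>2) / ((1 - Re k)\<^sup>2 + (Im k)\<^sup>2)"
proof -
  have "Im (\<i> * (1 + k)) * Re (1 - k) - Re (\<i> * (1 + k)) * Im (1 - k) = 1 - (norm k)\<^sup>2"
    unfolding cmod_power2 by (simp add: power2_eq_square algebra_simps)
  then show ?thesis by (simp add: Im_divide del: times_complex.sel)
qed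

lemma Im_cayley_inverse: "norm k < 1 \<Longrightarrow> Im (\<i> * (1 + k) / (1 - k)) > 0"
proof -
  assume k: "norm k < 1"
  then have "k \<noteq> 1" by auto
  then have "(1 - Re k)\<^sup>2 + (Im k)\<^sup>2 > 0" by (auto simp: complex_eq_iff sum_power2_gt_zero_iff)
  moreover have "(norm k)\<^sup>2 < 1" using k by (simp add: abs_square_less_1)
  ultimately show ?thesis unfolding Im_cayley_inverse_eq by simp
qed

lemma cayley_inverse_unit: "norm k = 1 \<Longrightarrow> Im (\<i> * (1 + k) / (1 - k)) = 0"
  unfolding Im_cayley_inverse_eq by simp

text \<open>
  If \<open>h\<close> approaches \<open>p\<close> from below instead, one reflects in the imaginary axis: see \<open>reflect\<close>.
\<close>

locale half_plane_upper_orbit = half_plane_boundary_orbit +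
  fixes p :: complex
  assumes h_tendsto: "((\<lambda>y. h (Complex x0 y)) \<longlongrightarrow> p) (at_right 0)"
    and Re_p: "\<And>y. y > 0 \<Longrightarrow> Re p < Re (h (Complex x0 y))"
    and Im_p: "\<forall>\<^sub>F y in at_right 0. Im p < Im (h (Complex x0 y))"
begin

definition "g0 \<xi> = g (p + \<xi>)"

text \<open>Orbits are horizontal in the Koenigs coordinate. The curve
  \<open>h (Complex x0 y)\<close> descends to \<open>p\<close> from above, so by the intermediate
  value theorem it meets every level slightly above \<open>Im p\<close>. A point far enough to the
  right on such a level is ahead on an orbit that starts at height at most
  \<open>y2\<close>.\<close>

lemma strip:
  assumes \<delta>: "\<delta> > 0" and Y: "Y > 0"
  obtains y2 where "0 < y2" "y2 < Y" "Im p < Im (h (Complex x0 y2))" "Re (h (Complex x0 y2)) < Re p + \<delta>"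
    "\<And>q. Re q \<ge> Re p + \<delta> \<Longrightarrow> Im p < Im q \<Longrightarrow> Im q < Im (h (Complex x0 y2)) \<Longrightarrow>
       \<exists>y\<in>{0<..y2}. \<exists>t\<in>{0..Re q - Re p}. q = h (Complex x0 y) + of_real t"
proof -
  have "\<forall>\<^sub>F y in at_right 0. Re (h (Complex x0 y)) < Re p + \<delta>"
    by (rule order_tendstoD[OF tendsto_Re[OF h_tendsto]]) (use \<delta> in simp)
  from eventually_happens'[OF trivial_limit_at_right_real eventually_conj[OF this eventually_conj[OF Im_p eventually_at_right_real[OF Y]]]]
  obtain y2 where y2: "Re (h (Complex x0 y2)) < Re p + \<delta>" "Im p < Im (h (Complex x0 y2))" "0 < y2" "y2 < Y" by auto
  have "\<exists>y\<in>{0<..y2}. \<exists>t\<in>{0..Re q - Re p}. q = h (Complex x0 y) + of_real t"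
    if q: "Re q \<ge> Re p + \<delta>" "Im p < Im q" "Im q < Im (h (Complex x0 y2))" for q
  proof -
    have "\<forall>\<^sub>F y in at_right 0. Im (h (Complex x0 y)) < Im q"
      by (rule order_tendstoD[OF tendsto_Im[OF h_tendsto]]) (use q in simp)
    from eventually_happens'[OF trivial_limit_at_right_real eventually_conj[OF this eventually_at_right_real[OF y2(3)]]]
    obtain y3 where y3: "Im (h (Complex x0 y3)) < Im q" "0 < y3" "y3 < y2" by auto
    have "continuous_on {y3..y2} (\<lambda>y. Im (h (Complex x0 y)))"
      by (intro continuous_intros continuous_on_subset[OF cont_h_vertical]) (use y3 in auto)
    then obtain y where y: "y3 \<le> y" "y \<le> y2" "Im (h (Complex x0 y)) = Im q"
      using IVT'[of "\<lambda>y. Im (h (Complex x0 y))" y3 "Im q" y2] y3 q by auto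
    have "Re (h (Complex x0 y)) \<le> Re (h (Complex x0 y2))"
      using Re_h_less[of y y2 x0] y y3 by (cases "y = y2") auto
    then have "Re q - Re (h (Complex x0 y)) \<in> {0..Re q - Re p}" using q y2 Re_p[of y] y y3 by auto
    moreover have "q = h (Complex x0 y) + of_real (Re q - Re (h (Complex x0 y)))"
      using y by (simp add: complex_eq_iff)
    moreover have "y \<in> {0<..y2}" using y y3 by auto
    ultimately show ?thesis by blast
  qed
  then show thesis using that y2 by blast
qed

lemma strip_in:
  assumes \<delta>: "\<delta> > 0"
  obtains \<eta> where "\<eta> > 0" "\<And>\<xi>. Re \<xi> \<ge> \<delta> \<Longrightarrow> 0 < Im \<xi> \<Longrightarrow> Im \<xi> < \<eta> \<Longrightarrow> p + \<xi> \<in> \<Omega>"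
proof -
  obtain y2 where y2: "0 < y2" "Im p < Im (h (Complex x0 y2))"
    "\<And>q. Re q \<ge> Re p + \<delta> \<Longrightarrow> Im p < Im q \<Longrightarrow> Im q < Im (h (Complex x0 y2)) \<Longrightarrow>
       \<exists>y\<in>{0<..y2}. \<exists>t\<in>{0..Re q - Re p}. q = h (Complex x0 y) + of_real t"
    using strip[OF \<delta> zero_less_one] by metis
  show thesis
  proof (rule that[of "Im (h (Complex x0 y2)) - Im p"])
    fix \<xi> assume "Re \<xi> \<ge> \<delta>" "0 < Im \<xi>" "Im \<xi> < Im (h (Complex x0 y2)) - Im p"
    then obtain y t where "y > 0" "t \<ge> 0" "p + \<xi> = h (Complex x0 y) + of_real t"
      using y2(3)[of "p + \<xi>"] by auto
    then show "p + \<xi> \<in> \<Omega>" using w_in[of y t] by simp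
  qed (use y2 in simp)
qed

text \<open>Near the point \<open>s\<close> of the ray, \<open>g0 \<xi>\<close> is the position of
  an orbit of small initial height at a time not exceeding \<open>s + 1\<close>, so uniform
  avoidance of \<open>K\<close> applies.\<close>

lemma g0_leaves:
  assumes K: "compact K" "K \<subseteq> uhp" and s: "s > 0"
  shows "\<forall>\<^sub>F \<xi> in at (of_real s) within uhp. p + \<xi> \<in> \<Omega> \<and> g0 \<xi> \<notin> K"
proof -
  have "\<forall>\<^sub>F y in at_right 0. \<forall>t\<in>{0..s+1}. w t y \<notin> K"
    by (intro uniformly_hugging leaves K) (use s in auto)
  then obtain Y where Y: "Y > 0" "\<And>y t. 0 < y \<Longrightarrow> y < Y \<Longrightarrow> 0 \<le> t \<Longrightarrow> t \<le> s+1 \<Longrightarrow> w t y \<notin> K"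
    unfolding eventually_at_right_field by auto
  have s2: "s/2 > 0" using s by simp
  obtain y2 where y2: "0 < y2" "y2 < Y" "Im p < Im (h (Complex x0 y2))"
    "\<And>q. Re q \<ge> Re p + s/2 \<Longrightarrow> Im p < Im q \<Longrightarrow> Im q < Im (h (Complex x0 y2)) \<Longrightarrow>
       \<exists>y\<in>{0<..y2}. \<exists>t\<in>{0..Re q - Re p}. q = h (Complex x0 y) + of_real t"
    using strip[OF s2 Y(1)] by metis
  define d where "d = min (min (s/2) 1) (Im (h (Complex x0 y2)) - Im p)"
  have d: "d > 0" using s y2 by (auto simp: d_def)
  have "p + \<xi> \<in> \<Omega> \<and> g0 \<xi> \<notin> K" if \<xi>: "Im \<xi> > 0" "dist \<xi> (of_real s) < d" for \<xi>
  proof -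
    have *: "\<bar>Re \<xi> - s\<bar> < d" "\<bar>Im \<xi>\<bar> < d"
      using abs_Re_le_cmod[of "\<xi> - of_real s"] abs_Im_le_cmod[of "\<xi> - of_real s"] \<xi> by (auto simp: dist_norm)
    moreover have "d \<le> s/2" "d \<le> 1" "d \<le> Im (h (Complex x0 y2)) - Im p" unfolding d_def by linarith+
    ultimately have "Re \<xi> \<ge> s/2" "Re \<xi> \<le> s+1" "Im \<xi> < Im (h (Complex x0 y2)) - Im p" by linarith+
    then obtain y t where yt: "y > 0" "y \<le> y2" "t \<ge> 0" "t \<le> s + 1" "p + \<xi> = h (Complex x0 y) + of_real t"
      using y2(4)[of "p + \<xi>"] \<xi> by auto
    then have "g0 \<xi> = w t y" by (simp add: g0_def w_def)
    then show ?thesis using yt w_in[of y t] Y(2)[of y t] y2 by simp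
  qed
  then show ?thesis unfolding eventually_at using d by (intro exI[of _ d]) auto
qed

text \<open>The disc coordinate of \<open>g0\<close>. Leaving all compact subsets of the half-plane
  includes running to infinity; in the disc infinity is the boundary point 1 and needs no separate
  treatment.\<close>

definition "k0 \<xi> = (g0 \<xi> - \<i>) / (g0 \<xi> + \<i>)"

lemma k0_norm_tendsto:
  assumes s: "s > 0"
  shows "((\<lambda>\<xi>. norm (k0 \<xi>)) \<longlongrightarrow> 1) (at (of_real s) within uhp)"
  unfolding tendsto_iff
proof (intro allI impI)
  fix e :: real assume e: "e > 0"
  define r where "r = max 0 (1 - e)"
  define K where "K = (\<lambda>k::complex. \<i> * (1 + k) / (1 - k)) ` cball 0 r"
  have r: "0 \<le> r" "r < 1" using e by (auto simp: r_def)
  have "compact K" unfolding K_def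
    by (intro compact_continuous_image continuous_intros) (use r in auto)
  moreover have "K \<subseteq> uhp" unfolding K_def using Im_cayley_inverse r by force
  ultimately have "\<forall>\<^sub>F \<xi> in at (of_real s) within uhp. p + \<xi> \<in> \<Omega> \<and> g0 \<xi> \<notin> K" using s by (rule g0_leaves)
  then show "\<forall>\<^sub>F \<xi> in at (of_real s) within uhp. dist (norm (k0 \<xi>)) 1 < e"
  proof eventually_elim
    case (elim \<xi>)
    have up: "Im (g0 \<xi>) > 0" using elim g_uhp by (simp add: g0_def)
    have "norm (k0 \<xi>) < 1" using cayley_norm_less_1[OF up] by (simp add: k0_def)
    moreover have "norm (k0 \<xi>) > r"
    proof (rule ccontr)
      assume "\<not> norm (k0 \<xi>) > r"
      then have "g0 \<xi> \<in> K" unfolding K_def using cayley_inverse[OF up k0_def]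
        by (intro image_eqI[of _ _ "k0 \<xi>"]) auto
      then show False using elim by simp
    qed
    ultimately show ?case by (auto simp: r_def dist_real_def)
  qed
qed

lemma holg0: "g0 holomorphic_on {\<xi>. p + \<xi> \<in> \<Omega>}"
  unfolding g0_def
  by (rule holomorphic_on_compose_gen[OF _ holg, unfolded o_def]) (auto intro!: holomorphic_intros)

lemma g0_uhp: "p + \<xi> \<in> \<Omega> \<Longrightarrow> Im (g0 \<xi>) > 0" unfolding g0_def by (rule g_uhp)

lemma inj_g0: "inj_on g0 {\<xi>. p + \<xi> \<in> \<Omega>}"
proof (rule inj_onI)
  fix a b assume "a \<in> {\<xi>. p + \<xi> \<in> \<Omega>}" "b \<in> {\<xi>. p + \<xi> \<in> \<Omega>}" "g0 a = g0 b"
  then have "p + a = p + b" using inj_onD[OF inj_g, of "p + a" "p + b"] by (simp add: g0_def)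
  then show "a = b" by simp
qed

lemma deriv_g0: "p + \<xi> \<in> \<Omega> \<Longrightarrow> (g0 has_field_derivative 1 / deriv h (g0 \<xi>)) (at \<xi>)"
proof -
  assume "p + \<xi> \<in> \<Omega>"
  moreover have "((\<lambda>\<xi>. p + \<xi>) has_field_derivative 1) (at \<xi>)" by (auto intro!: derivative_eq_intros)
  ultimately have "((\<lambda>\<xi>. g (p + \<xi>)) has_field_derivative 1 / deriv h (g (p + \<xi>)) * 1) (at \<xi>)"
    by (intro DERIV_chain2[where f=g and g="\<lambda>\<xi>. p + \<xi>" and x=\<xi>] deriv_g)
  then show ?thesis unfolding g0_def by simp
qed

lemma half_ball_in:
  assumes s: "s > 0"
  obtains R where "R > 0" "R \<le> s" "{z. dist z (of_real s) < R \<and> Im z > 0} \<subseteq> {\<xi>. p + \<xi> \<in> \<Omega>}"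
proof -
  have s2: "s/2 > 0" using s by simp
  obtain \<eta> where \<eta>: "\<eta> > 0" "\<And>\<xi>. Re \<xi> \<ge> s/2 \<Longrightarrow> 0 < Im \<xi> \<Longrightarrow> Im \<xi> < \<eta> \<Longrightarrow> p + \<xi> \<in> \<Omega>" using strip_in[OF s2] by blast
  show thesis
  proof (rule that[of "min (s/2) \<eta>"])
    show "{z. dist z (of_real s) < min (s/2) \<eta> \<and> Im z > 0} \<subseteq> {\<xi>. p + \<xi> \<in> \<Omega>}"
    proof clarify
      fix z assume z: "dist z (of_real s) < min (s/2) \<eta>" "Im z > 0"
      have "\<bar>Re z - s\<bar> < s/2" "\<bar>Im z\<bar> < \<eta>"
        using abs_Re_le_cmod[of "z - of_real s"] abs_Im_le_cmod[of "z - of_real s"] z by (auto simp: dist_norm)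
      then have "s/2 \<le> Re z" "Im z < \<eta>" by linarith+
      then show "p + z \<in> \<Omega>" using z by (intro \<eta>)
    qed
  qed (use s \<eta> in auto)
qed

lemma k0_limit:
  assumes s: "s > 0"
  obtains r F where "r > 0" "r \<le> s" "{z. dist z (of_real s) < r \<and> Im z > 0} \<subseteq> {\<xi>. p + \<xi> \<in> \<Omega>}"
    "F holomorphic_on ball (of_real s) r"
    "\<And>z. z \<in> ball (of_real s) r \<Longrightarrow> Im z > 0 \<Longrightarrow> k0 z = exp (\<i> * F z)"
    "\<And>z. z \<in> ball (of_real s) r \<Longrightarrow> Im z = 0 \<Longrightarrow> Im (F z) = 0"
proof -
  obtain R where R: "R > 0" "R \<le> s" and sub: "{z. dist z (of_real s) < R \<and> Im z > 0} \<subseteq> {\<xi>. p + \<xi> \<in> \<Omega>}"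
    using half_ball_in[OF s] by blast
  have nz: "g0 \<xi> + \<i> \<noteq> 0" if "p + \<xi> \<in> \<Omega>" for \<xi> using g0_uhp[OF that] by (auto simp: complex_eq_iff)
  obtain r F where "0 < r" "r \<le> R" "F holomorphic_on ball (of_real s) r"
    "\<And>z. z \<in> ball (of_real s) r \<Longrightarrow> Im z > 0 \<Longrightarrow> k0 z = exp (\<i> * F z)"
    "\<And>z. z \<in> ball (of_real s) r \<Longrightarrow> Im z = 0 \<Longrightarrow> Im (F z) = 0"
  proof (rule Schwarz_reflection_disc[OF R(1), of k0 s])
    show "k0 holomorphic_on {z. dist z (of_real s) < R \<and> Im z > 0}"
      unfolding k0_def using sub nz by (intro holomorphic_intros holomorphic_on_subset[OF holg0]) auto
    show "k0 ` {z. dist z (of_real s) < R \<and> Im z > 0} \<subseteq> ball 0 1"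
      using cayley_norm_less_1[OF g0_uhp] sub by (auto simp: k0_def)
    show "inj_on k0 {z. dist z (of_real s) < R \<and> Im z > 0}"
    proof (rule inj_onI)
      fix a b assume a: "a \<in> {z. dist z (of_real s) < R \<and> Im z > 0}" and b: "b \<in> {z. dist z (of_real s) < R \<and> Im z > 0}"
        and eq: "k0 a = k0 b"
      then have "g0 a = g0 b" using cayley_inverse[OF g0_uhp k0_def] sub by (metis (mono_tags, lifting) mem_Collect_eq subsetD)
      then show "a = b" using inj_onD[OF inj_on_subset[OF inj_g0 sub]] a b by blast
    qed
    show "((\<lambda>z. cmod (k0 z)) \<longlongrightarrow> 1) (at (of_real x) within uhp)" if "\<bar>x - s\<bar> < R" for x
      by (rule k0_norm_tendsto) (use that R in auto)
  qed (use that in blast)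
  moreover have "{z. dist z (of_real s) < r \<and> Im z > 0} \<subseteq> {\<xi>. p + \<xi> \<in> \<Omega>}" using sub \<open>r \<le> R\<close> by force
  ultimately show thesis using that[of r F] R by auto
qed

end

lemma of_real_in_ball_iff: "complex_of_real x \<in> ball (of_real s) r \<longleftrightarrow> \<bar>x - s\<bar> < r"
  by (metis dist_commute dist_of_real mem_ball dist_real_def)

lemma tendsto_Im_0_boundary:
  assumes contN: "continuous_on (ball (complex_of_real s) r) N"
    and eq: "\<And>z. z \<in> ball (of_real s) r \<Longrightarrow> Im z > 0 \<Longrightarrow> f z = N z"
    and re: "Im (N (of_real x)) = 0" and x: "\<bar>x - s\<bar> < r"
  shows "((\<lambda>z. Im (f z)) \<longlongrightarrow> 0) (at (of_real x) within uhp)"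
proof -
  have xb: "of_real x \<in> ball (complex_of_real s) r" using x by (simp only: of_real_in_ball_iff)
  have "isCont N (of_real x)" using contN xb by (simp add: continuous_on_eq_continuous_at)
  then have "(N \<longlongrightarrow> N (of_real x)) (at (of_real x) within uhp)"
    unfolding isCont_def by (rule tendsto_within_subset) simp
  then have "((\<lambda>z. Im (N z)) \<longlongrightarrow> 0) (at (of_real x) within uhp)" using tendsto_Im re by fastforce
  moreover have "\<forall>\<^sub>F z in at (of_real x) within uhp. Im (N z) = Im (f z)"
    unfolding eventually_at_filter using eventually_nhds_in_open[OF open_ball xb]
    by eventually_elim (use eq in auto)
  ultimately show ?thesis by (rule Lim_transform_eventually)
qed

context half_plane_upper_orbit begin

lemma Im_deriv_g0: "p + \<xi> \<in> \<Omega> \<Longrightarrow> Im (1 / deriv h (g0 \<xi>)) > 0"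
  unfolding g0_def by (rule Im_deriv_g)

text \<open>
  At a pole, \<open>- 1 / g\<close> would have a zero with positive derivative, and \<open>g'\<close> would have negative imaginary part
  in the direction \<open>\<omega>\<close> from it, contradicting \<open>Im_deriv_g0\<close>.
\<close>

lemma g0_no_pole:
  assumes s: "s > 0" and r: "r > 0" and sub: "{z. dist z (of_real s) < r \<and> Im z > 0} \<subseteq> {\<xi>. p + \<xi> \<in> \<Omega>}"
    and holF: "F holomorphic_on ball (of_real s) r"
    and k0: "\<And>z. z \<in> ball (of_real s) r \<Longrightarrow> Im z > 0 \<Longrightarrow> k0 z = exp (\<i> * F z)"
    and Freal: "\<And>z. z \<in> ball (of_real s) r \<Longrightarrow> Im z = 0 \<Longrightarrow> Im (F z) = 0"
  shows "exp (\<i> * F (of_real s)) \<noteq> 1"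
proof
  assume k1: "exp (\<i> * F (of_real s)) = 1"
  define D where "D = (\<lambda>z. 1 + exp (\<i> * F z))"
  have contF: "continuous_on (ball (of_real s) r) F" using holF by (rule holomorphic_on_imp_continuous_on)
  have "isCont F (of_real s)" using contF r by (simp add: continuous_on_eq_continuous_at)
  then have "isCont D (of_real s)" unfolding D_def by (intro continuous_intros)
  moreover have "D (of_real s) \<noteq> 0" by (simp add: D_def k1)
  ultimately obtain e where e: "e > 0" "\<And>z. dist (of_real s) z < e \<Longrightarrow> D z \<noteq> 0"
    using continuous_at_avoid[of "of_real s" D 0] by auto
  define r1 where "r1 = min e r"
  have r1: "r1 > 0" "r1 \<le> r" using e r by (auto simp: r1_def)
  have Dnz: "D z \<noteq> 0" if "z \<in> ball (of_real s) r1" for z using e that by (auto simp: r1_def)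
  define U where "U = {z. dist z (complex_of_real s) < r1 \<and> Im z > 0}"
  have Uin: "p + z \<in> \<Omega>" "z \<in> ball (of_real s) r1" "z \<in> ball (of_real s) r" "Im z > 0" if "z \<in> U" for z
    using that subsetD[OF sub, of z] r1 by (auto simp: U_def dist_commute)
  \<comment> \<open>The map \<open>- 1 / z\<close> of the half-plane moves infinity to 0.
    \<open>N\<close> is the same function written through \<open>F\<close>, which shows that it is
    continuous up to the axis and real there.\<close>
  define m where "m = (\<lambda>z. - 1 / g0 z)"
  define N where "N = (\<lambda>z. \<i> * (1 - exp (\<i> * F z)) / D z)"
  have g0nz: "g0 z \<noteq> 0" if "z \<in> U" for z using g0_uhp[OF Uin(1)[OF that]] by auto
  have mN: "m z = N z" if z: "z \<in> U" for z
  proof -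
    have "g0 z = \<i> * (1 + exp (\<i> * F z)) / (1 - exp (\<i> * F z))"
      using cayley_inverse[OF g0_uhp[OF Uin(1)[OF z]] k0_def] k0[OF Uin(3)[OF z] Uin(4)[OF z]] by simp
    moreover have "- 1 / (\<i> * a / b) = \<i> * b / a" for a b :: complex
      by (cases "a = 0"; cases "b = 0") (simp_all add: field_simps)
    ultimately show ?thesis by (simp only: m_def N_def D_def)
  qed
  have contN: "continuous_on (ball (of_real s) r1) N"
    unfolding N_def using Dnz unfolding D_def
    by (intro continuous_intros continuous_on_subset[OF contF]) (use r1 in auto)
  have Nreal: "Im (N (of_real x)) = 0" if "\<bar>x - s\<bar> < r1" for x
  proof -
    define \<theta> where "\<theta> = Re (F (of_real x))"
    have "of_real x \<in> ball (complex_of_real s) r" using that r1 of_real_in_ball_iff[of x s r] by linarith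
    then have "F (of_real x) = of_real \<theta>" using Freal[of "of_real x"] by (simp add: \<theta>_def complex_eq_iff)
    then have n: "norm (- exp (\<i> * F (of_real x))) = 1" by simp
    show ?thesis using cayley_inverse_unit[OF n] by (simp add: N_def D_def)
  qed
  obtain r2 M where r2: "0 < r2" "r2 \<le> r1" and holM: "M holomorphic_on ball (of_real s) r2"
    and Mm: "\<And>z. z \<in> ball (of_real s) r2 \<Longrightarrow> Im z > 0 \<Longrightarrow> M z = m z"
    and dM: "\<And>x. \<bar>x - s\<bar> < r2 \<Longrightarrow> Im (deriv M (of_real x)) = 0 \<and> Re (deriv M (of_real x)) > 0"
  proof (rule Schwarz_reflection_Im[OF r1(1), of m s])
    show "m holomorphic_on {z. dist z (of_real s) < r1 \<and> 0 < Im z}"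
      unfolding m_def U_def[symmetric]
      by (intro holomorphic_intros holomorphic_on_subset[OF holg0]) (use Uin g0nz in auto)
    show "0 < Im (m z)" if "z \<in> {z. dist z (of_real s) < r1 \<and> 0 < Im z}" for z
    proof -
      have "Im (g0 z) > 0" using that Uin(1) g0_uhp by (auto simp: U_def)
      then show ?thesis by (auto simp: m_def Im_divide intro!: divide_pos_pos add_nonneg_pos)
    qed
    show "inj_on m {z. dist z (of_real s) < r1 \<and> 0 < Im z}"
    proof (rule inj_onI)
      fix a b assume a: "a \<in> {z. dist z (of_real s) < r1 \<and> 0 < Im z}" and b: "b \<in> {z. dist z (of_real s) < r1 \<and> 0 < Im z}"
        and eq: "m a = m b"
      have "g0 a = g0 b" using eq by (simp add: m_def)
      then show "a = b" using inj_onD[OF inj_g0, of a b] a b Uin(1) by (auto simp: U_def)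
    qed
    show "((\<lambda>z. Im (m z)) \<longlongrightarrow> 0) (at (of_real x) within uhp)" if "\<bar>x - s\<bar> < r1" for x
      by (rule tendsto_Im_0_boundary[OF contN _ Nreal[OF that] that]) (use mN in \<open>auto simp: U_def dist_commute\<close>)
  qed (use that in blast)
  \<comment> \<open>At distance \<open>t\<close> in this direction \<open>M\<close> is about
    \<open>c * \<omega> * t\<close>, so the derivative of \<open>g0 = - 1 / M\<close> is about
    \<open>1 / (c * \<omega>\<^sup>2 * t\<^sup>2)\<close>. With
    \<open>\<omega>\<^sup>2 = 2 * \<i>\<close> and \<open>c > 0\<close> this is a negative multiple
    of \<open>\<i>\<close>; multiplication by \<open>t\<^sup>2\<close> gives the finite limit used
    below.\<close>
  define \<omega> where "\<omega> = 1 + \<i>"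
  have \<omega>: "\<omega> \<noteq> 0" "\<omega>\<^sup>2 = 2 * \<i>" by (auto simp: \<omega>_def power2_eq_square complex_eq_iff)
  have sb: "of_real s \<in> ball (complex_of_real s) r2" using r2 by simp
  define c where "c = deriv M (of_real s)"
  have c: "Im c = 0" "Re c > 0" using dM[of s] r2 by (auto simp: c_def)
  have line: "((\<lambda>t. of_real s + \<omega> * of_real t) \<longlongrightarrow> of_real s) (at_right (0::real))"
    by (auto intro!: tendsto_eq_intros)
  have evb: "\<forall>\<^sub>F t in at_right (0::real). of_real s + \<omega> * of_real t \<in> ball (of_real s) r2 \<and> t > 0"
    using topological_tendstoD[OF line open_ball sb] eventually_at_right_less[of 0] by eventually_elim auto
  have up: "Im (of_real s + \<omega> * of_real t) > 0" if "t > 0" for t using that by (simp add: \<omega>_def)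
  have inU: "z \<in> U" if "z \<in> ball (of_real s) r2" "Im z > 0" for z using that r2 by (auto simp: U_def dist_commute)
  have contM: "isCont M (of_real s)" "isCont (deriv M) (of_real s)"
    using holomorphic_on_imp_continuous_on[OF holM] holomorphic_on_imp_continuous_on[OF holomorphic_deriv[OF holM open_ball]] sb
    by (auto simp: continuous_on_eq_continuous_at)
  have Ms: "M (of_real s) = 0"
  proof (rule tendsto_unique)
    show "((\<lambda>t. M (of_real s + \<omega> * of_real t)) \<longlongrightarrow> M (of_real s)) (at_right 0)"
      by (rule isCont_tendsto_compose[OF contM(1) line])
    have "isCont N (of_real s)" using contN r1 by (simp add: continuous_on_eq_continuous_at)
    from isCont_tendsto_compose[OF this line]
    have "((\<lambda>t. N (of_real s + \<omega> * of_real t)) \<longlongrightarrow> 0) (at_right 0)" by (simp add: N_def k1)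
    then show "((\<lambda>t. M (of_real s + \<omega> * of_real t)) \<longlongrightarrow> 0) (at_right 0)"
    proof (rule Lim_transform_eventually)
      show "\<forall>\<^sub>F t in at_right (0::real). N (of_real s + \<omega> * of_real t) = M (of_real s + \<omega> * of_real t)"
        using evb by eventually_elim (use Mm mN inU up in auto)
    qed
  qed simp
  have "(M has_field_derivative c) (at (of_real s))"
    unfolding c_def by (rule holomorphic_derivI[OF holM open_ball sb])
  from field_derivative_quotient_right[OF this \<omega>(1)]
  have l1: "((\<lambda>t. M (of_real s + \<omega> * of_real t) / (\<omega> * of_real t)) \<longlongrightarrow> c) (at_right 0)" by (simp add: Ms)
  have l2: "((\<lambda>t. deriv M (of_real s + \<omega> * of_real t)) \<longlongrightarrow> c) (at_right 0)"
    unfolding c_def by (rule isCont_tendsto_compose[OF contM(2) line])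
  have cnz: "c \<noteq> 0" using c by auto
  have "((\<lambda>t. Im (deriv M (of_real s + \<omega> * of_real t) / (\<omega>\<^sup>2 * (M (of_real s + \<omega> * of_real t) / (\<omega> * of_real t))\<^sup>2)))
     \<longlongrightarrow> Im (c / (\<omega>\<^sup>2 * c\<^sup>2))) (at_right 0)"
    by (intro tendsto_intros l1 l2) (use \<omega> cnz in auto)
  moreover have "\<forall>\<^sub>F t in at_right (0::real). 0 \<le> Im (deriv M (of_real s + \<omega> * of_real t) / (\<omega>\<^sup>2 * (M (of_real s + \<omega> * of_real t) / (\<omega> * of_real t))\<^sup>2))"
    using evb
  proof eventually_elim
    case (elim t)
    define z where "z = of_real s + \<omega> * of_real t"
    have z: "z \<in> ball (of_real s) r2" "Im z > 0" using elim up by (auto simp: z_def)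
    have zU: "z \<in> U" using inU z by blast
    have dg: "(g0 has_field_derivative 1 / deriv h (g0 z)) (at z)" by (rule deriv_g0[OF Uin(1)[OF zU]])
    have "(m has_field_derivative (1 / deriv h (g0 z)) / (g0 z)\<^sup>2) (at z)"
      unfolding m_def by (rule DERIV_cong, (rule derivative_intros dg)+) (use g0nz[OF zU] in \<open>auto simp: power2_eq_square\<close>)
    moreover have "\<forall>\<^sub>F u in nhds z. m u = M u"
    proof -
      have "open (ball (of_real s) r2 \<inter> uhp)" by (intro open_Int open_ball open_uhp)
      then have "\<forall>\<^sub>F u in nhds z. u \<in> ball (of_real s) r2 \<inter> uhp" using z by (intro eventually_nhds_in_open) auto
      then show ?thesis by eventually_elim (use Mm in auto)
    qed
    ultimately have "(M has_field_derivative (1 / deriv h (g0 z)) / (g0 z)\<^sup>2) (at z)"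
      using DERIV_cong_ev[OF refl _ refl] by blast
    then have d: "deriv M z = (1 / deriv h (g0 z)) / (g0 z)\<^sup>2" by (rule DERIV_imp_deriv)
    have M1: "M z = - 1 / g0 z" using Mm[OF z] by (simp add: m_def)
    have "deriv M z / (\<omega>\<^sup>2 * (M z / (\<omega> * of_real t))\<^sup>2) = (1 / deriv h (g0 z)) * of_real (t\<^sup>2)"
      unfolding d M1 using g0nz[OF zU] \<omega>(1) elim by (simp add: field_simps power2_eq_square)
    moreover have "Im (a * of_real (t\<^sup>2)) \<ge> 0" if "Im a > 0" for a
      using that by (simp del: of_real_power)
    note this[OF Im_deriv_g0[OF Uin(1)[OF zU]]]
    ultimately show ?case by (simp only: z_def)
  qed
  ultimately have "0 \<le> Im (c / (\<omega>\<^sup>2 * c\<^sup>2))"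
    by (rule tendsto_lowerbound) simp
  moreover have "c / (\<omega>\<^sup>2 * c\<^sup>2) = - \<i> * of_real (1 / (2 * Re c))"
  proof -
    have "c = of_real (Re c)" using c by (simp add: complex_eq_iff)
    then obtain x where x: "c = of_real x" "x > 0" using c by metis
    then show ?thesis unfolding \<omega>(2) by (simp add: field_simps power2_eq_square)
  qed
  ultimately show False using c by simp
qed

text \<open>Since infinity is not a boundary value over the ray, the inverse Cayley transform of
  \<open>exp (\<i> * F z)\<close> is continuous near \<open>s\<close> and real on the axis. So
  \<open>Im g0\<close> tends to 0 there, and \<open>g0\<close> itself can be reflected.\<close>

lemma g0_extension:
  assumes s: "s > 0"
  obtains r G where "r > 0" "r \<le> s" "{z. dist z (of_real s) < r \<and> Im z > 0} \<subseteq> {\<xi>. p + \<xi> \<in> \<Omega>}"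
    "G holomorphic_on ball (of_real s) r"
    "\<And>z. z \<in> ball (of_real s) r \<Longrightarrow> Im z > 0 \<Longrightarrow> G z = g0 z"
    "\<And>z. z \<in> ball (of_real s) r \<Longrightarrow> Im z = 0 \<Longrightarrow> Im (G z) = 0"
    "\<And>z. z \<in> ball (of_real s) r \<Longrightarrow> Im z < 0 \<Longrightarrow> Im (G z) < 0"
    "inj_on G (ball (of_real s) r)"
    "\<And>x. \<bar>x - s\<bar> < r \<Longrightarrow> Im (deriv G (of_real x)) = 0 \<and> Re (deriv G (of_real x)) > 0"
proof (rule k0_limit[OF s])
  fix r F assume r: "r > 0" "r \<le> s" and sub: "{z. dist z (of_real s) < r \<and> Im z > 0} \<subseteq> {\<xi>. p + \<xi> \<in> \<Omega>}"
    and holF: "F holomorphic_on ball (of_real s) r"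
    and k0: "\<And>z. z \<in> ball (of_real s) r \<Longrightarrow> Im z > 0 \<Longrightarrow> k0 z = exp (\<i> * F z)"
    and Freal: "\<And>z. z \<in> ball (of_real s) r \<Longrightarrow> Im z = 0 \<Longrightarrow> Im (F z) = 0"
  define D where "D = (\<lambda>z. 1 - exp (\<i> * F z))"
  have contF: "continuous_on (ball (of_real s) r) F" using holF by (rule holomorphic_on_imp_continuous_on)
  have "isCont F (of_real s)" using contF r by (simp add: continuous_on_eq_continuous_at)
  then have "isCont D (of_real s)" unfolding D_def by (intro continuous_intros)
  moreover have "exp (\<i> * F (of_real s)) \<noteq> 1"
    by (rule g0_no_pole[OF s r(1) sub holF]) (use k0 Freal in auto)
  then have "D (of_real s) \<noteq> 0" by (simp add: D_def)
  ultimately obtain e where e: "e > 0" "\<And>z. dist (of_real s) z < e \<Longrightarrow> D z \<noteq> 0"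
    using continuous_at_avoid[of "of_real s" D 0] by auto
  define r1 where "r1 = min e r"
  have r1: "r1 > 0" "r1 \<le> r" using e r by (auto simp: r1_def)
  have Dnz: "D z \<noteq> 0" if "z \<in> ball (of_real s) r1" for z using e that by (auto simp: r1_def)
  define U where "U = {z. dist z (complex_of_real s) < r1 \<and> Im z > 0}"
  have Uin: "p + z \<in> \<Omega>" "z \<in> ball (of_real s) r1" "z \<in> ball (of_real s) r" "Im z > 0" if "z \<in> U" for z
    using that subsetD[OF sub, of z] r1 by (auto simp: U_def dist_commute)
  define N where "N = (\<lambda>z. \<i> * (1 + exp (\<i> * F z)) / D z)"
  have gN: "g0 z = N z" if z: "z \<in> U" for z
    using cayley_inverse[OF g0_uhp[OF Uin(1)[OF z]] k0_def] k0[OF Uin(3)[OF z] Uin(4)[OF z]]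
    by (simp add: N_def D_def)
  have contN: "continuous_on (ball (of_real s) r1) N"
    unfolding N_def using Dnz unfolding D_def
    by (intro continuous_intros continuous_on_subset[OF contF]) (use r1 in auto)
  have Nreal: "Im (N (of_real x)) = 0" if "\<bar>x - s\<bar> < r1" for x
  proof -
    define \<theta> where "\<theta> = Re (F (of_real x))"
    have "of_real x \<in> ball (complex_of_real s) r" using that r1 of_real_in_ball_iff[of x s r] by linarith
    then have "F (of_real x) = of_real \<theta>" using Freal[of "of_real x"] by (simp add: \<theta>_def complex_eq_iff)
    then have n: "norm (exp (\<i> * F (of_real x))) = 1" by simp
    show ?thesis using cayley_inverse_unit[OF n] by (simp add: N_def D_def)
  qed
  show thesis
  proof (rule Schwarz_reflection_Im[OF r1(1), of g0 s])
    show "g0 holomorphic_on {z. dist z (of_real s) < r1 \<and> 0 < Im z}"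
      unfolding U_def[symmetric] by (rule holomorphic_on_subset[OF holg0]) (use Uin in auto)
    show "0 < Im (g0 z)" if "z \<in> {z. dist z (of_real s) < r1 \<and> 0 < Im z}" for z
      using that Uin(1) g0_uhp by (auto simp: U_def)
    show "inj_on g0 {z. dist z (of_real s) < r1 \<and> 0 < Im z}"
      unfolding U_def[symmetric] by (rule inj_on_subset[OF inj_g0]) (use Uin in auto)
    show "((\<lambda>z. Im (g0 z)) \<longlongrightarrow> 0) (at (of_real x) within uhp)" if "\<bar>x - s\<bar> < r1" for x
      by (rule tendsto_Im_0_boundary[OF contN _ Nreal[OF that] that]) (use gN in \<open>auto simp: U_def dist_commute\<close>)
  next
    fix r2 G assume *: "0 < r2" "r2 \<le> r1" "G holomorphic_on ball (of_real s) r2"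
      "\<And>z. z \<in> ball (of_real s) r2 \<Longrightarrow> 0 < Im z \<Longrightarrow> G z = g0 z"
      "\<And>z. z \<in> ball (of_real s) r2 \<Longrightarrow> Im z = 0 \<Longrightarrow> Im (G z) = 0"
      "\<And>z. z \<in> ball (of_real s) r2 \<Longrightarrow> Im z < 0 \<Longrightarrow> Im (G z) < 0"
      "inj_on G (ball (of_real s) r2)"
      "\<And>x. \<bar>x - s\<bar> < r2 \<Longrightarrow> Im (deriv G (of_real x)) = 0 \<and> 0 < Re (deriv G (of_real x))"
    have sub2: "{z. dist z (of_real s) < r2 \<and> Im z > 0} \<subseteq> {\<xi>. p + \<xi> \<in> \<Omega>}"
    proof clarify
      fix z assume "dist z (complex_of_real s) < r2" "Im z > 0"
      then have "z \<in> U" using *(2) by (auto simp: U_def)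
      then show "p + z \<in> \<Omega>" by (rule Uin)
    qed
    show thesis by (rule that[OF *(1) _ sub2 *(3-8)]) (use * r1 r in auto)
  qed
qed

section \<open>The boundary orbit \<open>X\<close> and its speed\<close>

definition "X s = Re (Lim (at_right 0) (\<lambda>v. g0 (Complex s v)))"
definition "X' s = deriv X s"

lemma tendsto_Complex_right: "((\<lambda>v. Complex x v) \<longlongrightarrow> of_real x) (at_right 0)"
proof -
  have "((\<lambda>v. Complex x v) \<longlongrightarrow> Complex x 0) (at_right 0)" by (intro tendsto_intros)
  then show ?thesis by (simp add: complex_of_real_def)
qed

text \<open>On the axis the local reflections take the values \<open>X\<close>, a function that does
  not depend on the ball. Facts about one analytic curve can thus be proved ball by ball.\<close>

lemma X_local:
  assumes s: "s > 0"
  obtains r G where "r > 0" "r \<le> s" "\<And>z. z \<in> ball (of_real s) r \<Longrightarrow> Im z > 0 \<Longrightarrow> p + z \<in> \<Omega>"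
    "G holomorphic_on ball (of_real s) r"
    "\<And>z. z \<in> ball (of_real s) r \<Longrightarrow> Im z > 0 \<Longrightarrow> G z = g0 z"
    "\<And>x. \<bar>x - s\<bar> < r \<Longrightarrow> G (of_real x) = of_real (X x)"
    "\<And>z. z \<in> ball (of_real s) r \<Longrightarrow> Im z \<le> 0 \<Longrightarrow> Im (G z) \<le> 0"
    "inj_on G (ball (of_real s) r)"
    "\<And>x. \<bar>x - s\<bar> < r \<Longrightarrow> Im (deriv G (of_real x)) = 0 \<and> Re (deriv G (of_real x)) > 0"
proof (rule g0_extension[OF s])
  fix r G assume r: "r > 0" "r \<le> s" and sub: "{z. dist z (of_real s) < r \<and> Im z > 0} \<subseteq> {\<xi>. p + \<xi> \<in> \<Omega>}"
    and holG: "G holomorphic_on ball (of_real s) r"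
    and up: "\<And>z. z \<in> ball (of_real s) r \<Longrightarrow> Im z > 0 \<Longrightarrow> G z = g0 z"
    and re: "\<And>z. z \<in> ball (of_real s) r \<Longrightarrow> Im z = 0 \<Longrightarrow> Im (G z) = 0"
    and low: "\<And>z. z \<in> ball (of_real s) r \<Longrightarrow> Im z < 0 \<Longrightarrow> Im (G z) < 0"
    and inj: "inj_on G (ball (of_real s) r)"
    and d: "\<And>x. \<bar>x - s\<bar> < r \<Longrightarrow> Im (deriv G (of_real x)) = 0 \<and> Re (deriv G (of_real x)) > 0"
  have XG: "G (of_real x) = of_real (X x)" if x: "\<bar>x - s\<bar> < r" for x
  proof -
    have xb: "of_real x \<in> ball (complex_of_real s) r" using x by (simp only: of_real_in_ball_iff)
    have "isCont G (of_real x)" using holomorphic_on_imp_continuous_on[OF holG] xb by (simp add: continuous_on_eq_continuous_at)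
    from isCont_tendsto_compose[OF this tendsto_Complex_right]
    have "((\<lambda>v. G (Complex x v)) \<longlongrightarrow> G (of_real x)) (at_right 0)" .
    moreover have "\<forall>\<^sub>F v in at_right 0. G (Complex x v) = g0 (Complex x v)"
      using topological_tendstoD[OF tendsto_Complex_right open_ball xb] eventually_at_right_less[of 0]
      by eventually_elim (use up in auto)
    ultimately have "((\<lambda>v. g0 (Complex x v)) \<longlongrightarrow> G (of_real x)) (at_right 0)" by (rule Lim_transform_eventually)
    then have "X x = Re (G (of_real x))" unfolding X_def by (simp add: tendsto_Lim)
    then show ?thesis using re[OF xb] by (simp add: complex_eq_iff)
  qed
  show thesis
  proof (rule that[OF r _ holG up XG _ inj d])
    show "p + z \<in> \<Omega>" if "z \<in> ball (of_real s) r" "Im z > 0" for z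
      using subsetD[OF sub, of z] that by (simp add: dist_commute)
    show "Im (G z) \<le> 0" if "z \<in> ball (of_real s) r" "Im z \<le> 0" for z
      using re[of z] low[of z] that by (cases "Im z = 0") auto
  qed
qed

lemma X_real_derivative:
  assumes "G holomorphic_on ball (of_real s) r" "\<And>x. \<bar>x - s\<bar> < r \<Longrightarrow> G (of_real x) = of_real (X x)" "\<bar>x - s\<bar> < r"
  shows "(X has_real_derivative Re (deriv G (of_real x))) (at x)"
proof -
  have xb: "of_real x \<in> ball (complex_of_real s) r" using assms(3) by (simp only: of_real_in_ball_iff)
  have "(G has_field_derivative deriv G (of_real x)) (at (of_real x))"
    by (rule holomorphic_derivI[OF assms(1) open_ball xb])
  from has_vector_derivative_real_field[OF this]
  have "((\<lambda>v. G (of_real v)) has_vector_derivative deriv G (of_real x)) (at x)" by (simp add: o_def)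
  then have d: "((\<lambda>v. Re (G (of_real v))) has_real_derivative Re (deriv G (of_real x))) (at x)"
    using bounded_linear.has_vector_derivative[OF bounded_linear_Re] by (simp add: has_real_derivative_iff_has_vector_derivative)
  have "\<forall>\<^sub>F v in nhds x. v \<in> ball s r" by (rule eventually_nhds_in_open) (use assms(3) in \<open>auto simp: dist_real_def abs_minus_commute\<close>)
  then have "\<forall>\<^sub>F v in nhds x. Re (G (of_real v)) = X v"
    by eventually_elim (use assms(2) in \<open>auto simp: dist_real_def abs_minus_commute\<close>)
  from iffD1[OF DERIV_cong_ev[OF refl this refl] d] show ?thesis .
qed

lemma X'_eq:
  assumes "G holomorphic_on ball (of_real s) r" "\<And>x. \<bar>x - s\<bar> < r \<Longrightarrow> G (of_real x) = of_real (X x)" "\<bar>x - s\<bar> < r"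
  shows "X' x = Re (deriv G (of_real x))"
  unfolding X'_def by (rule DERIV_imp_deriv[OF X_real_derivative[OF assms]])

lemma X_deriv: "s > 0 \<Longrightarrow> (X has_real_derivative X' s) (at s) \<and> X' s > 0"
proof (rule X_local)
  fix r G assume "0 < r" and *: "G holomorphic_on ball (of_real s) r" "\<And>x. \<bar>x - s\<bar> < r \<Longrightarrow> G (of_real x) = of_real (X x)"
    and d: "\<And>x. \<bar>x - s\<bar> < r \<Longrightarrow> Im (deriv G (of_real x)) = 0 \<and> Re (deriv G (of_real x)) > 0"
  then have s: "\<bar>s - s\<bar> < r" by simp
  show ?thesis using X_real_derivative[OF * s] X'_eq[OF * s] d[OF s] by simp
qed

lemma X'_mono: "0 < s \<Longrightarrow> s \<le> t \<Longrightarrow> X' s \<le> X' t"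
proof (rule DERIV_nonneg_imp_nondecreasing[of s t X'])
  fix u assume "0 < s" "s \<le> u"
  then have u: "u > 0" by simp
  show "\<exists>D. (X' has_real_derivative D) (at u) \<and> 0 \<le> D"
  proof (rule X_local[OF u])
    fix r G assume r: "0 < r" and inO: "\<And>z. z \<in> ball (of_real u) r \<Longrightarrow> Im z > 0 \<Longrightarrow> p + z \<in> \<Omega>"
      and up: "\<And>z. z \<in> ball (of_real u) r \<Longrightarrow> Im z > 0 \<Longrightarrow> G z = g0 z"
      and *: "G holomorphic_on ball (of_real u) r" "\<And>x. \<bar>x - u\<bar> < r \<Longrightarrow> G (of_real x) = of_real (X x)"
      and d: "\<And>x. \<bar>x - u\<bar> < r \<Longrightarrow> Im (deriv G (of_real x)) = 0 \<and> Re (deriv G (of_real x)) > 0"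
    have ub: "of_real u \<in> ball (complex_of_real u) r" using r by simp
    define D where "D = deriv (deriv G) (of_real u)"
    have dD: "(deriv G has_field_derivative D) (at (of_real u))"
      unfolding D_def by (rule holomorphic_derivI[OF holomorphic_deriv[OF *(1) open_ball] open_ball ub])
    from has_vector_derivative_real_field[OF this]
    have "((\<lambda>v. deriv G (of_real v)) has_vector_derivative D) (at u)" by (simp add: o_def)
    then have d1: "((\<lambda>v. Re (deriv G (of_real v))) has_real_derivative Re D) (at u)"
      using bounded_linear.has_vector_derivative[OF bounded_linear_Re] by (simp add: has_real_derivative_iff_has_vector_derivative)
    have "\<forall>\<^sub>F v in nhds u. v \<in> ball u r" by (rule eventually_nhds_in_open) (use r in auto)
    then have "\<forall>\<^sub>F v in nhds u. Re (deriv G (of_real v)) = X' v"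
      by eventually_elim (use X'_eq[OF *] in \<open>auto simp: dist_real_def abs_minus_commute\<close>)
    from iffD1[OF DERIV_cong_ev[OF refl this refl] d1]
    have "(X' has_real_derivative Re D) (at u)" .
    \<comment> \<open>The sign lemma is applied to the derivative itself:
      \<open>Im (deriv G z)\<close> is 0 on the axis and positive above it.\<close>
    moreover have "Re D \<ge> 0"
    proof (rule Re_field_derivative_nonneg[OF dD])
      have "((\<lambda>t. of_real u + \<i> * of_real t) \<longlongrightarrow> of_real u) (at_right (0::real))" by (auto intro!: tendsto_eq_intros)
      from topological_tendstoD[OF this open_ball ub]
      show "\<forall>\<^sub>F t in at_right 0. Im (deriv G (of_real u)) \<le> Im (deriv G (of_real u + \<i> * of_real t))"
        using eventually_at_right_less[of 0]
      proof eventually_elim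
        case (elim t)
        define z where "z = of_real u + \<i> * of_real t"
        have z: "z \<in> ball (of_real u) r" "Im z > 0" using elim by (auto simp: z_def)
        have "open (ball (of_real u) r \<inter> uhp)" by (intro open_Int open_ball open_uhp)
        then have "\<forall>\<^sub>F v in nhds z. v \<in> ball (of_real u) r \<inter> uhp" using z by (intro eventually_nhds_in_open) auto
        then have "\<forall>\<^sub>F v in nhds z. G v = g0 v" by eventually_elim (use up in auto)
        then have "deriv G z = deriv g0 z" by (intro deriv_cong_ev) auto
        also have "\<dots> = 1 / deriv h (g0 z)" by (rule DERIV_imp_deriv[OF deriv_g0[OF inO[OF z]]])
        finally have "Im (deriv G z) > 0" using Im_deriv_g0[OF inO[OF z]] by simp
        then show ?case using d[of u] r by (simp add: z_def)
      qed
    qed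
    ultimately show ?thesis by blast
  qed
qed auto

lemma w_tendsto: "s > 0 \<Longrightarrow> ((\<lambda>y. w s y) \<longlongrightarrow> of_real (X s)) (at_right 0)"
proof (rule X_local)
  fix r G assume s: "s > 0" and r: "0 < r"
    and up: "\<And>z. z \<in> ball (of_real s) r \<Longrightarrow> Im z > 0 \<Longrightarrow> G z = g0 z"
    and *: "G holomorphic_on ball (of_real s) r" "\<And>x. \<bar>x - s\<bar> < r \<Longrightarrow> G (of_real x) = of_real (X x)"
  have sb: "of_real s \<in> ball (complex_of_real s) r" using r by simp
  have "isCont G (of_real s)" using holomorphic_on_imp_continuous_on[OF *(1)] sb by (simp add: continuous_on_eq_continuous_at)
  moreover have l: "((\<lambda>y. h (Complex x0 y) - p + of_real s) \<longlongrightarrow> of_real s) (at_right 0)"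
    using h_tendsto by (auto intro!: tendsto_eq_intros)
  ultimately have "((\<lambda>y. G (h (Complex x0 y) - p + of_real s)) \<longlongrightarrow> G (of_real s)) (at_right 0)"
    by (rule isCont_tendsto_compose)
  moreover have "\<forall>\<^sub>F y in at_right 0. G (h (Complex x0 y) - p + of_real s) = w s y"
    using topological_tendstoD[OF l open_ball sb] Im_p
    by eventually_elim (use up in \<open>auto simp: w_def g0_def\<close>)
  ultimately have "((\<lambda>y. w s y) \<longlongrightarrow> G (of_real s)) (at_right 0)" by (rule Lim_transform_eventually)
  then show ?thesis using *(2)[of s] r by simp
qed auto

text \<open>The local extension of \<open>g0\<close> has a holomorphic inverse, so \<open>h\<close>
  extends continuously to the axis at \<open>X s\<close>. The second limit identifies the speed with
  the boundary value of the generator, a quantity that depends on the position only.\<close>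

lemma h_tendsto_X:
  assumes s: "s > 0"
  shows "(h \<longlongrightarrow> p + of_real s) (at (of_real (X s)) within uhp)"
    and "((\<lambda>z. 1 / deriv h z) \<longlongrightarrow> of_real (X' s)) (at (of_real (X s)) within uhp)"
proof -
  have "(h \<longlongrightarrow> p + of_real s) (at (of_real (X s)) within uhp) \<and>
    ((\<lambda>z. 1 / deriv h z) \<longlongrightarrow> of_real (X' s)) (at (of_real (X s)) within uhp)"
  proof (rule X_local[OF s])
    fix r G assume r: "0 < r" and inO: "\<And>z. z \<in> ball (of_real s) r \<Longrightarrow> Im z > 0 \<Longrightarrow> p + z \<in> \<Omega>"
      and up: "\<And>z. z \<in> ball (of_real s) r \<Longrightarrow> Im z > 0 \<Longrightarrow> G z = g0 z"
      and low: "\<And>z. z \<in> ball (of_real s) r \<Longrightarrow> Im z \<le> 0 \<Longrightarrow> Im (G z) \<le> 0"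
      and inj: "inj_on G (ball (of_real s) r)"
      and *: "G holomorphic_on ball (of_real s) r" "\<And>x. \<bar>x - s\<bar> < r \<Longrightarrow> G (of_real x) = of_real (X x)"
      and d: "\<And>x. \<bar>x - s\<bar> < r \<Longrightarrow> Im (deriv G (of_real x)) = 0 \<and> Re (deriv G (of_real x)) > 0"
    define B where "B = ball (complex_of_real s) r"
    have sb: "of_real s \<in> B" using r by (simp add: B_def)
    have ss: "\<bar>s - s\<bar> < r" using r by simp
    have Gs: "G (of_real s) = of_real (X s)" by (rule *(2)[OF ss])
    have dGs: "deriv G (of_real s) = of_real (X' s)"
      using X'_eq[OF * ss] d[OF ss] by (simp add: complex_eq_iff)
    obtain k where k: "k holomorphic_on (G ` B)" "\<And>z. z \<in> B \<Longrightarrow> k (G z) = z"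
      using holomorphic_has_inverse[OF *(1) open_ball inj] unfolding B_def by metis
    have openGB: "open (G ` B)" unfolding B_def by (rule open_mapping_thm3[OF *(1) open_ball inj])
    have XsB: "of_real (X s) \<in> G ` B" using Gs sb by force
    have "isCont k (of_real (X s))"
      using holomorphic_on_imp_continuous_on[OF k(1)] openGB XsB continuous_on_eq_continuous_at by blast
    then have "(k \<longlongrightarrow> k (G (of_real s))) (at (of_real (X s)) within uhp)"
      unfolding isCont_def Gs by (rule tendsto_within_subset) simp
    then have kl: "(k \<longlongrightarrow> of_real s) (at (of_real (X s)) within uhp)" by (simp only: k(2)[OF sb])
    have ev: "\<forall>\<^sub>F z in at (of_real (X s)) within uhp. h z = p + k z \<and> 1 / deriv h z = deriv G (k z)"
      unfolding eventually_at_filter using eventually_nhds_in_open[OF openGB XsB]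
    proof eventually_elim
      case (elim z)
      show ?case
      proof (intro impI)
        assume "z \<in> uhp"
        obtain \<xi> where \<xi>: "\<xi> \<in> B" "z = G \<xi>" using elim by blast
        have i: "Im \<xi> > 0" using low[of \<xi>] \<xi> \<open>z \<in> uhp\<close> by (force simp: B_def)
        have O: "p + \<xi> \<in> \<Omega>" using inO i \<xi> by (simp add: B_def)
        have z: "z = g0 \<xi>" using up i \<xi> by (simp add: B_def)
        have kz: "k z = \<xi>" using k(2) \<xi> by simp
        have "h z = p + \<xi>" using h_g[OF O] z by (simp add: g0_def)
        moreover have "1 / deriv h z = deriv G \<xi>"
        proof -
          have "open (B \<inter> uhp)" unfolding B_def by (intro open_Int open_ball open_uhp)
          then have "\<forall>\<^sub>F v in nhds \<xi>. v \<in> B \<inter> uhp" using \<xi> i by (intro eventually_nhds_in_open) auto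
          then have "\<forall>\<^sub>F v in nhds \<xi>. G v = g0 v" by eventually_elim (use up in \<open>auto simp: B_def\<close>)
          then have "deriv G \<xi> = deriv g0 \<xi>" by (intro deriv_cong_ev) auto
          then show ?thesis using DERIV_imp_deriv[OF deriv_g0[OF O]] z by simp
        qed
        ultimately show "h z = p + k z \<and> 1 / deriv h z = deriv G (k z)" using kz by simp
      qed
    qed
    have "((\<lambda>z. p + k z) \<longlongrightarrow> p + of_real s) (at (of_real (X s)) within uhp)" by (intro tendsto_intros kl)
    then have 1: "(h \<longlongrightarrow> p + of_real s) (at (of_real (X s)) within uhp)"
      by (rule Lim_transform_eventually) (use ev in eventually_elim, auto)
    have "isCont (deriv G) (of_real s)"
      using holomorphic_on_imp_continuous_on[OF holomorphic_deriv[OF *(1) open_ball]] sb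
      by (simp add: continuous_on_eq_continuous_at B_def)
    from isCont_tendsto_compose[OF this kl]
    have "((\<lambda>z. deriv G (k z)) \<longlongrightarrow> of_real (X' s)) (at (of_real (X s)) within uhp)" by (simp add: dGs)
    then have "((\<lambda>z. 1 / deriv h z) \<longlongrightarrow> of_real (X' s)) (at (of_real (X s)) within uhp)"
      by (rule Lim_transform_eventually) (use ev in eventually_elim, auto)
    with 1 show ?thesis by blast
  qed
  then show "(h \<longlongrightarrow> p + of_real s) (at (of_real (X s)) within uhp)"
    "((\<lambda>z. 1 / deriv h z) \<longlongrightarrow> of_real (X' s)) (at (of_real (X s)) within uhp)" by blast+
qed

text \<open>By injectivity of \<open>g\<close>, values taken left of the strip are not taken in it.
  The image of the points with real part below \<open>Re p + 1\<close> is open and contains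
  \<open>Complex x0 y2\<close>, so a disc is omitted. Its radius is kept below
  \<open>Im \<omega>\<close> or equal to it, which separates the disc from the values of the
  reflected map in the lower half-plane.\<close>

lemma g0_omits:
  obtains \<omega> e \<eta> where "Im \<omega> \<ge> e" "e > 0" "\<eta> > 0"
    "\<And>\<xi>. Re \<xi> \<ge> 1 \<Longrightarrow> 0 < Im \<xi> \<Longrightarrow> Im \<xi> < \<eta> \<Longrightarrow> p + \<xi> \<in> \<Omega> \<and> norm (g0 \<xi> - \<omega>) \<ge> e"
proof -
  obtain y2 where y2: "0 < y2" "Im p < Im (h (Complex x0 y2))" "Re (h (Complex x0 y2)) < Re p + 1"
    "\<And>q. Re q \<ge> Re p + 1 \<Longrightarrow> Im p < Im q \<Longrightarrow> Im q < Im (h (Complex x0 y2)) \<Longrightarrow>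
       \<exists>y\<in>{0<..y2}. \<exists>t\<in>{0..Re q - Re p}. q = h (Complex x0 y) + of_real t"
    using strip[OF zero_less_one zero_less_one] by metis
  define \<omega> where "\<omega> = Complex x0 y2"
  define W where "W = \<Omega> \<inter> {q. Re q < Re p + 1}"
  have openW: "open W" unfolding W_def by (intro open_Int open_\<Omega> open_halfspace_Re_lt)
  have "open (g ` W)"
    by (rule open_mapping_thm3[OF holomorphic_on_subset[OF holg] openW inj_on_subset[OF inj_g]]) (auto simp: W_def)
  moreover have "\<omega> \<in> g ` W"
  proof (rule image_eqI)
    show "\<omega> = g (h \<omega>)" using y2 by (simp add: g_h \<omega>_def)
    show "h \<omega> \<in> W" using y2 by (auto simp: W_def \<omega>_def intro!: h_in)
  qed
  ultimately obtain \<rho> where \<rho>: "\<rho> > 0" "ball \<omega> \<rho> \<subseteq> g ` W" unfolding open_contains_ball by blast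
  show thesis
  proof (rule that[of "min \<rho> y2" \<omega> "Im (h (Complex x0 y2)) - Im p"])
    fix \<xi> assume \<xi>: "Re \<xi> \<ge> 1" "0 < Im \<xi>" "Im \<xi> < Im (h (Complex x0 y2)) - Im p"
    then obtain y t where yt: "y > 0" "t \<ge> 0" "p + \<xi> = h (Complex x0 y) + of_real t"
      using y2(4)[of "p + \<xi>"] by auto
    then have O: "p + \<xi> \<in> \<Omega>" using w_in[of y t] by simp
    have "norm (g0 \<xi> - \<omega>) \<ge> \<rho>"
    proof (rule ccontr)
      assume "\<not> ?thesis"
      then have "g0 \<xi> \<in> ball \<omega> \<rho>" by (simp add: dist_norm norm_minus_commute)
      then obtain q where q: "q \<in> W" "g (p + \<xi>) = g q" using \<rho>(2) by (auto simp: g0_def)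
      then have "p + \<xi> = q" using inj_onD[OF inj_g q(2) O] by (simp add: W_def)
      then show False using q \<xi> by (auto simp: W_def)
    qed
    then show "p + \<xi> \<in> \<Omega> \<and> norm (g0 \<xi> - \<omega>) \<ge> min \<rho> y2" using O by simp
  qed (use \<rho> y2 in \<open>auto simp: \<omega>_def\<close>)
qed

text \<open>Reflected over the ray, the map is holomorphic in a strip of fixed width and omits a
  disc about \<open>\<omega>\<close>. Hence \<open>Q = 1 / (F - \<omega>)\<close> is bounded there,
  and Cauchy's estimate with a fixed radius bounds its derivative; multiplying back by the square of
  \<open>norm (F - \<omega>)\<close> produces the quadratic growth.\<close>

lemma X'_bound: "\<exists>C. \<forall>s>0. X' s \<le> C * (1 + (X s)\<^sup>2)"
proof -
  obtain \<omega> e \<eta> where e: "Im \<omega> \<ge> e" "e > 0" "\<eta> > 0"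
    and om: "\<And>\<xi>. Re \<xi> \<ge> 1 \<Longrightarrow> 0 < Im \<xi> \<Longrightarrow> Im \<xi> < \<eta> \<Longrightarrow> p + \<xi> \<in> \<Omega> \<and> norm (g0 \<xi> - \<omega>) \<ge> e"
    using g0_omits by metis
  define S where "S = {\<xi>. Re \<xi> > 1} \<inter> {\<xi>. Im \<xi> < \<eta>} \<inter> {\<xi>. Im \<xi> > - \<eta>}"
  have openS: "open S" unfolding S_def
    by (intro open_Int open_halfspace_Re_gt open_halfspace_Im_lt open_halfspace_Im_gt)
  define f where "f = (\<lambda>\<xi>. if Im \<xi> > 0 then g0 \<xi> else of_real (X (Re \<xi>)))"
  define F where "F = (\<lambda>z. if 0 \<le> Im z then f z else cnj (f (cnj z)))"
  have holF: "F holomorphic_on S" unfolding F_def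
  proof (rule Schwarz_reflection[OF openS])
    show "cnj ` S \<subseteq> S" by (auto simp: S_def)
    show "f holomorphic_on S \<inter> {z. 0 < Im z}"
      by (subst holomorphic_cong[of _ _ _ g0]) (auto simp: f_def S_def om intro!: holomorphic_on_subset[OF holg0])
    show "continuous_on (S \<inter> {z. 0 \<le> Im z}) f"
      unfolding continuous_on_def
    proof
      fix z assume z: "z \<in> S \<inter> {z. 0 \<le> Im z}"
      show "(f \<longlongrightarrow> f z) (at z within S \<inter> {z. 0 \<le> Im z})"
      proof (cases "Im z > 0")
        case True
        then have O: "p + z \<in> \<Omega>" using z om by (simp add: S_def)
        have "isCont g0 z" using deriv_g0[OF O] by (rule DERIV_isCont)
        moreover have "\<forall>\<^sub>F u in nhds z. g0 u = f u"
          using eventually_nhds_in_open[OF open_uhp, of z] True by (auto elim!: eventually_mono simp: f_def)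
        ultimately have "isCont f z" by (simp add: isCont_cong)
        then show ?thesis unfolding isCont_def by (rule tendsto_within_subset) simp
      next
        case False
        define s where "s = Re z"
        have zs: "z = of_real s" using z False by (simp add: complex_eq_iff s_def)
        have s: "s > 0" using z by (simp add: S_def s_def)
        show ?thesis
        proof (rule X_local[OF s])
          fix r G assume r: "0 < r"
            and up: "\<And>z. z \<in> ball (of_real s) r \<Longrightarrow> Im z > 0 \<Longrightarrow> G z = g0 z"
            and *: "G holomorphic_on ball (of_real s) r" "\<And>x. \<bar>x - s\<bar> < r \<Longrightarrow> G (of_real x) = of_real (X x)"
          have sb: "z \<in> ball (complex_of_real s) r" using r zs by simp
          have "isCont G z" using holomorphic_on_imp_continuous_on[OF *(1)] sb by (simp add: continuous_on_eq_continuous_at)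
          then have lG: "(G \<longlongrightarrow> G z) (at z within S \<inter> {z. 0 \<le> Im z})"
            unfolding isCont_def by (rule tendsto_within_subset) simp
          have Gf: "G z = f z" using *(2)[of s] r zs by (simp add: f_def)
          have "\<forall>\<^sub>F u in at z within S \<inter> {z. 0 \<le> Im z}. G u = f u"
            unfolding eventually_at_filter using eventually_nhds_in_open[OF open_ball sb]
          proof eventually_elim
            case (elim u)
            show ?case
            proof (intro impI)
              assume u: "u \<in> S \<inter> {z. 0 \<le> Im z}"
              show "G u = f u"
              proof (cases "Im u > 0")
                case True then show ?thesis using up elim by (simp add: f_def)
              next
                case False
                then have uu: "u = of_real (Re u)" using u by (simp add: complex_eq_iff)
                then have "\<bar>Re u - s\<bar> < r" using elim of_real_in_ball_iff[of "Re u" s r] by simp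
                from *(2)[OF this] show ?thesis using False uu by (simp add: f_def)
              qed
            qed
          qed
          from Lim_transform_eventually[OF lG this] show ?thesis by (simp only: Gf)
        qed
      qed
    qed
    show "f z \<in> \<real>" if "z \<in> \<real>" for z using that by (auto simp: f_def complex_is_Real_iff)
  qed
  have away: "norm (F z - \<omega>) \<ge> e" if z: "z \<in> S" for z
  proof -
    have "Im (F z) \<le> 0 \<Longrightarrow> norm (F z - \<omega>) \<ge> e" using abs_Im_le_cmod[of "F z - \<omega>"] e by simp
    moreover have "Im (F z) \<le> 0" if "Im z \<le> 0"
    proof (cases "Im z = 0")
      case True then show ?thesis by (simp add: F_def f_def)
    next
      case False
      then have "p + cnj z \<in> \<Omega>" using om[of "cnj z"] z that by (simp add: S_def)
      then show ?thesis using False that g0_uhp[of "cnj z"] by (simp add: F_def f_def)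
    qed
    moreover have "norm (F z - \<omega>) \<ge> e" if "Im z > 0" using om[of z] z that by (simp add: F_def f_def S_def)
    ultimately show ?thesis by (cases "Im z > 0") auto
  qed
  define Q where "Q = (\<lambda>z. 1 / (F z - \<omega>))"
  have nz: "F z - \<omega> \<noteq> 0" if "z \<in> S" for z using away[OF that] e by auto
  have holQ: "Q holomorphic_on S" unfolding Q_def using nz by (intro holomorphic_intros holF) auto
  have bQ: "norm (Q z) \<le> 1 / e" if "z \<in> S" for z
    using away[OF that] e by (simp add: Q_def norm_divide frac_le)
  define r0 where "r0 = min (1/2) (\<eta>/2)"
  have r0: "r0 > 0" "r0 \<le> 1/2" "r0 \<le> \<eta>/2" using e by (auto simp: r0_def)
  \<comment> \<open>The first factor is the Cauchy bound for the derivative of \<open>Q\<close>. The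
    second comes from \<open>(X s - Re \<omega>)\<^sup>2 \<le> 2 * (X s)\<^sup>2 + 2 * (Re
    \<omega>)\<^sup>2\<close>.\<close>
  define C1 where "C1 = 1 / (e * r0) * (2 + 2 * (Re \<omega>)\<^sup>2 + (Im \<omega>)\<^sup>2)"
  have main: "X' s \<le> C1 * (1 + (X s)\<^sup>2)" if s: "s \<ge> 2" for s
  proof -
    have sub: "cball (of_real s) r0 \<subseteq> S"
    proof
      fix z assume "z \<in> cball (complex_of_real s) r0"
      then have "norm (z - of_real s) \<le> r0" by (simp add: dist_norm norm_minus_commute)
      then have "\<bar>Re z - s\<bar> \<le> r0" "\<bar>Im z\<bar> \<le> r0"
        using abs_Re_le_cmod[of "z - of_real s"] abs_Im_le_cmod[of "z - of_real s"] by auto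
      then have "Re z > 1" "Im z < \<eta>" "Im z > - \<eta>" using r0 s e by linarith+
      then show "z \<in> S" by (simp add: S_def)
    qed
    have sS: "of_real s \<in> S" using sub r0 by auto
    have "norm ((deriv ^^ 1) Q (of_real s)) \<le> fact 1 * (1/e) / r0 ^ 1"
    proof (rule Cauchy_inequality)
      show "Q holomorphic_on ball (of_real s) r0" using holomorphic_on_subset[OF holQ] sub by force
      show "continuous_on (cball (of_real s) r0) Q"
        using holomorphic_on_imp_continuous_on[OF holQ] sub continuous_on_subset by blast
      show "norm (Q x) \<le> 1 / e" if "norm (of_real s - x) = r0" for x
        by (rule bQ) (use sub that in \<open>auto simp: dist_norm\<close>)
    qed (rule r0)
    then have dQ: "norm (deriv Q (of_real s)) \<le> 1 / (e * r0)" by simp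
    have dF: "(F has_field_derivative deriv F (of_real s)) (at (of_real s))"
      by (rule holomorphic_derivI[OF holF openS sS])
    have Fs: "F (of_real v) = of_real (X v)" for v by (simp add: F_def f_def)
    have "(Q has_field_derivative - deriv F (of_real s) / (F (of_real s) - \<omega>)\<^sup>2) (at (of_real s))"
      unfolding Q_def by (rule DERIV_cong, (rule derivative_intros dF)+) (use nz[OF sS] in \<open>auto simp: power2_eq_square\<close>)
    then have dQ2: "deriv Q (of_real s) = - deriv F (of_real s) / (F (of_real s) - \<omega>)\<^sup>2" by (rule DERIV_imp_deriv)
    from has_vector_derivative_real_field[OF dF]
    have "((\<lambda>v. F (of_real v)) has_vector_derivative deriv F (of_real s)) (at s)" by (simp add: o_def)
    from bounded_linear.has_vector_derivative[OF bounded_linear_Re this]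
    have "(X has_real_derivative Re (deriv F (of_real s))) (at s)"
      by (simp add: has_real_derivative_iff_has_vector_derivative Fs)
    then have "X' s = Re (deriv F (of_real s))" using X_deriv[of s] s DERIV_unique by fastforce
    then have "X' s \<le> norm (deriv F (of_real s))" using complex_Re_le_cmod by simp
    also have "\<dots> = norm (deriv Q (of_real s)) * (norm (F (of_real s) - \<omega>))\<^sup>2"
      using nz[OF sS] by (simp add: dQ2 norm_divide norm_power)
    also have "\<dots> \<le> 1 / (e * r0) * (norm (F (of_real s) - \<omega>))\<^sup>2" using dQ by (rule mult_right_mono) simp
    also have "(norm (F (of_real s) - \<omega>))\<^sup>2 = (X s - Re \<omega>)\<^sup>2 + (Im \<omega>)\<^sup>2" by (simp add: Fs cmod_power2)
    also have "1 / (e * r0) * \<dots> \<le> 1 / (e * r0) * ((2 + 2 * (Re \<omega>)\<^sup>2 + (Im \<omega>)\<^sup>2) * (1 + (X s)\<^sup>2))"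
    proof (rule mult_left_mono)
      have "(X s - Re \<omega>)\<^sup>2 \<le> 2 * (X s)\<^sup>2 + 2 * (Re \<omega>)\<^sup>2"
        using zero_le_power2[of "X s + Re \<omega>"] by (simp add: power2_eq_square algebra_simps)
      moreover have "(Im \<omega>)\<^sup>2 * (X s)\<^sup>2 \<ge> 0" "(Re \<omega>)\<^sup>2 * (X s)\<^sup>2 \<ge> 0" by auto
      moreover have "(2 + 2 * (Re \<omega>)\<^sup>2 + (Im \<omega>)\<^sup>2) * (1 + (X s)\<^sup>2) = 2 + 2 * (X s)\<^sup>2 + 2 * (Re \<omega>)\<^sup>2
          + 2 * ((Re \<omega>)\<^sup>2 * (X s)\<^sup>2) + (Im \<omega>)\<^sup>2 + (Im \<omega>)\<^sup>2 * (X s)\<^sup>2"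
        by (simp add: algebra_simps)
      ultimately show "(X s - Re \<omega>)\<^sup>2 + (Im \<omega>)\<^sup>2 \<le> (2 + 2 * (Re \<omega>)\<^sup>2 + (Im \<omega>)\<^sup>2) * (1 + (X s)\<^sup>2)"
        by linarith
    qed (use e r0 in simp)
    finally show ?thesis by (simp add: C1_def mult.assoc)
  qed
  show ?thesis
  proof (intro exI allI impI)
    fix s :: real assume s: "s > 0"
    have C1: "C1 \<ge> 0" using e r0 by (simp add: C1_def)
    have p2: "X' 2 > 0" using X_deriv[of 2] by simp
    have pos: "1 + (X s)\<^sup>2 \<ge> 1" by simp
    \<comment> \<open>The strip begins at abscissa 1, so the estimate is available from 2 on;
      earlier times are covered by the monotonicity of \<open>X'\<close>.\<close>
    show "X' s \<le> max C1 (X' 2) * (1 + (X s)\<^sup>2)"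
    proof (cases "s \<ge> 2")
      case True
      have "C1 * (1 + (X s)\<^sup>2) \<le> max C1 (X' 2) * (1 + (X s)\<^sup>2)" by (intro mult_right_mono) auto
      then show ?thesis using main[OF True] by linarith
    next
      case False
      have "X' s \<le> X' 2" using X'_mono[of s 2] s False by simp
      also have "\<dots> \<le> max C1 (X' 2) * 1" by simp
      also have "\<dots> \<le> max C1 (X' 2) * (1 + (X s)\<^sup>2)" using pos p2 by (intro mult_left_mono) auto
      finally show ?thesis .
    qed
  qed
qed

lemma X_less: "0 < s \<Longrightarrow> s < t \<Longrightarrow> X s < X t"
proof (rule DERIV_pos_imp_increasing[of s t X])
  fix x assume "0 < s" "s \<le> x"
  then show "\<exists>y. (X has_real_derivative y) (at x) \<and> 0 < y" using X_deriv[of x] by auto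
qed

lemma X_diff:
  assumes "0 < s" "s < t" obtains u where "s < u" "u < t" "X t - X s = (t - s) * X' u"
proof -
  have "\<exists>z>s. z < t \<and> X t - X s = (t - s) * X' z"
    by (rule MVT2[OF assms(2)]) (use X_deriv assms in auto)
  then show thesis using that by blast
qed

lemma cont_X: "continuous_on {0<..} X"
proof (rule continuous_at_imp_continuous_on, rule ballI)
  fix x :: real assume "x \<in> {0<..}"
  then show "isCont X x" using X_deriv[of x] DERIV_isCont by auto
qed

text \<open>Orbits that start close to \<open>x0\<close> have to pass the abscissa \<open>a\<close>
  within the arbitrarily short time \<open>T\<close>. Until then the height only grows, so it is
  bounded by the small final height, and \<open>h\<close> moves by at most \<open>T\<close>.\<close>

lemma crossing_below_limit:
  assumes x0a: "x0 < a" and aX: "\<And>s. s > 0 \<Longrightarrow> a < X s" and \<delta>: "\<delta> > 0"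
  obtains z where "Re z = a" "0 < Im z" "Im z < \<delta>" "norm (h z - p) < \<delta>" "Re (h z) > Re p"
proof -
  define T where "T = \<delta>/2"
  have T: "T > 0" using \<delta> by (simp add: T_def)
  have "\<forall>\<^sub>F y in at_right 0. dist (h (Complex x0 y)) p < T" using h_tendsto T by (rule tendstoD)
  moreover have "\<forall>\<^sub>F y in at_right 0. a < Re (w T y)"
    using tendsto_Re[OF w_tendsto[OF T]] by (rule order_tendstoD) (use aX T in simp)
  moreover have "\<forall>\<^sub>F y in at_right 0. Im (w T y) < \<delta>"
    using tendsto_Im[OF w_tendsto[OF T]] by (rule order_tendstoD) (use \<delta> in simp)
  ultimately have "\<forall>\<^sub>F y in at_right 0. dist (h (Complex x0 y)) p < T \<and> a < Re (w T y) \<and> Im (w T y) < \<delta> \<and> y > 0"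
    using eventually_at_right_less[of 0] by eventually_elim auto
  from eventually_happens'[OF trivial_limit_at_right_real this]
  obtain y where y: "dist (h (Complex x0 y)) p < T" "a < Re (w T y)" "Im (w T y) < \<delta>" "y > 0" by auto
  have "continuous_on {0..T} (\<lambda>t. Re (w t y))" by (intro continuous_intros cont_w y)
  then obtain t where t: "0 \<le> t" "t \<le> T" "Re (w t y) = a"
    using IVT'[of "\<lambda>t. Re (w t y)" 0 a T] y T x0a by (auto simp: w_0)
  show thesis
  proof (rule that[of "w t y"])
    show "Im (w t y) < \<delta>" using Im_w_mono[OF y(4) t(1,2)] y by simp
    have "h (w t y) - p = (h (Complex x0 y) - p) + of_real t" using h_w[OF y(4) t(1)] by simp
    then have "norm (h (w t y) - p) \<le> norm (h (Complex x0 y) - p) + norm (complex_of_real t)"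
      by (metis norm_triangle_ineq)
    also have "\<dots> < T + T" using y t by (simp add: dist_norm)
    finally show "norm (h (w t y) - p) < \<delta>" by (simp add: T_def)
    show "Re (h (w t y)) > Re p" using h_w[OF y(4) t(1)] Re_p[OF y(4)] t by simp
  qed (use t w_uhp y in auto)
qed

text \<open>Otherwise \<open>h\<close> would have the constant boundary value \<open>p\<close> on an interval.\<close>

lemma not_X_above:
  assumes x1: "x0 < x1" and aX: "\<And>s. s > 0 \<Longrightarrow> x1 \<le> X s" shows False
proof -
  define a where "a = (x0 + x1)/2"
  define R where "R = (x1 - x0)/2"
  have R: "R > 0" using x1 by (simp add: R_def)
  have between: "x0 < x \<and> x < x1" if "\<bar>x - a\<bar> < R" for x using that by (auto simp: a_def R_def abs_less_iff field_simps)
  have cross: "\<exists>z. Re z = x \<and> 0 < Im z \<and> Im z < \<delta> \<and> norm (h z - p) < \<delta> \<and> Re (h z) > Re p"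
    if x: "\<bar>x - a\<bar> < R" and \<delta>: "\<delta> > 0" for x \<delta>
  proof -
    have "x < X s" if "s > 0" for s using aX[OF that] between[OF x] by simp
    from crossing_below_limit[OF conjunct1[OF between[OF x]] this \<delta>] show ?thesis by blast
  qed
  \<comment> \<open>\<open>Im f\<close> is \<open>Re h - Re p\<close>. The crossing points, together
    with the monotonicity of \<open>Re h\<close> along vertical lines, show that it is positive and
    tends to 0 at the interval.\<close>
  define f where "f = (\<lambda>z. \<i> * (h z - p))"
  show False
  proof (rule Schwarz_reflection_Im[OF R, of f a])
    show "f holomorphic_on {z. dist z (of_real a) < R \<and> 0 < Im z}"
      unfolding f_def by (intro holomorphic_intros holomorphic_on_subset[OF holh]) auto
    show "0 < Im (f z)" if "z \<in> {z. dist z (of_real a) < R \<and> 0 < Im z}" for z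
    proof -
      have "\<bar>Re z - a\<bar> < R" using that abs_Re_le_cmod[of "z - of_real a"] by (simp add: dist_norm)
      moreover have "Im z > 0" using that by simp
      ultimately obtain z' where z': "Re z' = Re z" "0 < Im z'" "Im z' < Im z" "Re (h z') > Re p"
        using cross[of "Re z" "Im z"] by blast
      have "Re (h (Complex (Re z) (Im z'))) < Re (h (Complex (Re z) (Im z)))" by (rule Re_h_less[OF z'(2,3)])
      moreover have "Complex (Re z) (Im z') = z'" using z'(1) by (simp add: complex_eq_iff)
      ultimately have "Re (h z') < Re (h z)" by (simp only: complex_surj)
      then show ?thesis using z' by (simp add: f_def)
    qed
    show "inj_on f {z. dist z (of_real a) < R \<and> 0 < Im z}"
    proof (rule inj_onI)
      fix u v assume "u \<in> {z. dist z (of_real a) < R \<and> 0 < Im z}" "v \<in> {z. dist z (of_real a) < R \<and> 0 < Im z}" "f u = f v"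
      then show "u = v" using inj_onD[OF inj_h, of u v] by (simp add: f_def)
    qed
    show "((\<lambda>z. Im (f z)) \<longlongrightarrow> 0) (at (of_real x) within uhp)" if x: "\<bar>x - a\<bar> < R" for x
      unfolding tendsto_iff
    proof (intro allI impI)
      fix e :: real assume e: "e > 0"
      obtain z' where z': "Re z' = x" "0 < Im z'" "norm (h z' - p) < e" using cross[OF x e] by blast
      define v where "v = Im z'"
      have zz: "z' = Complex x v" using z' by (simp add: complex_eq_iff v_def)
      have v: "v > 0" "Re (h (Complex x v)) < Re p + e"
        using z' complex_Re_le_cmod[of "h z' - p"] by (auto simp: zz)
      have "isCont (\<lambda>s. Re (h (Complex s v))) x"
        by (intro isCont_Re isCont_o2[OF _ isCont_h]) (use v in \<open>auto simp: Complex_eq\<close>)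
      then have "((\<lambda>s. Re (h (Complex s v))) \<longlongrightarrow> Re (h (Complex x v))) (at x)" by (simp add: isCont_def)
      then have "\<forall>\<^sub>F s in at x. Re (h (Complex s v)) < Re p + e" using v(2) by (rule order_tendstoD)
      then obtain d where d: "d > 0" "\<And>s. s \<noteq> x \<Longrightarrow> dist s x < d \<Longrightarrow> Re (h (Complex s v)) < Re p + e"
        unfolding eventually_at by auto
      then have d': "Re (h (Complex s v)) < Re p + e" if "dist s x < d" for s using that v by (cases "s = x") auto
      define d1 where "d1 = min (min d v) (R - \<bar>x - a\<bar>)"
      have d1: "d1 > 0" "d1 \<le> d" "d1 \<le> v" "d1 \<le> R - \<bar>x - a\<bar>" using d v x by (auto simp: d1_def)
      have "\<bar>Im (f z)\<bar> < e" if z: "Im z > 0" "dist z (of_real x) < d1" for z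
      proof -
        have n: "\<bar>Re z - x\<bar> < d1" "\<bar>Im z\<bar> < d1"
          using abs_Re_le_cmod[of "z - of_real x"] abs_Im_le_cmod[of "z - of_real x"] z by (auto simp: dist_norm)
        have "Re (h (Complex (Re z) (Im z))) < Re p + e"
          using Re_h_less[of "Im z" v "Re z"] d'[of "Re z"] z n d1 by (auto simp: dist_real_def)
        then have up: "Re (h z) < Re p + e" by simp
        have "\<bar>Re z - a\<bar> < R" using n d1 by linarith
        then obtain z2 where z2: "Re z2 = Re z" "0 < Im z2" "Im z2 < Im z" "Re (h z2) > Re p"
          using cross[of "Re z" "Im z"] z by blast
        have "Re (h (Complex (Re z) (Im z2))) < Re (h (Complex (Re z) (Im z)))" by (rule Re_h_less[OF z2(2,3)])
        moreover have "Complex (Re z) (Im z2) = z2" using z2(1) by (simp add: complex_eq_iff)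
      ultimately have "Re (h z2) < Re (h z)" by (simp only: complex_surj)
        then show ?thesis using z2 up by (simp add: f_def)
      qed
      then show "\<forall>\<^sub>F z in at (of_real x) within uhp. dist (Im (f z)) 0 < e"
        unfolding eventually_at using d1 by (intro exI[of _ d1]) auto
    qed
  next
    fix r F assume r: "0 < r" "r \<le> R" and holF: "F holomorphic_on ball (of_real a) r"
      and up: "\<And>z. z \<in> ball (of_real a) r \<Longrightarrow> 0 < Im z \<Longrightarrow> F z = f z"
      and injF: "inj_on F (ball (of_real a) r)"
    have zero: "F (of_real x) = 0" if x: "\<bar>x - a\<bar> < r" for x
    proof (rule ccontr)
      assume nz: "F (of_real x) \<noteq> 0"
      define e where "e = norm (F (of_real x)) / 2"
      have e: "e > 0" using nz by (simp add: e_def)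
      have xb: "of_real x \<in> ball (complex_of_real a) r" using x by (simp only: of_real_in_ball_iff)
      have "isCont F (of_real x)" using holomorphic_on_imp_continuous_on[OF holF] xb by (simp add: continuous_on_eq_continuous_at)
      then obtain d where d: "d > 0" "\<And>z. dist z (of_real x) < d \<Longrightarrow> dist (F z) (F (of_real x)) < e"
        using e unfolding continuous_at_eps_delta by blast
      define \<delta> where "\<delta> = min (min d e) (r - \<bar>x - a\<bar>)"
      have \<delta>: "\<delta> > 0" "\<delta> \<le> d" "\<delta> \<le> e" "\<delta> \<le> r - \<bar>x - a\<bar>" using d e x by (auto simp: \<delta>_def)
      obtain z where z: "Re z = x" "0 < Im z" "Im z < \<delta>" "norm (h z - p) < \<delta>" using cross[of x \<delta>] x r \<delta> by auto
      have "z - of_real x = \<i> * of_real (Im z)" using z by (simp add: complex_eq_iff)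
      then have n: "norm (z - of_real x) = Im z" using z by (simp add: norm_mult)
      have "norm (z - of_real a) \<le> norm (z - of_real x) + norm (complex_of_real (x - a))"
        using norm_triangle_ineq[of "z - of_real x" "of_real x - of_real a"] by simp
      then have "norm (z - of_real a) < r" using n z \<delta> by (simp only: norm_of_real)
      then have "F z = f z" using up z by (simp add: dist_norm norm_minus_commute)
      then have "norm (F z) < e" using z \<delta> by (simp add: f_def norm_mult)
      moreover have "dist (F z) (F (of_real x)) < e" by (rule d(2)) (use n z \<delta> in \<open>simp add: dist_norm\<close>)
      ultimately have "norm (F (of_real x)) < e + e"
        using norm_triangle_ineq2[of "F (of_real x)" "F z"] by (simp add: dist_norm norm_minus_commute)
      then show False by (simp add: e_def)
    qed
    have eq: "F (of_real a) = F (of_real (a + r/2))" using zero[of a] zero[of "a + r/2"] r by simp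
    have "complex_of_real a = of_real (a + r/2)"
    proof (rule inj_onD[OF injF eq])
      show "of_real a \<in> ball (complex_of_real a) r" "of_real (a + r/2) \<in> ball (complex_of_real a) r"
        unfolding of_real_in_ball_iff using r by auto
    qed
    then show False using r by (simp only: of_real_eq_iff)
  qed
qed

text \<open>Monotonicity of \<open>X\<close> and of its speed gives a limit. It is not to the right
  of \<open>x0\<close> by \<open>not_X_above\<close>. If it were to the left, \<open>X\<close> would
  pass \<open>x0\<close> at some time \<open>s > 0\<close>; there \<open>h\<close> has the boundary
  value \<open>p + of_real s\<close>, while along the vertical line it tends to
  \<open>p\<close>.\<close>

lemma X_tendsto_x0: "(X \<longlongrightarrow> x0) (at_right 0)"
proof -
  have lb: "X s \<ge> X 1 - X' 1" if s: "s > 0" for s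
  proof (cases "s < 1")
    case True
    obtain u where u: "s < u" "u < 1" "X 1 - X s = (1 - s) * X' u" using X_diff[OF s True] by blast
    have "(1 - s) * X' u \<le> 1 * X' 1"
      using X'_mono[of u 1] X_deriv[of 1] X_deriv[of u] u s by (intro mult_mono) auto
    then show ?thesis using u by simp
  next
    case False
    then have "X 1 \<le> X s" using X_less[of 1 s] by (cases "s = 1") auto
    then show ?thesis using X_deriv[of 1] by simp
  qed
  define A where "A = X ` {0<..}"
  have bd: "bdd_below A" unfolding A_def using lb by (auto intro!: bdd_belowI)
  have ne: "A \<noteq> {}" by (auto simp: A_def)
  define xs where "xs = Inf A"
  have le: "xs \<le> X s" if "s > 0" for s unfolding xs_def by (rule cInf_lower[OF _ bd]) (use that in \<open>auto simp: A_def\<close>)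
  have lim: "(X \<longlongrightarrow> xs) (at_right 0)"
  proof (rule order_tendstoI)
    fix a assume "a < xs"
    show "\<forall>\<^sub>F s in at_right 0. a < X s"
      using eventually_at_right_less[of 0] by eventually_elim (use le \<open>a < xs\<close> in force)
  next
    fix a assume "xs < a"
    then obtain s1 where s1: "s1 > 0" "X s1 < a"
      using cInf_less_iff[OF ne bd, of a] unfolding xs_def[symmetric] by (auto simp: A_def)
    show "\<forall>\<^sub>F s in at_right 0. X s < a"
      using eventually_at_right_real[OF s1(1)] by eventually_elim (use X_less[of _ s1] s1 in force)
  qed
  have "\<not> x0 < xs" using not_X_above[of xs] le by blast
  moreover have "\<not> xs < x0"
  proof
    assume lt: "xs < x0"
    from eventually_happens'[OF trivial_limit_at_right_real eventually_conj[OF order_tendstoD(2)[OF lim lt] eventually_at_right_real[OF zero_less_one]]]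
    obtain s1 where s1: "X s1 < x0" "0 < s1" "s1 < 1" by auto
    \<comment> \<open>After time 1 the speed is at least \<open>X' 1\<close>, so the curve has
      reached \<open>x0\<close> by this time.\<close>
    define s2 where "s2 = 2 + \<bar>x0 - X 1\<bar> / X' 1"
    have X'1: "X' 1 > 0" using X_deriv[of 1] by simp
    have s2: "s2 > 1" using X'1 by (simp add: s2_def add_pos_nonneg)
    obtain u where u: "1 < u" "u < s2" "X s2 - X 1 = (s2 - 1) * X' u" using X_diff[OF zero_less_one s2] by blast
    have "\<bar>x0 - X 1\<bar> \<le> (s2 - 1) * X' 1" using X'1 by (simp add: s2_def field_simps)
    also have "\<dots> \<le> (s2 - 1) * X' u" using X'_mono[of 1 u] u s2 by (intro mult_left_mono) auto
    finally have "x0 \<le> X s2" using u by linarith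
    then obtain s where s: "s1 \<le> s" "X s = x0"
      using IVT'[of X s1 x0 s2] s1 s2 continuous_on_subset[OF cont_X, of "{s1..s2}"] by force
    have s0: "s > 0" using s s1 by simp
    have "((\<lambda>y. h (Complex x0 y)) \<longlongrightarrow> p + of_real s) (at_right 0)"
    proof (rule filterlim_compose[OF h_tendsto_X(1)[OF s0]])
      show "filterlim (\<lambda>y. Complex x0 y) (at (of_real (X s)) within uhp) (at_right 0)"
        unfolding filterlim_at s(2) using tendsto_Complex_right eventually_at_right_less[of 0]
        by (auto elim!: eventually_mono simp: complex_eq_iff)
    qed
    then have "p = p + of_real s" using tendsto_unique[OF trivial_limit_at_right_real h_tendsto] by blast
    then show False using s0 by simp
  qed
  ultimately have "xs = x0" by simp
  then show ?thesis using lim by simp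
qed

end

text \<open>What is needed of the boundary trajectory, expressed by the flow and its generator
  \<open>G\<close> alone. The sign \<open>\<sigma>\<close> is the direction of travel and
  \<open>\<sigma> * X' s\<close> the speed. Time 0 has its own clause because the curve arises from
  limits at positive times. The clause on \<open>G\<close> makes the speed a function of the
  position; the last clause bounds the speed in the metric \<open>dx / (1 + x^2)\<close> of the
  circle.\<close>

definition boundary_curve ::
  "(complex \<Rightarrow> complex) \<Rightarrow> (real \<Rightarrow> complex \<Rightarrow> complex) \<Rightarrow> real \<Rightarrow> (real \<Rightarrow> real) \<Rightarrow> (real \<Rightarrow> real) \<Rightarrow> real \<Rightarrow> bool" where
  "boundary_curve G F x0 X X' \<sigma> \<longleftrightarrow> \<sigma> \<in> {-1, 1} \<and> X 0 = x0 \<and> (X \<longlongrightarrow> x0) (at_right 0) \<and>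
     (\<forall>s\<ge>0. ((\<lambda>y. F s (Complex x0 y)) \<longlongrightarrow> of_real (X s)) (at_right 0)) \<and>
     (\<forall>s>0. (X has_real_derivative X' s) (at s) \<and> \<sigma> * X' s > 0) \<and>
     (\<forall>s t. 0 < s \<longrightarrow> s \<le> t \<longrightarrow> \<sigma> * X' s \<le> \<sigma> * X' t) \<and>
     (\<forall>s>0. (G \<longlongrightarrow> of_real (X' s)) (at (of_real (X s)) within uhp)) \<and>
     (\<exists>C. \<forall>s>0. \<bar>X' s\<bar> \<le> C * (1 + (X s)\<^sup>2))"

lemma boundary_curve_cong:
  assumes "boundary_curve G F x0 X X' \<sigma>"
    and "\<And>z. Im z > 0 \<Longrightarrow> G' z = G z" and "\<And>s y. s \<ge> 0 \<Longrightarrow> y > 0 \<Longrightarrow> F' s (Complex x0 y) = F s (Complex x0 y)"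
  shows "boundary_curve G' F' x0 X X' \<sigma>"
proof -
  have "((\<lambda>y. F' s (Complex x0 y)) \<longlongrightarrow> of_real (X s)) (at_right 0)" if s: "s \<ge> 0" for s
  proof (rule Lim_transform_eventually)
    show "((\<lambda>y. F s (Complex x0 y)) \<longlongrightarrow> of_real (X s)) (at_right 0)"
      using assms(1) s by (simp add: boundary_curve_def)
    show "\<forall>\<^sub>F y in at_right 0. F s (Complex x0 y) = F' s (Complex x0 y)"
      using eventually_at_right_less[of 0] by eventually_elim (use assms(3) s in auto)
  qed
  moreover have "(G' \<longlongrightarrow> of_real (X' s)) (at (of_real (X s)) within uhp)" if s: "s > 0" for s
  proof (rule Lim_transform_eventually)
    show "(G \<longlongrightarrow> of_real (X' s)) (at (of_real (X s)) within uhp)"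
      using assms(1) s by (simp add: boundary_curve_def)
    show "\<forall>\<^sub>F z in at (of_real (X s)) within uhp. G z = G' z"
      using assms(2) by (auto simp: eventually_at_filter)
  qed
  ultimately show ?thesis using assms(1) unfolding boundary_curve_def by simp
qed

lemma boundary_curve_reflect:
  assumes bc: "boundary_curve (\<lambda>z. - cnj (G (- cnj z))) (\<lambda>t z. - cnj (F t (- cnj z))) (- x0) X X' \<sigma>"
  shows "boundary_curve G F x0 (\<lambda>s. - X s) (\<lambda>s. - X' s) (- \<sigma>)"
proof -
  have X0: "X 0 = - x0" and Xl: "(X \<longlongrightarrow> - x0) (at_right 0)" and \<sigma>: "\<sigma> \<in> {-1, 1}"
    and Fl: "\<And>s. s \<ge> 0 \<Longrightarrow> ((\<lambda>y. - cnj (F s (- cnj (Complex (- x0) y)))) \<longlongrightarrow> of_real (X s)) (at_right 0)"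
    and d: "\<And>s. s > 0 \<Longrightarrow> (X has_real_derivative X' s) (at s) \<and> \<sigma> * X' s > 0"
    and m: "\<And>s t. 0 < s \<Longrightarrow> s \<le> t \<Longrightarrow> \<sigma> * X' s \<le> \<sigma> * X' t"
    and Gl: "\<And>s. s > 0 \<Longrightarrow> ((\<lambda>z. - cnj (G (- cnj z))) \<longlongrightarrow> of_real (X' s)) (at (of_real (X s)) within uhp)"
    and C: "\<exists>C. \<forall>s>0. \<bar>X' s\<bar> \<le> C * (1 + (X s)\<^sup>2)"
    using bc unfolding boundary_curve_def by auto
  have "((\<lambda>y. F s (Complex x0 y)) \<longlongrightarrow> of_real (- X s)) (at_right 0)" if "s \<ge> 0" for s
  proof -
    have "- cnj (Complex (- x0) y) = Complex x0 y" for y by (simp add: complex_eq_iff)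
    then have "((\<lambda>y. - cnj (- cnj (F s (Complex x0 y)))) \<longlongrightarrow> - cnj (of_real (X s))) (at_right 0)"
      using Fl[OF that] by (intro tendsto_intros) simp
    then show ?thesis by simp
  qed
  moreover have "(G \<longlongrightarrow> of_real (- X' s)) (at (of_real (- X s)) within uhp)" if "s > 0" for s
  proof -
    have 1: "filterlim (\<lambda>z. - cnj z) (at (of_real (X s)) within uhp) (at (of_real (- X s)) within uhp)"
      unfolding filterlim_at
    proof
      have "((\<lambda>z. - cnj z) \<longlongrightarrow> - cnj (of_real (- X s))) (at (of_real (- X s)) within uhp)"
        by (intro tendsto_intros)
      then show "((\<lambda>z. - cnj z) \<longlongrightarrow> of_real (X s)) (at (of_real (- X s)) within uhp)" by simp
      show "\<forall>\<^sub>F z in at (of_real (- X s)) within uhp. - cnj z \<in> uhp \<and> - cnj z \<noteq> of_real (X s)"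
        unfolding eventually_at_filter by (auto intro!: always_eventually simp: complex_eq_iff)
    qed
    have "((\<lambda>z. - cnj (- cnj (G (- cnj (- cnj z))))) \<longlongrightarrow> - cnj (of_real (X' s))) (at (of_real (- X s)) within uhp)"
      by (intro tendsto_intros filterlim_compose[OF Gl[OF that] 1])
    then show ?thesis by simp
  qed
  moreover have "((\<lambda>s. - X s) has_real_derivative - X' s) (at s) \<and> - \<sigma> * - X' s > 0" if "s > 0" for s
    using d[OF that] by (auto intro!: derivative_intros)
  moreover have "((\<lambda>s. - X s) \<longlongrightarrow> x0) (at_right 0)" using tendsto_minus[OF Xl] by simp
  ultimately show ?thesis unfolding boundary_curve_def using \<sigma> X0 m C by auto
qed

context half_plane_upper_orbit begin

lemma upper_boundary_curve:
  "boundary_curve (\<lambda>z. 1 / deriv h z) (\<lambda>t z. g (h z + of_real t)) x0 (\<lambda>s. if s = 0 then x0 else X s) X' 1"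
proof -
  define Y where "Y = (\<lambda>s. if s = 0 then x0 else X s)"
  have "(Y \<longlongrightarrow> x0) (at_right 0)"
  proof (rule Lim_transform_eventually[OF X_tendsto_x0])
    show "\<forall>\<^sub>F s in at_right 0. X s = Y s"
      using eventually_at_right_less[of 0] by eventually_elim (simp add: Y_def)
  qed
  moreover have "((\<lambda>y. g (h (Complex x0 y) + of_real s)) \<longlongrightarrow> of_real (Y s)) (at_right 0)" if "s \<ge> 0" for s
  proof (cases "s = 0")
    case True
    have "\<forall>\<^sub>F y in at_right 0. Complex x0 y = g (h (Complex x0 y) + of_real s)"
      using eventually_at_right_less[of 0] by eventually_elim (simp add: True g_h)
    from Lim_transform_eventually[OF tendsto_Complex_right this] show ?thesis by (simp add: Y_def True)
  next
    case False
    then show ?thesis using w_tendsto[of s] that by (simp add: w_def Y_def)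
  qed
  moreover have "(Y has_real_derivative X' s) (at s) \<and> 1 * X' s > 0" if s: "s > 0" for s
  proof -
    have "\<forall>\<^sub>F v in nhds s. v \<in> {0<..}" by (rule eventually_nhds_in_open) (use s in auto)
    then have ev: "\<forall>\<^sub>F v in nhds s. X v = Y v" by eventually_elim (simp add: Y_def)
    show ?thesis using X_deriv[OF s] iffD1[OF DERIV_cong_ev[OF refl ev refl]] by simp
  qed
  moreover have "((\<lambda>z. 1 / deriv h z) \<longlongrightarrow> of_real (X' s)) (at (of_real (Y s)) within uhp)" if s: "s > 0" for s
    using h_tendsto_X(2)[OF s] s by (simp add: Y_def)
  moreover have "\<exists>C. \<forall>s>0. \<bar>X' s\<bar> \<le> C * (1 + (Y s)\<^sup>2)"
    using X'_bound X_deriv by (auto simp: Y_def abs_of_pos)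
  ultimately show ?thesis unfolding boundary_curve_def Y_def[symmetric] using X'_mono
    by (simp add: Y_def)
qed

end

context half_plane_koenigs begin

text \<open>The map \<open>- cnj z\<close> of the half-plane, combined with \<open>cnj\<close> in
  the Koenigs coordinate, respects real translations and exchanges approach to \<open>p\<close> from
  above with approach from below.\<close>

lemma reflect: "half_plane_koenigs (\<lambda>z. cnj (h (- cnj z)))"
  and deriv_reflect: "Im z > 0 \<Longrightarrow> deriv (\<lambda>z. cnj (h (- cnj z))) z = - cnj (deriv h (- cnj z))"
proof -
  have D: "((\<lambda>z. cnj (h (- cnj z))) has_field_derivative - cnj (deriv h (- cnj z))) (at z)" if z: "Im z > 0" for z
  proof -
    have "(h has_field_derivative deriv h (- cnj z)) (at (- cnj z))"
      by (rule holomorphic_derivI[OF holh open_uhp]) (use z in simp)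
    then have "((\<lambda>z. h (- z)) has_field_derivative deriv h (- cnj z) * (- 1)) (at (cnj z))"
      by (intro DERIV_chain2[where f=h and g=uminus]) (auto intro!: derivative_eq_intros)
    from has_field_derivative_cnj_cnj[OF this] show ?thesis by (simp add: o_def)
  qed
  show deriv: "deriv (\<lambda>z. cnj (h (- cnj z))) z = - cnj (deriv h (- cnj z))" if "Im z > 0" for z
    by (rule DERIV_imp_deriv[OF D[OF that]])
  have im: "q \<in> (\<lambda>z. cnj (h (- cnj z))) ` uhp \<longleftrightarrow> cnj q \<in> h ` uhp" for q
  proof
    assume "q \<in> (\<lambda>z. cnj (h (- cnj z))) ` uhp"
    then obtain z where "Im z > 0" "q = cnj (h (- cnj z))" by auto
    then show "cnj q \<in> h ` uhp" by (intro image_eqI[of _ _ "- cnj z"]) auto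
  next
    assume "cnj q \<in> h ` uhp"
    then obtain z where "Im z > 0" "cnj q = h z" by auto
    then show "q \<in> (\<lambda>z. cnj (h (- cnj z))) ` uhp" by (intro image_eqI[of _ _ "- cnj z"]) (auto simp: complex_eq_iff)
  qed
  show "half_plane_koenigs (\<lambda>z. cnj (h (- cnj z)))"
  proof
    show "(\<lambda>z. cnj (h (- cnj z))) holomorphic_on uhp"
      using D unfolding holomorphic_on_open[OF open_uhp] by auto
    show "Im (deriv (\<lambda>z. cnj (h (- cnj z))) z) < 0" if "Im z > 0" for z
      unfolding deriv[OF that] using Im_deriv[of "- cnj z"] that by simp
    show "q + of_real t \<in> (\<lambda>z. cnj (h (- cnj z))) ` uhp" if "q \<in> (\<lambda>z. cnj (h (- cnj z))) ` uhp" "0 \<le> t" for q t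
      using shift[of "cnj q" t] that unfolding im by simp
  qed
qed

end

context half_plane_boundary_orbit begin

theorem ex_boundary_curve: "\<exists>X X' \<sigma>. boundary_curve (\<lambda>z. 1 / deriv h z) (\<lambda>t z. g (h z + of_real t)) x0 X X' \<sigma>"
proof (rule h_limit)
  fix p assume lim: "((\<lambda>y. h (Complex x0 y)) \<longlongrightarrow> p) (at_right 0)"
    and Re: "\<And>y. y > 0 \<Longrightarrow> Re p < Re (h (Complex x0 y))"
    and side: "(\<forall>\<^sub>F y in at_right 0. Im (h (Complex x0 y)) < Im p) \<or> (\<forall>\<^sub>F y in at_right 0. Im (h (Complex x0 y)) > Im p)"
  show ?thesis
  proof (cases "\<forall>\<^sub>F y in at_right 0. Im (h (Complex x0 y)) > Im p")
    case True
    interpret half_plane_upper_orbit h x0 p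
      by unfold_locales (use lim Re True in auto)
    show ?thesis using upper_boundary_curve by blast
  next
    case False
    then have neg: "\<forall>\<^sub>F y in at_right 0. Im (h (Complex x0 y)) < Im p" using side by blast
    define h2 where "h2 = (\<lambda>z. cnj (h (- cnj z)))"
    interpret R: half_plane_koenigs h2 "- x0" unfolding h2_def by (rule reflect)
    have C: "- cnj (Complex (- x0) y) = Complex x0 y" for y by (simp add: complex_eq_iff)
    have h2C: "h2 (Complex (- x0) y) = cnj (h (Complex x0 y))" for y by (simp only: h2_def C)
    have g2: "R.g (h2 z + of_real t) = - cnj (g (h (- cnj z) + of_real t))" if z: "Im z > 0" and t: "t \<ge> 0" for z t
    proof -
      define u where "u = g (h (- cnj z) + of_real t)"
      have O: "h (- cnj z) + of_real t \<in> \<Omega>" using z t by (intro shift_\<Omega> h_in) auto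
      have u: "Im u > 0" "h u = h (- cnj z) + of_real t" using g_uhp[OF O] h_g[OF O] by (auto simp: u_def)
      have "h2 (- cnj u) = cnj (h u)" by (simp add: h2_def)
      then have "h2 z + of_real t = h2 (- cnj u)" using u by (simp add: h2_def)
      then show ?thesis using R.g_h[of "- cnj u"] u by (simp add: u_def)
    qed
    have w2: "R.w t y = - cnj (w t y)" if "t \<ge> 0" "y > 0" for t y
      using g2[of "Complex (- x0) y" t] that unfolding R.w_def w_def C by simp
    interpret R: half_plane_upper_orbit h2 "- x0" "cnj p"
    proof
      show "\<forall>\<^sub>F y in at_right 0. R.w t y \<notin> K" if K: "compact K" "K \<subseteq> uhp" and t: "0 \<le> t" for K t
      proof -
        define K' where "K' = (\<lambda>z. - cnj z) ` K"
        have "compact K'" unfolding K'_def by (intro compact_continuous_image continuous_intros K)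
        moreover have "K' \<subseteq> uhp" using K by (auto simp: K'_def)
        ultimately have "\<forall>\<^sub>F y in at_right 0. w t y \<notin> K'" using t by (rule leaves)
        then show ?thesis using eventually_at_right_less[of 0]
        proof eventually_elim
          case (elim y)
          show ?case
          proof
            assume "R.w t y \<in> K"
            then have "w t y \<in> K'" unfolding K'_def using w2[OF t, of y] elim by (intro image_eqI[of _ _ "R.w t y"]) auto
            then show False using elim by simp
          qed
        qed
      qed
      obtain t where t: "t \<ge> 0" "\<not> ((\<lambda>y. w t y) \<longlongrightarrow> of_real x0) (at_right 0)" using nonfixed by blast
      have "\<not> ((\<lambda>y. R.w t y) \<longlongrightarrow> of_real (- x0)) (at_right 0)"
      proof
        assume "((\<lambda>y. R.w t y) \<longlongrightarrow> of_real (- x0)) (at_right 0)"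
        then have "((\<lambda>y. - cnj (R.w t y)) \<longlongrightarrow> - cnj (of_real (- x0))) (at_right 0)" by (intro tendsto_intros)
        then have "((\<lambda>y. w t y) \<longlongrightarrow> - cnj (of_real (- x0))) (at_right 0)"
        proof (rule Lim_transform_eventually)
          show "\<forall>\<^sub>F y in at_right 0. - cnj (R.w t y) = w t y"
            using eventually_at_right_less[of 0] by eventually_elim (simp add: w2 t)
        qed
        then show False using t by simp
      qed
      then show "\<exists>t\<ge>0. \<not> ((\<lambda>y. R.w t y) \<longlongrightarrow> of_real (- x0)) (at_right 0)" using t by blast
      show "((\<lambda>y. h2 (Complex (- x0) y)) \<longlongrightarrow> cnj p) (at_right 0)" unfolding h2C by (intro tendsto_intros lim)
    qed (use Re neg in \<open>auto simp: h2C\<close>)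
    have "boundary_curve (\<lambda>z. - cnj (1 / deriv h (- cnj z))) (\<lambda>t z. - cnj (g (h (- cnj z) + of_real t))) (- x0)
        (\<lambda>s. if s = 0 then - x0 else R.X s) R.X' 1"
    proof (rule boundary_curve_cong[OF R.upper_boundary_curve])
      show "- cnj (1 / deriv h (- cnj z)) = 1 / deriv h2 z" if "Im z > 0" for z
        using deriv_reflect[OF that] by (simp add: h2_def)
      show "- cnj (g (h (- cnj (Complex (- x0) y)) + of_real s)) = R.g (h2 (Complex (- x0) y) + of_real s)"
        if "0 \<le> s" "0 < y" for s y using g2[of "Complex (- x0) y" s] that by simp
    qed
    from boundary_curve_reflect[OF this] show ?thesis by blast
  qed
qed

end

text \<open>The Koenigs function is built here from the generator, so that a flow lifted from a
  punctured disc is treated like any other. A zero of \<open>Im G\<close> would be a minimum; by the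
  open mapping theorem \<open>G\<close> is then a real constant, the flow is a translation and the
  curve is explicit.\<close>

theorem half_plane_flow_boundary_curve:
  fixes F :: "real \<Rightarrow> complex \<Rightarrow> complex"
  assumes holG: "G holomorphic_on uhp"
    and F0: "\<And>z. Im z > 0 \<Longrightarrow> F 0 z = z"
    and FI: "\<And>t z. t \<ge> 0 \<Longrightarrow> Im z > 0 \<Longrightarrow> Im (F t z) \<ge> Im z"
    and FD: "\<And>t z. t \<ge> 0 \<Longrightarrow> Im z > 0 \<Longrightarrow> ((\<lambda>t. F t z) has_vector_derivative G (F t z)) (at t within {0..})"
    and leaves: "\<And>K t. compact K \<Longrightarrow> K \<subseteq> uhp \<Longrightarrow> t \<ge> 0 \<Longrightarrow> \<forall>\<^sub>F y in at_right 0. F t (Complex x0 y) \<notin> K"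
    and nonfixed: "\<exists>t\<ge>0. \<not> ((\<lambda>y. F t (Complex x0 y)) \<longlongrightarrow> of_real x0) (at_right 0)"
  shows "\<exists>X X' \<sigma>. boundary_curve G F x0 X X' \<sigma>"
proof -
  have ImG: "Im (G z) \<ge> 0" if z: "Im z > 0" for z
  proof -
    have "((\<lambda>t. F t z) has_vector_derivative G z) (at 0 within {0..})" using FD[of 0 z] z F0 by simp
    then have "((\<lambda>t. Im (F t z)) has_vector_derivative Im (G z)) (at 0 within {0..})"
      by (rule bounded_linear.has_vector_derivative[OF bounded_linear_Im])
    then have "((\<lambda>t. (Im (F t z) - Im (F 0 z)) / (t - 0)) \<longlongrightarrow> Im (G z)) (at 0 within {0..})"
      by (simp add: has_real_derivative_iff_has_vector_derivative[symmetric] has_field_derivative_iff)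
    moreover have "\<forall>\<^sub>F t in at 0 within {0..}. (Im (F t z) - Im (F 0 z)) / (t - 0) \<ge> 0"
      unfolding eventually_at_filter using FI z F0 by (auto intro!: always_eventually)
    moreover have "at (0::real) within {0..} \<noteq> bot" using trivial_limit_at_right_real[of 0] by (simp add: at_within_Ici_at_right)
    ultimately show ?thesis by (rule tendsto_lowerbound)
  qed
  show ?thesis
  proof (cases "\<exists>z. Im z > 0 \<and> Im (G z) = 0")
    case True
    then obtain z0 where z0: "Im z0 > 0" "Im (G z0) = 0" by blast
    have "G constant_on uhp"
    proof (rule ccontr)
      assume "\<not> G constant_on uhp"
      then have "open (G ` uhp)"
        by (intro open_mapping_thm[OF holG open_uhp convex_connected[OF convex_uhp] open_uhp]) auto
      moreover have "G z0 \<in> G ` uhp" using z0 by auto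
      ultimately obtain e where e: "e > 0" "ball (G z0) e \<subseteq> G ` uhp" unfolding open_contains_ball by blast
      define u where "u = G z0 - \<i> * of_real (e/2)"
      have "norm (G z0 - u) = e/2" using e by (simp add: u_def norm_mult norm_divide)
      then have "u \<in> ball (G z0) e" using e by (simp add: dist_norm)
      then have "u \<in> G ` uhp" using e(2) by blast
      then obtain z where "Im z > 0" "G z = u" by auto
      then have "Im z > 0" "Im (G z) = Im (G z0) - e/2" by (simp_all add: u_def)
      then show False using ImG[of z] z0 e by simp
    qed
    then have Gc: "G z = G z0" if "Im z > 0" for z using that z0 unfolding constant_on_def by (metis mem_Collect_eq)
    define a where "a = Re (G z0)"
    have Ga: "G z = of_real a" if "Im z > 0" for z using Gc[OF that] z0 by (simp add: a_def complex_eq_iff)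
    have Fa: "F t z = z + of_real (a * t)" if t: "t \<ge> 0" and z: "Im z > 0" for t z
    proof -
      have "((\<lambda>t. F t z - of_real (a * t)) has_vector_derivative 0) (at s within {0..})" if "s \<in> {0..}" for s
      proof -
        have "Im (F s z) > 0" using FI[of s z] that z by simp
        then have "((\<lambda>t. F t z) has_vector_derivative of_real a) (at s within {0..})" using FD[of s z] that z Ga by simp
        moreover have "((\<lambda>t. complex_of_real (a * t)) has_vector_derivative of_real a) (at s within {0..})"
          by (auto intro!: derivative_eq_intros)
        ultimately show ?thesis using has_vector_derivative_diff by fastforce
      qed
      from has_vector_derivative_zero_constant[OF convex_real_interval(1) this]
      obtain c where c: "\<And>s. s \<in> {0..} \<Longrightarrow> F s z - of_real (a * s) = c" by blast
      have "F t z - of_real (a * t) = F 0 z - of_real (a * 0)" using c[of t] c[of 0] t by simp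
      then show ?thesis using F0[OF z] by (simp add: algebra_simps)
    qed
    have Fl: "((\<lambda>y. F s (Complex x0 y)) \<longlongrightarrow> of_real (x0 + a * s)) (at_right 0)" if "s \<ge> 0" for s
    proof (rule Lim_transform_eventually)
      have "((\<lambda>y. Complex x0 y + of_real (a * s)) \<longlongrightarrow> Complex x0 0 + of_real (a * s)) (at_right 0)"
        by (intro tendsto_intros)
      then show "((\<lambda>y. Complex x0 y + of_real (a * s)) \<longlongrightarrow> of_real (x0 + a * s)) (at_right 0)"
        by (simp add: complex_of_real_def complex_add)
      show "\<forall>\<^sub>F y in at_right 0. Complex x0 y + of_real (a * s) = F s (Complex x0 y)"
        using eventually_at_right_less[of 0] by eventually_elim (simp add: Fa that)
    qed
    have "a \<noteq> 0" using nonfixed Fl by force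
    then have "sgn a \<in> {-1, 1}" "sgn a * a > 0" by (auto simp: sgn_real_def)
    moreover have "((\<lambda>s. x0 + a * s) \<longlongrightarrow> x0) (at_right 0)" by (auto intro!: tendsto_eq_intros)
    moreover have "((\<lambda>s. x0 + a * s) has_real_derivative a) (at s)" for s by (auto intro!: derivative_eq_intros)
    moreover have "(G \<longlongrightarrow> of_real a) (at (of_real (x0 + a * s)) within uhp)" for s
      by (rule Lim_transform_eventually[OF tendsto_const]) (auto simp: eventually_at_filter Ga)
    moreover have "\<bar>a\<bar> \<le> \<bar>a\<bar> * (1 + (x0 + a * s)\<^sup>2)" for s
      using mult_left_mono[of 1 "1 + (x0 + a * s)\<^sup>2" "\<bar>a\<bar>"] by simp
    ultimately have "boundary_curve G F x0 (\<lambda>s. x0 + a * s) (\<lambda>s. a) (sgn a)"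
      unfolding boundary_curve_def using Fl by auto
    then show ?thesis by blast
  next
    case False
    then have ImG': "Im (G z) > 0" if "Im z > 0" for z using ImG[OF that] that by force
    have Gnz: "G z \<noteq> 0" if "Im z > 0" for z using ImG'[OF that] by auto
    have "(\<lambda>z. 1 / G z) holomorphic_on uhp" using Gnz by (intro holomorphic_intros holG) auto
    from holomorphic_convex_primitive'[OF convex_uhp open_uhp this]
    obtain h where "\<And>z. z \<in> uhp \<Longrightarrow> (h has_field_derivative 1 / G z) (at z within uhp)" by blast
    then have hD: "(h has_field_derivative 1 / G z) (at z)" if "Im z > 0" for z
      using that at_within_open[OF _ open_uhp] by (metis mem_Collect_eq)
    have dh: "deriv h z = 1 / G z" if "Im z > 0" for z by (rule DERIV_imp_deriv[OF hD[OF that]])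
    have Fup: "Im (F t z) > 0" if "t \<ge> 0" "Im z > 0" for t z using FI[OF that] that by simp
    \<comment> \<open>Along a trajectory the derivative of \<open>h\<close> is
      \<open>G * (1 / G) = 1\<close>.\<close>
    have hF: "h (F t z) = h z + of_real t" if t: "t \<ge> 0" and z: "Im z > 0" for t z
    proof -
      have "((\<lambda>t. h (F t z) - of_real t) has_vector_derivative 0) (at s within {0..})" if "s \<in> {0..}" for s
      proof -
        have up: "Im (F s z) > 0" using Fup z that by simp
        have "((h \<circ> (\<lambda>t. F t z)) has_vector_derivative G (F s z) * (1 / G (F s z))) (at s within {0..})"
          by (rule field_vector_diff_chain_within) (use FD z that hD[OF up] in \<open>auto intro: has_field_derivative_at_within\<close>)
        then have "((\<lambda>t. h (F t z)) has_vector_derivative 1) (at s within {0..})" using Gnz[OF up] by (simp add: o_def)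
        moreover have "((\<lambda>t. complex_of_real t) has_vector_derivative 1) (at s within {0..})"
          by (auto intro!: derivative_eq_intros)
        ultimately show ?thesis using has_vector_derivative_diff by fastforce
      qed
      from has_vector_derivative_zero_constant[OF convex_real_interval(1) this]
      obtain c where c: "\<And>s. s \<in> {0..} \<Longrightarrow> h (F s z) - of_real s = c" by blast
      have "h (F t z) - of_real t = h (F 0 z) - of_real 0" using c[of t] c[of 0] t by simp
      then show ?thesis using F0[OF z] by (simp add: algebra_simps)
    qed
    interpret half_plane_koenigs h x0
    proof
      show "h holomorphic_on uhp" using hD unfolding holomorphic_on_open[OF open_uhp] by auto
      show "Im (deriv h z) < 0" if "Im z > 0" for z
        unfolding dh[OF that] using ImG'[OF that] by (auto simp: Im_divide intro!: divide_pos_pos add_nonneg_pos)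
      show "q + of_real t \<in> h ` uhp" if q: "q \<in> h ` uhp" and t: "0 \<le> t" for q t
      proof -
        obtain z where "Im z > 0" "q = h z" using q by auto
        then show ?thesis using hF[OF t, of z] Fup[OF t, of z] by (intro image_eqI[of _ _ "F t z"]) auto
      qed
    qed
    have gF: "g (h z + of_real t) = F t z" if "t \<ge> 0" "Im z > 0" for t z
      using g_h[OF Fup[OF that]] hF[OF that] by simp
    have wF: "w t y = F t (Complex x0 y)" if "t \<ge> 0" "y > 0" for t y
      unfolding w_def by (rule gF) (use that in auto)
    interpret half_plane_boundary_orbit h x0
    proof
      show "\<forall>\<^sub>F y in at_right 0. w t y \<notin> K" if "compact K" "K \<subseteq> uhp" "0 \<le> t" for K t
        using leaves[OF that] eventually_at_right_less[of 0] by eventually_elim (simp add: wF that)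
      obtain t where t: "t \<ge> 0" "\<not> ((\<lambda>y. F t (Complex x0 y)) \<longlongrightarrow> of_real x0) (at_right 0)" using nonfixed by blast
      have "\<not> ((\<lambda>y. w t y) \<longlongrightarrow> of_real x0) (at_right 0)"
      proof
        assume "((\<lambda>y. w t y) \<longlongrightarrow> of_real x0) (at_right 0)"
        then have "((\<lambda>y. F t (Complex x0 y)) \<longlongrightarrow> of_real x0) (at_right 0)"
        proof (rule Lim_transform_eventually)
          show "\<forall>\<^sub>F y in at_right 0. w t y = F t (Complex x0 y)"
            using eventually_at_right_less[of 0] by eventually_elim (simp add: wF t)
        qed
        then show False using t by simp
      qed
      then show "\<exists>t\<ge>0. \<not> ((\<lambda>y. w t y) \<longlongrightarrow> of_real x0) (at_right 0)" using t by blast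
    qed
    obtain X X' \<sigma> where "boundary_curve (\<lambda>z. 1 / deriv h z) (\<lambda>t z. g (h z + of_real t)) x0 X X' \<sigma>"
      using ex_boundary_curve by blast
    then have "boundary_curve G F x0 X X' \<sigma>"
      by (rule boundary_curve_cong) (use dh gF in auto)
    then show ?thesis by blast
  qed
qed

section \<open>The infinitesimal generator and the Denjoy-Wolff point\<close>

definition pdist :: "complex \<Rightarrow> complex \<Rightarrow> real" where
  "pdist a b = norm (a - b) / norm (1 - cnj a * b)"

lemma one_minus_cnj_mult_nonzero:
  fixes a b :: complex
  assumes "norm a < 1" "norm b < 1" shows "1 - cnj a * b \<noteq> 0"
proof
  assume "1 - cnj a * b = 0"
  then have "norm (cnj a * b) = 1" by simp
  moreover have "norm a * norm b < 1 * 1" using assms by (intro mult_strict_mono') auto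
  ultimately show False by (simp add: norm_mult)
qed

lemma norm_one_minus_cnj_mult:
  "(norm (1 - cnj a * b))\<^sup>2 = (norm (a - b))\<^sup>2 + (1 - (norm a)\<^sup>2) * (1 - (norm b)\<^sup>2)"
  unfolding cmod_power2 by (simp add: power2_eq_square algebra_simps)

lemma norm_diff_le_pdist: assumes "norm a < 1" "norm b < 1" shows "norm (a - b) \<le> 2 * pdist a b"
proof -
  have nz: "norm (1 - cnj a * b) > 0" using one_minus_cnj_mult_nonzero[OF assms] by simp
  have "norm (1 - cnj a * b) \<le> norm (1::complex) + norm (cnj a * b)" by (rule norm_triangle_ineq4)
  also have "\<dots> \<le> 2" using assms mult_mono[of "norm a" 1 "norm b" 1] by (simp add: norm_mult)
  finally have "pdist a b * norm (1 - cnj a * b) \<le> pdist a b * 2"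
    by (intro mult_left_mono) (auto simp: pdist_def)
  moreover have "pdist a b * norm (1 - cnj a * b) = norm (a - b)" using nz by (simp add: pdist_def)
  ultimately show ?thesis by simp
qed

text \<open>Expanding \<open>1 - cnj a * b\<close> about \<open>b\<close> turns a bound for the
  quotient into one for \<open>norm (a - b)\<close> alone. It shows that a pseudo-hyperbolic ball of
  fixed radius shrinks as its centre tends to the circle.\<close>

lemma norm_diff_le_of_pdist:
  assumes "norm a < 1" "norm b < 1" "pdist a b \<le> \<rho>" "\<rho> < 1"
  shows "norm (a - b) \<le> \<rho> / (1 - \<rho>) * (1 - (norm b)\<^sup>2)"
proof -
  have nz: "norm (1 - cnj a * b) > 0" using one_minus_cnj_mult_nonzero[OF assms(1,2)] by simp
  have r0: "\<rho> \<ge> 0" using assms(3) order_trans[of 0 "pdist a b" \<rho>] by (simp add: pdist_def)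
  have "1 - cnj a * b = of_real (1 - (norm b)\<^sup>2) - cnj (a - b) * b"
    using complex_norm_square[of b] by (simp add: algebra_simps)
  then have "norm (1 - cnj a * b) \<le> norm (complex_of_real (1 - (norm b)\<^sup>2)) + norm (cnj (a - b) * b)"
    by (metis norm_triangle_ineq4)
  also have "norm (complex_of_real (1 - (norm b)\<^sup>2)) = 1 - (norm b)\<^sup>2"
  proof -
    have "(norm b)\<^sup>2 < 1" using assms(2) by (simp add: abs_square_less_1)
    then show ?thesis by (simp only: norm_of_real)
  qed
  also have "norm (cnj (a - b) * b) \<le> norm (a - b) * 1"
    unfolding norm_mult complex_mod_cnj using assms by (intro mult_left_mono) auto
  finally have n: "norm (1 - cnj a * b) \<le> 1 - (norm b)\<^sup>2 + norm (a - b)" by simp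
  have "norm (a - b) = pdist a b * norm (1 - cnj a * b)" using nz by (simp add: pdist_def)
  also have "\<dots> \<le> \<rho> * norm (1 - cnj a * b)" using assms(3) nz by (intro mult_right_mono) auto
  also have "\<dots> \<le> \<rho> * (1 - (norm b)\<^sup>2 + norm (a - b))" using n r0 by (rule mult_left_mono)
  finally have "norm (a - b) * (1 - \<rho>) \<le> \<rho> * (1 - (norm b)\<^sup>2)" by (simp add: algebra_simps)
  then show ?thesis using assms(4) by (simp add: field_simps)
qed

theorem Schwarz_Pick:
  assumes holf: "f holomorphic_on ball 0 1" and fD: "f ` ball 0 1 \<subseteq> ball 0 1"
    and a: "norm a < 1" and b: "norm b < 1"
  shows "pdist (f a) (f b) \<le> pdist a b"
proof -
  have fn: "norm (f z) < 1" if "norm z < 1" for z using fD that by (force simp: image_subset_iff)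
  define k where "k = (\<lambda>z. Moebius_function 0 (f a) (f (Moebius_function 0 (- a) z)))"
  have ma: "norm (- a) < 1" using a by simp
  have mD: "norm (Moebius_function 0 (- a) z) < 1" if "norm z < 1" for z
    by (rule Moebius_function_norm_lt_1[OF ma that])
  have "k holomorphic_on ball 0 1"
    unfolding k_def
  proof (rule holomorphic_on_compose_gen[unfolded o_def, where t="ball 0 1" and g="Moebius_function 0 (f a)"])
    show "(\<lambda>z. f (Moebius_function 0 (- a) z)) holomorphic_on ball 0 1"
      by (rule holomorphic_on_compose_gen[unfolded o_def, OF Moebius_function_holomorphic[OF ma] holf]) (use mD in auto)
    show "Moebius_function 0 (f a) holomorphic_on ball 0 1" by (rule Moebius_function_holomorphic[OF fn[OF a]])
    show "(\<lambda>z. f (Moebius_function 0 (- a) z)) ` ball 0 1 \<subseteq> ball 0 1" using fn mD by auto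
  qed
  moreover have "k 0 = 0" by (simp add: k_def Moebius_function_of_zero Moebius_function_eq_zero)
  moreover have "norm (k z) < 1" if "norm z < 1" for z
    unfolding k_def by (intro Moebius_function_norm_lt_1 fn a mD that)
  moreover define u where "u = Moebius_function 0 a b"
  moreover have u: "norm u < 1" unfolding u_def by (rule Moebius_function_norm_lt_1[OF a b])
  ultimately have "norm (k u) \<le> norm u" using Schwarz_Lemma(1)[of k u] by blast
  moreover have "Moebius_function 0 (- a) u = b"
    unfolding u_def using Moebius_function_compose[of "- a" a b] a b by simp
  moreover have "norm (Moebius_function 0 x y) = pdist x y" for x y
    by (simp add: Moebius_function_simple pdist_def norm_divide norm_minus_commute)
  ultimately show ?thesis by (simp add: k_def u_def)
qed

text \<open>Unimodular limits are shared by functions at bounded pseudo-hyperbolic distance. This is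
  how one way of approaching a boundary point is replaced by another.\<close>

lemma tendsto_of_pdist_le:
  assumes lim: "(g \<longlongrightarrow> a) F" and a: "norm a = 1" and \<rho>: "\<rho> < 1"
    and ev: "\<forall>\<^sub>F x in F. norm (f x) < 1 \<and> norm (g x) < 1 \<and> pdist (f x) (g x) \<le> \<rho>"
  shows "(f \<longlongrightarrow> a) F"
proof -
  have "((\<lambda>x. \<rho> / (1 - \<rho>) * (1 - (norm (g x))\<^sup>2)) \<longlongrightarrow> \<rho> / (1 - \<rho>) * (1 - (norm a)\<^sup>2)) F"
    by (intro tendsto_intros lim)
  then have z: "((\<lambda>x. \<rho> / (1 - \<rho>) * (1 - (norm (g x))\<^sup>2)) \<longlongrightarrow> 0) F" by (simp add: a)
  have "((\<lambda>x. f x - g x) \<longlongrightarrow> 0) F"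
  proof (rule Lim_null_comparison[OF _ z])
    show "\<forall>\<^sub>F x in F. norm (f x - g x) \<le> \<rho> / (1 - \<rho>) * (1 - (norm (g x))\<^sup>2)"
      using ev by eventually_elim (use norm_diff_le_of_pdist \<rho> in blast)
  qed
  from tendsto_add[OF this lim] show ?thesis by simp
qed

lemma pdist_le_norm:
  assumes "norm a < 1" "norm b < 1" shows "pdist a b \<le> norm (a - b) / (1 - norm b)"
proof -
  have "norm (cnj a * b) \<le> 1 * norm b" unfolding norm_mult using assms by (intro mult_right_mono) auto
  then have "1 - norm b \<le> norm (1::complex) - norm (cnj a * b)" by simp
  also have "\<dots> \<le> norm (1 - cnj a * b)" by (rule norm_triangle_ineq2)
  finally show ?thesis unfolding pdist_def using assms by (intro frac_le) auto
qed

section \<open>Regularity of the semigroup in time, and its generator\<close>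

locale semigroup_in_disc =
  fixes phi :: "real \<Rightarrow> complex \<Rightarrow> complex"
  assumes semigroup: "disc_semigroup phi"
begin

lemma hol: "t \<ge> 0 \<Longrightarrow> phi t holomorphic_on ball 0 1"
  and image: "t \<ge> 0 \<Longrightarrow> phi t ` ball 0 1 \<subseteq> ball 0 1"
  and phi_0: "norm z < 1 \<Longrightarrow> phi 0 z = z"
  and phi_add: "t \<ge> 0 \<Longrightarrow> s \<ge> 0 \<Longrightarrow> norm z < 1 \<Longrightarrow> phi (t + s) z = phi t (phi s z)"
  and unif: "compact K \<Longrightarrow> K \<subseteq> ball 0 1 \<Longrightarrow> uniform_limit K phi (phi 0) (at_right 0)"
  using semigroup unfolding disc_semigroup_def by auto

lemma in_disc: "t \<ge> 0 \<Longrightarrow> norm z < 1 \<Longrightarrow> norm (phi t z) < 1"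
  using image[of t] by (force simp: image_subset_iff)

lemma pick: "t \<ge> 0 \<Longrightarrow> norm a < 1 \<Longrightarrow> norm b < 1 \<Longrightarrow> pdist (phi t a) (phi t b) \<le> pdist a b"
  by (rule Schwarz_Pick[OF hol image])

lemma lipschitz_in_z:
  assumes "t \<ge> 0" "norm a < 1" "norm b < 1"
  shows "norm (phi t a - phi t b) \<le> 2 / (1 - norm b) * norm (a - b)"
proof -
  have "norm (phi t a - phi t b) \<le> 2 * pdist (phi t a) (phi t b)" using assms by (intro norm_diff_le_pdist in_disc)
  also have "\<dots> \<le> 2 * (norm (a - b) / (1 - norm b))"
    using pick[OF assms] pdist_le_norm[OF assms(2,3)] by linarith
  finally show ?thesis by simp
qed

text \<open>By the semigroup law the small time step can be taken first:
  \<open>phi (t + s) z\<close> and \<open>phi t z\<close> are the values of \<open>phi t\<close> at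
  the close points \<open>phi s z\<close> and \<open>z\<close>, and the Lipschitz constant of
  \<open>phi t\<close> does not depend on \<open>t\<close>. The factor \<open>(1 - r) / 2\<close> in
  the tolerance cancels that constant.\<close>

lemma equicontinuous_in_t:
  assumes r: "0 \<le> r" "r < 1" and e: "e > 0"
  obtains d where "d > 0"
    "\<And>t t' z. 0 \<le> t \<Longrightarrow> 0 \<le> t' \<Longrightarrow> \<bar>t - t'\<bar> < d \<Longrightarrow> norm z \<le> r \<Longrightarrow> norm (phi t z - phi t' z) < e"
proof -
  have e': "e * (1 - r) / 2 > 0" using e r by simp
  have "uniform_limit (cball 0 r) phi (phi 0) (at_right 0)" by (rule unif) (use r in auto)
  from uniform_limitD[OF this e']
  obtain d where d: "d > 0" "\<And>s z. 0 < s \<Longrightarrow> s < d \<Longrightarrow> norm z \<le> r \<Longrightarrow> dist (phi s z) (phi 0 z) < e * (1 - r) / 2"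
    unfolding eventually_at_right_field by auto
  have one: "norm (phi (t + s) z - phi t z) < e" if "0 \<le> t" "0 \<le> s" "s < d" "norm z \<le> r" for t s z
  proof -
    have z: "norm z < 1" using that r by simp
    have "dist (phi s z) (phi 0 z) < e * (1 - r) / 2" using d(2)[of s z] that e' by (cases "s = 0") auto
    then have n: "norm (phi s z - z) < e * (1 - r) / 2" using phi_0[OF z] by (simp add: dist_norm)
    have "norm (phi (t + s) z - phi t z) \<le> 2 / (1 - norm z) * norm (phi s z - z)"
      using lipschitz_in_z[OF that(1) in_disc[OF that(2) z] z] phi_add[OF that(1,2) z] by simp
    also have "\<dots> \<le> 2 / (1 - r) * norm (phi s z - z)"
      using that r by (intro mult_right_mono divide_left_mono mult_pos_pos) auto
    also have "\<dots> < 2 / (1 - r) * (e * (1 - r) / 2)" using n r by (intro mult_strict_left_mono) auto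
    also have "\<dots> = e" using r by simp
    finally show ?thesis .
  qed
  have "norm (phi t z - phi t' z) < e" if "0 \<le> t" "0 \<le> t'" "\<bar>t - t'\<bar> < d" "norm z \<le> r" for t t' z
  proof (cases "t' \<le> t")
    case True
    then show ?thesis using one[of t' "t - t'" z] that by simp
  next
    case False
    then show ?thesis using one[of t "t' - t" z] that by (simp add: norm_minus_commute)
  qed
  then show thesis using that d(1) by blast
qed

lemma cont_in_t: "norm z < 1 \<Longrightarrow> continuous_on {0..} (\<lambda>t. phi t z)"
  unfolding continuous_on_iff
proof (intro ballI allI impI)
  fix t e :: real assume z: "norm z < 1" and t: "t \<in> {0..}" and e: "0 < e"
  obtain d where "d > 0" "\<And>t t' z'. 0 \<le> t \<Longrightarrow> 0 \<le> t' \<Longrightarrow> \<bar>t - t'\<bar> < d \<Longrightarrow> norm z' \<le> norm z \<Longrightarrow> norm (phi t z' - phi t' z') < e"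
    by (rule equicontinuous_in_t[of "norm z" e]) (use z e in auto)
  then show "\<exists>d>0. \<forall>x'\<in>{0..}. dist x' t < d \<longrightarrow> dist (phi x' z) (phi t z) < e"
    using t by (intro exI[of _ d]) (auto simp: dist_norm)
qed

lemma deriv_joint_continuous:
  "continuous_on (ball 0 1 \<times> {0..\<delta>}) (\<lambda>(x, t). deriv (phi t) x)"
  unfolding continuous_on_iff
proof (intro ballI allI impI)
  fix xt :: "complex \<times> real" and e :: real
  assume "xt \<in> ball 0 1 \<times> {0..\<delta>}" and e: "0 < e"
  then obtain x0 t0 where xt: "xt = (x0, t0)" "norm x0 < 1" "0 \<le> t0" by (cases xt) auto
  define r where "r = (1 - norm x0) / 3"
  define R where "R = 1 - r"
  have r: "r > 0" "norm x0 + r + r \<le> R" "R < 1" "0 \<le> R" using xt by (auto simp: r_def R_def field_simps)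
  have er: "e * r / 4 > 0" using e r by simp
  obtain d1 where d1: "d1 > 0"
    "\<And>t t' z. 0 \<le> t \<Longrightarrow> 0 \<le> t' \<Longrightarrow> \<bar>t - t'\<bar> < d1 \<Longrightarrow> norm z \<le> R \<Longrightarrow> norm (phi t z - phi t' z) < e * r / 4"
    by (rule equicontinuous_in_t[OF r(4,3) er]) blast
  \<comment> \<open>The last entry lets a displacement \<open>x - x0\<close> cost at most
    \<open>e * r / 4\<close> against the Lipschitz constant \<open>2 / r\<close>.\<close>
  define d where "d = min d1 (min r (e * r * r / 8))"
  have d: "d > 0" "d \<le> d1" "d \<le> r" "d \<le> e * r * r / 8" using d1 r e by (auto simp: d_def)
  show "\<exists>d>0. \<forall>x'\<in>ball 0 1 \<times> {0..\<delta>}. dist x' xt < d \<longrightarrow>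
      dist (case x' of (x, t) \<Rightarrow> deriv (phi t) x) (case xt of (x, t) \<Rightarrow> deriv (phi t) x) < e"
  proof (intro exI[of _ d] conjI ballI impI d(1))
    fix x' :: "complex \<times> real" assume x': "x' \<in> ball 0 1 \<times> {0..\<delta>}" "dist x' xt < d"
    obtain x t where xtt: "x' = (x, t)" by (cases x')
    have x: "norm x < 1" and t: "t \<ge> 0" using x' xtt by auto
    have nx: "norm (x - x0) < d" "\<bar>t - t0\<bar> < d"
      using x'(2) dist_fst_le[of x' xt] dist_snd_le[of x' xt] by (auto simp: xt xtt dist_norm)
    \<comment> \<open>The shift turns the derivatives of \<open>phi t\<close> at \<open>x\<close>
      and of \<open>phi t0\<close> at \<open>x0\<close> into a single derivative of \<open>k\<close>
      at \<open>x0\<close>, to which Cauchy's estimate applies.\<close>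
    define k where "k = (\<lambda>z. phi t (z + (x - x0)) - phi t0 z)"
    have inb: "norm (z + (x - x0)) \<le> R" "norm z \<le> R" if "norm (z - x0) \<le> r" for z
    proof -
      have "norm z \<le> norm (z - x0) + norm x0" using norm_triangle_ineq[of "z - x0" x0] by simp
      then have z: "norm z \<le> norm x0 + r" using that by simp
      then show "norm z \<le> R" using r by linarith
      have "norm (z + (x - x0)) \<le> norm z + norm (x - x0)" by (rule norm_triangle_ineq)
      then show "norm (z + (x - x0)) \<le> R" using z nx d r by linarith
    qed
    have holk: "k holomorphic_on cball x0 r" unfolding k_def
    proof (intro holomorphic_intros)
      show "phi t0 holomorphic_on cball x0 r"
        by (rule holomorphic_on_subset[OF hol[OF xt(3)]]) (use inb(2) r in \<open>force simp: dist_norm norm_minus_commute\<close>)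
      show "(\<lambda>z. phi t (z + (x - x0))) holomorphic_on cball x0 r"
      proof (rule holomorphic_on_compose_gen[unfolded o_def, OF _ hol[OF t]])
        show "(\<lambda>z. z + (x - x0)) holomorphic_on cball x0 r" by (intro holomorphic_intros)
        show "(\<lambda>z. z + (x - x0)) ` cball x0 r \<subseteq> ball 0 1"
        proof (rule image_subsetI)
          fix z assume "z \<in> cball x0 r"
          then have "norm (z - x0) \<le> r" by (simp add: dist_norm norm_minus_commute)
          from inb(1)[OF this] show "z + (x - x0) \<in> ball 0 1" using r by simp
        qed
      qed
    qed
    have bk: "norm (k z) \<le> e * r / 2" if z: "norm (x0 - z) = r" for z
    proof -
      have z': "norm (z - x0) \<le> r" using z by (simp add: norm_minus_commute)
      have zR: "norm z \<le> norm x0 + r" using norm_triangle_ineq[of "z - x0" x0] z' by simp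
      have z1: "norm z < 1" "norm (z + (x - x0)) < 1" using inb[OF z'] r by auto
      have "norm (phi t (z + (x - x0)) - phi t z) \<le> 2 / (1 - norm z) * norm (z + (x - x0) - z)"
        by (rule lipschitz_in_z[OF t z1(2,1)])
      also have "\<dots> \<le> 2 / r * norm (x - x0)"
      proof -
        have "2 / (1 - norm z) \<le> 2 / r" using zR r z1 unfolding R_def by (intro divide_left_mono mult_pos_pos) auto
        then have "2 / (1 - norm z) * norm (x - x0) \<le> 2 / r * norm (x - x0)" by (rule mult_right_mono) simp
        then show ?thesis by (simp only: add_diff_cancel_left')
      qed
      also have "\<dots> \<le> 2 / r * (e * r * r / 8)" using nx d r by (intro mult_left_mono) auto
      also have "\<dots> = e * r / 4" using r by simp
      finally have 1: "norm (phi t (z + (x - x0)) - phi t z) \<le> e * r / 4" .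
      have 2: "norm (phi t z - phi t0 z) < e * r / 4"
        by (rule d1(2)) (use t xt nx d inb(2)[OF z'] in auto)
      have "k z = (phi t (z + (x - x0)) - phi t z) + (phi t z - phi t0 z)" by (simp add: k_def)
      then have "norm (k z) \<le> norm (phi t (z + (x - x0)) - phi t z) + norm (phi t z - phi t0 z)"
        by (metis norm_triangle_ineq)
      then show ?thesis using 1 2 by linarith
    qed
    have "norm ((deriv ^^ 1) k x0) \<le> fact 1 * (e * r / 2) / r ^ 1"
      by (rule Cauchy_inequality[OF holomorphic_on_subset[OF holk] holomorphic_on_imp_continuous_on[OF holk] r(1) bk]) auto
    then have dk: "norm (deriv k x0) \<le> e / 2" using r by simp
    have "(k has_field_derivative deriv (phi t) x * 1 - deriv (phi t0) x0) (at x0)"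
      unfolding k_def
    proof (rule DERIV_diff)
      show "((\<lambda>z. phi t (z + (x - x0))) has_field_derivative deriv (phi t) x * 1) (at x0)"
      proof (rule DERIV_chain2[where f="phi t"])
        show "(phi t has_field_derivative deriv (phi t) x) (at (x0 + (x - x0)))"
          using holomorphic_derivI[OF hol[OF t] open_ball, of x] x by simp
      qed (auto intro!: derivative_eq_intros)
      show "(phi t0 has_field_derivative deriv (phi t0) x0) (at x0)"
        using holomorphic_derivI[OF hol[OF xt(3)] open_ball, of x0] xt by simp
    qed
    then have "deriv k x0 = deriv (phi t) x - deriv (phi t0) x0" by (simp add: DERIV_imp_deriv)
    then show "dist (case x' of (x, t) \<Rightarrow> deriv (phi t) x) (case xt of (x, t) \<Rightarrow> deriv (phi t) x) < e"
      using dk e by (simp add: xt xtt dist_norm)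
  qed
qed

text \<open>
  Since \<open>\<Psi> \<delta> (phi t z)\<close> is the integral of \<open>phi s z\<close> over \<open>[t, t + \<delta>]\<close>, it is differentiable in \<open>t\<close>, and so is \<open>phi t z\<close>
  wherever \<open>\<Psi> \<delta>\<close> is locally invertible.
\<close>

definition "\<Psi> \<delta> z = integral {0..\<delta>} (\<lambda>s. phi s z)"

lemma hol_\<Psi>: "\<Psi> \<delta> holomorphic_on ball 0 1"
proof -
  have "(\<lambda>z. integral (cbox 0 \<delta>) (\<lambda>s. phi s z)) holomorphic_on ball 0 1"
  proof (rule leibniz_rule_holomorphic)
    show "((\<lambda>z. phi s z) has_field_derivative deriv (phi s) z) (at z within ball 0 1)"
      if "z \<in> ball 0 1" "s \<in> cbox 0 \<delta>" for z s
      using that holomorphic_derivI[OF hol[of s] open_ball, of z] by (auto intro: has_field_derivative_at_within)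
    show "(\<lambda>s. phi s z) integrable_on cbox 0 \<delta>" if "z \<in> ball 0 1" for z
      by (rule integrable_continuous) (use that in \<open>auto intro!: continuous_on_subset[OF cont_in_t]\<close>)
    show "continuous_on (ball 0 1 \<times> cbox 0 \<delta>) (\<lambda>(x, t). deriv (phi t) x)"
      using deriv_joint_continuous by simp
  qed simp
  then show ?thesis by (simp add: \<Psi>_def[abs_def])
qed

text \<open>For small \<open>\<delta>\<close> the average of \<open>phi s z\<close> over
  \<open>[0, \<delta>]\<close> is close to \<open>z\<close>, so by Cauchy's estimate the derivative
  of \<open>\<Psi> \<delta>\<close> differs from \<open>\<delta>\<close> by at most
  \<open>\<delta> / 2\<close>.\<close>

lemma \<Psi>_deriv_nonzero:
  assumes w: "norm w < 1" obtains \<delta> where "\<delta> > 0" "deriv (\<Psi> \<delta>) w \<noteq> 0"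
proof -
  define r where "r = (1 - norm w) / 2"
  have r: "r > 0" "norm w + r < 1" using w by (auto simp: r_def field_simps)
  define R where "R = norm w + r"
  have R: "0 \<le> R" "R < 1" using r by (auto simp: R_def)
  have r2: "r / 2 > 0" using r by simp
  obtain d where d: "d > 0"
    "\<And>t t' z. 0 \<le> t \<Longrightarrow> 0 \<le> t' \<Longrightarrow> \<bar>t - t'\<bar> < d \<Longrightarrow> norm z \<le> R \<Longrightarrow> norm (phi t z - phi t' z) < r / 2"
    by (rule equicontinuous_in_t[OF R r2]) blast
  define \<delta> where "\<delta> = d / 2"
  have \<delta>: "\<delta> > 0" "\<delta> < d" using d by (auto simp: \<delta>_def)
  define k where "k = (\<lambda>z. \<Psi> \<delta> z - of_real \<delta> * z)"
  have sub: "cball w r \<subseteq> ball 0 1"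
  proof
    fix z assume "z \<in> cball w r"
    then have "norm z \<le> norm w + r" using norm_triangle_ineq[of "z - w" w] by (simp add: dist_norm norm_minus_commute)
    then show "z \<in> ball 0 1" using r by simp
  qed
  have holk: "k holomorphic_on cball w r"
    unfolding k_def by (intro holomorphic_intros holomorphic_on_subset[OF hol_\<Psi> sub])
  have bk: "norm (k z) \<le> \<delta> * (r / 2)" if z: "norm (w - z) = r" for z
  proof -
    have zR: "norm z \<le> R" using norm_triangle_ineq[of "z - w" w] z by (simp add: R_def norm_minus_commute)
    have z1: "norm z < 1" using zR R by simp
    have int: "(\<lambda>s. phi s z) integrable_on {0..\<delta>}"
      by (intro integrable_continuous_real continuous_on_subset[OF cont_in_t[OF z1]]) auto
    have "integral {0..\<delta>} (\<lambda>s. phi s z - z) = \<Psi> \<delta> z - integral {0..\<delta>} (\<lambda>s. z)"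
      unfolding \<Psi>_def by (rule integral_diff[OF int]) auto
    then have "k z = integral {0..\<delta>} (\<lambda>s. phi s z - z)"
      using \<delta> by (simp add: k_def scaleR_conv_of_real)
    also have "norm \<dots> \<le> r / 2 * (\<delta> - 0)"
    proof (rule integral_bound)
      show "continuous_on {0..\<delta>} (\<lambda>s. phi s z - z)"
        by (intro continuous_intros continuous_on_subset[OF cont_in_t[OF z1]]) auto
      show "norm (phi s z - z) \<le> r / 2" if "s \<in> {0..\<delta>}" for s
        using d(2)[of s 0 z] that \<delta> zR phi_0[OF z1] by simp
    qed (use \<delta> in simp)
    finally show ?thesis by (simp add: mult.commute)
  qed
  have "norm ((deriv ^^ 1) k w) \<le> fact 1 * (\<delta> * (r / 2)) / r ^ 1"
    by (rule Cauchy_inequality[OF holomorphic_on_subset[OF holk] holomorphic_on_imp_continuous_on[OF holk] r(1) bk]) auto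
  then have dk: "norm (deriv k w) \<le> \<delta> / 2" using r by simp
  have "(k has_field_derivative deriv (\<Psi> \<delta>) w - of_real \<delta>) (at w)"
    unfolding k_def by (rule DERIV_diff) (use w holomorphic_derivI[OF hol_\<Psi> open_ball] in \<open>auto intro!: derivative_eq_intros\<close>)
  then have "deriv k w = deriv (\<Psi> \<delta>) w - of_real \<delta>" by (rule DERIV_imp_deriv)
  then have "deriv (\<Psi> \<delta>) w \<noteq> 0" using dk \<delta> by auto
  then show thesis using that \<delta> by blast
qed

lemma vector_derivative_phi:
  assumes z: "norm z < 1" and t: "t \<ge> 0" and \<delta>: "\<delta> > 0" and nz: "deriv (\<Psi> \<delta>) (phi t z) \<noteq> 0"
  shows "((\<lambda>t. phi t z) has_vector_derivative (phi \<delta> (phi t z) - phi t z) / deriv (\<Psi> \<delta>) (phi t z)) (at t within {0..})"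
proof -
  define w where "w = phi t z"
  have w: "norm w < 1" using in_disc z t by (simp add: w_def)
  define J where "J = (\<lambda>u. integral {0..u} (\<lambda>s. phi s z))"
  have cont: "continuous_on {0..T} (\<lambda>s. phi s z)" for T
    by (rule continuous_on_subset[OF cont_in_t[OF z]]) auto
  have dJ: "(J has_vector_derivative phi u z) (at u within {0..})" if "u \<ge> 0" for u
  proof -
    have "(J has_vector_derivative phi u z) (at u within {0..u+1})"
      unfolding J_def by (rule integral_has_vector_derivative[OF cont]) (use that in auto)
    moreover have "at u within {0..u+1} = at u within {0..}"
      by (rule at_within_nhd[of _ "{..<u+1}"]) (use that in auto)
    ultimately show ?thesis by simp
  qed
  have J\<Psi>: "\<Psi> \<delta> (phi u z) = J (u + \<delta>) - J u" if u: "u \<ge> 0" for u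
  proof -
    have "\<Psi> \<delta> (phi u z) = integral {0..\<delta>} ((\<lambda>s. phi s z) \<circ> ((+) u))"
      unfolding \<Psi>_def by (rule integral_cong) (use phi_add[of _ u z] u z in \<open>auto simp: add.commute\<close>)
    also have "\<dots> = integral {0 + u..\<delta> + u} (\<lambda>s. phi s z)"
      by (rule integral_shift_Icc_real)
    also have "\<dots> = J (u + \<delta>) - J u"
      using Henstock_Kurzweil_Integration.integral_combine[of 0 u "u + \<delta>" "\<lambda>s. phi s z"] u \<delta> integrable_continuous_real[OF cont]
      by (simp add: J_def add.commute algebra_simps)
    finally show ?thesis .
  qed
  obtain r where r: "r > 0" "ball w r \<subseteq> ball 0 1" "inj_on (\<Psi> \<delta>) (ball w r)"
    using has_complex_derivative_locally_injective[OF hol_\<Psi> _ open_ball nz[folded w_def]] w by auto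
  obtain k where k: "k holomorphic_on (\<Psi> \<delta> ` ball w r)" "\<And>u. u \<in> ball w r \<Longrightarrow> deriv (\<Psi> \<delta>) u * deriv k (\<Psi> \<delta> u) = 1"
    "\<And>u. u \<in> ball w r \<Longrightarrow> k (\<Psi> \<delta> u) = u"
    using holomorphic_has_inverse[OF holomorphic_on_subset[OF hol_\<Psi> r(2)] open_ball r(3)] by metis
  have op: "open (\<Psi> \<delta> ` ball w r)"
    by (rule open_mapping_thm3[OF holomorphic_on_subset[OF hol_\<Psi> r(2)] open_ball r(3)])
  have wr: "w \<in> ball w r" using r by simp
  have dk: "(k has_field_derivative deriv k (\<Psi> \<delta> w)) (at (\<Psi> \<delta> w))"
    by (rule holomorphic_derivI[OF k(1) op]) (use wr in blast)
  have dk2: "deriv k (\<Psi> \<delta> w) = 1 / deriv (\<Psi> \<delta>) w"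
    using k(2)[OF wr] nz by (simp add: w_def[symmetric] field_simps)
  have "((\<lambda>u. J (u + \<delta>)) has_vector_derivative phi (t + \<delta>) z) (at t within {0..})"
  proof -
    have "((J \<circ> (\<lambda>u. u + \<delta>)) has_vector_derivative (1 *\<^sub>R phi (t + \<delta>) z)) (at t within {0..})"
    proof (rule vector_diff_chain_within)
      show "((\<lambda>u. u + \<delta>) has_vector_derivative 1) (at t within {0..})"
        by (auto intro!: derivative_eq_intros)
      show "(J has_vector_derivative phi (t + \<delta>) z) (at (t + \<delta>) within (\<lambda>u. u + \<delta>) ` {0..})"
        by (rule has_vector_derivative_within_subset[OF dJ]) (use t \<delta> in auto)
    qed
    then show ?thesis by (simp add: o_def)
  qed
  then have dJ2: "((\<lambda>u. J (u + \<delta>) - J u) has_vector_derivative phi (t + \<delta>) z - phi t z) (at t within {0..})"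
    by (intro has_vector_derivative_diff dJ t)
  have "J (t + \<delta>) - J t = \<Psi> \<delta> w" using J\<Psi>[OF t] by (simp add: w_def)
  then have "(k has_field_derivative deriv k (\<Psi> \<delta> w)) (at (J (t + \<delta>) - J t) within (\<lambda>u. J (u + \<delta>) - J u) ` {0..})"
    using dk by (simp add: has_field_derivative_at_within)
  from field_vector_diff_chain_within[OF dJ2 this]
  have "((k \<circ> (\<lambda>u. J (u + \<delta>) - J u)) has_vector_derivative (phi (t + \<delta>) z - phi t z) * deriv k (\<Psi> \<delta> w)) (at t within {0..})" .
  moreover have "phi (t + \<delta>) z = phi \<delta> w" using phi_add[of \<delta> t z] t \<delta> z by (simp add: w_def add.commute)
  ultimately have D: "((k \<circ> (\<lambda>u. J (u + \<delta>) - J u)) has_vector_derivative (phi \<delta> w - w) / deriv (\<Psi> \<delta>) w) (at t within {0..})"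
    by (simp add: dk2 w_def[symmetric])
  have "((\<lambda>u. phi u z) \<longlongrightarrow> w) (at t within {0..})"
    using cont_in_t[OF z] t unfolding continuous_on_def w_def by auto
  from topological_tendstoD[OF this open_ball wr]
  obtain d where d: "d > 0" "\<And>u. u \<in> {0..} \<Longrightarrow> u \<noteq> t \<Longrightarrow> dist u t < d \<Longrightarrow> phi u z \<in> ball w r"
    unfolding eventually_at by auto
  have "((\<lambda>u. phi u z) has_vector_derivative (phi \<delta> w - w) / deriv (\<Psi> \<delta>) w) (at t within {0..})"
  proof (rule has_vector_derivative_transform_within[OF D d(1)])
    fix u assume u: "u \<in> {0..}" "dist u t < d"
    then have "phi u z \<in> ball w r" using d(2)[of u] wr by (cases "u = t") (auto simp: w_def)
    then have "k (\<Psi> \<delta> (phi u z)) = phi u z" by (rule k(3))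
    then show "(k \<circ> (\<lambda>u. J (u + \<delta>) - J u)) u = phi u z" using J\<Psi>[of u] u by simp
  qed (use t in simp)
  then show ?thesis by (simp add: w_def)
qed

definition "gen w = vector_derivative (\<lambda>t. phi t w) (at 0 within {0..})"

lemma at_0_within: "at (0::real) within {0..} \<noteq> bot"
  using trivial_limit_at_right_real[of 0] by (simp add: at_within_Ici_at_right)

lemma gen_eq:
  assumes "norm w < 1" "\<delta> > 0" "deriv (\<Psi> \<delta>) w \<noteq> 0"
  shows "gen w = (phi \<delta> w - w) / deriv (\<Psi> \<delta>) w"
  unfolding gen_def using vector_derivative_phi[of w 0 \<delta>] assms phi_0[OF assms(1)]
  by (intro vector_derivative_within[OF at_0_within]) simp

lemma gen_deriv:
  assumes "norm z < 1" "t \<ge> 0"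
  shows "((\<lambda>t. phi t z) has_vector_derivative gen (phi t z)) (at t within {0..})"
proof -
  have w: "norm (phi t z) < 1" using in_disc assms by simp
  obtain \<delta> where \<delta>: "\<delta> > 0" "deriv (\<Psi> \<delta>) (phi t z) \<noteq> 0" by (rule \<Psi>_deriv_nonzero[OF w])
  show ?thesis using vector_derivative_phi[OF assms \<delta>] gen_eq[OF w \<delta>] by simp
qed

text \<open>One \<open>\<delta>\<close> serves a whole neighbourhood of a point, and there
  \<open>gen\<close> is a quotient of holomorphic functions.\<close>

lemma hol_gen: "gen holomorphic_on ball 0 1"
  unfolding holomorphic_on_open[OF open_ball]
proof
  fix w :: complex assume w: "w \<in> ball 0 1"
  obtain \<delta> where \<delta>: "\<delta> > 0" "deriv (\<Psi> \<delta>) w \<noteq> 0" using \<Psi>_deriv_nonzero[of w] w by auto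
  have hd: "deriv (\<Psi> \<delta>) holomorphic_on ball 0 1" by (rule holomorphic_deriv[OF hol_\<Psi> open_ball])
  have "isCont (deriv (\<Psi> \<delta>)) w"
    using holomorphic_on_imp_continuous_on[OF hd] w by (simp add: continuous_on_eq_continuous_at)
  then obtain e where e: "e > 0" "\<And>z. dist w z < e \<Longrightarrow> deriv (\<Psi> \<delta>) z \<noteq> 0"
    using continuous_at_avoid[of w "deriv (\<Psi> \<delta>)" 0] \<delta> by auto
  define U where "U = ball w e \<inter> ball 0 1"
  have U: "open U" "w \<in> U" using w e by (auto simp: U_def)
  have "(\<lambda>w. (phi \<delta> w - w) / deriv (\<Psi> \<delta>) w) holomorphic_on U"
    using e \<delta> unfolding U_def by (intro holomorphic_intros holomorphic_on_subset[OF hol] holomorphic_on_subset[OF hd]) auto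
  then have "gen holomorphic_on U"
    by (subst holomorphic_cong[OF refl]) (use gen_eq \<delta> e in \<open>auto simp: U_def\<close>)
  then show "\<exists>f'. (gen has_field_derivative f') (at w)" using U unfolding holomorphic_on_open[OF U(1)] by blast
qed

end

text \<open>
  For \<open>norm s = 1\<close> this says that the horodisks at \<open>s\<close> are invariant; for \<open>norm s < 1\<close> it means \<open>f s = s\<close>.
\<close>

definition horocyclic :: "complex \<Rightarrow> (complex \<Rightarrow> complex) \<Rightarrow> bool" where
  "horocyclic s f \<longleftrightarrow> (\<forall>z. norm z < 1 \<longrightarrow>
     (1 - (norm z)\<^sup>2) * (norm (1 - cnj s * f z))\<^sup>2 \<le> (1 - (norm (f z))\<^sup>2) * (norm (1 - cnj s * z))\<^sup>2)"

text \<open>Schwarz-Pick without denominators. In this form it survives limits in which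
  \<open>a\<close> tends to the unit circle.\<close>

lemma Schwarz_Pick_product:
  assumes "f holomorphic_on ball 0 1" "f ` ball 0 1 \<subseteq> ball 0 1" "norm a < 1" "norm b < 1"
  shows "(1 - (norm a)\<^sup>2) * (1 - (norm b)\<^sup>2) * (norm (1 - cnj (f a) * f b))\<^sup>2
       \<le> (1 - (norm (f a))\<^sup>2) * (1 - (norm (f b))\<^sup>2) * (norm (1 - cnj a * b))\<^sup>2"
proof -
  have fa: "norm (f a) < 1" "norm (f b) < 1" using assms by (force simp: image_subset_iff)+
  define N where "N = (norm (1 - cnj a * b))\<^sup>2"
  define N' where "N' = (norm (1 - cnj (f a) * f b))\<^sup>2"
  define P where "P = (1 - (norm a)\<^sup>2) * (1 - (norm b)\<^sup>2)"
  define P' where "P' = (1 - (norm (f a))\<^sup>2) * (1 - (norm (f b))\<^sup>2)"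
  have N: "N > 0" "N' > 0" unfolding N_def N'_def
    using one_minus_cnj_mult_nonzero[OF assms(3,4)] one_minus_cnj_mult_nonzero[OF fa] by auto
  have "(pdist (f a) (f b))\<^sup>2 \<le> (pdist a b)\<^sup>2"
    by (intro power_mono Schwarz_Pick assms) (simp add: pdist_def)
  moreover have "(pdist a b)\<^sup>2 = (N - P) / N"
    using norm_one_minus_cnj_mult[of a b] by (simp add: pdist_def power_divide N_def P_def)
  moreover have "(pdist (f a) (f b))\<^sup>2 = (N' - P') / N'"
    using norm_one_minus_cnj_mult[of "f a" "f b"] by (simp add: pdist_def power_divide N'_def P'_def)
  ultimately have "(N' - P') / N' \<le> (N - P) / N" by simp
  then have "(N' - P') * N \<le> (N - P) * N'" using N by (simp add: field_simps)
  then have "P * N' \<le> P' * N" by (simp add: algebra_simps)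
  then show ?thesis by (simp only: N_def N'_def P_def P'_def)
qed

lemma one_minus_norm_sq_pos: "norm (z::complex) < 1 \<Longrightarrow> 1 - (norm z)\<^sup>2 > 0"
  by (simp add: abs_square_less_1)

lemma norm_one_minus_cnj_mult_pos:
  assumes "norm s \<le> 1" "norm z < 1" shows "(norm (1 - cnj s * z))\<^sup>2 > 0"
proof -
  have "norm (cnj s * z) < 1"
    using assms mult_left_le_one_le[of "norm z" "norm s"] by (simp add: norm_mult)
  then have "cnj s * z \<noteq> 1" by auto
  then show ?thesis by simp
qed

lemma horocyclic_compose:
  assumes f: "horocyclic s f" and g: "horocyclic s g" and gD: "\<And>z. norm z < 1 \<Longrightarrow> norm (g z) < 1" and s: "norm s \<le> 1"
  shows "horocyclic s (\<lambda>z. f (g z))"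
  unfolding horocyclic_def
proof (intro allI impI)
  fix z :: complex assume z: "norm z < 1"
  define a where "a = 1 - (norm z)\<^sup>2"
  define b where "b = 1 - (norm (g z))\<^sup>2"
  define c where "c = 1 - (norm (f (g z)))\<^sup>2"
  define A where "A = (norm (1 - cnj s * z))\<^sup>2"
  define B where "B = (norm (1 - cnj s * g z))\<^sup>2"
  define C where "C = (norm (1 - cnj s * f (g z)))\<^sup>2"
  have pos: "a > 0" "b > 0" "A > 0" "B > 0" unfolding a_def b_def A_def B_def
    by (intro one_minus_norm_sq_pos norm_one_minus_cnj_mult_pos z gD s)+
  have 1: "a * B \<le> b * A" using g z by (simp add: horocyclic_def a_def b_def A_def B_def)
  have 2: "b * C \<le> c * B" using f gD[OF z] by (simp add: horocyclic_def b_def c_def B_def C_def)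
  have C0: "C \<ge> 0" by (simp add: C_def)
  have "(a * C) * (b * B) = (a * B) * (b * C)" by simp
  also have "\<dots> \<le> (b * A) * (c * B)" by (rule mult_mono[OF 1 2]) (use pos C0 in auto)
  also have "\<dots> = (c * A) * (b * B)" by simp
  finally have "a * C \<le> c * A" using pos by (simp add: mult_le_cancel_right)
  then show "(1 - (norm z)\<^sup>2) * (norm (1 - cnj s * f (g z)))\<^sup>2 \<le> (1 - (norm (f (g z)))\<^sup>2) * (norm (1 - cnj s * z))\<^sup>2"
    by (simp add: a_def c_def A_def C_def)
qed

text \<open>At \<open>z = s\<close> the identity for \<open>norm (1 - cnj a * b)\<close> reduces the
  inequality to \<open>(norm (s - f s))\<^sup>2 \<le> 0\<close>.\<close>

lemma horocyclic_interior_fixed: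
  assumes "horocyclic s f" "norm s < 1"
  shows "f s = s"
proof -
  have s: "1 - (norm s)\<^sup>2 > 0" by (rule one_minus_norm_sq_pos[OF assms(2)])
  have "(norm (1 - cnj s * s))\<^sup>2 = (1 - (norm s)\<^sup>2) * (1 - (norm s)\<^sup>2)"
    using norm_one_minus_cnj_mult[of s s] by simp
  moreover have "(1 - (norm s)\<^sup>2) * (norm (1 - cnj s * f s))\<^sup>2 \<le> (1 - (norm (f s))\<^sup>2) * (norm (1 - cnj s * s))\<^sup>2"
    using assms by (simp add: horocyclic_def)
  ultimately have "(1 - (norm s)\<^sup>2) * (norm (1 - cnj s * f s))\<^sup>2 \<le> (1 - (norm s)\<^sup>2) * ((1 - (norm s)\<^sup>2) * (1 - (norm (f s))\<^sup>2))"
    by (simp only: mult_ac)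
  then have "(norm (1 - cnj s * f s))\<^sup>2 \<le> (1 - (norm s)\<^sup>2) * (1 - (norm (f s))\<^sup>2)"
    using s by (simp only: mult_le_cancel_left_pos)
  then have "(norm (s - f s))\<^sup>2 \<le> 0" by (simp add: norm_one_minus_cnj_mult)
  then show ?thesis by simp
qed

text \<open>Fixed points of \<open>(1 - \<epsilon>) f\<close> accumulate at the point \<open>s\<close>, as in Wolff's lemma.\<close>

lemma ex_horocyclic:
  assumes holf: "f holomorphic_on ball 0 1" and fD: "f ` ball 0 1 \<subseteq> ball 0 1"
  obtains s where "norm s \<le> 1" "horocyclic s f"
proof -
  have fn: "norm (f z) < 1" if "norm z < 1" for z using fD that by (force simp: image_subset_iff)
  define \<epsilon> where "\<epsilon> = (\<lambda>n. inverse (real (Suc (Suc n))))"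
  have \<epsilon>: "0 < \<epsilon> n" "\<epsilon> n < 1" for n by (simp_all add: \<epsilon>_def inverse_less_1_iff)
  have "\<exists>z. norm z < 1 \<and> of_real (1 - \<epsilon> n) * f z = z" for n
  proof -
    have sub: "cball 0 (1 - \<epsilon> n) \<subseteq> ball (0::complex) 1" using \<epsilon>[of n] by auto
    obtain z where z: "z \<in> cball 0 (1 - \<epsilon> n)" "of_real (1 - \<epsilon> n) * f z = z"
    proof (rule brouwer[of "cball 0 (1 - \<epsilon> n)" "\<lambda>z. of_real (1 - \<epsilon> n) * f z"])
      show "continuous_on (cball 0 (1 - \<epsilon> n)) (\<lambda>z. of_real (1 - \<epsilon> n) * f z)"
        by (intro continuous_intros continuous_on_subset[OF holomorphic_on_imp_continuous_on[OF holf] sub])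
      show "(\<lambda>z. of_real (1 - \<epsilon> n) * f z) \<in> cball 0 (1 - \<epsilon> n) \<rightarrow> cball 0 (1 - \<epsilon> n)"
      proof (rule Pi_I)
        fix z :: complex assume "z \<in> cball 0 (1 - \<epsilon> n)"
        then have "norm (f z) \<le> 1" using fn[of z] sub by auto
        then have "(1 - \<epsilon> n) * norm (f z) \<le> (1 - \<epsilon> n) * 1" using \<epsilon>[of n] by (intro mult_left_mono) auto
        then show "of_real (1 - \<epsilon> n) * f z \<in> cball 0 (1 - \<epsilon> n)" using \<epsilon>[of n] by (simp add: norm_mult del: of_real_diff)
      qed
    qed (use \<epsilon>[of n] in auto)
    from subsetD[OF sub z(1)] have "norm z < 1" by simp
    then show ?thesis using z(2) by blast
  qed
  then obtain z where z: "\<And>n. norm (z n) < 1" "\<And>n. of_real (1 - \<epsilon> n) * f (z n) = z n" by metis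
  have "compact (cball (0::complex) 1)" by simp
  then obtain s r where s: "s \<in> cball 0 1" "strict_mono (r :: nat \<Rightarrow> nat)" "(z \<circ> r) \<longlonglongrightarrow> s"
    unfolding compact_def using z(1) by (metis less_imp_le mem_cball_0)
  have \<epsilon>0: "\<epsilon> \<longlonglongrightarrow> 0" unfolding \<epsilon>_def by (rule LIMSEQ_Suc[OF LIMSEQ_inverse_real_of_nat])
  have fz: "f (z n) = z n / of_real (1 - \<epsilon> n)" for n
  proof -
    have "complex_of_real (1 - \<epsilon> n) \<noteq> 0" unfolding of_real_eq_0_iff using \<epsilon>(2)[of n] by linarith
    then have "f (z n) = (of_real (1 - \<epsilon> n) * f (z n)) / of_real (1 - \<epsilon> n)" by simp
    then show ?thesis by (simp only: z(2))
  qed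
  have fl: "(\<lambda>n. f (z (r n))) \<longlonglongrightarrow> s"
  proof -
    have "(\<lambda>n. (z \<circ> r) n / of_real (1 - (\<epsilon> \<circ> r) n)) \<longlonglongrightarrow> s / of_real (1 - 0)"
      by (intro tendsto_intros s(3) LIMSEQ_subseq_LIMSEQ[OF \<epsilon>0 s(2)]) simp
    then show ?thesis by (simp add: fz)
  qed
  have zl: "(\<lambda>n. z (r n)) \<longlonglongrightarrow> s" using s(3) by (simp add: o_def)
  have "horocyclic s f"
    unfolding horocyclic_def
  proof (intro allI impI)
    fix u :: complex assume u: "norm u < 1"
    have "(1 - (norm u)\<^sup>2) * (norm (1 - cnj (f (z n)) * f u))\<^sup>2 \<le> (1 - (norm (f u))\<^sup>2) * (norm (1 - cnj (z n) * u))\<^sup>2" for n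
    proof -
      have p: "1 - (norm (z n))\<^sup>2 > 0" by (rule one_minus_norm_sq_pos[OF z(1)])
      \<comment> \<open>The fixed point of the contracted map satisfies
        \<open>norm (z n) \<le> norm (f (z n))\<close>. So the factors that belong to
        \<open>z n\<close>, which may tend to 0, can be cancelled before the limit is taken.\<close>
      have "norm (z n) = (1 - \<epsilon> n) * norm (f (z n))"
        by (subst z(2)[symmetric]) (use \<epsilon>[of n] in \<open>simp add: norm_mult del: of_real_diff\<close>)
      also have "\<dots> \<le> norm (f (z n))" using \<epsilon>[of n] by (intro mult_left_le_one_le) auto
      finally have le: "1 - (norm (f (z n)))\<^sup>2 \<le> 1 - (norm (z n))\<^sup>2" by (simp add: power_mono)
      have "(1 - (norm (z n))\<^sup>2) * ((1 - (norm u)\<^sup>2) * (norm (1 - cnj (f (z n)) * f u))\<^sup>2)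
          \<le> (1 - (norm (f (z n)))\<^sup>2) * ((1 - (norm (f u))\<^sup>2) * (norm (1 - cnj (z n) * u))\<^sup>2)"
        using Schwarz_Pick_product[OF holf fD z(1)[of n] u] by (simp only: mult.assoc)
      also have "\<dots> \<le> (1 - (norm (z n))\<^sup>2) * ((1 - (norm (f u))\<^sup>2) * (norm (1 - cnj (z n) * u))\<^sup>2)"
        using le one_minus_norm_sq_pos[OF fn[OF u]] by (intro mult_right_mono) auto
      finally show ?thesis using p by (simp only: mult_le_cancel_left_pos)
    qed
    note ineq = this
    show "(1 - (norm u)\<^sup>2) * (norm (1 - cnj s * f u))\<^sup>2 \<le> (1 - (norm (f u))\<^sup>2) * (norm (1 - cnj s * u))\<^sup>2"
    proof (rule tendsto_le[OF sequentially_bot])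
      show "(\<lambda>n. (1 - (norm u)\<^sup>2) * (norm (1 - cnj (f (z (r n))) * f u))\<^sup>2) \<longlonglongrightarrow> (1 - (norm u)\<^sup>2) * (norm (1 - cnj s * f u))\<^sup>2"
        by (intro tendsto_intros fl)
      show "(\<lambda>n. (1 - (norm (f u))\<^sup>2) * (norm (1 - cnj (z (r n)) * u))\<^sup>2) \<longlonglongrightarrow> (1 - (norm (f u))\<^sup>2) * (norm (1 - cnj s * u))\<^sup>2"
        by (intro tendsto_intros zl)
    qed (use ineq in simp)
  qed
  then show thesis using that s(1) by simp
qed

context semigroup_in_disc begin

text \<open>For each step \<open>\<delta> k\<close> one point works for all multiples of the step,
  since the inequality is stable under composition. A limit point of these points, with
  \<open>t\<close> approximated from below by the multiples \<open>T k\<close>, serves all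
  times.\<close>

theorem ex_common_horocyclic:
  obtains s where "norm s \<le> 1" "\<And>t. t \<ge> 0 \<Longrightarrow> horocyclic s (phi t)"
proof -
  define \<delta> where "\<delta> = (\<lambda>k. inverse (real (Suc k)))"
  have \<delta>: "\<delta> k > 0" for k by (simp add: \<delta>_def)
  have "\<exists>s. norm s \<le> 1 \<and> horocyclic s (phi (\<delta> k))" for k
    using ex_horocyclic[OF hol image, of "\<delta> k"] \<delta>[of k] by (metis less_imp_le)
  then obtain s where s: "\<And>k. norm (s k) \<le> 1" "\<And>k. horocyclic (s k) (phi (\<delta> k))" by metis
  have iter: "horocyclic (s k) (phi (real m * \<delta> k))" for k m
  proof (induction m)
    case 0
    then show ?case by (simp add: horocyclic_def phi_0)
  next
    case (Suc m)
    have "horocyclic (s k) (\<lambda>z. phi (\<delta> k) (phi (real m * \<delta> k) z))"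
      by (rule horocyclic_compose[OF s(2) Suc _ s(1)]) (use \<delta>[of k] in_disc in auto)
    moreover have "phi (real (Suc m) * \<delta> k) z = phi (\<delta> k) (phi (real m * \<delta> k) z)" if "norm z < 1" for z
      using phi_add[of "\<delta> k" "real m * \<delta> k" z] \<delta>[of k] that by (simp add: algebra_simps)
    ultimately show ?case by (simp add: horocyclic_def)
  qed
  have "compact (cball (0::complex) 1)" by simp
  then obtain l r where l: "l \<in> cball 0 1" "strict_mono (r :: nat \<Rightarrow> nat)" "(s \<circ> r) \<longlonglongrightarrow> l"
    unfolding compact_def using s(1) by (metis mem_cball_0)
  have sl: "(\<lambda>n. s (r n)) \<longlonglongrightarrow> l" using l(3) by (simp add: o_def)
  have \<delta>0: "\<delta> \<longlonglongrightarrow> 0" unfolding \<delta>_def by (rule LIMSEQ_inverse_real_of_nat)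
  have "horocyclic l (phi t)" if t: "t \<ge> 0" for t
    unfolding horocyclic_def
  proof (intro allI impI)
    fix u :: complex assume u: "norm u < 1"
    define T where "T = (\<lambda>k. real (nat \<lfloor>t / \<delta> k\<rfloor>) * \<delta> k)"
    have Tb: "T k \<le> t" "t - \<delta> k \<le> T k" "T k \<ge> 0" for k
    proof -
      have fl: "real (nat \<lfloor>t / \<delta> k\<rfloor>) = of_int \<lfloor>t / \<delta> k\<rfloor>" using t \<delta>[of k] by simp
      have "of_int \<lfloor>t / \<delta> k\<rfloor> \<le> t / \<delta> k" "t / \<delta> k < of_int \<lfloor>t / \<delta> k\<rfloor> + 1" by linarith+
      then have "of_int \<lfloor>t / \<delta> k\<rfloor> * \<delta> k \<le> t" "t \<le> (of_int \<lfloor>t / \<delta> k\<rfloor> + 1) * \<delta> k"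
        using mult_right_mono[of "of_int \<lfloor>t / \<delta> k\<rfloor>" "t / \<delta> k" "\<delta> k"]
          mult_right_mono[of "t / \<delta> k" "of_int \<lfloor>t / \<delta> k\<rfloor> + 1" "\<delta> k"] \<delta>[of k]
        by (simp_all add: less_imp_le)
      then show "T k \<le> t" "t - \<delta> k \<le> T k" unfolding T_def fl by (auto simp: algebra_simps)
      show "T k \<ge> 0" using \<delta>[of k] by (simp add: T_def)
    qed
    have Tl: "T \<longlonglongrightarrow> t"
    proof (rule tendsto_sandwich)
      show "(\<lambda>k. t - \<delta> k) \<longlonglongrightarrow> t" using tendsto_diff[OF tendsto_const \<delta>0, of t] by simp
      show "(\<lambda>k. t) \<longlonglongrightarrow> t" by simp
    qed (use Tb in auto)
    have Trl: "(\<lambda>n. T (r n)) \<longlonglongrightarrow> t" using LIMSEQ_subseq_LIMSEQ[OF Tl l(2)] by (simp add: o_def)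
    have pl: "(\<lambda>n. phi (T (r n)) u) \<longlonglongrightarrow> phi t u"
      by (rule continuous_on_tendsto_compose[OF cont_in_t[OF u] Trl]) (use t Tb in auto)
    have ineq: "(1 - (norm u)\<^sup>2) * (norm (1 - cnj (s k) * phi (T k) u))\<^sup>2
        \<le> (1 - (norm (phi (T k) u))\<^sup>2) * (norm (1 - cnj (s k) * u))\<^sup>2" for k
      using iter[of k "nat \<lfloor>t / \<delta> k\<rfloor>"] u by (simp add: horocyclic_def T_def)
    show "(1 - (norm u)\<^sup>2) * (norm (1 - cnj l * phi t u))\<^sup>2 \<le> (1 - (norm (phi t u))\<^sup>2) * (norm (1 - cnj l * u))\<^sup>2"
    proof (rule tendsto_le[OF sequentially_bot])
      show "(\<lambda>n. (1 - (norm u)\<^sup>2) * (norm (1 - cnj (s (r n)) * phi (T (r n)) u))\<^sup>2)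
          \<longlonglongrightarrow> (1 - (norm u)\<^sup>2) * (norm (1 - cnj l * phi t u))\<^sup>2"
        by (intro tendsto_intros sl pl)
      show "(\<lambda>n. (1 - (norm (phi (T (r n)) u))\<^sup>2) * (norm (1 - cnj (s (r n)) * u))\<^sup>2)
          \<longlonglongrightarrow> (1 - (norm (phi t u))\<^sup>2) * (norm (1 - cnj l * u))\<^sup>2"
        by (intro tendsto_intros sl pl)
    qed (use ineq in simp)
  qed
  then show thesis using that l(1) by simp
qed

end

section \<open>Half-plane charts and exceptional orbits\<close>

lemma lipschitz_of_derivative_bound:
  fixes \<gamma> :: "real \<Rightarrow> complex"
  assumes cont: "continuous_on {0..} \<gamma>" and B: "B \<ge> 0"
    and d: "\<And>s. s > 0 \<Longrightarrow> (\<gamma> has_vector_derivative \<gamma>' s) (at s) \<and> norm (\<gamma>' s) \<le> B"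
  shows "B-lipschitz_on {0..} \<gamma>"
proof -
  have "B-lipschitz_on {0<..} \<gamma>"
  proof (rule lipschitz_onI[OF _ B])
    fix x y :: real assume xy: "x \<in> {0<..}" "y \<in> {0<..}"
    have "norm (\<gamma> x - \<gamma> y) \<le> B * norm (x - y)"
    proof (rule differentiable_bound[of "{0<..}" \<gamma> "\<lambda>s t. t *\<^sub>R \<gamma>' s"])
      show "(\<gamma> has_derivative (\<lambda>t. t *\<^sub>R \<gamma>' s)) (at s within {0<..})" if "s \<in> {0<..}" for s
        using d[of s] that by (auto simp: has_vector_derivative_def intro: has_derivative_at_withinI)
      show "onorm (\<lambda>t. t *\<^sub>R \<gamma>' s) \<le> B" if "s \<in> {0<..}" for s
        using d[of s] that by (intro onorm_le) (auto simp: mult.commute[of B] intro!: mult_left_mono)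
    qed (use xy in auto)
    then show "dist (\<gamma> x) (\<gamma> y) \<le> B * dist x y" by (simp add: dist_norm)
  qed
  then show ?thesis using lipschitz_on_closure[of B "{0<..}" \<gamma>] cont by simp
qed

text \<open>Common frame for boundary and interior fixed points. In the instances \<open>c\<close>
  covers the disc or the punctured disc, \<open>F\<close> is the lifted semigroup and
  \<open>chat\<close> the boundary value of \<open>c\<close>. By \<open>comparison\<close> the
  points of a Stolz region stay at bounded pseudo-hyperbolic distance from the image of the vertical
  line over \<open>x0\<close>, and by \<open>stolz\<close> this image is itself nontangential.
  Together they exchange unimodular nontangential limits of \<open>phi t\<close> with limits along
  the vertical line.\<close>

locale boundary_chart = semigroup_in_disc +
  fixes \<zeta> :: complex and c :: "complex \<Rightarrow> complex" and chat :: "real \<Rightarrow> complex" and x0 :: real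
    and F :: "real \<Rightarrow> complex \<Rightarrow> complex" and G :: "complex \<Rightarrow> complex"
  assumes c_cont: "continuous_on uhp c"
    and c_disc: "\<And>w. Im w > 0 \<Longrightarrow> norm (c w) < 1"
    and c_lim: "\<And>x. (c \<longlongrightarrow> chat x) (at (of_real x) within uhp)"
    and chat_norm: "\<And>x. norm (chat x) = 1"
    and chat_x0: "chat x0 = \<zeta>"
    and c_F: "\<And>t w. t \<ge> 0 \<Longrightarrow> Im w > 0 \<Longrightarrow> phi t (c w) = c (F t w)"
    and hol_G: "G holomorphic_on uhp"
    and F_0: "\<And>z. Im z > 0 \<Longrightarrow> F 0 z = z"
    and F_Im: "\<And>t z. t \<ge> 0 \<Longrightarrow> Im z > 0 \<Longrightarrow> Im (F t z) \<ge> Im z"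
    and F_deriv: "\<And>t z. t \<ge> 0 \<Longrightarrow> Im z > 0 \<Longrightarrow> ((\<lambda>t. F t z) has_vector_derivative G (F t z)) (at t within {0..})"
    and comparison: "\<And>M. M > 1 \<Longrightarrow> \<exists>\<rho><1. \<exists>Y. filterlim Y (at_right 0) (at \<zeta> within stolz_region \<zeta> M) \<and>
        (\<forall>\<^sub>F z in at \<zeta> within stolz_region \<zeta> M. pdist z (c (Complex x0 (Y z))) \<le> \<rho>)"
    and stolz: "\<exists>M>1. \<forall>\<^sub>F y in at_right 0. c (Complex x0 y) \<in> stolz_region \<zeta> M"
begin

lemma \<zeta>_sphere: "\<zeta> \<in> sphere 0 1" using chat_norm[of x0] chat_x0 by simp

lemma Complex_to_real: "filterlim (\<lambda>y. Complex x0 y) (at (of_real x0) within uhp) (at_right 0)"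
proof -
  have "((\<lambda>v. Complex x0 v) \<longlongrightarrow> Complex x0 0) (at_right 0)" by (intro tendsto_intros)
  then have "((\<lambda>v. Complex x0 v) \<longlongrightarrow> of_real x0) (at_right 0)" by (simp add: complex_of_real_def)
  then show ?thesis unfolding filterlim_at using eventually_at_right_less[of 0]
    by (auto elim!: eventually_mono simp: complex_eq_iff)
qed

lemma nontangential_of_vertical:
  assumes t: "t \<ge> 0" and lim: "((\<lambda>y. phi t (c (Complex x0 y))) \<longlongrightarrow> a) (at_right 0)" and a: "norm a = 1"
  shows "(phi t \<longlongrightarrow> a) (nontangential_at \<zeta>)"
  unfolding tendsto_nontangential_iff
proof (intro allI impI)
  fix M :: real assume "M > 1"
  then obtain \<rho> Y where \<rho>: "\<rho> < 1" and Y: "filterlim Y (at_right 0) (at \<zeta> within stolz_region \<zeta> M)"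
    and ev: "\<forall>\<^sub>F z in at \<zeta> within stolz_region \<zeta> M. pdist z (c (Complex x0 (Y z))) \<le> \<rho>"
    using comparison by blast
  have Ypos: "\<forall>\<^sub>F z in at \<zeta> within stolz_region \<zeta> M. Y z > 0"
    using Y unfolding filterlim_at by (auto elim: eventually_mono)
  have inD: "\<forall>\<^sub>F z in at \<zeta> within stolz_region \<zeta> M. norm z < 1"
    unfolding eventually_at_filter by (auto simp: stolz_region_def)
  show "(phi t \<longlongrightarrow> a) (at \<zeta> within stolz_region \<zeta> M)"
  proof (rule tendsto_of_pdist_le[OF _ a \<rho>])
    show "((\<lambda>z. phi t (c (Complex x0 (Y z)))) \<longlongrightarrow> a) (at \<zeta> within stolz_region \<zeta> M)"
      by (rule filterlim_compose[OF lim Y])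
    show "\<forall>\<^sub>F z in at \<zeta> within stolz_region \<zeta> M. norm (phi t z) < 1 \<and> norm (phi t (c (Complex x0 (Y z)))) < 1
        \<and> pdist (phi t z) (phi t (c (Complex x0 (Y z)))) \<le> \<rho>"
      using ev Ypos inD
    proof eventually_elim
      case (elim z)
      have cD: "norm (c (Complex x0 (Y z))) < 1" using c_disc elim by simp
      show ?case using in_disc[OF t elim(3)] in_disc[OF t cD] pick[OF t elim(3) cD] elim(1) by simp
    qed
  qed
qed

lemma vertical_to_nontangential: "filterlim (\<lambda>y. c (Complex x0 y)) (nontangential_at \<zeta>) (at_right 0)"
proof -
  obtain M where M: "M > 1" "\<forall>\<^sub>F y in at_right 0. c (Complex x0 y) \<in> stolz_region \<zeta> M" using stolz by blast
  have l: "((\<lambda>y. c (Complex x0 y)) \<longlongrightarrow> \<zeta>) (at_right 0)"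
    using filterlim_compose[OF c_lim[of x0] Complex_to_real] chat_x0 by simp
  have "filterlim (\<lambda>y. c (Complex x0 y)) (at \<zeta> within stolz_region \<zeta> M) (at_right 0)"
    unfolding filterlim_at
  proof (intro conjI l)
    show "\<forall>\<^sub>F y in at_right 0. c (Complex x0 y) \<in> stolz_region \<zeta> M \<and> c (Complex x0 y) \<noteq> \<zeta>"
      using M(2) by eventually_elim (use \<zeta>_sphere in \<open>auto simp: stolz_region_def\<close>)
  qed
  moreover have "at \<zeta> within stolz_region \<zeta> M \<le> nontangential_at \<zeta>"
    unfolding nontangential_at_def by (rule SUP_upper) (use M in auto)
  ultimately show ?thesis by (rule filterlim_mono) simp
qed

theorem exceptional_boundary_curve:
  assumes life: "life_time phi \<zeta> = \<infinity>" and nf: "\<not> fixed_boundary_point phi \<zeta>"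
  shows "\<exists>X X' \<sigma>. boundary_curve G F x0 X X' \<sigma> \<and> (\<forall>t\<ge>0. boundary_orbit phi \<zeta> t = chat (X t))"
proof -
  have F_uhp: "Im (F t z) > 0" if "t \<ge> 0" "Im z > 0" for t z using F_Im[OF that] that by simp
  have push: "((\<lambda>y. phi t (c (Complex x0 y))) \<longlongrightarrow> chat x) (at_right 0)"
    if t: "t \<ge> 0" and l: "((\<lambda>y. F t (Complex x0 y)) \<longlongrightarrow> of_real x) (at_right 0)" for t x
  proof -
    have "filterlim (\<lambda>y. F t (Complex x0 y)) (at (of_real x) within uhp) (at_right 0)"
      unfolding filterlim_at
    proof (intro conjI l)
      show "\<forall>\<^sub>F y in at_right 0. F t (Complex x0 y) \<in> uhp \<and> F t (Complex x0 y) \<noteq> of_real x"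
        using eventually_at_right_less[of 0]
      proof eventually_elim
        case (elim y)
        then have "Im (F t (Complex x0 y)) > 0" by (intro F_uhp t) simp
        then show ?case by auto
      qed
    qed
    from filterlim_compose[OF c_lim this]
    have "((\<lambda>y. c (F t (Complex x0 y))) \<longlongrightarrow> chat x) (at_right 0)" .
    then show ?thesis
    proof (rule Lim_transform_eventually)
      show "\<forall>\<^sub>F y in at_right 0. c (F t (Complex x0 y)) = phi t (c (Complex x0 y))"
        using eventually_at_right_less[of 0] by eventually_elim (simp add: c_F t)
    qed
  qed
  have leaves: "\<forall>\<^sub>F y in at_right 0. F t (Complex x0 y) \<notin> K"
    if K: "compact K" "K \<subseteq> uhp" and t: "t \<ge> 0" for K t
  proof -
    \<comment> \<open>The infinite life-time provides a later time \<open>T\<close> whose limit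
      \<open>w\<close> is on the unit circle. If \<open>F t\<close> were in \<open>K\<close>, then
      \<open>phi T\<close> would be in the compact subset \<open>K'\<close> of the open disc, away
      from \<open>w\<close>.\<close>
    have "ereal t < life_time phi \<zeta>" using life by simp
    then obtain T w where T: "t < T" "norm w = 1" "(phi T \<longlongrightarrow> w) (nontangential_at \<zeta>)"
      unfolding life_time_def less_Sup_iff by auto
    define K' where "K' = phi (T - t) ` c ` K"
    have cK: "c ` K \<subseteq> ball 0 1" using K c_disc by auto
    have compcK: "compact (c ` K)" by (intro compact_continuous_image continuous_on_subset[OF c_cont] K)
    then have "compact K'" unfolding K'_def
      using continuous_on_subset[OF holomorphic_on_imp_continuous_on[OF hol[of "T - t"]] cK] T
      by (intro compact_continuous_image[OF _ compcK]) auto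
    then have "closed K'" by (rule compact_imp_closed)
    moreover have "w \<notin> K'" using T(2) image[of "T - t"] T(1) cK unfolding K'_def by fastforce
    ultimately have "open (- K')" "w \<in> - K'" by auto
    from topological_tendstoD[OF filterlim_compose[OF T(3) vertical_to_nontangential] this]
    have "\<forall>\<^sub>F y in at_right 0. phi T (c (Complex x0 y)) \<in> - K'" .
    then show ?thesis using eventually_at_right_less[of 0]
    proof eventually_elim
      case (elim y)
      have D: "norm (c (Complex x0 y)) < 1" using elim by (intro c_disc) simp
      have "phi T (c (Complex x0 y)) = phi (T - t) (phi t (c (Complex x0 y)))"
        using phi_add[of "T - t" t "c (Complex x0 y)"] T t D by simp
      also have "phi t (c (Complex x0 y)) = c (F t (Complex x0 y))" using elim t by (intro c_F) auto
      finally show ?case using elim by (auto simp: K'_def)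
    qed
  qed
  have nonfixed: "\<exists>t\<ge>0. \<not> ((\<lambda>y. F t (Complex x0 y)) \<longlongrightarrow> of_real x0) (at_right 0)"
  proof (rule ccontr)
    assume neg: "\<not> ?thesis"
    have "(phi t \<longlongrightarrow> \<zeta>) (nontangential_at \<zeta>)" if t: "t \<ge> 0" for t
    proof (rule nontangential_of_vertical[OF t])
      show "((\<lambda>y. phi t (c (Complex x0 y))) \<longlongrightarrow> \<zeta>) (at_right 0)"
        using push[OF t, of x0] neg t chat_x0 by auto
      show "norm \<zeta> = 1" using \<zeta>_sphere by simp
    qed
    then show False using nf by (simp add: fixed_boundary_point_def)
  qed
  obtain X X' \<sigma> where bc: "boundary_curve G F x0 X X' \<sigma>"
    using half_plane_flow_boundary_curve[OF hol_G F_0 F_Im F_deriv leaves nonfixed] by blast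
  have "boundary_orbit phi \<zeta> t = chat (X t)" if t: "t \<ge> 0" for t
  proof -
    have "((\<lambda>y. F t (Complex x0 y)) \<longlongrightarrow> of_real (X t)) (at_right 0)" using bc t by (simp add: boundary_curve_def)
    from nontangential_of_vertical[OF t push[OF t this] chat_norm]
    show ?thesis unfolding boundary_orbit_def by (intro tendsto_Lim nontangential_at_neq_bot \<zeta>_sphere)
  qed
  then show ?thesis using bc by blast
qed

theorem exceptional_lipschitz:
  assumes life: "life_time phi \<zeta> = \<infinity>" and nf: "\<not> fixed_boundary_point phi \<zeta>"
    and dchat: "\<And>x. (chat has_vector_derivative chat' x) (at x)"
    and bound: "\<And>X X' \<sigma>. boundary_curve G F x0 X X' \<sigma> \<Longrightarrow> \<exists>B. \<forall>s>0. \<bar>X' s\<bar> * norm (chat' (X s)) \<le> B"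
  shows "lipschitz_orbit phi \<zeta>"
proof -
  obtain X X' \<sigma> where bc: "boundary_curve G F x0 X X' \<sigma>"
    and orb: "\<And>t. t \<ge> 0 \<Longrightarrow> boundary_orbit phi \<zeta> t = chat (X t)"
    using exceptional_boundary_curve[OF life nf] by blast
  obtain B where B: "\<And>s. s > 0 \<Longrightarrow> \<bar>X' s\<bar> * norm (chat' (X s)) \<le> B" using bound[OF bc] by blast
  have B0: "B \<ge> 0" using B[of 1] by (intro order_trans[OF _ B[of 1]]) auto
  have dX: "(X has_real_derivative X' s) (at s)" if "s > 0" for s using bc that by (simp add: boundary_curve_def)
  have contX: "continuous_on {0..} X"
    unfolding continuous_on_def
  proof
    fix s :: real assume s: "s \<in> {0..}"
    show "(X \<longlongrightarrow> X s) (at s within {0..})"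
    proof (cases "s = 0")
      case True
      then show ?thesis using bc by (simp add: boundary_curve_def at_within_Ici_at_right)
    next
      case False
      then have "isCont X s" using dX[of s] s DERIV_isCont by auto
      then show ?thesis unfolding isCont_def by (rule tendsto_within_subset) simp
    qed
  qed
  have contchat: "continuous_on UNIV chat"
    using dchat has_vector_derivative_continuous continuous_at_imp_continuous_on by blast
  have "B-lipschitz_on {0..} (\<lambda>t. chat (X t))"
  proof (rule lipschitz_of_derivative_bound[OF _ B0])
    show "continuous_on {0..} (\<lambda>t. chat (X t))"
      by (rule continuous_on_compose2[OF contchat contX]) simp
    fix s :: real assume s: "s > 0"
    have "((chat \<circ> X) has_vector_derivative X' s *\<^sub>R chat' (X s)) (at s)"
      by (rule vector_diff_chain_at) (use dX[OF s] dchat in \<open>auto simp: has_real_derivative_iff_has_vector_derivative\<close>)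
    then show "((\<lambda>t. chat (X t)) has_vector_derivative X' s *\<^sub>R chat' (X s)) (at s) \<and> norm (X' s *\<^sub>R chat' (X s)) \<le> B"
      using B[OF s] by (simp add: o_def)
  qed
  then have "B-lipschitz_on {0..} (boundary_orbit phi \<zeta>)"
    by (rule lipschitz_on_transform) (use orb in auto)
  moreover have "orbit_interval phi \<zeta> = {0..}" by (auto simp: orbit_interval_def life)
  ultimately have "B-lipschitz_on (orbit_interval phi \<zeta>) (boundary_orbit phi \<zeta>)" by simp
  then have "(B + 1)-lipschitz_on (orbit_interval phi \<zeta>) (boundary_orbit phi \<zeta>)"
    by (rule lipschitz_on_mono) auto
  then show ?thesis unfolding lipschitz_orbit_def using B0 by (intro exI[of _ "B + 1"]) auto
qed

end

section \<open>The chart at a boundary Denjoy-Wolff point\<close>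

lemma cayley_of_inverse:
  assumes "k \<noteq> 1" "w = \<i> * (1 + k) / (1 - k)"
  shows "(w - \<i>) / (w + \<i>) = k"
proof -
  have nz: "1 - k \<noteq> 0" using assms by simp
  have "w - \<i> = 2 * \<i> * k / (1 - k)" "w + \<i> = 2 * \<i> / (1 - k)"
    using nz by (simp_all add: assms(2) field_simps)
  then show ?thesis using nz by simp
qed

lemma norm_one_minus_power2: "(norm (1 - k))\<^sup>2 = (1 - Re k)\<^sup>2 + (Im k)\<^sup>2"
  by (simp add: cmod_power2)

lemma cayley_diff:
  assumes "a + \<i> \<noteq> 0" "b + \<i> \<noteq> 0"
  shows "(a - \<i>) / (a + \<i>) - (b - \<i>) / (b + \<i>) = 2 * \<i> * (a - b) / ((a + \<i>) * (b + \<i>))"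
  using assms by (simp add: divide_simps) (simp add: algebra_simps)

lemma pdist_cayley:
  assumes a: "Im a > 0" and b: "Im b > 0"
  shows "pdist ((a - \<i>) / (a + \<i>)) ((b - \<i>) / (b + \<i>)) = norm (a - b) / norm (cnj a - b)"
proof -
  have nz: "a + \<i> \<noteq> 0" "b + \<i> \<noteq> 0" "cnj a - \<i> \<noteq> 0" using a b by (auto simp: complex_eq_iff)
  have c: "cnj ((a - \<i>) / (a + \<i>)) = (cnj a + \<i>) / (cnj a - \<i>)" by simp
  have "1 - cnj ((a - \<i>) / (a + \<i>)) * ((b - \<i>) / (b + \<i>)) = 2 * \<i> * (cnj a - b) / ((cnj a - \<i>) * (b + \<i>))"
    unfolding c using nz by (simp add: divide_simps) (simp add: algebra_simps)
  moreover have "norm (cnj a - \<i>) = norm (a + \<i>)"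
    by (metis complex_cnj_add complex_cnj_i complex_mod_cnj uminus_add_conv_diff add.commute)
  ultimately show ?thesis unfolding pdist_def cayley_diff[OF nz(1,2)]
    using nz by (simp add: norm_divide norm_mult)
qed

lemma norm_cayley_power2:
  assumes "Im w > 0"
  shows "1 - (norm ((w - \<i>) / (w + \<i>)))\<^sup>2 = 4 * Im w / (norm (w + \<i>))\<^sup>2"
proof -
  have "w + \<i> \<noteq> 0" using assms by (auto simp: complex_eq_iff)
  then have nz: "(norm (w + \<i>))\<^sup>2 \<noteq> 0" by simp
  have "(norm (w + \<i>))\<^sup>2 - (norm (w - \<i>))\<^sup>2 = 4 * Im w"
    unfolding cmod_power2 by (simp add: power2_eq_square algebra_simps)
  moreover have "1 - (norm ((w - \<i>) / (w + \<i>)))\<^sup>2 = ((norm (w + \<i>))\<^sup>2 - (norm (w - \<i>))\<^sup>2) / (norm (w + \<i>))\<^sup>2"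
    unfolding norm_divide power_divide using nz by (simp add: diff_divide_distrib)
  ultimately show ?thesis by simp
qed

locale boundary_denjoy_wolff = semigroup_in_disc +
  fixes \<tau> \<zeta> :: complex
  assumes \<tau>: "norm \<tau> = 1" and \<zeta>: "norm \<zeta> = 1" and neq: "\<zeta> \<noteq> \<tau>"
    and horo: "\<And>t. t \<ge> 0 \<Longrightarrow> horocyclic \<tau> (phi t)"
begin

text \<open>The inverse chart \<open>C\<close> sends \<open>\<tau>\<close> to infinity. Horodisks at
  \<open>\<tau>\<close> become half-planes bounded by horizontal lines, so their invariance says
  that heights do not decrease under \<open>F\<close>. \<open>G\<close> is the generator in this
  coordinate; its first factor is the derivative of \<open>C\<close>.\<close>

definition "c w = \<tau> * ((w - \<i>) / (w + \<i>))"
definition "C z = \<i> * (1 + cnj \<tau> * z) / (1 - cnj \<tau> * z)"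
definition "x0 = Re (C \<zeta>)"
definition "F t w = C (phi t (c w))"
definition "G w = 2 * \<i> * cnj \<tau> / (1 - cnj \<tau> * c w)\<^sup>2 * gen (c w)"

lemma \<tau>\<tau>: "cnj \<tau> * \<tau> = 1"
  using complex_norm_square[of \<tau>] \<tau> by (simp add: mult.commute)

lemma nz1: "z \<noteq> \<tau> \<Longrightarrow> cnj \<tau> * z \<noteq> 1"
  using \<tau>\<tau> by (metis mult_left_cancel mult_zero_left zero_neq_one)

lemma c_disc: "Im w > 0 \<Longrightarrow> norm (c w) < 1"
  unfolding c_def norm_mult \<tau> using cayley_norm_less_1[of w] by simp

lemma C_c: assumes "Im w > 0" shows "C (c w) = w"
proof -
  have "cnj \<tau> * c w = (cnj \<tau> * \<tau>) * ((w - \<i>) / (w + \<i>))" by (simp only: c_def mult.assoc)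
  then have "cnj \<tau> * c w = (w - \<i>) / (w + \<i>)" by (simp add: \<tau>\<tau>)
  from cayley_inverse[OF assms this] show ?thesis unfolding C_def by simp
qed

lemma c_C: assumes "z \<noteq> \<tau>" shows "c (C z) = z"
proof -
  have "c (C z) = \<tau> * (cnj \<tau> * z)"
    unfolding c_def by (rule arg_cong[of _ _ "\<lambda>u. \<tau> * u"], rule cayley_of_inverse[OF nz1[OF assms]]) (simp add: C_def)
  also have "\<dots> = (cnj \<tau> * \<tau>) * z" by (simp only: mult_ac)
  finally show ?thesis by (simp add: \<tau>\<tau>)
qed

lemma disc_neq: "norm z < 1 \<Longrightarrow> z \<noteq> \<tau>" using \<tau> by auto

lemma Im_C: "Im (C z) = (1 - (norm z)\<^sup>2) / (norm (1 - cnj \<tau> * z))\<^sup>2"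
  unfolding C_def Im_cayley_inverse_eq norm_one_minus_power2 by (simp add: norm_mult \<tau>)

lemma Im_C_pos: assumes "norm z < 1" shows "Im (C z) > 0"
  unfolding Im_C using one_minus_norm_sq_pos[OF assms] norm_one_minus_cnj_mult_pos[of \<tau> z] assms \<tau> by simp

lemma C_deriv: "z \<noteq> \<tau> \<Longrightarrow> (C has_field_derivative 2 * \<i> * cnj \<tau> / (1 - cnj \<tau> * z)\<^sup>2) (at z)"
  unfolding C_def using nz1[of z]
  by (auto intro!: derivative_eq_intros simp: power2_eq_square divide_simps) (simp add: algebra_simps)

lemma C_\<zeta>: "C \<zeta> = of_real x0"
proof -
  have "norm (cnj \<tau> * \<zeta>) = 1" using \<tau> \<zeta> by (simp add: norm_mult)
  from cayley_inverse_unit[OF this] have "Im (C \<zeta>) = 0" by (simp add: C_def)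
  then show ?thesis by (simp add: x0_def complex_eq_iff)
qed

lemma of_real_i_nz: "of_real x + \<i> \<noteq> 0" by (auto simp: complex_eq_iff)

lemma uhp_i_nz: "Im w > 0 \<Longrightarrow> w + \<i> \<noteq> 0" by (auto simp: complex_eq_iff)

lemma C_diff:
  assumes "z \<noteq> \<tau>"
  shows "norm (C z - of_real x0) = 2 * norm (z - \<zeta>) / (norm (1 - cnj \<tau> * z) * norm (1 - cnj \<tau> * \<zeta>))"
proof -
  have nz: "1 - cnj \<tau> * z \<noteq> 0" "1 - cnj \<tau> * \<zeta> \<noteq> 0" using nz1[OF assms] nz1[OF neq] by auto
  have "C z - C \<zeta> = 2 * \<i> * (cnj \<tau> * (z - \<zeta>)) / ((1 - cnj \<tau> * z) * (1 - cnj \<tau> * \<zeta>))"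
    unfolding C_def using nz by (simp add: divide_simps) (simp add: algebra_simps)
  then show ?thesis using \<tau> by (simp add: C_\<zeta> norm_divide norm_mult)
qed

sublocale boundary_chart phi \<zeta> c "\<lambda>x. c (of_real x)" x0 F G
proof
  have cC: "isCont c w" if "w + \<i> \<noteq> 0" for w
    unfolding c_def by (intro continuous_intros that)
  show "continuous_on uhp c"
    by (intro continuous_at_imp_continuous_on ballI cC uhp_i_nz) simp
  show "norm (c w) < 1" if "Im w > 0" for w by (rule c_disc[OF that])
  show "(c \<longlongrightarrow> c (of_real x)) (at (of_real x) within uhp)" for x
    using cC[OF of_real_i_nz] unfolding isCont_def by (rule tendsto_within_subset) simp
  show "norm (c (of_real x)) = 1" for x
  proof -
    have "norm (of_real x - \<i>) = norm (of_real x + \<i>)" by (simp add: cmod_def)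
    then show ?thesis using \<tau> of_real_i_nz[of x] by (simp add: c_def norm_mult norm_divide)
  qed
  show "c (of_real x0) = \<zeta>" using c_C[OF neq] C_\<zeta> by simp
  show "phi t (c w) = c (F t w)" if "t \<ge> 0" "Im w > 0" for t w
    unfolding F_def using c_C[OF disc_neq[OF in_disc[OF that(1) c_disc[OF that(2)]]]] by simp
  have holc: "c holomorphic_on uhp"
    unfolding c_def using uhp_i_nz by (intro holomorphic_intros) auto
  show "G holomorphic_on uhp"
    unfolding G_def
  proof (intro holomorphic_intros holc)
    show "(\<lambda>w. gen (c w)) holomorphic_on uhp"
      by (rule holomorphic_on_compose_gen[unfolded o_def, OF holc hol_gen]) (use c_disc in auto)
    show "(1 - cnj \<tau> * c z)\<^sup>2 \<noteq> 0" if "z \<in> uhp" for z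
      using nz1[OF disc_neq[OF c_disc]] that by auto
  qed
  show "F 0 z = z" if "Im z > 0" for z
    unfolding F_def using phi_0[OF c_disc[OF that]] C_c[OF that] by simp
  show "Im (F t z) \<ge> Im z" if t: "t \<ge> 0" and z: "Im z > 0" for t z
  proof -
    define u where "u = c z"
    have u: "norm u < 1" unfolding u_def by (rule c_disc[OF z])
    have p: "(norm (1 - cnj \<tau> * u))\<^sup>2 > 0" "(norm (1 - cnj \<tau> * phi t u))\<^sup>2 > 0"
      using norm_one_minus_cnj_mult_pos[of \<tau>] \<tau> u in_disc[OF t u] by auto
    have "(1 - (norm u)\<^sup>2) * (norm (1 - cnj \<tau> * phi t u))\<^sup>2 \<le> (1 - (norm (phi t u))\<^sup>2) * (norm (1 - cnj \<tau> * u))\<^sup>2"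
      using horo[OF t] u by (simp add: horocyclic_def)
    then have "Im (C u) \<le> Im (C (phi t u))"
      unfolding Im_C using p by (simp add: divide_le_eq le_divide_eq mult.commute)
    then show ?thesis unfolding F_def u_def C_c[OF z] .
  qed
  show "((\<lambda>t. F t z) has_vector_derivative G (F t z)) (at t within {0..})" if t: "t \<ge> 0" and z: "Im z > 0" for t z
  proof -
    define u where "u = phi t (c z)"
    have u: "norm u < 1" unfolding u_def by (rule in_disc[OF t c_disc[OF z]])
    have "((C \<circ> (\<lambda>t. phi t (c z))) has_vector_derivative gen u * (2 * \<i> * cnj \<tau> / (1 - cnj \<tau> * u)\<^sup>2)) (at t within {0..})"
      unfolding u_def
      by (rule field_vector_diff_chain_within[OF gen_deriv[OF c_disc[OF z] t]])
        (use C_deriv[OF disc_neq[OF u]] in \<open>simp add: u_def has_field_derivative_at_within\<close>)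
    moreover have "c (F t z) = u" unfolding F_def u_def[symmetric] by (rule c_C[OF disc_neq[OF u]])
    ultimately show ?thesis by (simp add: o_def F_def[symmetric] G_def mult.commute)
  qed
  have z\<zeta>: "norm (1 - cnj \<tau> * \<zeta>) > 0" using nz1[OF neq] by simp
  show "\<exists>\<rho><1. \<exists>Y. filterlim Y (at_right 0) (at \<zeta> within stolz_region \<zeta> M) \<and>
        (\<forall>\<^sub>F z in at \<zeta> within stolz_region \<zeta> M. pdist z (c (Complex x0 (Y z))) \<le> \<rho>)" if M: "M > 1" for M
  proof -
    \<comment> \<open>\<open>M'\<close> bounds the ratio of the offset of \<open>C z\<close> from
      the vertical line to its height. \<open>C_diff\<close> and the Stolz condition contribute
      \<open>2 * M / norm (1 - cnj \<tau> * \<zeta>)\<close>, and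
      \<open>norm (1 - cnj \<tau> * z) \<le> 2\<close> the remaining factor.\<close>
    define M' where "M' = 4 * M / norm (1 - cnj \<tau> * \<zeta>)"
    have M': "M' > 0" using M z\<zeta> by (simp add: M'_def)
    \<comment> \<open>Points at equal height \<open>v\<close> and horizontal distance
      \<open>d\<close> have pseudo-hyperbolic distance
      \<open>d / sqrt (d\<^sup>2 + 4 * v\<^sup>2)\<close>; this is its value for
      \<open>d = M' * v\<close>.\<close>
    define \<rho> where "\<rho> = M' / sqrt (M'\<^sup>2 + 4)"
    have sq: "sqrt (M'\<^sup>2 + 4) > M'" using M' by (intro real_less_rsqrt) simp
    have "sqrt (M'\<^sup>2 + 4) > 0" using sq M' by linarith
    then have \<rho>: "\<rho> < 1" using sq by (simp add: \<rho>_def)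
    have "((\<lambda>z. Im (C z)) \<longlongrightarrow> Im (C \<zeta>)) (at \<zeta> within stolz_region \<zeta> M)"
      by (intro tendsto_Im) (use DERIV_isCont[OF C_deriv[OF neq]] in \<open>auto simp: isCont_def intro: tendsto_within_subset\<close>)
    then have "((\<lambda>z. Im (C z)) \<longlongrightarrow> 0) (at \<zeta> within stolz_region \<zeta> M)" by (simp add: C_\<zeta>)
    moreover have "\<forall>\<^sub>F z in at \<zeta> within stolz_region \<zeta> M. Im (C z) > 0"
      unfolding eventually_at_filter using Im_C_pos by (auto simp: stolz_region_def)
    ultimately have Y: "filterlim (\<lambda>z. Im (C z)) (at_right 0) (at \<zeta> within stolz_region \<zeta> M)"
      unfolding filterlim_at by (auto elim: eventually_mono)
    have pd: "pdist z (c (Complex x0 (Im (C z)))) \<le> \<rho>" if z: "z \<in> stolz_region \<zeta> M" for z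
    proof -
      have zD: "norm z < 1" and zM: "norm (z - \<zeta>) < M * (1 - norm z)" using z by (auto simp: stolz_region_def dist_norm)
      define v where "v = Im (C z)"
      define d where "d = \<bar>Re (C z) - x0\<bar>"
      have v: "v > 0" unfolding v_def by (rule Im_C_pos[OF zD])
      define A where "A = norm (1 - cnj \<tau> * z)"
      have A: "A > 0" using nz1[OF disc_neq[OF zD]] by (simp add: A_def)
      have A2: "A \<le> 2"
      proof -
        have "A \<le> norm (1::complex) + norm (cnj \<tau> * z)" unfolding A_def by (rule norm_triangle_ineq4)
        then show ?thesis using \<tau> zD by (simp add: norm_mult)
      qed
      have "d \<le> norm (C z - of_real x0)" unfolding d_def using abs_Re_le_cmod[of "C z - of_real x0"] by simp
      also have "\<dots> = 2 * norm (z - \<zeta>) / (A * norm (1 - cnj \<tau> * \<zeta>))" unfolding A_def by (rule C_diff[OF disc_neq[OF zD]])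
      also have "\<dots> \<le> 2 * (M * (1 - (norm z)\<^sup>2)) / (A * norm (1 - cnj \<tau> * \<zeta>))"
      proof (intro divide_right_mono mult_left_mono)
        have "(norm z)\<^sup>2 \<le> norm z" using zD by (simp add: power2_eq_square mult_left_le_one_le)
        then have "M * (1 - norm z) \<le> M * (1 - (norm z)\<^sup>2)" using M by (intro mult_left_mono) auto
        then show "norm (z - \<zeta>) \<le> M * (1 - (norm z)\<^sup>2)" using zM by linarith
      qed (use A in auto)
      also have "\<dots> = M' / 2 * (v * A)"
      proof -
        have "2 * (M * P) / (A * E) = 4 * M / E / 2 * (P / A\<^sup>2 * A)" if "E > 0" for P E
          using A that by (simp add: power2_eq_square mult_ac)
        from this[OF z\<zeta>] show ?thesis unfolding v_def Im_C A_def M'_def .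
      qed
      also have "\<dots> \<le> M' / 2 * (v * 2)" using M' v A2 by (intro mult_left_mono) auto
      finally have dv: "d \<le> M' * v" by simp
      have "C z - Complex x0 v = of_real (Re (C z) - x0)" by (simp add: complex_eq_iff v_def)
      then have n1: "norm (C z - Complex x0 v) = d" by (simp only: norm_of_real d_def)
      have n2: "norm (cnj (C z) - Complex x0 v) = sqrt (d\<^sup>2 + 4 * v\<^sup>2)"
        by (simp add: cmod_def v_def d_def power2_eq_square algebra_simps)
      have "pdist z (c (Complex x0 v)) = pdist (c (C z)) (c (Complex x0 v))" using c_C[OF disc_neq[OF zD]] by simp
      also have "\<dots> = pdist ((C z - \<i>) / (C z + \<i>)) ((Complex x0 v - \<i>) / (Complex x0 v + \<i>))"
      proof -
        have "pdist (\<tau> * a) (\<tau> * b) = pdist a b" for a b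
        proof -
          have "cnj (\<tau> * a) * (\<tau> * b) = (cnj \<tau> * \<tau>) * (cnj a * b)" by (simp add: mult_ac)
          then have e: "cnj (\<tau> * a) * (\<tau> * b) = cnj a * b" by (simp only: \<tau>\<tau> mult_1)
          have "norm (\<tau> * a - \<tau> * b) = norm (a - b)" using \<tau> by (simp add: right_diff_distrib[symmetric] norm_mult)
          then show ?thesis by (simp only: pdist_def e)
        qed
        then show ?thesis by (simp only: c_def)
      qed
      also have "\<dots> = d / sqrt (d\<^sup>2 + 4 * v\<^sup>2)"
        using pdist_cayley[of "C z" "Complex x0 v"] v n1 n2 by (simp add: v_def)
      also have "\<dots> \<le> \<rho>"
      proof -
        have d0: "d \<ge> 0" by (simp add: d_def)
        have pos: "sqrt (d\<^sup>2 + 4 * v\<^sup>2) > 0" "sqrt (M'\<^sup>2 + 4) > 0" using v M' by (auto intro!: add_nonneg_pos)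
        have "d\<^sup>2 \<le> (M' * v)\<^sup>2" using dv d0 by (intro power_mono) auto
        then have "d\<^sup>2 * (M'\<^sup>2 + 4) \<le> M'\<^sup>2 * (d\<^sup>2 + 4 * v\<^sup>2)" by (simp add: power_mult_distrib algebra_simps)
        then have "sqrt (d\<^sup>2 * (M'\<^sup>2 + 4)) \<le> sqrt (M'\<^sup>2 * (d\<^sup>2 + 4 * v\<^sup>2))" by simp
        then have "d * sqrt (M'\<^sup>2 + 4) \<le> M' * sqrt (d\<^sup>2 + 4 * v\<^sup>2)" using d0 M' by (simp add: real_sqrt_mult)
        then show ?thesis unfolding \<rho>_def using pos by (simp add: divide_le_eq le_divide_eq mult.commute)
      qed
      finally show ?thesis by (simp add: v_def)
    qed
    have "\<forall>\<^sub>F z in at \<zeta> within stolz_region \<zeta> M. pdist z (c (Complex x0 (Im (C z)))) \<le> \<rho>"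
      unfolding eventually_at_filter using pd by auto
    then show ?thesis using \<rho> Y by blast
  qed
  show "\<exists>M>1. \<forall>\<^sub>F y in at_right 0. c (Complex x0 y) \<in> stolz_region \<zeta> M"
  proof (intro exI[of _ 3] conjI)
    show "\<forall>\<^sub>F y in at_right 0. c (Complex x0 y) \<in> stolz_region \<zeta> 3"
      using eventually_at_right_real[OF zero_less_one]
    proof eventually_elim
      case (elim y)
      define w where "w = Complex x0 y"
      have w: "Im w > 0" "Im w = y" using elim by (auto simp: w_def)
      define N where "N = norm (w + \<i>)"
      define N0 where "N0 = norm (complex_of_real x0 + \<i>)"
      have N: "N > 0" using uhp_i_nz[OF w(1)] by (simp add: N_def)
      have N0: "N0 \<ge> 1" unfolding N0_def using abs_Im_le_cmod[of "complex_of_real x0 + \<i>"] by simp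
      have wd: "w - of_real x0 = \<i> * of_real y" by (simp add: w_def complex_eq_iff)
      have "N \<le> norm (w - of_real x0) + norm (of_real x0 + \<i>)"
        unfolding N_def using norm_triangle_ineq[of "w - of_real x0" "of_real x0 + \<i>"] by simp
      then have NN: "N \<le> y + N0" unfolding wd N0_def using elim by (simp add: norm_mult)
      have "c w - c (of_real x0) = \<tau> * (2 * \<i> * (w - of_real x0) / ((w + \<i>) * (of_real x0 + \<i>)))"
        unfolding c_def right_diff_distrib[symmetric] cayley_diff[OF uhp_i_nz[OF w(1)] of_real_i_nz] ..
      then have n1: "norm (c w - \<zeta>) = 2 * y / (N * N0)"
        using \<tau> c_C[OF neq] C_\<zeta> elim unfolding wd by (simp add: norm_mult norm_divide N_def N0_def)
      have cw: "norm (c w) < 1" by (rule c_disc[OF w(1)])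
      have "1 - (norm (c w))\<^sup>2 = 4 * y / N\<^sup>2"
      proof -
        have "norm (c w) = norm ((w - \<i>) / (w + \<i>))" by (simp only: c_def norm_mult \<tau> mult_1)
        then show ?thesis using norm_cayley_power2[OF w(1)] by (simp only: w(2) N_def)
      qed
      moreover have "1 - (norm (c w))\<^sup>2 \<le> 2 * (1 - norm (c w))"
      proof -
        have "2 * (1 - norm (c w)) - (1 - (norm (c w))\<^sup>2) = (1 - norm (c w))\<^sup>2" by (simp add: power2_eq_square algebra_simps)
        then show ?thesis using zero_le_power2[of "1 - norm (c w)"] by linarith
      qed
      ultimately have n2: "2 * y / N\<^sup>2 \<le> 1 - norm (c w)" by simp
      \<comment> \<open>As \<open>y < 1 \<le> N0\<close> and \<open>N \<le> y + N0\<close>, the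
        ratio \<open>N / N0\<close> stays below 3, the aperture chosen.\<close>
      have "2 * y / (N * N0) < 3 * (2 * y / N\<^sup>2)"
      proof -
        have "N < 3 * N0" using NN N0 elim by auto
        then have "N / N0 < 3" using N0 by (simp add: divide_less_eq)
        then have "2 * y / N\<^sup>2 * (N / N0) < 2 * y / N\<^sup>2 * 3" using elim N by (intro mult_strict_left_mono) auto
        then show ?thesis using N by (simp add: power2_eq_square mult.commute)
      qed
      then have "norm (c w - \<zeta>) < 3 * (2 * y / N\<^sup>2)" by (simp only: n1)
      also have "\<dots> \<le> 3 * (1 - norm (c w))" using n2 by (rule mult_left_mono) simp
      finally have "norm (c w - \<zeta>) < 3 * (1 - norm (c w))" .
      then show ?case using cw by (simp add: stolz_region_def dist_norm w_def)
    qed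
  qed simp
qed

theorem lipschitz:
  assumes "life_time phi \<zeta> = \<infinity>" "\<not> fixed_boundary_point phi \<zeta>"
  shows "lipschitz_orbit phi \<zeta>"
proof (rule exceptional_lipschitz[OF assms])
  show "((\<lambda>x. c (of_real x)) has_vector_derivative \<tau> * (2 * \<i> / (of_real x + \<i>)\<^sup>2)) (at x)" for x
  proof -
    have "(c has_field_derivative \<tau> * (2 * \<i> / (of_real x + \<i>)\<^sup>2)) (at (of_real x))"
      unfolding c_def using of_real_i_nz[of x]
      by (auto intro!: derivative_eq_intros simp: power2_eq_square divide_simps) (simp add: algebra_simps)
    from has_vector_derivative_real_field[OF this] show ?thesis by (simp add: o_def)
  qed
  fix X X' \<sigma> assume bc: "boundary_curve G F x0 X X' \<sigma>"
  then obtain K where K: "\<And>s. s > 0 \<Longrightarrow> \<bar>X' s\<bar> \<le> K * (1 + (X s)\<^sup>2)" unfolding boundary_curve_def by blast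
  have "\<bar>X' s\<bar> * norm (\<tau> * (2 * \<i> / (of_real (X s) + \<i>)\<^sup>2)) \<le> 2 * K" if s: "s > 0" for s
  proof -
    have "(norm (complex_of_real (X s) + \<i>))\<^sup>2 = 1 + (X s)\<^sup>2" unfolding cmod_power2 by simp
    then have n: "norm (\<tau> * (2 * \<i> / (of_real (X s) + \<i>)\<^sup>2)) = 2 / (1 + (X s)\<^sup>2)"
      using \<tau> by (simp add: norm_mult norm_divide norm_power)
    have p: "1 + (X s)\<^sup>2 > 0" by (simp add: add_pos_nonneg)
    have "\<bar>X' s\<bar> * (2 / (1 + (X s)\<^sup>2)) \<le> K * (1 + (X s)\<^sup>2) * (2 / (1 + (X s)\<^sup>2))"
      using K[OF s] p by (intro mult_right_mono) auto
    also have "\<dots> = 2 * K" using p by simp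
    finally show ?thesis unfolding n .
  qed
  then show "\<exists>B. \<forall>s>0. \<bar>X' s\<bar> * norm (\<tau> * (2 * \<i> / (of_real (X s) + \<i>)\<^sup>2)) \<le> B" by blast
qed

end

section \<open>Disc automorphisms and the chart at an interior fixed point\<close>

definition mob :: "complex \<Rightarrow> complex \<Rightarrow> complex" where
  "mob q z = (z - q) / (1 - cnj q * z)"

lemma mob_denom_nz: assumes "norm q < 1" "norm z \<le> 1" shows "1 - cnj q * z \<noteq> 0"
proof
  assume "1 - cnj q * z = 0"
  then have "norm (cnj q * z) = 1" by simp
  moreover have "norm q * norm z \<le> norm q * 1" using assms by (intro mult_left_mono) auto
  ultimately show False using assms by (simp add: norm_mult)
qed

lemma mob_diff:
  assumes "norm q < 1" "norm a \<le> 1" "norm b \<le> 1"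
  shows "norm (mob q a - mob q b) = (1 - (norm q)\<^sup>2) * norm (a - b) / (norm (1 - cnj q * a) * norm (1 - cnj q * b))"
proof -
  have nz: "1 - cnj q * a \<noteq> 0" "1 - cnj q * b \<noteq> 0" using mob_denom_nz assms by auto
  have "mob q a - mob q b = (1 - q * cnj q) * (a - b) / ((1 - cnj q * a) * (1 - cnj q * b))"
    unfolding mob_def using nz by (simp add: divide_simps) (simp add: algebra_simps)
  also have "1 - q * cnj q = of_real (1 - (norm q)\<^sup>2)" using complex_norm_square[of q] by simp
  finally show ?thesis using one_minus_norm_sq_pos[OF assms(1)]
    by (simp only: norm_mult norm_divide norm_of_real abs_of_pos)
qed

lemma mob_norm:
  assumes "norm q < 1" "norm z \<le> 1"
  shows "1 - (norm (mob q z))\<^sup>2 = (1 - (norm q)\<^sup>2) * (1 - (norm z)\<^sup>2) / (norm (1 - cnj q * z))\<^sup>2"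
proof -
  have nz: "(norm (1 - cnj q * z))\<^sup>2 \<noteq> 0" using mob_denom_nz[OF assms] by simp
  have "1 - (norm (mob q z))\<^sup>2 = ((norm (1 - cnj q * z))\<^sup>2 - (norm (z - q))\<^sup>2) / (norm (1 - cnj q * z))\<^sup>2"
    unfolding mob_def norm_divide power_divide using nz by (simp add: diff_divide_distrib)
  then show ?thesis using norm_one_minus_cnj_mult[of q z] by (simp add: norm_minus_commute)
qed

lemma mob_disc: assumes "norm q < 1" "norm z < 1" shows "norm (mob q z) < 1"
  using Moebius_function_norm_lt_1[OF assms, of 0] by (simp add: mob_def Moebius_function_simple)

lemma mob_circle: assumes "norm q < 1" "norm z = 1" shows "norm (mob q z) = 1"
proof -
  have "1 - (norm (mob q z))\<^sup>2 = 0" using mob_norm[of q z] assms by simp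
  then have "(norm (mob q z))\<^sup>2 = 1\<^sup>2" by simp
  then show ?thesis using power2_eq_iff_nonneg[of "norm (mob q z)" 1] by simp
qed

lemma mob_inverse: assumes "norm q < 1" "norm z \<le> 1" shows "mob (- q) (mob q z) = z"
proof -
  have nz: "1 - cnj q * z \<noteq> 0" by (rule mob_denom_nz[OF assms])
  have "1 - (norm q)\<^sup>2 \<noteq> 0" using one_minus_norm_sq_pos[OF assms(1)] by simp
  then have "complex_of_real (1 - (norm q)\<^sup>2) \<noteq> 0" unfolding of_real_eq_0_iff .
  then have nq: "1 - cnj q * q \<noteq> 0" using complex_norm_square[of q] by (simp add: mult.commute)
  have 1: "mob q z + q = z * (1 - cnj q * q) / (1 - cnj q * z)"
    unfolding mob_def using nz by (simp add: divide_simps) (simp add: algebra_simps)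
  have 2: "1 + cnj q * mob q z = (1 - cnj q * q) / (1 - cnj q * z)"
    unfolding mob_def using nz by (simp add: divide_simps) (simp add: algebra_simps)
  have "mob (- q) (mob q z) = (mob q z + q) / (1 + cnj q * mob q z)" by (simp add: mob_def)
  also have "\<dots> = z" unfolding 1 2 using nz nq by simp
  finally show ?thesis .
qed

lemma mob_deriv:
  assumes "norm q < 1" "norm z \<le> 1"
  shows "(mob q has_field_derivative of_real (1 - (norm q)\<^sup>2) / (1 - cnj q * z)\<^sup>2) (at z)"
proof -
  have nz: "1 - cnj q * z \<noteq> 0" by (rule mob_denom_nz[OF assms])
  have "(mob q has_field_derivative (1 * (1 - cnj q * z) - (z - q) * (- cnj q)) / ((1 - cnj q * z) * (1 - cnj q * z))) (at z)"
    unfolding mob_def using nz by (auto intro!: derivative_eq_intros)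
  moreover have "1 * (1 - cnj q * z) - (z - q) * (- cnj q) = of_real (1 - (norm q)\<^sup>2)"
    using complex_norm_square[of q] by (simp add: algebra_simps)
  ultimately show ?thesis by (simp only: power2_eq_square[symmetric])
qed

lemma mob_holomorphic: assumes "norm q < 1" shows "mob q holomorphic_on ball 0 1"
  unfolding holomorphic_on_open[OF open_ball]
proof
  fix z :: complex assume "z \<in> ball 0 1"
  then have "norm z \<le> 1" by simp
  from mob_deriv[OF assms this] show "\<exists>f'. (mob q has_field_derivative f') (at z)" by blast
qed

lemma pdist_mob: "norm (mob q z) = pdist q z"
  by (simp add: mob_def pdist_def norm_divide norm_minus_commute)

lemma one_minus_square_le: "1 - (norm (z::complex))\<^sup>2 \<le> 2 * (1 - norm z)"
proof -
  have "2 * (1 - norm z) - (1 - (norm z)\<^sup>2) = (1 - norm z)\<^sup>2" by (simp add: power2_eq_square algebra_simps)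
  then show ?thesis using zero_le_power2[of "1 - norm z"] by linarith
qed

lemma one_minus_le_square: "norm (z::complex) \<le> 1 \<Longrightarrow> 1 - norm z \<le> 1 - (norm z)\<^sup>2"
  by (simp add: power2_eq_square mult_left_le_one_le)

lemma norm_one_minus_bounds:
  assumes "norm q < 1" "norm z \<le> 1"
  shows "1 - norm q \<le> norm (1 - cnj q * z)" "norm (1 - cnj q * z) \<le> 2"
proof -
  have le: "norm (cnj q * z) \<le> norm q" using assms mult_left_mono[of "norm z" 1 "norm q"] by (simp add: norm_mult)
  have "norm (1::complex) - norm (cnj q * z) \<le> norm (1 - cnj q * z)" by (rule norm_triangle_ineq2)
  then show "1 - norm q \<le> norm (1 - cnj q * z)" using le by simp
  have "norm (1 - cnj q * z) \<le> norm (1::complex) + norm (cnj q * z)" by (rule norm_triangle_ineq4)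
  then show "norm (1 - cnj q * z) \<le> 2" using le assms by simp
qed

text \<open>An automorphism changes \<open>norm (a - e)\<close> and
  \<open>1 - (norm a)\<^sup>2\<close> by comparable factors, so Stolz regions go into Stolz regions
  of larger aperture. In the constant one factor 2 bounds \<open>norm (1 - cnj q * a)\<close>, the
  other comes from estimating \<open>1 - (norm z)\<^sup>2\<close> by
  \<open>2 * (1 - norm z)\<close>.\<close>

lemma mob_stolz:
  assumes q: "norm q < 1" and a: "norm a < 1" and e: "norm e = 1"
    and M: "norm (a - e) \<le> M * (1 - norm a)" "M \<ge> 0"
  shows "norm (mob q a - mob q e) \<le> 4 * M / (1 - norm q) * (1 - norm (mob q a))"
proof -
  define A where "A = norm (1 - cnj q * a)"
  define E where "E = norm (1 - cnj q * e)"
  have A: "0 < 1 - norm q" "1 - norm q \<le> A" "A \<le> 2" and E: "1 - norm q \<le> E"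
    using norm_one_minus_bounds[OF q, of a] norm_one_minus_bounds[OF q, of e] a e q by (auto simp: A_def E_def)
  have Q: "1 - (norm q)\<^sup>2 > 0" by (rule one_minus_norm_sq_pos[OF q])
  have "norm (mob q a - mob q e) = (1 - (norm q)\<^sup>2) * norm (a - e) / (A * E)"
    unfolding A_def E_def by (rule mob_diff) (use q a e in auto)
  also have "\<dots> \<le> (1 - (norm q)\<^sup>2) * (M * (1 - (norm a)\<^sup>2)) / (A * E)"
  proof (intro divide_right_mono mult_left_mono)
    have "M * (1 - norm a) \<le> M * (1 - (norm a)\<^sup>2)" using M one_minus_le_square[of a] a by (intro mult_left_mono) auto
    then show "norm (a - e) \<le> M * (1 - (norm a)\<^sup>2)" using M by linarith
  qed (use A E Q in auto)
  also have "\<dots> = (1 - (norm q)\<^sup>2) * (1 - (norm a)\<^sup>2) / A\<^sup>2 * (M * (A / E))"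
    using A by (simp add: power2_eq_square)
  also have "(1 - (norm q)\<^sup>2) * (1 - (norm a)\<^sup>2) / A\<^sup>2 = 1 - (norm (mob q a))\<^sup>2"
    unfolding A_def by (rule mob_norm[symmetric]) (use q a in auto)
  also have "(1 - (norm (mob q a))\<^sup>2) * (M * (A / E)) \<le> (2 * (1 - norm (mob q a))) * (M * (2 / (1 - norm q)))"
  proof (intro mult_mono mult_left_mono frac_le one_minus_square_le)
    show "0 \<le> 2 * (1 - norm (mob q a))" using mob_disc[OF q a] by simp
    show "0 \<le> M * (A / E)" using M A E by simp
  qed (use A E M in auto)
  also have "\<dots> = 4 * M / (1 - norm q) * (1 - norm (mob q a))" by simp
  finally show ?thesis .
qed

locale interior_fixed_point = semigroup_in_disc +
  fixes q \<zeta> :: complex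
  assumes q: "norm q < 1" and \<zeta>: "norm \<zeta> = 1" and fix_q: "\<And>t. t \<ge> 0 \<Longrightarrow> phi t q = q"
begin

lemma mq: "norm (- q) < 1" using q by simp

text \<open>The semigroup conjugated so that its fixed point is 0; \<open>gpsi\<close> is the
  generator of \<open>\<psi>\<close>, by the chain rule.\<close>

definition "\<psi> t z = mob q (phi t (mob (- q) z))"
definition "gpsi w = of_real (1 - (norm q)\<^sup>2) / (1 - cnj q * mob (- q) w)\<^sup>2 * gen (mob (- q) w)"

lemma \<psi>_disc: "t \<ge> 0 \<Longrightarrow> norm z < 1 \<Longrightarrow> norm (\<psi> t z) < 1"
  unfolding \<psi>_def by (intro mob_disc q mq in_disc)

lemma mob_\<psi>: "t \<ge> 0 \<Longrightarrow> norm z < 1 \<Longrightarrow> mob (- q) (\<psi> t z) = phi t (mob (- q) z)"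
  unfolding \<psi>_def by (rule mob_inverse[OF q less_imp_le]) (intro in_disc mob_disc[OF mq])

lemma mob_mob: "norm z \<le> 1 \<Longrightarrow> mob q (mob (- q) z) = z"
  using mob_inverse[OF mq, of z] by simp

lemma \<psi>_le: "t \<ge> 0 \<Longrightarrow> norm z < 1 \<Longrightarrow> norm (\<psi> t z) \<le> norm z"
proof -
  assume t: "t \<ge> 0" and z: "norm z < 1"
  have "norm (\<psi> t z) = pdist (phi t q) (phi t (mob (- q) z))" by (simp add: \<psi>_def pdist_mob fix_q t)
  also have "\<dots> \<le> pdist q (mob (- q) z)" by (rule pick[OF t q mob_disc[OF mq z]])
  also have "\<dots> = norm z" using mob_mob[of z] z by (simp add: pdist_mob[symmetric])
  finally show ?thesis .
qed

lemma \<psi>_deriv: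
  assumes t: "t \<ge> 0" and z: "norm z < 1"
  shows "((\<lambda>t. \<psi> t z) has_vector_derivative gpsi (\<psi> t z)) (at t within {0..})"
proof -
  define u where "u = phi t (mob (- q) z)"
  have u: "norm u < 1" unfolding u_def by (rule in_disc[OF t mob_disc[OF mq z]])
  have "((mob q \<circ> (\<lambda>t. phi t (mob (- q) z))) has_vector_derivative gen u * (of_real (1 - (norm q)\<^sup>2) / (1 - cnj q * u)\<^sup>2)) (at t within {0..})"
    unfolding u_def
    by (rule field_vector_diff_chain_within[OF gen_deriv[OF mob_disc[OF mq z] t]])
      (use mob_deriv[OF q, of u] u in \<open>simp add: u_def has_field_derivative_at_within\<close>)
  moreover have "mob (- q) (\<psi> t z) = u" unfolding u_def by (rule mob_\<psi>[OF t z])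
  ultimately show ?thesis by (simp add: o_def gpsi_def \<psi>_def mult.commute)
qed

lemma hol_gpsi: "gpsi holomorphic_on ball 0 1"
  unfolding gpsi_def
proof (intro holomorphic_intros)
  show h: "mob (- q) holomorphic_on ball 0 1" by (rule mob_holomorphic[OF mq])
  show "(\<lambda>w. gen (mob (- q) w)) holomorphic_on ball 0 1"
    by (rule holomorphic_on_compose_gen[unfolded o_def, OF h hol_gen]) (use mob_disc[OF mq] in auto)
  show "(1 - cnj q * mob (- q) w)\<^sup>2 \<noteq> 0" if "w \<in> ball 0 1" for w
    using mob_denom_nz[OF q, of "mob (- q) w"] mob_disc[OF mq, of w] that by auto
qed

lemma gpsi_0: "gpsi 0 = 0"
proof -
  have "((\<lambda>t. phi t q) has_vector_derivative gen q) (at 0 within {0..})"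
    using gen_deriv[OF q order_refl] fix_q by simp
  moreover have "((\<lambda>t. phi t q) has_vector_derivative 0) (at 0 within {0..})"
    by (rule has_vector_derivative_transform_within[of "\<lambda>t. q" _ _ _ 1]) (auto simp: fix_q)
  ultimately have "gen q = 0"
    using vector_derivative_within[OF at_0_within] by metis
  then show ?thesis by (simp add: gpsi_def mob_def)
qed

definition "R = (SOME R. R holomorphic_on ball 0 1 \<and> (\<forall>z. norm z < 1 \<longrightarrow> gpsi z = z * R z))"

lemma R: "R holomorphic_on ball 0 1" "norm z < 1 \<Longrightarrow> gpsi z = z * R z"
proof -
  have "\<exists>R. R holomorphic_on ball 0 1 \<and> (\<forall>z. norm z < 1 \<longrightarrow> gpsi z = z * R z)"
    by (rule Schwarz3[OF hol_gpsi gpsi_0]) blast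
  from someI_ex[OF this, folded R_def]
  show "R holomorphic_on ball 0 1" "norm z < 1 \<Longrightarrow> gpsi z = z * R z" by auto
qed

text \<open>\<open>R (\<psi> s z)\<close> is the logarithmic time derivative of the trajectory, and
  its integral is a logarithm of \<open>\<psi> t z / z\<close> that depends continuously on time.
  This gives a formula for the lift \<open>F\<close> of the flow through the covering
  \<open>Z \<mapsto> exp (\<i> * Z)\<close> of the punctured disc, without a choice of
  branches.\<close>

definition "I t z = integral {0..t} (\<lambda>s. R (\<psi> s z))"
definition "c Z = mob (- q) (exp (\<i> * Z))"
definition "F t Z = Z - \<i> * I t (exp (\<i> * Z))"
definition "G Z = - \<i> * R (exp (\<i> * Z))"
definition "x0 = Arg (mob q \<zeta>)"

lemma exp_disc: "Im Z > 0 \<Longrightarrow> norm (exp (\<i> * Z)) < 1" by simp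

lemma I_deriv:
  assumes t: "t \<ge> 0" and z: "norm z < 1"
  shows "((\<lambda>t. I t z) has_vector_derivative R (\<psi> t z)) (at t within {0..})"
proof -
  have "continuous_on {0..} (\<lambda>s. \<psi> s z)"
    using \<psi>_deriv[OF _ z] by (auto simp: continuous_on_eq_continuous_within intro: has_vector_derivative_continuous)
  then have "continuous_on {0..t+1} (\<lambda>s. \<psi> s z)" by (rule continuous_on_subset) auto
  then have cont: "continuous_on {0..t+1} (\<lambda>s. R (\<psi> s z))"
    by (rule continuous_on_compose2[OF holomorphic_on_imp_continuous_on[OF R(1)]]) (use \<psi>_disc z in auto)
  have "((\<lambda>t. I t z) has_vector_derivative R (\<psi> t z)) (at t within {0..t+1})"
    unfolding I_def by (rule integral_has_vector_derivative[OF cont]) (use t in auto)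
  moreover have "at t within {0..t+1} = at t within {0..}"
    by (rule at_within_nhd[of _ "{..<t+1}"]) (use t in auto)
  ultimately show ?thesis by simp
qed

text \<open>Uniqueness for the linear equation with coefficient \<open>R (\<psi> t z)\<close>: the
  product of \<open>\<psi> t z\<close> with \<open>exp (- I t z)\<close> has derivative 0.\<close>

lemma \<psi>_exp:
  assumes t: "t \<ge> 0" and z: "norm z < 1"
  shows "\<psi> t z = z * exp (I t z)"
proof -
  have d: "((\<lambda>t. \<psi> t z * exp (- I t z)) has_vector_derivative 0) (at s within {0..})" if "s \<in> {0..}" for s
  proof -
    have s: "s \<ge> 0" using that by simp
    have "((\<lambda>t. - I t z) has_vector_derivative - R (\<psi> s z)) (at s within {0..})"
      by (rule has_vector_derivative_minus[OF I_deriv[OF s z]])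
    from field_vector_diff_chain_within[OF this has_field_derivative_at_within[OF DERIV_exp]]
    have "((\<lambda>t. exp (- I t z)) has_vector_derivative - R (\<psi> s z) * exp (- I s z)) (at s within {0..})" by (simp add: o_def)
    from has_vector_derivative_mult[OF \<psi>_deriv[OF s z] this]
    show ?thesis using R(2)[OF \<psi>_disc[OF s z]] by (simp add: mult_ac)
  qed
  from has_vector_derivative_zero_constant[OF convex_real_interval(1) d]
  obtain k where k: "\<And>s. s \<in> {0..} \<Longrightarrow> \<psi> s z * exp (- I s z) = k" by blast
  have "\<psi> 0 z = z" using phi_0[OF mob_disc[OF mq z]] mob_mob[of z] z by (simp add: \<psi>_def)
  then have "k = z" using k[of 0] by (simp add: I_def)
  then have "\<psi> t z * exp (- I t z) * exp (I t z) = z * exp (I t z)" using k[of t] t by simp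
  then show ?thesis by (simp add: mult.assoc exp_minus_inverse flip: exp_add)
qed

lemma exp_F: "t \<ge> 0 \<Longrightarrow> Im Z > 0 \<Longrightarrow> exp (\<i> * F t Z) = \<psi> t (exp (\<i> * Z))"
  unfolding \<psi>_exp[OF _ exp_disc] F_def by (simp add: algebra_simps exp_add)

lemma mob_\<zeta>: "norm (mob q \<zeta>) = 1" by (rule mob_circle[OF q \<zeta>])

lemma exp_x0: "exp (\<i> * of_real x0) = mob q \<zeta>"
  unfolding x0_def using rcis_cmod_Arg[of "mob q \<zeta>"] by (simp add: mob_\<zeta> rcis_def cis_conv_exp)

lemma mob_minus_cont: "norm z \<le> 1 \<Longrightarrow> isCont (mob (- q)) z"
  using mob_deriv[OF mq] DERIV_isCont by blast

lemma isCont_c: "Im Z \<ge> 0 \<Longrightarrow> isCont c Z"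
  unfolding c_def by (intro isCont_o2[OF _ mob_minus_cont] continuous_intros) simp

sublocale boundary_chart phi \<zeta> c "\<lambda>x. c (of_real x)" x0 F G
proof
  show "continuous_on uhp c"
    by (intro continuous_at_imp_continuous_on ballI isCont_c) simp
  show "norm (c w) < 1" if "Im w > 0" for w unfolding c_def by (rule mob_disc[OF mq exp_disc[OF that]])
  show "(c \<longlongrightarrow> c (of_real x)) (at (of_real x) within uhp)" for x
  proof -
    have "isCont c (of_real x)" by (rule isCont_c) simp
    then show ?thesis unfolding isCont_def by (rule tendsto_within_subset) simp
  qed
  show "norm (c (of_real x)) = 1" for x
    unfolding c_def by (rule mob_circle[OF mq]) simp
  show "c (of_real x0) = \<zeta>"
    unfolding c_def exp_x0 by (rule mob_inverse[OF q]) (simp add: \<zeta>)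
  show "phi t (c w) = c (F t w)" if "t \<ge> 0" "Im w > 0" for t w
    unfolding c_def exp_F[OF that] by (rule mob_\<psi>[OF that(1) exp_disc[OF that(2)], symmetric])
  have he: "(\<lambda>Z. exp (\<i> * Z)) holomorphic_on uhp" by (intro holomorphic_intros)
  show "G holomorphic_on uhp"
    unfolding G_def by (intro holomorphic_intros holomorphic_on_compose_gen[unfolded o_def, OF he R(1)]) auto
  show "F 0 z = z" if "Im z > 0" for z by (simp add: F_def I_def)
  \<comment> \<open>Schwarz's lemma at the fixed point 0 makes moduli decrease, and the modulus of
    \<open>exp (\<i> * Z)\<close> is \<open>exp (- Im Z)\<close>.\<close>
  show "Im (F t z) \<ge> Im z" if "t \<ge> 0" "Im z > 0" for t z
  proof -
    have "norm (exp (\<i> * F t z)) \<le> norm (exp (\<i> * z))"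
      unfolding exp_F[OF that] by (rule \<psi>_le[OF that(1) exp_disc[OF that(2)]])
    then show ?thesis by simp
  qed
  show "((\<lambda>t. F t z) has_vector_derivative G (F t z)) (at t within {0..})" if "t \<ge> 0" "Im z > 0" for t z
  proof -
    have "((\<lambda>t. z - \<i> * I t (exp (\<i> * z))) has_vector_derivative 0 - \<i> * R (\<psi> t (exp (\<i> * z)))) (at t within {0..})"
      by (intro has_vector_derivative_diff has_vector_derivative_const has_vector_derivative_mult_right I_deriv that exp_disc)
    then show ?thesis by (simp add: F_def[symmetric] G_def exp_F[OF that])
  qed
  show "\<exists>\<rho><1. \<exists>Y. filterlim Y (at_right 0) (at \<zeta> within stolz_region \<zeta> M) \<and>
        (\<forall>\<^sub>F z in at \<zeta> within stolz_region \<zeta> M. pdist z (c (Complex x0 (Y z))) \<le> \<rho>)" if M: "M > 1" for M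
  proof -
    define M' where "M' = 4 * M / (1 - norm q)"
    have M': "M' > 0" using M q by (simp add: M'_def)
    \<comment> \<open>In the centred coordinate, \<open>a = mob q z\<close> and the point
      \<open>b\<close> of equal modulus \<open>r\<close> on the radius to
      \<open>mob q \<zeta>\<close> differ by at most \<open>(M' + 1) * (1 - r)\<close>. Then
      \<open>norm (1 - cnj a * b) \<le> (M' + 2) * (1 - r\<^sup>2)\<close>, while the squared
      distance is
      \<open>1 - (1 - r\<^sup>2)\<^sup>2 / (norm (1 - cnj a * b))\<^sup>2\<close>.\<close>
    define \<rho> where "\<rho> = sqrt (1 - 1 / (M' + 2)\<^sup>2)"
    have \<rho>: "\<rho> < 1" unfolding \<rho>_def using M' by simp
    \<comment> \<open>The height at which \<open>exp (\<i> * Complex x0 y)\<close> has the modulus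
      of \<open>mob q z\<close>.\<close>
    define Y where "Y = (\<lambda>z. - ln (norm (mob q z)))"
    have ml: "((\<lambda>z. mob q z) \<longlongrightarrow> mob q \<zeta>) (at \<zeta> within stolz_region \<zeta> M)"
    proof -
      have "norm \<zeta> \<le> 1" using \<zeta> by simp
      from DERIV_isCont[OF mob_deriv[OF q this]]
      show ?thesis unfolding isCont_def by (rule tendsto_within_subset) simp
    qed
    then have nl: "((\<lambda>z. norm (mob q z)) \<longlongrightarrow> 1) (at \<zeta> within stolz_region \<zeta> M)" using tendsto_norm[OF ml] mob_\<zeta> by simp
    have Yl: "(Y \<longlongrightarrow> 0) (at \<zeta> within stolz_region \<zeta> M)"
      unfolding Y_def using tendsto_minus[OF tendsto_ln[OF nl]] by simp
    have nzev: "\<forall>\<^sub>F z in at \<zeta> within stolz_region \<zeta> M. norm (mob q z) > 0"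
      using nl by (rule order_tendstoD) simp
    have inS: "\<forall>\<^sub>F z in at \<zeta> within stolz_region \<zeta> M. z \<in> stolz_region \<zeta> M"
      unfolding eventually_at_filter by simp
    have "\<forall>\<^sub>F z in at \<zeta> within stolz_region \<zeta> M. Y z > 0"
      using nzev inS
    proof eventually_elim
      case (elim z)
      then have "norm (mob q z) < 1" using mob_disc[OF q] by (simp add: stolz_region_def)
      then show ?case using elim by (simp add: Y_def)
    qed
    then have Y: "filterlim Y (at_right 0) (at \<zeta> within stolz_region \<zeta> M)"
      unfolding filterlim_at using Yl by (auto elim: eventually_mono)
    have "\<forall>\<^sub>F z in at \<zeta> within stolz_region \<zeta> M. pdist z (c (Complex x0 (Y z))) \<le> \<rho>"
      using nzev inS
    proof eventually_elim
      case (elim z)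
      have zD: "norm z < 1" and zM: "norm (z - \<zeta>) \<le> M * (1 - norm z)"
        using elim(2) by (auto simp: stolz_region_def dist_norm)
      define a where "a = mob q z"
      define r where "r = norm a"
      define b where "b = of_real r * mob q \<zeta>"
      have a: "norm a < 1" unfolding a_def by (rule mob_disc[OF q zD])
      have r: "0 < r" "r < 1" using elim(1) a by (auto simp: r_def a_def)
      have nb: "norm b = r" using r mob_\<zeta> by (simp add: b_def norm_mult)
      have "\<i> * Complex x0 (Y z) = - of_real (Y z) + \<i> * of_real x0" by (simp add: complex_eq_iff)
      then have "exp (\<i> * Complex x0 (Y z)) = exp (- of_real (Y z)) * mob q \<zeta>"
        by (simp only: exp_add exp_x0)
      also have "exp (- complex_of_real (Y z)) = of_real r"
        using r by (simp add: Y_def r_def a_def exp_of_real flip: of_real_minus)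
      finally have cb: "c (Complex x0 (Y z)) = mob (- q) b" by (simp add: c_def b_def)
      have "pdist z (c (Complex x0 (Y z))) = pdist (mob (- q) a) (mob (- q) b)"
        unfolding cb a_def using mob_inverse[OF q, of z] zD by simp
      also have "\<dots> \<le> pdist a b"
        by (rule Schwarz_Pick[OF mob_holomorphic[OF mq]]) (use mob_disc[OF mq] a nb r in auto)
      also have "\<dots> \<le> \<rho>"
      proof -
        have "norm (a - mob q \<zeta>) \<le> M' * (1 - r)"
          unfolding a_def r_def M'_def by (rule mob_stolz[OF q zD \<zeta> zM]) (use M in simp)
        moreover have "norm (mob q \<zeta> - b) = 1 - r"
        proof -
          have "mob q \<zeta> - b = of_real (1 - r) * mob q \<zeta>" by (simp add: b_def algebra_simps)
          then show ?thesis using mob_\<zeta> r by (simp only: norm_mult norm_of_real) simp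
        qed
        moreover have "norm (a - b) \<le> norm (a - mob q \<zeta>) + norm (mob q \<zeta> - b)"
          using norm_triangle_ineq[of "a - mob q \<zeta>" "mob q \<zeta> - b"] by simp
        ultimately have ab: "norm (a - b) \<le> (M' + 1) * (1 - r)" by (simp add: algebra_simps)
        have r2: "1 - r \<le> 1 - r\<^sup>2" using one_minus_le_square[of a] a by (simp add: r_def)
        have r2p: "1 - r\<^sup>2 > 0" using one_minus_norm_sq_pos[OF a] by (simp add: r_def)
        have "1 - cnj a * b = of_real (1 - r\<^sup>2) - cnj (a - b) * b"
          using complex_norm_square[of b] nb by (simp add: algebra_simps)
        then have "norm (1 - cnj a * b) \<le> norm (complex_of_real (1 - r\<^sup>2)) + norm (cnj (a - b) * b)"
          by (metis norm_triangle_ineq4)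
        also have "norm (complex_of_real (1 - r\<^sup>2)) = 1 - r\<^sup>2" using r2p by (simp only: norm_of_real)
        also have "norm (cnj (a - b) * b) \<le> norm (a - b) * 1"
          unfolding norm_mult complex_mod_cnj nb using r by (intro mult_left_mono) auto
        also have "norm (a - b) * 1 \<le> (M' + 1) * (1 - r\<^sup>2)"
          using order_trans[OF ab mult_left_mono[of "1 - r" "1 - r\<^sup>2" "M' + 1"]] r2 M' by simp
        finally have N: "norm (1 - cnj a * b) \<le> (M' + 2) * (1 - r\<^sup>2)" by (simp add: algebra_simps)
        have nz: "norm (1 - cnj a * b) > 0" using one_minus_cnj_mult_nonzero[of a b] a nb r by simp
        have "(norm (1 - cnj a * b))\<^sup>2 \<le> ((M' + 2) * (1 - r\<^sup>2))\<^sup>2" using N nz by (intro power_mono) auto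
        then have 1: "1 / (M' + 2)\<^sup>2 \<le> (1 - r\<^sup>2)\<^sup>2 / (norm (1 - cnj a * b))\<^sup>2"
          using nz M' by (simp add: divide_le_eq le_divide_eq power_mult_distrib mult.commute)
        have "(pdist a b)\<^sup>2 = ((norm (1 - cnj a * b))\<^sup>2 - (1 - r\<^sup>2)\<^sup>2) / (norm (1 - cnj a * b))\<^sup>2"
          using norm_one_minus_cnj_mult[of a b] nb by (simp add: pdist_def power_divide r_def power2_eq_square)
        also have "\<dots> = 1 - (1 - r\<^sup>2)\<^sup>2 / (norm (1 - cnj a * b))\<^sup>2" using nz by (simp add: diff_divide_distrib)
        also have "\<dots> \<le> 1 - 1 / (M' + 2)\<^sup>2" using 1 by simp
        finally show ?thesis unfolding \<rho>_def by (rule real_le_rsqrt)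
      qed
      finally show ?case .
    qed
    then show ?thesis using \<rho> Y by blast
  qed
  show "\<exists>M>1. \<forall>\<^sub>F y in at_right 0. c (Complex x0 y) \<in> stolz_region \<zeta> M"
  proof (intro exI[of _ "4 * 1 / (1 - norm q) + 1"] conjI)
    \<comment> \<open>\<open>mob_stolz\<close> with \<open>M = 1\<close> handles the radial points
      of the centred disc; the added 1 makes the inequality strict and the constant larger than
      1.\<close>
    show "1 < 4 * 1 / (1 - norm q) + 1" using q by simp
    show "\<forall>\<^sub>F y in at_right 0. c (Complex x0 y) \<in> stolz_region \<zeta> (4 * 1 / (1 - norm q) + 1)"
      using eventually_at_right_less[of 0]
    proof eventually_elim
      case (elim y)
      define r where "r = exp (- y)"
      have r: "0 < r" "r < 1" using elim by (auto simp: r_def)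
      define a where "a = of_real r * mob q \<zeta>"
      have na: "norm a = r" using r mob_\<zeta> by (simp add: a_def norm_mult)
      have "\<i> * Complex x0 y = - of_real y + \<i> * of_real x0" by (simp add: complex_eq_iff)
      then have "exp (\<i> * Complex x0 y) = exp (- of_real y) * mob q \<zeta>"
        by (simp only: exp_add exp_x0)
      also have "exp (- complex_of_real y) = of_real r" by (simp add: r_def exp_of_real flip: of_real_minus)
      finally have ca: "c (Complex x0 y) = mob (- q) a" by (simp add: c_def a_def)
      have cD: "norm (mob (- q) a) < 1" using mob_disc[OF mq, of a] na r by simp
      have "a - mob q \<zeta> = - (of_real (1 - r) * mob q \<zeta>)" by (simp add: a_def algebra_simps)
      then have "norm (a - mob q \<zeta>) \<le> 1 * (1 - norm a)"
        using mob_\<zeta> r na by (simp only: norm_minus_cancel norm_mult norm_of_real)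
      from mob_stolz[OF mq _ mob_\<zeta> this]
      have "norm (mob (- q) a - \<zeta>) \<le> 4 * 1 / (1 - norm q) * (1 - norm (mob (- q) a))"
        using na r mob_inverse[OF q, of \<zeta>] \<zeta> by simp
      also have "\<dots> < (4 * 1 / (1 - norm q) + 1) * (1 - norm (mob (- q) a))"
        using cD by (intro mult_strict_right_mono) auto
      finally show ?case unfolding ca using cD by (simp add: stolz_region_def dist_norm)
    qed
  qed
qed

lemma G_periodic: "G (Z + of_real (2 * pi * real n)) = G Z" "G (Z - of_real (2 * pi * real n)) = G Z"
proof -
  have e: "exp (\<i> * of_real (2 * pi * real n)) = 1"
    using exp_integer_2pi[of "of_nat n"] by (simp add: mult_ac)
  show "G (Z + of_real (2 * pi * real n)) = G Z"
    unfolding G_def distrib_left exp_add e by simp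
  show "G (Z - of_real (2 * pi * real n)) = G Z"
    unfolding G_def right_diff_distrib exp_diff e by simp
qed

text \<open>
  Once the orbit has travelled a multiple of the period \<open>2 * pi\<close> beyond \<open>X 1\<close>, it has the speed \<open>X' 1\<close> again, so
  a monotone speed can never exceed \<open>X' 1\<close>.
\<close>

lemma speed_bounded:
  assumes bc: "boundary_curve G F x0 X X' \<sigma>" and s: "s > 0"
  shows "\<bar>X' s\<bar> \<le> \<sigma> * X' 1"
proof -
  have \<sigma>: "\<sigma> \<in> {-1, 1}" "\<sigma> * \<sigma> = 1" using bc by (auto simp: boundary_curve_def)
  have d: "(X has_real_derivative X' s) (at s)" "\<sigma> * X' s > 0" if "s > 0" for s using bc that by (auto simp: boundary_curve_def)
  have m: "\<sigma> * X' s \<le> \<sigma> * X' t" if "0 < s" "s \<le> t" for s t using bc that by (simp add: boundary_curve_def)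
  have Gl: "(G \<longlongrightarrow> of_real (X' s)) (at (of_real (X s)) within uhp)" if "s > 0" for s using bc that by (simp add: boundary_curve_def)
  have "\<sigma> * X' s \<le> \<sigma> * X' 1"
  proof (cases "s \<le> 1")
    case True then show ?thesis using m s by blast
  next
    case False
    \<comment> \<open>\<open>n\<close> periods exceed the distance covered between the times 1 and
      \<open>s\<close>, so the point congruent to \<open>X 1\<close> is reached at some
      \<open>t \<ge> s\<close>.\<close>
    obtain n where n: "real n > \<sigma> * (X s - X 1)" using reals_Archimedean2 by blast
    define L where "L = 2 * pi * real n"
    have Ln: "L \<ge> real n" unfolding L_def using pi_gt3 mult_right_mono[of 1 "2 * pi" "real n"] by simp
    define Z where "Z = (\<lambda>t. \<sigma> * (X t - X 1))"
    have dZ: "(Z has_real_derivative \<sigma> * X' t) (at t)" if "t > 0" for t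
      unfolding Z_def using d(1)[OF that] by (auto intro!: derivative_eq_intros)
    \<comment> \<open>With speed at least \<open>\<sigma> * X' 1\<close> after time 1, the curve has
      covered the distance \<open>L\<close> from \<open>X 1\<close> by this time.\<close>
    define t1 where "t1 = s + L / (\<sigma> * X' 1)"
    have t1: "t1 \<ge> s" unfolding t1_def using d(2)[of 1] Ln by simp
    have "Z t1 \<ge> L"
    proof -
      have "t1 > 1" using t1 False by simp
      then obtain u where u: "1 < u" "u < t1" "Z t1 - Z 1 = (t1 - 1) * (\<sigma> * X' u)"
        using MVT2[of 1 t1 Z "\<lambda>t. \<sigma> * X' t"] dZ by auto
      have "L \<le> (t1 - 1) * (\<sigma> * X' 1)"
      proof -
        have "L = L / a * a" if "a > 0" for a :: real using that by simp
        from this[OF d(2)[OF zero_less_one]] have "L = (t1 - s) * (\<sigma> * X' 1)"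
          unfolding t1_def add_diff_cancel_left' .
        also have "\<dots> \<le> (t1 - 1) * (\<sigma> * X' 1)" using False d(2)[of 1] by (intro mult_right_mono) auto
        finally show ?thesis .
      qed
      also have "\<dots> \<le> (t1 - 1) * (\<sigma> * X' u)" by (rule mult_left_mono[OF m[of 1 u]]) (use u in auto)
      finally have "L \<le> Z t1 - Z 1" using u(3) by simp
      then show ?thesis by (simp add: Z_def)
    qed
    moreover have "Z s \<le> L" using n Ln by (simp add: Z_def)
    moreover have "continuous_on {s..t1} Z"
      by (intro continuous_at_imp_continuous_on ballI DERIV_isCont[OF dZ]) (use s in auto)
    ultimately obtain t where t: "s \<le> t" "Z t = L" using IVT'[of Z s L t1] t1 by auto
    have t0: "t > 0" using t s by simp
    have "X t = X 1 + \<sigma> * L"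
    proof -
      have "\<sigma> * L = (\<sigma> * \<sigma>) * (X t - X 1)" using t(2) by (simp only: Z_def mult.assoc)
      then show ?thesis using \<sigma>(2) by simp
    qed
    have per: "G (z + of_real (\<sigma> * L)) = G z" for z
      using \<sigma>(1) G_periodic[of z n] by (auto simp: L_def)
    have "filterlim (\<lambda>z. z + of_real (\<sigma> * L)) (at (of_real (X t)) within uhp) (at (of_real (X 1)) within uhp)"
      unfolding filterlim_at
    proof
      have "((\<lambda>z. z + of_real (\<sigma> * L)) \<longlongrightarrow> of_real (X 1) + of_real (\<sigma> * L)) (at (of_real (X 1)) within uhp)"
        by (intro tendsto_intros)
      then show "((\<lambda>z. z + of_real (\<sigma> * L)) \<longlongrightarrow> of_real (X t)) (at (of_real (X 1)) within uhp)"
        by (simp add: \<open>X t = X 1 + \<sigma> * L\<close>)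
      show "\<forall>\<^sub>F z in at (of_real (X 1)) within uhp. z + of_real (\<sigma> * L) \<in> uhp \<and> z + of_real (\<sigma> * L) \<noteq> of_real (X t)"
        unfolding eventually_at_filter by (auto intro!: always_eventually simp: complex_eq_iff)
    qed
    from filterlim_compose[OF Gl[OF t0] this]
    have "(G \<longlongrightarrow> of_real (X' t)) (at (of_real (X 1)) within uhp)" by (simp only: per)
    moreover have "at (complex_of_real (X 1)) within uhp \<noteq> bot"
    proof -
      have "filterlim (\<lambda>v. Complex (X 1) v) (at (of_real (X 1)) within uhp) (at_right 0)"
      proof -
        have "((\<lambda>v. Complex (X 1) v) \<longlongrightarrow> Complex (X 1) 0) (at_right 0)" by (intro tendsto_intros)
        then have "((\<lambda>v. Complex (X 1) v) \<longlongrightarrow> of_real (X 1)) (at_right 0)" by (simp add: complex_of_real_def)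
        then show ?thesis unfolding filterlim_at using eventually_at_right_less[of 0]
          by (auto elim!: eventually_mono simp: complex_eq_iff)
      qed
      then show ?thesis using filterlim_at_bot by (metis filtermap_bot_iff filterlim_def bot.extremum_uniqueI trivial_limit_at_right_real)
    qed
    ultimately have "complex_of_real (X' t) = of_real (X' 1)" using Gl[OF zero_less_one] tendsto_unique by blast
    then have "X' t = X' 1" by simp
    then show ?thesis using m[of s t] s t by simp
  qed
  moreover have "\<bar>X' s\<bar> = \<sigma> * X' s" using d(2)[OF s] \<sigma>(1) by auto
  ultimately show ?thesis by simp
qed

theorem lipschitz:
  assumes "life_time phi \<zeta> = \<infinity>" "\<not> fixed_boundary_point phi \<zeta>"
  shows "lipschitz_orbit phi \<zeta>"
proof (rule exceptional_lipschitz[OF assms])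
  define D where "D = (\<lambda>x. \<i> * exp (\<i> * complex_of_real x) * (of_real (1 - (norm q)\<^sup>2) / (1 - cnj (- q) * exp (\<i> * of_real x))\<^sup>2))"
  show "((\<lambda>x. c (of_real x)) has_vector_derivative D x) (at x)" for x
  proof -
    have e: "((\<lambda>x. exp (\<i> * complex_of_real x)) has_vector_derivative \<i> * exp (\<i> * of_real x)) (at x)"
    proof -
      have "((\<lambda>x. exp (\<i> * x)) has_field_derivative \<i> * exp (\<i> * of_real x)) (at (of_real x))"
        by (auto intro!: derivative_eq_intros)
      from has_vector_derivative_real_field[OF this] show ?thesis by (simp add: o_def)
    qed
    have "norm (exp (\<i> * complex_of_real x)) \<le> 1" by simp
    from field_vector_diff_chain_at[OF e mob_deriv[OF mq this]]
    show ?thesis by (simp add: o_def c_def D_def)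
  qed
  fix X X' \<sigma> assume bc: "boundary_curve G F x0 X X' \<sigma>"
  have nD: "norm (D x) \<le> 1 / (1 - norm q)\<^sup>2" for x
  proof -
    define N where "N = norm (1 - cnj (- q) * exp (\<i> * complex_of_real x))"
    have N: "1 - norm q \<le> N" "0 < 1 - norm q"
      using norm_one_minus_bounds(1)[OF mq, of "exp (\<i> * of_real x)"] q by (auto simp: N_def)
    have Q: "0 < 1 - (norm q)\<^sup>2" by (rule one_minus_norm_sq_pos[OF q])
    have "norm (D x) = (1 - (norm q)\<^sup>2) / N\<^sup>2"
      unfolding D_def norm_mult norm_divide norm_power N_def[symmetric] norm_of_real using Q by simp
    also have "\<dots> \<le> 1 / (1 - norm q)\<^sup>2"
      using N Q by (intro frac_le power_mono zero_less_power) auto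
    finally show ?thesis .
  qed
  have "\<bar>X' s\<bar> * norm (D (X s)) \<le> \<sigma> * X' 1 * (1 / (1 - norm q)\<^sup>2)" if "s > 0" for s
    using speed_bounded[OF bc that] nD[of "X s"] by (intro mult_mono) (auto intro: order_trans[OF abs_ge_zero])
  then show "\<exists>B. \<forall>s>0. \<bar>X' s\<bar> * norm (D (X s)) \<le> B" by blast
qed

end

theorem (in semigroup_in_disc) exceptional_orbit_lipschitz:
  assumes \<zeta>: "norm \<zeta> = 1" and nf: "\<not> fixed_boundary_point phi \<zeta>" and ex: "exceptional_orbit phi \<zeta>"
  shows "lipschitz_orbit phi \<zeta>"
proof -
  have life: "life_time phi \<zeta> = \<infinity>" using ex by (simp add: exceptional_orbit_def)
  obtain s where s: "norm s \<le> 1" "\<And>t. t \<ge> 0 \<Longrightarrow> horocyclic s (phi t)" by (rule ex_common_horocyclic) blast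
  show ?thesis
  proof (cases "norm s < 1")
    case True
    interpret interior_fixed_point phi s \<zeta>
      by unfold_locales (use True \<zeta> s horocyclic_interior_fixed in auto)
    show ?thesis by (rule lipschitz[OF life nf])
  next
    case False
    then have s1: "norm s = 1" using s by simp
    \<comment> \<open>Otherwise \<open>\<zeta>\<close> would be fixed: the horocyclic inequality
      bounds \<open>(norm (phi t z - \<zeta>))\<^sup>2\<close> by
      \<open>(norm (z - \<zeta>))\<^sup>2 / (1 - (norm z)\<^sup>2)\<close>, which in a Stolz region
      is at most \<open>M * norm (z - \<zeta>)\<close>.\<close>
    have "\<zeta> \<noteq> s"
    proof
      assume eq: "\<zeta> = s"
      have "(phi t \<longlongrightarrow> \<zeta>) (nontangential_at \<zeta>)" if t: "t \<ge> 0" for t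
        unfolding tendsto_nontangential_iff
      proof (intro allI impI)
        fix M :: real assume M: "M > 1"
        have bnd: "norm (phi t z - \<zeta>) \<le> sqrt (2 * M\<^sup>2 * norm (z - \<zeta>))" if z: "z \<in> stolz_region \<zeta> M" for z
        proof -
          have zD: "norm z < 1" and zM: "norm (z - \<zeta>) < M * (1 - norm z)" using z by (auto simp: stolz_region_def dist_norm)
          have ss: "cnj s * s = 1" using complex_norm_square[of s] s1 by (simp add: mult.commute)
          have n: "norm (1 - cnj s * u) = norm (u - \<zeta>)" for u
          proof -
            have "cnj s * (s - u) = 1 - cnj s * u" using ss by (simp add: right_diff_distrib)
            then have "norm (1 - cnj s * u) = norm (cnj s * (s - u))" by simp
            then show ?thesis using s1 eq by (simp add: norm_mult norm_minus_commute)
          qed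
          have z2: "1 - norm z \<le> 1 - (norm z)\<^sup>2" by (rule one_minus_le_square) (use zD in simp)
          have "(1 - (norm z)\<^sup>2) * (norm (phi t z - \<zeta>))\<^sup>2 \<le> (1 - (norm (phi t z))\<^sup>2) * (norm (z - \<zeta>))\<^sup>2"
            using s(2)[OF t] zD by (simp add: horocyclic_def n)
          also have "\<dots> \<le> 1 * (norm (z - \<zeta>))\<^sup>2" by (intro mult_right_mono) auto
          also have "\<dots> \<le> (M * (1 - norm z)) * norm (z - \<zeta>)"
            unfolding power2_eq_square mult_1 using zM by (intro mult_right_mono) auto
          also have "\<dots> \<le> (1 - (norm z)\<^sup>2) * (M * norm (z - \<zeta>))"
          proof -
            have "(1 - norm z) * (M * norm (z - \<zeta>)) \<le> (1 - (norm z)\<^sup>2) * (M * norm (z - \<zeta>))"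
              using z2 M by (intro mult_right_mono) auto
            then show ?thesis by (simp add: mult_ac)
          qed
          finally have "(norm (phi t z - \<zeta>))\<^sup>2 \<le> M * norm (z - \<zeta>)"
            using one_minus_norm_sq_pos[OF zD] by (simp only: mult_le_cancel_left_pos)
          also have "\<dots> \<le> 2 * M\<^sup>2 * norm (z - \<zeta>)"
          proof (rule mult_right_mono)
            have "M * 1 \<le> M * M" using M by (intro mult_left_mono) auto
            then show "M \<le> 2 * M\<^sup>2" using M by (simp add: power2_eq_square)
          qed simp
          finally show ?thesis by (rule real_le_rsqrt)
        qed
        have "((\<lambda>z. sqrt (2 * M\<^sup>2 * norm (z - \<zeta>))) \<longlongrightarrow> sqrt (2 * M\<^sup>2 * norm (\<zeta> - \<zeta>))) (at \<zeta> within stolz_region \<zeta> M)"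
          by (intro tendsto_intros)
        then have z: "((\<lambda>z. sqrt (2 * M\<^sup>2 * norm (z - \<zeta>))) \<longlongrightarrow> 0) (at \<zeta> within stolz_region \<zeta> M)" by simp
        have "((\<lambda>z. phi t z - \<zeta>) \<longlongrightarrow> 0) (at \<zeta> within stolz_region \<zeta> M)"
          by (rule Lim_null_comparison[OF _ z]) (auto simp: eventually_at_filter intro!: always_eventually bnd)
        then show "(phi t \<longlongrightarrow> \<zeta>) (at \<zeta> within stolz_region \<zeta> M)" by (simp add: LIM_zero_iff)
      qed
      then show False using nf by (simp add: fixed_boundary_point_def)
    qed
    then interpret boundary_denjoy_wolff phi s \<zeta>
      by unfold_locales (use s1 \<zeta> s in auto)
    show ?thesis by (rule lipschitz[OF life nf])
  qed
qed

section \<open>Isolated orbits\<close>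

lemma filterlim_radius_nontangential:
  assumes \<zeta>: "norm \<zeta> = 1"
  shows "filterlim (\<lambda>r. of_real r * \<zeta>) (nontangential_at \<zeta>) (at_left 1)"
proof -
  have "((\<lambda>r. of_real r * \<zeta>) \<longlongrightarrow> of_real 1 * \<zeta>) (at_left 1)"
    by (intro tendsto_intros)
  moreover have "\<forall>\<^sub>F r in at_left 1. of_real r * \<zeta> \<in> stolz_region \<zeta> 2 \<and> of_real r * \<zeta> \<noteq> \<zeta>"
    using eventually_at_left_real[of 0 "1::real", OF zero_less_one]
  proof eventually_elim
    case (elim r)
    have n: "norm (of_real r * \<zeta>) = r" using elim \<zeta> by (simp add: norm_mult)
    have "of_real r * \<zeta> - \<zeta> = - (of_real (1 - r) * \<zeta>)" by (simp add: algebra_simps)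
    then have "norm (of_real r * \<zeta> - \<zeta>) = 1 - r"
      using elim \<zeta> by (simp add: norm_mult del: of_real_diff)
    then show ?case using n elim \<zeta> by (auto simp: stolz_region_def dist_norm)
  qed
  ultimately have "filterlim (\<lambda>r. of_real r * \<zeta>) (at \<zeta> within stolz_region \<zeta> 2) (at_left 1)"
    by (simp add: filterlim_at conj_commute)
  moreover have "at \<zeta> within stolz_region \<zeta> 2 \<le> nontangential_at \<zeta>"
    unfolding nontangential_at_def by (rule SUP_upper) auto
  ultimately show ?thesis by (rule filterlim_mono) auto
qed

text \<open>\<open>z\<close> is within \<open>M * (1 - norm z)\<close> of \<open>\<zeta>\<close> and
  its projection to the radius within \<open>1 - norm z\<close>, whence the factor
  \<open>M + 1\<close>. The identity for \<open>norm (1 - cnj a * b)\<close> turns this into a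
  distance bounded away from 1.\<close>

lemma pdist_radial_projection_le:
  assumes \<zeta>: "norm \<zeta> = 1" and M: "M > 0" and z: "z \<in> stolz_region \<zeta> M"
  shows "pdist z (of_real (norm z) * \<zeta>) \<le> sqrt ((M + 1)\<^sup>2 / ((M + 1)\<^sup>2 + 1))"
proof -
  define b where "b = of_real (norm z) * \<zeta>"
  define r where "r = norm z"
  have z1: "norm z < 1" and zM: "norm (z - \<zeta>) < M * (1 - r)"
    using z by (auto simp: stolz_region_def dist_norm r_def)
  have nb: "norm b = r" using \<zeta> by (simp add: b_def r_def norm_mult)
  have r: "0 \<le> r" "r < 1" using z1 by (auto simp: r_def)
  define N where "N = 1 - r\<^sup>2"
  have r2: "r\<^sup>2 \<le> r" using r by (simp add: power2_eq_square mult_left_le)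
  then have N: "N > 0" "1 - r \<le> N" using r by (auto simp: N_def)
  have "\<zeta> - b = of_real (1 - r) * \<zeta>" by (simp add: b_def r_def algebra_simps)
  then have "norm (\<zeta> - b) = 1 - r" using \<zeta> r by (simp add: norm_mult del: of_real_diff)
  then have "norm (z - b) \<le> (M + 1) * (1 - r)"
    using norm_triangle_ineq[of "z - \<zeta>" "\<zeta> - b"] zM by (simp add: algebra_simps)
  also have "\<dots> \<le> (M + 1) * N" using N M by (intro mult_left_mono) auto
  finally have d: "norm (z - b) \<le> (M + 1) * N" .
  define d where "d = (norm (z - b))\<^sup>2"
  have d2: "d \<le> (M + 1)\<^sup>2 * N\<^sup>2" using power_mono[OF d, of 2] by (simp add: d_def power_mult_distrib)
  have "(norm (1 - cnj z * b))\<^sup>2 = d + N\<^sup>2"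
    unfolding norm_one_minus_cnj_mult nb d_def N_def r_def by (simp add: power2_eq_square)
  then have "(pdist z b)\<^sup>2 = d / (d + N\<^sup>2)" by (simp add: pdist_def power_divide d_def)
  also have "\<dots> \<le> (M + 1)\<^sup>2 / ((M + 1)\<^sup>2 + 1)"
  proof -
    have "d + N\<^sup>2 > 0" using N by (simp add: d_def add_nonneg_pos)
    moreover have "(M + 1)\<^sup>2 + 1 > 0" by (simp add: add_nonneg_pos)
    moreover have "d * ((M + 1)\<^sup>2 + 1) \<le> (M + 1)\<^sup>2 * (d + N\<^sup>2)" using d2 by (simp add: algebra_simps)
    ultimately show ?thesis by (simp add: pos_divide_le_eq pos_le_divide_eq mult.commute)
  qed
  finally show ?thesis unfolding b_def[symmetric] by (rule real_le_rsqrt)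
qed

text \<open>Schwarz-Pick carries the bounded distance between a point and its radial projection over
  to the images. The boundary orbit is defined by nontangential limits, whereas the square-root
  coordinate is followed along radii only.\<close>

lemma tendsto_nontangential_of_radial:
  assumes holf: "f holomorphic_on ball 0 1" and fD: "f ` ball 0 1 \<subseteq> ball 0 1"
    and \<zeta>: "norm \<zeta> = 1" and a: "norm a = 1"
    and lim: "((\<lambda>r. f (of_real r * \<zeta>)) \<longlongrightarrow> a) (at_left 1)"
  shows "(f \<longlongrightarrow> a) (nontangential_at \<zeta>)"
  unfolding tendsto_nontangential_iff
proof (intro allI impI)
  fix M :: real assume M: "M > 1"
  define \<rho> where "\<rho> = sqrt ((M + 1)\<^sup>2 / ((M + 1)\<^sup>2 + 1))"
  have "(M + 1)\<^sup>2 / ((M + 1)\<^sup>2 + 1) < 1" by (simp add: divide_less_eq add_nonneg_pos)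
  then have \<rho>: "\<rho> < 1" unfolding \<rho>_def by (simp add: real_sqrt_lt_1_iff)
  have st: "\<forall>\<^sub>F z in at \<zeta> within stolz_region \<zeta> M. z \<in> stolz_region \<zeta> M"
    by (rule eventually_at_topological[THEN iffD2]) (auto intro: open_UNIV)
  have "filterlim norm (at_left 1) (at \<zeta> within stolz_region \<zeta> M)"
    unfolding filterlim_at
  proof
    have "(norm \<longlongrightarrow> norm \<zeta>) (at \<zeta> within stolz_region \<zeta> M)" by (intro tendsto_intros)
    then show "(norm \<longlongrightarrow> 1) (at \<zeta> within stolz_region \<zeta> M)" by (simp add: \<zeta>)
    show "\<forall>\<^sub>F z in at \<zeta> within stolz_region \<zeta> M. norm z \<in> {..<1} \<and> norm z \<noteq> 1"
      using st by eventually_elim (auto simp: stolz_region_def)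
  qed
  from filterlim_compose[OF lim this]
  have "((\<lambda>z. f (of_real (norm z) * \<zeta>)) \<longlongrightarrow> a) (at \<zeta> within stolz_region \<zeta> M)" .
  then show "(f \<longlongrightarrow> a) (at \<zeta> within stolz_region \<zeta> M)"
  proof (rule tendsto_of_pdist_le[OF _ a \<rho>])
    show "\<forall>\<^sub>F z in at \<zeta> within stolz_region \<zeta> M. norm (f z) < 1 \<and> norm (f (of_real (norm z) * \<zeta>)) < 1 \<and>
        pdist (f z) (f (of_real (norm z) * \<zeta>)) \<le> \<rho>"
      using st
    proof eventually_elim
      case (elim z)
      have z: "norm z < 1" using elim by (simp add: stolz_region_def)
      have b: "norm (of_real (norm z) * \<zeta>) < 1" using z \<zeta> by (simp add: norm_mult)
      have im: "norm (f v) < 1" if "norm v < 1" for v using that fD by (auto simp: image_subset_iff)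
      have "pdist (f z) (f (of_real (norm z) * \<zeta>)) \<le> pdist z (of_real (norm z) * \<zeta>)"
        by (rule Schwarz_Pick[OF holf fD z b])
      also have "\<dots> \<le> \<rho>" unfolding \<rho>_def by (rule pdist_radial_projection_le[OF \<zeta> _ elim]) (use M in simp)
      finally show ?case using im z b by blast
    qed
  qed
qed

text \<open>If \<open>p = h z0\<close>, the image of a smaller disc about 0 is a neighbourhood of
  \<open>p\<close>, and by injectivity values in it come from this disc only; so the points
  \<open>z x\<close> could not approach the circle.\<close>

lemma limit_notin_image_of_norm_tendsto_1:
  fixes h :: "complex \<Rightarrow> complex"
  assumes holh: "h holomorphic_on ball 0 1" and inj: "inj_on h (ball 0 1)"
    and F: "F \<noteq> bot" and lim: "((\<lambda>x. h (z x)) \<longlongrightarrow> p) F"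
    and nz: "((\<lambda>x. norm (z x)) \<longlongrightarrow> 1) F" and zD: "\<forall>\<^sub>F x in F. norm (z x) < 1"
  shows "p \<notin> h ` ball 0 1"
proof
  assume "p \<in> h ` ball 0 1"
  then obtain z0 where z0: "norm z0 < 1" "p = h z0" by auto
  obtain s where s: "norm z0 < s" "s < 1" using dense[OF z0(1)] by blast
  have sub: "ball 0 s \<subseteq> ball (0::complex) 1" using s by auto
  have "open (h ` ball 0 s)"
    using open_mapping_thm3[OF holomorphic_on_subset[OF holh sub] _ inj_on_subset[OF inj sub]] by simp
  moreover have "p \<in> h ` ball 0 s" using z0 s by auto
  ultimately have "\<forall>\<^sub>F x in F. h (z x) \<in> h ` ball 0 s" using lim topological_tendstoD by blast
  moreover have "\<forall>\<^sub>F x in F. norm (z x) > s" using nz s(2) by (rule order_tendstoD(1))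
  ultimately have "\<forall>\<^sub>F x in F. False"
    using zD
  proof eventually_elim
    case (elim x)
    then obtain v where v: "norm v < s" "h (z x) = h v" by auto
    have "z x = v" by (rule inj_onD[OF inj v(2)]) (use elim v s in auto)
    then show False using elim v by simp
  qed
  then show False using F by (simp add: eventually_False)
qed

text \<open>The image of a smaller closed disc is compact and misses \<open>p\<close>, so the points
  \<open>z x\<close> finally leave each such disc.\<close>

lemma norm_tendsto_1_of_limit_notin_image:
  fixes h :: "complex \<Rightarrow> complex"
  assumes conth: "continuous_on (ball 0 1) h" and p: "p \<notin> h ` ball 0 1"
    and lim: "((\<lambda>x. h (z x)) \<longlongrightarrow> p) F" and zD: "\<forall>\<^sub>F x in F. norm (z x) < 1"
  shows "((\<lambda>x. norm (z x)) \<longlongrightarrow> 1) F"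
proof (rule order_tendstoI)
  fix a :: real assume a: "a < 1"
  have sub: "cball 0 a \<subseteq> ball (0::complex) 1" using a by auto
  have "closed (h ` cball 0 a)"
    by (intro compact_imp_closed compact_continuous_image continuous_on_subset[OF conth sub] compact_cball)
  then have "open (- (h ` cball 0 a))" by auto
  moreover have "p \<in> - (h ` cball 0 a)" using p sub by auto
  ultimately have "\<forall>\<^sub>F x in F. h (z x) \<in> - (h ` cball 0 a)" using lim topological_tendstoD by blast
  then show "\<forall>\<^sub>F x in F. a < norm (z x)" by eventually_elim (auto simp: not_le[symmetric])
next
  fix a :: real assume "1 < a"
  then show "\<forall>\<^sub>F x in F. norm (z x) < a" using zD by (auto elim: eventually_mono)
qed

text \<open>Some later time \<open>T\<close> has a limit on the circle, and \<open>phi T\<close> is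
  \<open>phi (T - t)\<close> after \<open>phi t\<close>. If \<open>phi t\<close> returned to a
  compact subset of the disc, \<open>phi T\<close> would return to one as well.\<close>

lemma (in semigroup_in_disc) norm_tendsto_1_before_life_time:
  assumes \<zeta>: "norm \<zeta> = 1" and t: "0 \<le> t" "ereal t < life_time phi \<zeta>"
  shows "((\<lambda>r. norm (phi t (of_real r * \<zeta>))) \<longlongrightarrow> 1) (at_left 1)"
proof -
  obtain T w where T: "T > t" and w: "norm w = 1" "(phi T \<longlongrightarrow> w) (nontangential_at \<zeta>)"
    using t(2) unfolding life_time_def less_Sup_iff by auto
  have rad: "\<forall>\<^sub>F r in at_left 1. norm (of_real r * \<zeta>) < 1"
    using eventually_at_left_real[of 0 "1::real", OF zero_less_one]
    by eventually_elim (use \<zeta> in \<open>simp add: norm_mult\<close>)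
  have "((\<lambda>r. phi T (of_real r * \<zeta>)) \<longlongrightarrow> w) (at_left 1)"
    by (rule filterlim_compose[OF w(2) filterlim_radius_nontangential[OF \<zeta>]])
  then have lim: "((\<lambda>r. phi (T - t) (phi t (of_real r * \<zeta>))) \<longlongrightarrow> w) (at_left 1)"
  proof (rule Lim_transform_eventually)
    show "\<forall>\<^sub>F r in at_left 1. phi T (of_real r * \<zeta>) = phi (T - t) (phi t (of_real r * \<zeta>))"
      using rad
    proof eventually_elim
      case (elim r)
      then show ?case using phi_add[of "T - t" t "of_real r * \<zeta>"] T t(1) by simp
    qed
  qed
  show ?thesis
  proof (rule norm_tendsto_1_of_limit_notin_image[where h="phi (T - t)", OF _ _ lim])
    show "continuous_on (ball 0 1) (phi (T - t))"
      by (rule holomorphic_on_imp_continuous_on[OF hol]) (use T in simp)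
    show "w \<notin> phi (T - t) ` ball 0 1"
    proof
      assume "w \<in> phi (T - t) ` ball 0 1"
      then obtain z where "norm z < 1" "w = phi (T - t) z" by auto
      then show False using in_disc[of "T - t" z] T w(1) by simp
    qed
    show "\<forall>\<^sub>F r in at_left 1. norm (phi t (of_real r * \<zeta>)) < 1"
      using rad by eventually_elim (rule in_disc[OF t(1)])
  qed
qed

text \<open>
  In the coordinate \<open>\<xi>\<close> given by \<open>E\<close>, the tip of the slit is \<open>0\<close> and the slit is the negative real axis.
\<close>

locale square_root_tip =
  fixes h E :: "complex \<Rightarrow> complex" and \<rho> :: real
  assumes holh: "h holomorphic_on ball 0 1" and injh: "inj_on h (ball 0 1)"
    and \<rho>: "\<rho> > 0" and holE: "E holomorphic_on ball 0 \<rho>" and injE: "inj_on E (ball 0 \<rho>)"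
    and slit: "\<And>s. - \<rho> < s \<Longrightarrow> s \<le> 0 \<Longrightarrow> E (of_real s) \<notin> h ` ball 0 1"
    and fr: "\<And>\<xi>. norm \<xi> < \<rho> \<Longrightarrow> E \<xi> \<in> frontier (h ` ball 0 1) \<Longrightarrow> Im \<xi> = 0 \<and> Re \<xi> \<le> 0"
    and ex: "\<exists>\<xi>. norm \<xi> < \<rho> \<and> E \<xi> \<in> h ` ball 0 1"
begin

definition "g = the_inv_into (ball 0 1) h"

text \<open>The map \<open>u \<mapsto> - u\<^sup>2\<close> takes the upper half of the disc of
  radius \<open>sqrt \<rho>\<close> onto the disc of radius \<open>\<rho>\<close> slit along the
  nonpositive axis. The two sides of the slit become the two halves of one real segment.\<close>

definition "k u = g (E (- u\<^sup>2))"

definition "V = {u. dist u (complex_of_real 0) < sqrt \<rho> \<and> Im u > 0}"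

lemma convex_V: "convex V"
proof -
  have V: "V = ball 0 (sqrt \<rho>) \<inter> {u. Im u > 0}" by (auto simp: V_def)
  show ?thesis unfolding V by (simp add: convex_Int convex_halfspace_Im_gt)
qed

lemma norm_square_less: "norm (u::complex) < sqrt \<rho> \<Longrightarrow> norm (- u\<^sup>2) < \<rho>"
  using \<rho> power_strict_mono[of "norm u" "sqrt \<rho>" 2] by (simp add: norm_power)

lemma square_not_slit:
  assumes "Im u > 0" "Im (- u\<^sup>2) = 0" shows "Re (- u\<^sup>2) > 0"
proof -
  have "Re u = 0" using assms by (simp add: power2_eq_square)
  then show ?thesis using assms by (simp add: power2_eq_square)
qed

lemma not_slit_imp_square:
  assumes "norm \<xi> < \<rho>" "\<not> (Im \<xi> = 0 \<and> Re \<xi> \<le> 0)"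
  obtains u where "u \<in> V" "- u\<^sup>2 = \<xi>"
proof
  have "Re (csqrt \<xi>) \<noteq> 0"
  proof
    assume "Re (csqrt \<xi>) = 0"
    then have "csqrt \<xi> = \<i> * of_real (Im (csqrt \<xi>))" by (simp add: complex_eq_iff)
    then have "\<xi> = (\<i> * of_real (Im (csqrt \<xi>)))\<^sup>2" using power2_csqrt[of \<xi>] by metis
    then have "\<xi> = - of_real ((Im (csqrt \<xi>))\<^sup>2)" by (simp add: power_mult_distrib)
    then have "Im \<xi> = 0" "Re \<xi> = - (Im (csqrt \<xi>))\<^sup>2" by (metis Im_complex_of_real uminus_complex.sel neg_0_equal_iff_equal, metis Re_complex_of_real uminus_complex.sel)
    then have "Re \<xi> \<le> 0" by (simp only: neg_le_0_iff_le zero_le_power2)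
    then show False using assms(2) \<open>Im \<xi> = 0\<close> by blast
  qed
  then have "Re (csqrt \<xi>) > 0" using csqrt_principal[of \<xi>] by auto
  then show "\<i> * csqrt \<xi> \<in> V"
    using assms(1) by (simp add: V_def norm_mult norm_csqrt)
  show "- (\<i> * csqrt \<xi>)\<^sup>2 = \<xi>" by (simp add: power_mult_distrib)
qed

text \<open>A connected set that meets the Koenigs domain and avoids its frontier lies inside
  it.\<close>

lemma image_V: "(\<lambda>u. E (- u\<^sup>2)) ` V \<subseteq> h ` ball 0 1"
proof -
  have hs: "(\<lambda>u. E (- u\<^sup>2)) holomorphic_on V"
    by (rule holomorphic_on_compose_gen[unfolded o_def, where t="ball 0 \<rho>", OF _ holE])
      (use norm_square_less in \<open>auto intro!: holomorphic_intros simp: V_def\<close>)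
  have "connected ((\<lambda>u. E (- u\<^sup>2)) ` V)"
    by (intro connected_continuous_image holomorphic_on_imp_continuous_on[OF hs] convex_connected convex_V)
  moreover obtain \<xi> where \<xi>: "norm \<xi> < \<rho>" "E \<xi> \<in> h ` ball 0 1" using ex by blast
  have "\<not> (Im \<xi> = 0 \<and> Re \<xi> \<le> 0)"
  proof
    assume a: "Im \<xi> = 0 \<and> Re \<xi> \<le> 0"
    then have "\<xi> = of_real (Re \<xi>)" by (simp add: complex_eq_iff)
    moreover have "\<bar>Re \<xi>\<bar> < \<rho>" using \<xi>(1) abs_Re_le_cmod[of \<xi>] by simp
    ultimately show False using slit[of "Re \<xi>"] a \<xi>(2) by (metis abs_less_iff minus_less_iff)
  qed
  then obtain u where u: "u \<in> V" "- u\<^sup>2 = \<xi>" using not_slit_imp_square[OF \<xi>(1)] by metis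
  have "(\<lambda>u. E (- u\<^sup>2)) ` V \<inter> h ` ball 0 1 \<noteq> {}" using u \<xi>(2) by blast
  moreover have "(\<lambda>u. E (- u\<^sup>2)) ` V \<inter> frontier (h ` ball 0 1) = {}"
  proof -
    have "E (- u\<^sup>2) \<notin> frontier (h ` ball 0 1)" if "u \<in> V" for u
    proof
      assume "E (- u\<^sup>2) \<in> frontier (h ` ball 0 1)"
      from fr[OF norm_square_less this] show False using square_not_slit[of u] that by (auto simp: V_def)
    qed
    then show ?thesis by blast
  qed
  ultimately have "\<not> (\<lambda>u. E (- u\<^sup>2)) ` V - h ` ball 0 1 \<noteq> {}"
    using connected_Int_frontier[of "(\<lambda>u. E (- u\<^sup>2)) ` V" "h ` ball 0 1"] by metis
  then show ?thesis by (simp only: not_not Diff_eq_empty_iff)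
qed

lemma g_h: "norm z < 1 \<Longrightarrow> g (h z) = z"
  unfolding g_def by (rule the_inv_into_f_f[OF injh]) simp

lemma h_g: "w \<in> h ` ball 0 1 \<Longrightarrow> h (g w) = w"
  unfolding g_def by (rule f_the_inv_into_f[OF injh])

lemma g_disc: "w \<in> h ` ball 0 1 \<Longrightarrow> norm (g w) < 1"
  using the_inv_into_into[OF injh _ subset_refl] by (simp add: g_def)

lemma hol_g: "g holomorphic_on h ` ball 0 1"
proof -
  obtain g' where g': "g' holomorphic_on h ` ball 0 1" "\<And>z. z \<in> ball 0 1 \<Longrightarrow> g' (h z) = z"
    by (rule holomorphic_has_inverse[OF holh open_ball injh]) blast
  show ?thesis
    by (rule holomorphic_transform[OF g'(1)]) (use g'(2) g_h in auto)
qed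

text \<open>\<open>k\<close> is injective because \<open>g\<close> and \<open>E\<close> are and
  because \<open>u\<close> and \<open>- u\<close> are not both in the upper half-plane. Its modulus
  tends to 1 at the real segment, since the points of the slit are limits of \<open>h (k u)\<close>
  that \<open>h\<close> does not attain.\<close>

lemma boundary_map:
  obtains r F where "0 < r" "F holomorphic_on ball 0 r" "deriv F 0 \<noteq> 0"
    "\<And>u. norm u < r \<Longrightarrow> Im u > 0 \<Longrightarrow> u \<in> V \<and> k u = exp (\<i> * F u)"
    "\<And>x::real. \<bar>x\<bar> < r \<Longrightarrow> Im (F (of_real x)) = 0"
proof -
  have V0: "norm (- u\<^sup>2) < \<rho>" if "u \<in> V" for u using that norm_square_less by (auto simp: V_def)
  have k1: "k holomorphic_on V"
    unfolding k_def
  proof (rule holomorphic_on_compose_gen[unfolded o_def, OF _ hol_g image_V])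
    show "(\<lambda>u. E (- u\<^sup>2)) holomorphic_on V"
      by (rule holomorphic_on_compose_gen[unfolded o_def, where t="ball 0 \<rho>", OF _ holE])
        (use V0 in \<open>auto intro!: holomorphic_intros\<close>)
  qed
  have k2: "k ` V \<subseteq> ball 0 1"
    using image_V g_disc by (auto simp: k_def image_subset_iff)
  have k3: "inj_on k V"
  proof (rule inj_onI)
    fix u v assume u: "u \<in> V" and v: "v \<in> V" and eq: "k u = k v"
    have "h (k u) = E (- u\<^sup>2)" "h (k v) = E (- v\<^sup>2)"
      using u v image_V h_g by (auto simp: k_def image_subset_iff)
    then have "E (- u\<^sup>2) = E (- v\<^sup>2)" using eq by simp
    then have "- u\<^sup>2 = - v\<^sup>2" by (rule inj_onD[OF injE]) (use V0[OF u] V0[OF v] in auto)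
    then have "u = v \<or> u = - v" by (simp add: power2_eq_iff)
    then show "u = v" using u v by (auto simp: V_def)
  qed
  have k4: "((\<lambda>u. norm (k u)) \<longlongrightarrow> 1) (at (of_real x) within {u. Im u > 0})" if x: "\<bar>x - 0\<bar> < sqrt \<rho>" for x :: real
  proof (rule norm_tendsto_1_of_limit_notin_image[where h=h])
    show "continuous_on (ball 0 1) h" by (rule holomorphic_on_imp_continuous_on[OF holh])
    have x2: "x\<^sup>2 < \<rho>" using x power_strict_mono[of "\<bar>x\<bar>" "sqrt \<rho>" 2] \<rho> by simp
    then show "E (- (of_real x)\<^sup>2) \<notin> h ` ball 0 1" using slit[of "- x\<^sup>2"] by simp
    have ev: "\<forall>\<^sub>F u in at (of_real x) within {u. Im u > 0}. u \<in> V"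
    proof -
      have "\<forall>\<^sub>F u in at (complex_of_real x) within {u. Im u > 0}. u \<in> ball 0 (sqrt \<rho>)"
        using x by (intro eventually_at_in_open' [THEN filter_leD[OF at_le, rotated]]) auto
      moreover have "\<forall>\<^sub>F u in at (complex_of_real x) within {u. Im u > 0}. Im u > 0"
        by (rule eventually_at_topological[THEN iffD2]) (auto intro: open_UNIV)
      ultimately show ?thesis by eventually_elim (simp add: V_def)
    qed
    then show "\<forall>\<^sub>F u in at (of_real x) within {u. Im u > 0}. norm (k u) < 1"
      by eventually_elim (use k2 in \<open>auto simp: image_subset_iff\<close>)
    have "isCont E (- (of_real x)\<^sup>2)"
      using holomorphic_on_imp_continuous_on[OF holE] x2
      by (subst (asm) continuous_on_eq_continuous_at) (auto simp: norm_power)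
    moreover have "((\<lambda>u. - u\<^sup>2) \<longlongrightarrow> - (complex_of_real x)\<^sup>2) (at (of_real x) within {u. Im u > 0})"
      by (intro tendsto_intros)
    ultimately have "((\<lambda>u. E (- u\<^sup>2)) \<longlongrightarrow> E (- (of_real x)\<^sup>2)) (at (of_real x) within {u. Im u > 0})"
      by (rule isCont_tendsto_compose)
    then show "((\<lambda>u. h (k u)) \<longlongrightarrow> E (- (of_real x)\<^sup>2)) (at (of_real x) within {u. Im u > 0})"
    proof (rule Lim_transform_eventually)
      show "\<forall>\<^sub>F u in at (of_real x) within {u. Im u > 0}. E (- u\<^sup>2) = h (k u)"
        using ev by eventually_elim (use image_V h_g in \<open>auto simp: k_def image_subset_iff\<close>)
    qed
  qed
  show thesis
  proof (rule Schwarz_reflection_disc[where R="sqrt \<rho>" and a=0 and k=k, folded V_def, OF _ k1 k2 k3 k4])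
    show "sqrt \<rho> > 0" using \<rho> by simp
    fix r F assume r: "0 < r" "r \<le> sqrt \<rho>" and F: "F holomorphic_on ball (of_real 0) r"
      "\<And>z. z \<in> ball (of_real 0) r \<Longrightarrow> Im z > 0 \<Longrightarrow> k z = exp (\<i> * F z)"
      "\<And>z. z \<in> ball (of_real 0) r \<Longrightarrow> Im z = 0 \<Longrightarrow> Im (F z) = 0"
      "inj_on F (ball (of_real 0) r)"
    show thesis
    proof (rule that[OF r(1)])
      show "F holomorphic_on ball 0 r" using F(1) by simp
      show "deriv F 0 \<noteq> 0"
        using holomorphic_injective_imp_regular[OF F(1) open_ball F(4), of 0] r by simp
      show "u \<in> V \<and> k u = exp (\<i> * F u)" if "norm u < r" "Im u > 0" for u
        using F(2)[of u] that r by (simp add: V_def)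
      show "Im (F (of_real x)) = 0" if "\<bar>x\<bar> < r" for x :: real
        using F(3)[of "of_real x"] that by simp
    qed
  qed
qed

end

section \<open>The orbit in the square-root coordinate\<close>

lemma csqrt_tendsto_Reals:
  assumes lim: "(f \<longlongrightarrow> complex_of_real x) F" and x: "x \<ge> 0"
  shows "((\<lambda>z. csqrt (f z)) \<longlongrightarrow> of_real (sqrt x)) F"
proof (cases "x = 0")
  \<comment> \<open>0 is the branch point of \<open>csqrt\<close>, where the limit is obtained from
    the modulus alone.\<close>
  case True
  have "((\<lambda>z. sqrt (norm (f z))) \<longlongrightarrow> sqrt (norm (complex_of_real x))) F"
    by (intro tendsto_intros lim)
  then have "((\<lambda>z. norm (csqrt (f z))) \<longlongrightarrow> 0) F" by (simp add: True norm_csqrt)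
  then show ?thesis using True by (simp add: tendsto_norm_zero_cancel)
next
  case False
  have "isCont csqrt (complex_of_real x)"
    by (rule continuous_at_csqrt) (use False x in \<open>auto simp: complex_nonpos_Reals_iff\<close>)
  from isCont_tendsto_compose[OF this lim] show ?thesis by (simp only: of_real_sqrt[OF x])
qed

lemma Im_csqrt_sgn: "Im z \<noteq> 0 \<Longrightarrow> sgn (Im (csqrt z)) = sgn (Im z)"
proof -
  assume z: "Im z \<noteq> 0"
  have "Im (w\<^sup>2) = 2 * (Re w * Im w)" for w by (simp add: power2_eq_square)
  from this[of "csqrt z"] have "Im z = 2 * (Re (csqrt z) * Im (csqrt z))" by (simp only: power2_csqrt)
  moreover have "Re (csqrt z) > 0"
    using csqrt_principal[of z] calculation z by (metis less_irrefl mult_zero_left mult_zero_right)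
  then have "sgn (2 * (Re (csqrt z) * Im (csqrt z))) = sgn (Im (csqrt z))"
    by (simp only: sgn_mult sgn_pos zero_less_numeral mult_1)
  ultimately show ?thesis by (simp only:)
qed

text \<open>Abstracts from the two models. In the coordinate given by \<open>E\<close> the flow is
  translation by the time and the tip, reached at time \<open>S\<close>, is 0;
  \<open>\<xi> r\<close> is the coordinate, at time \<open>S\<close>, of the orbit that starts on
  the radius.\<close>

theorem (in semigroup_in_disc) not_lipschitz_at_tip:
  fixes \<xi> :: "real \<Rightarrow> complex" and h E :: "complex \<Rightarrow> complex"
  assumes \<zeta>: "norm \<zeta> = 1" and life: "life_time phi \<zeta> = ereal S" and S: "S > 0"
    and holh: "h holomorphic_on ball 0 1" and injh: "inj_on h (ball 0 1)"
    and \<rho>: "\<rho> > 0" and holE: "E holomorphic_on UNIV" and injE: "inj_on E (ball 0 \<rho>)"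
    and fr: "\<And>\<xi>. norm \<xi> < \<rho> \<Longrightarrow> E \<xi> \<in> frontier (h ` ball 0 1) \<Longrightarrow> Im \<xi> = 0 \<and> Re \<xi> \<le> 0"
    and r0: "0 \<le> r0" "r0 < 1" and cont\<xi>: "continuous_on {r0..<1} \<xi>" and lim\<xi>: "(\<xi> \<longlongrightarrow> 0) (at_left 1)"
    and lift: "\<And>r t. r0 \<le> r \<Longrightarrow> r < 1 \<Longrightarrow> t \<ge> 0 \<Longrightarrow> h (phi t (of_real r * \<zeta>)) = E (\<xi> r + of_real (t - S))"
  shows "\<not> lipschitz_orbit phi \<zeta>"
proof -
  have contE: "isCont E z" for z
    using holomorphic_on_imp_continuous_on[OF holE] by (simp add: continuous_on_eq_continuous_at)
  have nr: "norm (of_real r * \<zeta>) < 1" if "r0 \<le> r" "r < 1" for r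
    using that r0 \<zeta> by (simp add: norm_mult)
  have lift_in: "E (\<xi> r + of_real (t - S)) \<in> h ` ball 0 1" if "r0 \<le> r" "r < 1" "t \<ge> 0" for r t
    using lift[OF that] in_disc[OF that(3) nr[OF that(1,2)]] by (metis image_eqI mem_ball_0)
  have evr: "\<forall>\<^sub>F r in at_left 1. a \<le> r \<and> r < 1" if "a < 1" for a :: real
    using eventually_at_left_real[OF that] by eventually_elim auto
  have openO: "open (h ` ball 0 1)" by (rule open_mapping_thm3[OF holh open_ball injh])
  \<comment> \<open>These points are radial limits of \<open>h\<close> after \<open>phi t\<close> at
    times before the life-time, when the modulus of \<open>phi t\<close> tends to 1.\<close>
  have slit_neg: "E (of_real s) \<notin> h ` ball 0 1" if s: "- S \<le> s" "s < 0" for s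
  proof (rule limit_notin_image_of_norm_tendsto_1[OF holh injh, where F="at_left (1::real)" and z="\<lambda>r. phi (s + S) (of_real r * \<zeta>)"])
    show "at_left (1::real) \<noteq> bot" by simp
    show "((\<lambda>r. norm (phi (s + S) (of_real r * \<zeta>))) \<longlongrightarrow> 1) (at_left 1)"
      by (rule norm_tendsto_1_before_life_time[OF \<zeta>]) (use s life in auto)
    show "\<forall>\<^sub>F r in at_left 1. norm (phi (s + S) (of_real r * \<zeta>)) < 1"
      using evr[OF r0(2)] by eventually_elim (use s nr in \<open>auto intro!: in_disc\<close>)
    have "((\<lambda>r. \<xi> r + of_real s) \<longlongrightarrow> 0 + of_real s) (at_left 1)" by (intro tendsto_intros lim\<xi>)
    then have "((\<lambda>r. E (\<xi> r + of_real s)) \<longlongrightarrow> E (of_real s)) (at_left 1)"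
      using isCont_tendsto_compose[OF contE] by simp
    then show "((\<lambda>r. h (phi (s + S) (of_real r * \<zeta>))) \<longlongrightarrow> E (of_real s)) (at_left 1)"
    proof (rule Lim_transform_eventually)
      show "\<forall>\<^sub>F r in at_left 1. E (\<xi> r + of_real s) = h (phi (s + S) (of_real r * \<zeta>))"
        using evr[OF r0(2)] by eventually_elim (use s lift[of _ "s + S"] in auto)
    qed
  qed
  \<comment> \<open>The tip is a limit of points of the slit, and the Koenigs domain is
    open.\<close>
  have slit: "E (of_real s) \<notin> h ` ball 0 1" if s: "- S \<le> s" "s \<le> 0" for s
  proof (cases "s = 0")
    case True
    have "\<not> (\<forall>\<^sub>F s in at_left 0. E (of_real s) \<in> h ` ball 0 1)"
    proof
      assume "\<forall>\<^sub>F s in at_left 0. E (of_real s) \<in> h ` ball 0 1"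
      moreover have "\<forall>\<^sub>F s in at_left 0. s \<in> {- S<..<0}" using eventually_at_left_real[of "- S" 0] S by simp
      ultimately have "\<forall>\<^sub>F s in at_left (0::real). False"
        by eventually_elim (use slit_neg in auto)
      then show False by (simp add: eventually_False)
    qed
    moreover have "((\<lambda>s. complex_of_real s) \<longlongrightarrow> of_real 0) (at_left 0)" by (intro tendsto_intros)
    then have "((\<lambda>s. E (of_real s)) \<longlongrightarrow> E (of_real 0)) (at_left 0)" by (rule isCont_tendsto_compose[OF contE])
    ultimately show ?thesis using topological_tendstoD[OF _ openO] True by blast
  qed (use s slit_neg in auto)
  \<comment> \<open>Only the part of the slit traversed during \<open>[0, S]\<close> is known to lie
    outside the domain, so the radius must not exceed \<open>S\<close>.\<close>
  define \<rho>' where "\<rho>' = min \<rho> S"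
  have \<rho>': "\<rho>' > 0" "\<rho>' \<le> \<rho>" "\<rho>' \<le> S" using \<rho> S by (auto simp: \<rho>'_def)
  have "\<forall>\<^sub>F r in at_left 1. norm (\<xi> r) < \<rho>'"
    using order_tendstoD(2)[OF tendsto_norm_zero[OF lim\<xi>] \<rho>'(1)] .
  then obtain r1 where r1: "r0 \<le> r1" "r1 < 1" "\<And>r. r1 \<le> r \<Longrightarrow> r < 1 \<Longrightarrow> norm (\<xi> r) < \<rho>'"
  proof -
    assume "\<forall>\<^sub>F r in at_left 1. norm (\<xi> r) < \<rho>'"
    then obtain b where b: "b < 1" "\<And>r. b < r \<Longrightarrow> r < 1 \<Longrightarrow> norm (\<xi> r) < \<rho>'"
      unfolding eventually_at_left_field by blast
    show thesis
    proof (rule that[of "max r0 ((b + 1) / 2)"])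
      fix r assume "max r0 ((b + 1) / 2) \<le> r" "r < 1"
      then show "norm (\<xi> r) < \<rho>'" using b(1) by (intro b(2)) auto
    qed (use b(1) r0 in auto)
  qed
  interpret tip: square_root_tip h E \<rho>'
  proof
    show "E holomorphic_on ball 0 \<rho>'" by (rule holomorphic_on_subset[OF holE]) simp
    show "inj_on E (ball 0 \<rho>')" by (rule inj_on_subset[OF injE]) (use \<rho>' in auto)
    show "E (of_real s) \<notin> h ` ball 0 1" if "- \<rho>' < s" "s \<le> 0" for s
      using slit[of s] that \<rho>' by simp
    show "Im \<xi> = 0 \<and> Re \<xi> \<le> 0" if "norm \<xi> < \<rho>'" "E \<xi> \<in> frontier (h ` ball 0 1)" for \<xi>
      using fr[OF _ that(2)] that(1) \<rho>' by simp
    show "\<exists>\<xi>. norm \<xi> < \<rho>' \<and> E \<xi> \<in> h ` ball 0 1"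
      using lift_in[of r1 S] r1 S by auto
  qed (fact holh injh \<rho>'(1))+
  obtain \<eta> F where \<eta>: "0 < \<eta>" and F: "F holomorphic_on ball 0 \<eta>" "deriv F 0 \<noteq> 0"
    and kF: "\<And>u. norm u < \<eta> \<Longrightarrow> Im u > 0 \<Longrightarrow> u \<in> tip.V \<and> tip.k u = exp (\<i> * F u)"
    and ImF: "\<And>x::real. \<bar>x\<bar> < \<eta> \<Longrightarrow> Im (F (of_real x)) = 0"
    by (rule tip.boundary_map) blast
  define e where "e u = exp (\<i> * F u)" for u
  \<comment> \<open>Otherwise a suitable time puts the orbit on the slit: the time \<open>S\<close>
    if \<open>x \<le> 0\<close>, and the time \<open>S - x\<close>, which leads to the tip, if
    \<open>x > 0\<close>.\<close>
  have Im\<xi>: "Im (\<xi> r) \<noteq> 0" if r: "r1 \<le> r" "r < 1" for r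
  proof
    assume im: "Im (\<xi> r) = 0"
    define x where "x = Re (\<xi> r)"
    have x: "\<xi> r = of_real x" using im by (simp add: x_def complex_eq_iff)
    have "\<bar>x\<bar> < \<rho>'" using r1(3)[OF r] x by simp
    then have "- S \<le> x" "x \<le> S" using \<rho>' by auto
    then have "E (\<xi> r + of_real ((S - max x 0) - S)) \<in> h ` ball 0 1"
      using lift_in[of r "S - max x 0"] r r1 S by auto
    moreover have "\<xi> r + of_real ((S - max x 0) - S) = of_real (x - max x 0)" by (simp add: x)
    ultimately show False using slit[of "x - max x 0"] \<open>- S \<le> x\<close> S by auto
  qed
  \<comment> \<open>The side of the slit along which the radius approaches; it selects the half of
    the real segment that carries the orbit.\<close>
  define \<sigma> where "\<sigma> = sgn (Im (\<xi> r1))"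
  have \<sigma>: "\<bar>\<sigma>\<bar> = 1" using Im\<xi>[of r1] r1 by (simp add: \<sigma>_def abs_sgn_eq)
  have sgn\<xi>: "sgn (Im (\<xi> r)) = \<sigma>" if r: "r1 \<le> r" "r < 1" for r
  proof (rule ccontr)
    assume ne: "sgn (Im (\<xi> r)) \<noteq> \<sigma>"
    have c: "continuous_on {r1..r} (\<lambda>r. Im (\<xi> r))"
      by (intro continuous_intros continuous_on_subset[OF cont\<xi>]) (use r r1 in auto)
    have "Im (\<xi> r1) < 0 \<and> 0 < Im (\<xi> r) \<or> Im (\<xi> r) < 0 \<and> 0 < Im (\<xi> r1)"
      using ne Im\<xi>[OF r] Im\<xi>[of r1] r1 by (auto simp: \<sigma>_def sgn_if split: if_splits)
    then obtain x where "r1 \<le> x" "x \<le> r" "Im (\<xi> x) = 0"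
      using IVT'[of "\<lambda>r. Im (\<xi> r)" r1 0 r, OF _ _ r(1) c] IVT2'[of "\<lambda>r. Im (\<xi> r)" r 0 r1, OF _ _ r(1) c]
      by fastforce
    then show False using Im\<xi>[of x] r by simp
  qed
  have orbit: "boundary_orbit phi \<zeta> (S - x\<^sup>2) = e (of_real (- \<sigma> * x))"
    if x: "0 \<le> x" "x < \<eta>" "x\<^sup>2 \<le> S" for x
  proof -
    define t where "t = S - x\<^sup>2"
    have t: "t \<ge> 0" using x by (simp add: t_def)
    have xb: "norm (complex_of_real (- \<sigma> * x)) < \<eta>" using x \<sigma> by (simp add: abs_mult norm_mult)
    \<comment> \<open>The square root of \<open>of_real (S - t) - \<xi> r\<close> that lies in the
      upper half-plane: \<open>csqrt\<close> has an imaginary part of sign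
      \<open>- \<sigma>\<close>, and the factor \<open>- \<sigma>\<close> makes it positive.\<close>
    define u where "u r = - of_real \<sigma> * csqrt (of_real (S - t) - \<xi> r)" for r
    have "((\<lambda>r. csqrt (of_real (S - t) - \<xi> r)) \<longlongrightarrow> of_real (sqrt (x\<^sup>2))) (at_left 1)"
    proof (rule csqrt_tendsto_Reals)
      have "((\<lambda>r. of_real (S - t) - \<xi> r) \<longlongrightarrow> of_real (S - t) - 0) (at_left 1)" by (intro tendsto_intros lim\<xi>)
      then show "((\<lambda>r. of_real (S - t) - \<xi> r) \<longlongrightarrow> of_real (x\<^sup>2)) (at_left 1)" by (simp add: t_def)
    qed simp
    then have "(u \<longlongrightarrow> - of_real \<sigma> * of_real (sqrt (x\<^sup>2))) (at_left 1)"
      unfolding u_def by (intro tendsto_intros)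
    then have ulim: "(u \<longlongrightarrow> of_real (- \<sigma> * x)) (at_left 1)" using x by simp
    have "isCont F (of_real (- \<sigma> * x))"
      using holomorphic_on_imp_continuous_on[OF F(1)] xb continuous_on_eq_continuous_at[OF open_ball] by (metis mem_ball_0)
    then have "isCont e (of_real (- \<sigma> * x))" unfolding e_def by (intro continuous_intros)
    from isCont_tendsto_compose[OF this ulim]
    have "((\<lambda>r. phi t (of_real r * \<zeta>)) \<longlongrightarrow> e (of_real (- \<sigma> * x))) (at_left 1)"
    proof (rule Lim_transform_eventually)
      have "\<forall>\<^sub>F r in at_left 1. norm (u r) < \<eta>"
        using order_tendstoD(2)[OF tendsto_norm[OF ulim] xb] .
      then show "\<forall>\<^sub>F r in at_left 1. e (u r) = phi t (of_real r * \<zeta>)"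
        using evr[OF r1(2)]
      proof eventually_elim
        case (elim r)
        have sq: "- (u r)\<^sup>2 = \<xi> r + of_real (t - S)"
        proof -
          have "(complex_of_real \<sigma>)\<^sup>2 = 1" using \<sigma> by (metis of_real_1 of_real_power power2_abs power_one)
          then show ?thesis by (simp add: u_def power_mult_distrib)
        qed
        have "Im (of_real (S - t) - \<xi> r) \<noteq> 0" using Im\<xi>[of r] elim by simp
        from Im_csqrt_sgn[OF this] have "sgn (Im (csqrt (of_real (S - t) - \<xi> r))) = - \<sigma>"
          using sgn\<xi>[of r] elim by (simp add: sgn_minus)
        moreover have "Im (u r) = - \<sigma> * Im (csqrt (of_real (S - t) - \<xi> r))" by (simp add: u_def)
        ultimately have "Im (u r) = \<bar>Im (csqrt (of_real (S - t) - \<xi> r))\<bar>" "Im (u r) \<noteq> 0"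
          using \<sigma> by (auto simp: abs_sgn mult.commute)
        then have "Im (u r) > 0" by simp
        then have "e (u r) = tip.g (E (\<xi> r + of_real (t - S)))"
          using kF[of "u r"] elim sq by (simp add: e_def tip.k_def)
        also have "\<dots> = tip.g (h (phi t (of_real r * \<zeta>)))" using lift[of r t] elim r1 t by simp
        also have "\<dots> = phi t (of_real r * \<zeta>)" using elim r1 by (intro tip.g_h in_disc t nr) auto
        finally show ?case .
      qed
    qed
    moreover have "norm (e (of_real (- \<sigma> * x))) = 1"
      using ImF[of "- \<sigma> * x"] xb by (simp add: e_def norm_exp_eq_Re del: of_real_mult of_real_minus)
    ultimately have "(phi t \<longlongrightarrow> e (of_real (- \<sigma> * x))) (nontangential_at \<zeta>)"
      by (intro tendsto_nontangential_of_radial hol image t \<zeta>)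
    then show ?thesis unfolding boundary_orbit_def t_def[symmetric]
      by (intro tendsto_Lim nontangential_at_neq_bot) (use \<zeta> in auto)
  qed
  show ?thesis
  proof
    assume "lipschitz_orbit phi \<zeta>"
    then obtain C where C: "C-lipschitz_on (orbit_interval phi \<zeta>) (boundary_orbit phi \<zeta>)"
      unfolding lipschitz_orbit_def by blast
    \<comment> \<open>\<open>D\<close> is the derivative of \<open>e\<close> at 0. A Lipschitz bound
      between the times \<open>S - x\<^sup>2\<close> and \<open>S\<close> is quadratic in
      \<open>x\<close>, so it would force the difference quotient of \<open>e\<close> at 0 to tend
      to 0.\<close>
    define D where "D = exp (\<i> * F 0) * (\<i> * deriv F 0)"
    have "(F has_field_derivative deriv F 0) (at 0)"
      by (rule holomorphic_derivI[OF F(1) open_ball]) (use \<eta> in simp)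
    then have "(e has_field_derivative D) (at 0)"
      unfolding e_def D_def by (auto intro!: derivative_eq_intros)
    then have "((\<lambda>y. (e y - e 0) / y) \<longlongrightarrow> D) (at 0)" by (simp add: has_field_derivative_iff)
    moreover have "filterlim (\<lambda>x. complex_of_real (- \<sigma> * x)) (at 0) (at_right 0)"
      unfolding filterlim_at
    proof
      have "((\<lambda>x. complex_of_real (- \<sigma> * x)) \<longlongrightarrow> of_real (- \<sigma> * 0)) (at_right 0)" by (intro tendsto_intros)
      then show "((\<lambda>x. complex_of_real (- \<sigma> * x)) \<longlongrightarrow> 0) (at_right 0)" by simp
      show "\<forall>\<^sub>F x in at_right 0. complex_of_real (- \<sigma> * x) \<in> UNIV \<and> complex_of_real (- \<sigma> * x) \<noteq> 0"
        using eventually_at_right_less[of "0::real"] by eventually_elim (use \<sigma> in auto)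
    qed
    ultimately have "((\<lambda>x. (e (of_real (- \<sigma> * x)) - e 0) / of_real (- \<sigma> * x)) \<longlongrightarrow> D) (at_right 0)"
      by (rule filterlim_compose)
    from tendsto_norm[OF this]
    have "((\<lambda>x. norm ((e (of_real (- \<sigma> * x)) - e 0) / of_real (- \<sigma> * x))) \<longlongrightarrow> norm D) (at_right 0)" .
    moreover have "((\<lambda>x. C * x) \<longlongrightarrow> C * 0) (at_right (0::real))" by (intro tendsto_intros)
    moreover have "0 < min \<eta> (sqrt S)" using \<eta> S by simp
    from eventually_at_right_real[OF this]
    have "\<forall>\<^sub>F x in at_right 0. norm ((e (of_real (- \<sigma> * x)) - e 0) / of_real (- \<sigma> * x)) \<le> C * x"
    proof eventually_elim
      case (elim x)
      then have x: "0 < x" "x < \<eta>" "x < sqrt S" by auto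
      have x2: "x\<^sup>2 \<le> S" using power_mono[of x "sqrt S" 2] x S by simp
      have "dist (boundary_orbit phi \<zeta> (S - x\<^sup>2)) (boundary_orbit phi \<zeta> (S - 0\<^sup>2)) \<le> C * dist (S - x\<^sup>2) (S - 0\<^sup>2)"
        by (rule lipschitz_onD[OF C]) (use x2 S in \<open>auto simp: orbit_interval_def life\<close>)
      then have "norm (e (of_real (- \<sigma> * x)) - e 0) \<le> C * x\<^sup>2"
        using orbit[of x] orbit[of 0] x x2 \<eta> S by (simp add: dist_norm)
      moreover have "norm (complex_of_real (- \<sigma> * x)) = x" using \<sigma> x by (simp add: norm_mult)
      ultimately show ?case using x by (simp only: norm_divide) (simp add: divide_le_eq power2_eq_square)
    qed
    ultimately have "norm D \<le> C * 0" by (intro tendsto_le[of "at_right (0::real)"]) auto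
    then show False using F(2) by (simp add: D_def)
  qed
qed

theorem (in semigroup_in_disc) isolated_orbit_not_lipschitz:
  assumes \<zeta>: "norm \<zeta> = 1" and pos: "life_time phi \<zeta> > 0" and iso: "isolated_orbit phi \<zeta>"
  shows "\<not> lipschitz_orbit phi \<zeta>"
proof -
  obtain S where life: "life_time phi \<zeta> = ereal S"
    and cases: "(\<exists>h w. koenigs_non_elliptic phi h \<and> (h \<longlongrightarrow> w) (nontangential_at \<zeta>) \<and>
           (\<exists>\<epsilon>>0. ball (w + of_real S) \<epsilon> \<inter> frontier (h ` ball 0 1) \<subseteq> {w + of_real s | s. s \<le> S})) \<or>
        (\<exists>\<mu> h w. koenigs_elliptic phi \<mu> h \<and> (h \<longlongrightarrow> w) (nontangential_at \<zeta>) \<and>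
           (\<exists>\<epsilon>>0. ball (exp (- \<mu> * of_real S) * w) \<epsilon> \<inter> frontier (h ` ball 0 1)
                    \<subseteq> {exp (- \<mu> * of_real s) * w | s. s \<le> S}))"
    using iso unfolding isolated_orbit_def by blast
  have S: "S > 0" using pos life by simp
  have rad: "norm (of_real r * \<zeta>) < 1" if "0 \<le> r" "r < 1" for r using that \<zeta> by (simp add: norm_mult)
  have radcont: "continuous_on {r0..<1} (\<lambda>r. h (of_real r * \<zeta>))" if "h holomorphic_on ball 0 1" "0 \<le> r0" for h r0
    by (rule continuous_on_compose2[OF holomorphic_on_imp_continuous_on[OF that(1)]])
      (use that(2) rad in \<open>auto intro!: continuous_intros\<close>)
  from cases show ?thesis
  proof (elim disjE exE conjE)
    fix h w \<epsilon> assume k: "koenigs_non_elliptic phi h" and w: "(h \<longlongrightarrow> w) (nontangential_at \<zeta>)"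
      and \<epsilon>: "\<epsilon> > 0" "ball (w + of_real S) \<epsilon> \<inter> frontier (h ` ball 0 1) \<subseteq> {w + of_real s | s. s \<le> S}"
    have h: "h holomorphic_on ball 0 1" "inj_on h (ball 0 1)"
      and hphi: "\<And>t z. t \<ge> 0 \<Longrightarrow> norm z < 1 \<Longrightarrow> h (phi t z) = h z + of_real t"
      using k unfolding koenigs_non_elliptic_def by auto
    have lim: "((\<lambda>r. h (of_real r * \<zeta>)) \<longlongrightarrow> w) (at_left 1)"
      by (rule filterlim_compose[OF w filterlim_radius_nontangential[OF \<zeta>]])
    show ?thesis
    proof (rule not_lipschitz_at_tip[OF \<zeta> life S h \<epsilon>(1), where E="\<lambda>\<xi>. w + of_real S + \<xi>"
          and \<xi>="\<lambda>r. h (of_real r * \<zeta>) - w" and ?r0.0=0])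
      fix \<xi> assume "norm \<xi> < \<epsilon>" "w + of_real S + \<xi> \<in> frontier (h ` ball 0 1)"
      then obtain s where "w + of_real S + \<xi> = w + of_real s" "s \<le> S"
        using subsetD[OF \<epsilon>(2), of "w + of_real S + \<xi>"] by (auto simp: dist_norm)
      then have "\<xi> = of_real (s - S)" by (simp add: algebra_simps)
      then show "Im \<xi> = 0 \<and> Re \<xi> \<le> 0" using \<open>s \<le> S\<close> by simp
    next
      show "((\<lambda>r. h (of_real r * \<zeta>) - w) \<longlongrightarrow> 0) (at_left 1)" using tendsto_diff[OF lim tendsto_const[of w]] by simp
      show "continuous_on {0..<1} (\<lambda>r. h (of_real r * \<zeta>) - w)" by (intro continuous_intros radcont h) simp
      show "h (phi t (of_real r * \<zeta>)) = w + of_real S + (h (of_real r * \<zeta>) - w + of_real (t - S))"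
        if "0 \<le> r" "r < 1" "t \<ge> 0" for r t
        using hphi[OF that(3) rad[OF that(1,2)]] by simp
    qed (auto intro!: holomorphic_intros inj_onI)
  next
    fix \<mu> h w \<epsilon> assume k: "koenigs_elliptic phi \<mu> h" and w: "(h \<longlongrightarrow> w) (nontangential_at \<zeta>)"
      and \<epsilon>: "\<epsilon> > 0" "ball (exp (- \<mu> * of_real S) * w) \<epsilon> \<inter> frontier (h ` ball 0 1)
                    \<subseteq> {exp (- \<mu> * of_real s) * w | s. s \<le> S}"
    have h: "h holomorphic_on ball 0 1" "inj_on h (ball 0 1)"
      and hphi: "\<And>t z. t \<ge> 0 \<Longrightarrow> norm z < 1 \<Longrightarrow> h (phi t z) = exp (- \<mu> * of_real t) * h z"
      and \<mu>: "Re \<mu> > 0"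
      using k unfolding koenigs_elliptic_def spectral_value_def by auto
    have \<mu>0: "\<mu> \<noteq> 0" using \<mu> by auto
    obtain q where q: "norm q < 1" "h q = 0"
      using k unfolding koenigs_elliptic_def elliptic_def by auto
    have lim: "((\<lambda>r. h (of_real r * \<zeta>)) \<longlongrightarrow> w) (at_left 1)"
      by (rule filterlim_compose[OF w filterlim_radius_nontangential[OF \<zeta>]])
    have evr: "\<forall>\<^sub>F r in at_left 1. 0 < r \<and> r < (1::real)"
      using eventually_at_left_real[of 0 "1::real"] by simp
    \<comment> \<open>A boundary value of \<open>h\<close> is not attained, whereas 0 is, at the
      Denjoy-Wolff point. So \<open>w\<close> is not 0 and the spiral does not degenerate.\<close>
    have "w \<notin> h ` ball 0 1"
    proof (rule limit_notin_image_of_norm_tendsto_1[OF h _ lim])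
      show "at_left (1::real) \<noteq> bot" by simp
      have "((\<lambda>r. norm (of_real r * \<zeta>)) \<longlongrightarrow> norm (of_real 1 * \<zeta>)) (at_left 1)" by (intro tendsto_intros)
      then show "((\<lambda>r. norm (of_real r * \<zeta>)) \<longlongrightarrow> 1) (at_left 1)" by (simp add: \<zeta>)
      show "\<forall>\<^sub>F r in at_left 1. norm (of_real r * \<zeta>) < 1"
        using evr by eventually_elim (use rad in auto)
    qed
    then have w0: "w \<noteq> 0" using q by (metis image_eqI mem_ball_0)
    have "((\<lambda>r. h (of_real r * \<zeta>) / w) \<longlongrightarrow> w / w) (at_left 1)" by (intro tendsto_intros lim w0)
    then have lim1: "((\<lambda>r. h (of_real r * \<zeta>) / w) \<longlongrightarrow> 1) (at_left 1)" using w0 by simp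
    have "\<forall>\<^sub>F r in at_left 1. dist (h (of_real r * \<zeta>) / w) 1 < 1" by (rule tendstoD[OF lim1]) simp
    then obtain b where b: "b < 1" "\<And>r. b < r \<Longrightarrow> r < 1 \<Longrightarrow> dist (h (of_real r * \<zeta>) / w) 1 < 1"
      unfolding eventually_at_left_field by blast
    \<comment> \<open>From here on \<open>h (of_real r * \<zeta>) / w\<close> is in the right
      half-plane, where \<open>Ln\<close> is continuous.\<close>
    define r0 where "r0 = max 0 ((b + 1) / 2)"
    have r0: "0 \<le> r0" "r0 < 1" "b < r0" using b(1) by (auto simp: r0_def less_max_iff_disj)
    have slitc: "h (of_real r * \<zeta>) / w \<notin> \<real>\<^sub>\<le>\<^sub>0" if "r0 \<le> r" "r < 1" for r
    proof -
      have "Re (1 - h (of_real r * \<zeta>) / w) < 1"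
        using b(2)[of r] that r0 complex_Re_le_cmod[of "1 - h (of_real r * \<zeta>) / w"]
        by (simp add: dist_norm norm_minus_commute)
      then show ?thesis by (auto simp: complex_nonpos_Reals_iff)
    qed
    define P where "P = exp (- \<mu> * of_real S) * w"
    \<comment> \<open>The flow multiplies by \<open>exp (- \<mu> * of_real t)\<close>, so in the
      exponential coordinate centred at the tip \<open>P\<close> it is translation by
      \<open>t\<close>.\<close>
    define E where "E \<xi> = P * exp (- \<mu> * \<xi>)" for \<xi>
    have P0: "P \<noteq> 0" using w0 by (simp add: P_def)
    have Es: "exp (- \<mu> * of_real s) * w = E (of_real (s - S))" for s
      by (simp add: E_def P_def right_diff_distrib exp_diff exp_minus field_simps)
    have Eeq: "\<xi> = \<xi>'" if "E \<xi> = E \<xi>'" "norm (\<mu> * \<xi> - \<mu> * \<xi>') < 2 * pi" for \<xi> \<xi>'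
    proof -
      have e: "exp (- \<mu> * \<xi>) = exp (- \<mu> * \<xi>')" using that(1) P0 by (simp add: E_def)
      have "\<bar>Im (- \<mu> * \<xi>) - Im (- \<mu> * \<xi>')\<bar> < 2 * pi"
      proof -
        have "\<bar>Im (- \<mu> * \<xi>) - Im (- \<mu> * \<xi>')\<bar> = \<bar>Im (\<mu> * \<xi> - \<mu> * \<xi>')\<bar>" by simp
        also have "\<dots> < 2 * pi" using abs_Im_le_cmod[of "\<mu> * \<xi> - \<mu> * \<xi>'"] that(2) by linarith
        finally show ?thesis .
      qed
      then have "- \<mu> * \<xi> = - \<mu> * \<xi>'" by (rule exp_complex_eqI[OF _ e])
      then show ?thesis using \<mu>0 by simp
    qed
    have holE: "E holomorphic_on UNIV" unfolding E_def by (intro holomorphic_intros)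
    have "isCont E 0" using holomorphic_on_imp_continuous_on[OF holE] by (simp add: continuous_on_eq_continuous_at)
    then obtain \<delta> where \<delta>: "\<delta> > 0" "\<And>\<xi>. norm \<xi> < \<delta> \<Longrightarrow> dist (E \<xi>) P < \<epsilon>"
      using \<epsilon>(1) unfolding continuous_at_eps_delta by (fastforce simp: E_def)
    \<comment> \<open>If \<open>E \<xi>\<close> is the point of the spiral with real parameter
      \<open>x\<close>, equality of moduli gives
      \<open>\<bar>x\<bar> \<le> norm \<mu> * norm \<xi> / Re \<mu>\<close>. So
      \<open>K * norm \<xi>\<close> bounds
      \<open>norm (\<mu> * \<xi>) + norm (\<mu> * of_real x)\<close>. Exponents at distance less
      than \<open>2 * pi\<close> are determined by their exponentials, hence
      \<open>\<xi> = of_real x\<close>.\<close>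
    define K where "K = norm \<mu> + norm \<mu> * norm \<mu> / Re \<mu>"
    have K: "K > 0" "norm \<mu> \<le> K" using \<mu> \<mu>0 by (auto simp: K_def add_pos_nonneg)
    define \<rho> where "\<rho> = min \<delta> (pi / K)"
    have \<rho>: "\<rho> > 0" "\<rho> \<le> \<delta>" using \<delta> K by (auto simp: \<rho>_def)
    have \<rho>K: "K * x < pi" if "x < \<rho>" for x
    proof -
      have "x < pi / K" using that by (simp add: \<rho>_def)
      then show ?thesis using K(1) by (simp add: pos_less_divide_eq mult.commute)
    qed
    show ?thesis
    proof (rule not_lipschitz_at_tip[OF \<zeta> life S h \<rho>(1) holE _ _ r0(1,2),
          where \<xi>="\<lambda>r. - Ln (h (of_real r * \<zeta>) / w) / \<mu>"])
      show "inj_on E (ball 0 \<rho>)"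
      proof (rule inj_onI)
        fix x y assume xy: "x \<in> ball 0 \<rho>" "y \<in> ball 0 \<rho>" "E x = E y"
        have "norm (\<mu> * v) < pi" if "norm v < \<rho>" for v
          using \<rho>K[OF that] mult_right_mono[OF K(2) norm_ge_zero[of v]] by (simp add: norm_mult)
        from this[of x] this[of y] have "norm (\<mu> * x - \<mu> * y) < 2 * pi"
          using norm_triangle_ineq4[of "\<mu> * x" "\<mu> * y"] xy by simp
        then show "x = y" by (rule Eeq[OF xy(3)])
      qed
      fix \<xi> assume \<xi>: "norm \<xi> < \<rho>" "E \<xi> \<in> frontier (h ` ball 0 1)"
      have "E \<xi> \<in> ball P \<epsilon>" using \<delta>(2)[of \<xi>] \<xi> \<rho> by (simp add: dist_commute)
      then obtain s where s: "E \<xi> = E (of_real (s - S))" "s \<le> S"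
        using subsetD[OF \<epsilon>(2)[folded P_def, unfolded Es], of "E \<xi>"] \<xi>(2) by auto
      define x where "x = s - S"
      have "norm (exp (- \<mu> * \<xi>)) = norm (exp (- \<mu> * of_real x))" using s P0 by (simp add: E_def x_def)
      then have "Re \<mu> * x = Re (\<mu> * \<xi>)" by (simp add: norm_exp_eq_Re)
      then have "Re \<mu> * \<bar>x\<bar> \<le> norm \<mu> * norm \<xi>"
        using abs_Re_le_cmod[of "\<mu> * \<xi>"] \<mu> by (simp add: abs_mult norm_mult flip: abs_mult)
      then have "\<bar>x\<bar> \<le> norm \<mu> * norm \<xi> / Re \<mu>" using \<mu> by (simp add: pos_le_divide_eq mult.commute)
      then have "norm \<mu> * \<bar>x\<bar> \<le> norm \<mu> * (norm \<mu> * norm \<xi> / Re \<mu>)" by (rule mult_left_mono) simp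
      then have "norm (\<mu> * \<xi>) + norm (\<mu> * of_real x) \<le> K * norm \<xi>"
        by (simp add: K_def norm_mult algebra_simps)
      then have "norm (\<mu> * \<xi> - \<mu> * of_real x) < 2 * pi"
        using norm_triangle_ineq4[of "\<mu> * \<xi>" "\<mu> * of_real x"] \<rho>K[OF \<xi>(1)] pi_gt_zero by linarith
      moreover have "E \<xi> = E (of_real x)" using s(1) by (simp only: x_def)
      ultimately have "\<xi> = of_real x" using Eeq by blast
      then show "Im \<xi> = 0 \<and> Re \<xi> \<le> 0" using s(2) by (simp add: x_def)
    next
      show "continuous_on {r0..<1} (\<lambda>r. - Ln (h (of_real r * \<zeta>) / w) / \<mu>)"
        by (intro continuous_intros radcont h r0(1)) (use slitc w0 \<mu>0 in auto)
      have "((\<lambda>r. - Ln (h (of_real r * \<zeta>) / w) / \<mu>) \<longlongrightarrow> - Ln 1 / \<mu>) (at_left 1)"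
        by (intro tendsto_intros lim1 \<mu>0) simp
      then show "((\<lambda>r. - Ln (h (of_real r * \<zeta>) / w) / \<mu>) \<longlongrightarrow> 0) (at_left 1)" by simp
      fix r t :: real assume r: "r0 \<le> r" "r < 1" and t: "t \<ge> 0"
      have "h (of_real r * \<zeta>) / w \<noteq> 0" using slitc[OF r] by auto
      then have "exp (Ln (h (of_real r * \<zeta>) / w)) = h (of_real r * \<zeta>) / w" by (rule exp_Ln)
      moreover have "- \<mu> * (- Ln (h (of_real r * \<zeta>) / w) / \<mu> + of_real (t - S)) =
          Ln (h (of_real r * \<zeta>) / w) + (- \<mu> * of_real t + \<mu> * of_real S)"
        using \<mu>0 by (simp add: field_simps)
      ultimately have "E (- Ln (h (of_real r * \<zeta>) / w) / \<mu> + of_real (t - S)) =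
          P * (h (of_real r * \<zeta>) / w * (exp (- \<mu> * of_real t) * exp (\<mu> * of_real S)))"
        by (simp only: E_def exp_add)
      also have "\<dots> = exp (- \<mu> * of_real t) * h (of_real r * \<zeta>)"
        using w0 by (simp add: P_def exp_minus field_simps)
      also have "\<dots> = h (phi t (of_real r * \<zeta>))" using hphi[OF t rad[of r]] r r0 by simp
      finally show "h (phi t (of_real r * \<zeta>)) = E (- Ln (h (of_real r * \<zeta>) / w) / \<mu> + of_real (t - S))" ..
    qed
  qed
qed

theorem theorem5p1:
  fixes phi :: "real \<Rightarrow> complex \<Rightarrow> complex" and \<zeta> :: complex
  assumes "disc_semigroup phi"
    and "\<zeta> \<in> sphere 0 1"
    and "\<not> fixed_boundary_point phi \<zeta>"
    and "life_time phi \<zeta> > 0"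
  shows "(exceptional_orbit phi \<zeta> \<longrightarrow> lipschitz_orbit phi \<zeta>) \<and>
         (isolated_orbit phi \<zeta> \<longrightarrow> \<not> lipschitz_orbit phi \<zeta>)"
proof -
  interpret semigroup_in_disc phi by unfold_locales (rule assms(1))
  have "norm \<zeta> = 1" using assms(2) by simp
  then show ?thesis
    using exceptional_orbit_lipschitz[OF _ assms(3)] isolated_orbit_not_lipschitz[OF _ assms(4)] by blast
qed

end
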